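(* Let $\alpha\in(1,\infty)$, let $\mathcal N,\mathcal M$ be completely positive maps from $\mathscr L(X)$ to $\mathscr L(Y)$, and let $d=\dim X\cdot\dim Y$. Then for every integer $m\ge1$, $$\frac1m D^{\#}_\alpha(\mathcal N^{\otimes m}\|\mathcal M^{\otimes m})-\frac1m\frac{\alpha}{\alpha-1}(d^2+d)\log_2(m+d)\ \le\ \widetilde D^{\mathrm{reg}}_\alpha(\mathcal N\|\mathcal M)\ \le\ \frac1mD^{\#}_\alpha(\mathcal N^{\otimes m}\|\mathcal M^{\otimes m}),$$ and moreover $$\widetilde D^{\mathrm{reg}}_\alpha(\mathcal N\|\mathcal M)-\frac1m\widetilde D_\alpha(\mathcal N^{\otimes m}\|\mathcal M^{\otimes m})\le\frac1m\frac{\alpha}{\alpha-1}(d^2+d)\log_2(m+d).$$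
   Context: For $\beta\in(0,1)$ and positive semidefinite $A,B$, $A\#_\beta B:=\lim_{\varepsilon\downarrow0}A_\varepsilon^{1/2}(A_\varepsilon^{-1/2}B_\varepsilon A_\varepsilon^{-1/2})^{\beta}A_\varepsilon^{1/2}$, $A_\varepsilon=A+\varepsilon I$, $B_\varepsilon=B+\varepsilon I$. For states: $Q^{\#}_\alpha(\rho\|\sigma):=\inf\{\mathrm{tr}(A): A\ge 0,\ \rho\le\sigma\#_{1/\alpha}A\}$, $D^{\#}_\alpha:=\frac{1}{\alpha-1}\log_2 Q^{\#}_\alpha$. Sandwiched divergence: $\widetilde D_\alpha(\rho\|\sigma)=\frac{1}{\alpha-1}\log_2\mathrm{tr}\big((\sigma^{\frac{1-\alpha}{2\alpha}}\rho\sigma^{\frac{1-\alpha}{2\alpha}})^\alpha\big)$ if $\mathrm{supp}\rho\subseteq\mathrm{supp}\sigma$ (generalized inverses; same formula if $\rho$ unnormalized), $+\infty$ otherwise. Choi operator $J^{\mathcal N}_{XY}=(\mathcal I_X\otimes\mathcal N)(\Phi_{XX'})$, $\Phi_{XX'}=\sum_{x,x'}|x\rangle\langle x'|\otimes|x\rangle\langle x'|$. Channel divergence: $\mathbf D(\mathcal N\|\mathcal M):=\sup_{\omega\in\mathscr D(X)}\mathbf D\big((\omega^{1/2}\otimes I_Y)J^{\mathcal N}(\omega^{1/2}\otimes I_Y)\,\|\,(\omega^{1/2}\otimes I_Y)J^{\mathcal M}(\omega^{1/2}\otimes I_Y)\big)$. Regularized divergence: $\widetilde D^{\mathrm{reg}}_\alpha(\mathcal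 N\|\mathcal M):=\lim_{n\to\infty}\frac1n\widetilde D_\alpha(\mathcal N^{\otimes n}\|\mathcal M^{\otimes n})$ (the limit exists and equals the supremum over $n$). *)

theory Defs
  imports "Jordan_Normal_Form.Matrix" "HOL-Library.Extended_Real"
begin

definition adj :: "complex mat \<Rightarrow> complex mat" where
  "adj A = mat (dim_col A) (dim_row A) (\<lambda>(i,j). cnj (A $$ (j,i)))"

definition mtrace :: "complex mat \<Rightarrow> complex" where
  "mtrace A = (\<Sum>i<dim_row A. A $$ (i,i))"

definition hermitian :: "complex mat \<Rightarrow> bool" where
  "hermitian A \<longleftrightarrow> A = adj A"

definition psd :: "nat \<Rightarrow> complex mat \<Rightarrow> bool" where
  "psd n A \<longleftrightarrow> A \<in> carrier_mat n n \<and> hermitian A \<and>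
     (\<forall>v \<in> carrier_vec n. Im (conjugate v \<bullet> (A *\<^sub>v v)) = 0 \<and> 0 \<le> Re (conjugate v \<bullet> (A *\<^sub>v v)))"

definition loewner_le :: "nat \<Rightarrow> complex mat \<Rightarrow> complex mat \<Rightarrow> bool" where
  "loewner_le n A B \<longleftrightarrow> A \<in> carrier_mat n n \<and> B \<in> carrier_mat n n \<and> psd n (B - A)"

definition density :: "nat \<Rightarrow> complex mat \<Rightarrow> bool" where
  "density n \<omega> \<longleftrightarrow> psd n \<omega> \<and> mtrace \<omega> = 1"

definition unitary :: "nat \<Rightarrow> complex mat \<Rightarrow> bool" where
  "unitary n U \<longleftrightarrow> U \<in> carrier_mat n n \<and> U * adj U = 1\<^sub>m n \<and> adj U * U = 1\<^sub>m n"

definition mat_fun :: "(real \<Rightarrow> real) \<Rightarrow> complex mat \<Rightarrow> complex mat" where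
  "mat_fun f A = (let n = dim_row A;
      p = (SOME p :: complex mat \<times> (nat \<Rightarrow> real). unitary n (fst p) \<and>
              A = fst p * mat_diag n (\<lambda>i. complex_of_real (snd p i)) * adj (fst p))
    in fst p * mat_diag n (\<lambda>i. complex_of_real (f (snd p i))) * adj (fst p))"

text \<open>Matrix powers with generalized inverse convention: eigenvalue 0 is mapped to 0
  (for negative exponents this is the power taken on the support).\<close>
definition mpow :: "real \<Rightarrow> complex mat \<Rightarrow> complex mat" where
  "mpow t A = mat_fun (\<lambda>x. if 0 < x then x powr t else 0) A"

definition mat_lim0 :: "nat \<Rightarrow> (real \<Rightarrow> complex mat) \<Rightarrow> complex mat" where
  "mat_lim0 n F = (THE L. L \<in> carrier_mat n n \<and>
      (\<forall>i<n. \<forall>j<n. ((\<lambda>e. F e $$ (i,j)) \<longlongrightarrow> L $$ (i,j)) (at_right 0)))"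

definition wgm :: "real \<Rightarrow> complex mat \<Rightarrow> complex mat \<Rightarrow> complex mat" where
  "wgm \<beta> A B = (let n = dim_row A;
      Ae = (\<lambda>e. A + complex_of_real e \<cdot>\<^sub>m 1\<^sub>m n);
      Be = (\<lambda>e. B + complex_of_real e \<cdot>\<^sub>m 1\<^sub>m n)
    in mat_lim0 n (\<lambda>e. mpow (1/2) (Ae e) *
          mpow \<beta> (mpow (-1/2) (Ae e) * Be e * mpow (-1/2) (Ae e)) * mpow (1/2) (Ae e)))"

text \<open>Kronecker (tensor) product; the first factor is the outer index.\<close>
definition kron :: "complex mat \<Rightarrow> complex mat \<Rightarrow> complex mat" where
  "kron A B = mat (dim_row A * dim_row B) (dim_col A * dim_col B)
     (\<lambda>(i,j). A $$ (i div dim_row B, j div dim_col B) * B $$ (i mod dim_row B, j mod dim_col B))"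

definition munit :: "nat \<Rightarrow> nat \<Rightarrow> nat \<Rightarrow> complex mat" where
  "munit n i j = mat n n (\<lambda>(a,b). if a = i \<and> b = j then 1 else 0)"

definition elog2 :: "ereal \<Rightarrow> ereal" where
  "elog2 x = (if x = \<infinity> then \<infinity> else if x \<le> 0 then -\<infinity> else ereal (log 2 (real_of_ereal x)))"

definition supp_le :: "complex mat \<Rightarrow> complex mat \<Rightarrow> bool" where
  "supp_le \<rho> \<sigma> \<longleftrightarrow> (\<forall>v \<in> carrier_vec (dim_col \<rho>). \<exists>w \<in> carrier_vec (dim_col \<sigma>). \<rho> *\<^sub>v v = \<sigma> *\<^sub>v w)"

definition sandwiched :: "real \<Rightarrow> complex mat \<Rightarrow> complex mat \<Rightarrow> ereal" where
  "sandwiched \<alpha> \<rho> \<sigma> = (if supp_le \<rho> \<sigma> then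
     (let s = (1 - \<alpha>) / (2 * \<alpha>) in
       ereal (1 / (\<alpha> - 1)) * elog2 (ereal (Re (mtrace (mpow \<alpha> (mpow s \<sigma> * \<rho> * mpow s \<sigma>))))))
     else \<infinity>)"

definition Qsharp :: "real \<Rightarrow> complex mat \<Rightarrow> complex mat \<Rightarrow> ereal" where
  "Qsharp \<alpha> \<rho> \<sigma> = Inf {ereal (Re (mtrace A)) | A. psd (dim_row \<rho>) A \<and>
                          loewner_le (dim_row \<rho>) \<rho> (wgm (1/\<alpha>) \<sigma> A)}"

definition Dsharp :: "real \<Rightarrow> complex mat \<Rightarrow> complex mat \<Rightarrow> ereal" where
  "Dsharp \<alpha> \<rho> \<sigma> = ereal (1 / (\<alpha> - 1)) * elog2 (Qsharp \<alpha> \<rho> \<sigma>)"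

type_synonym qmap = "complex mat \<Rightarrow> complex mat"

definition lin_map :: "nat \<Rightarrow> nat \<Rightarrow> qmap \<Rightarrow> bool" where
  "lin_map dX dY N \<longleftrightarrow> (\<forall>A \<in> carrier_mat dX dX. N A \<in> carrier_mat dY dY) \<and>
     (\<forall>A \<in> carrier_mat dX dX. \<forall>B \<in> carrier_mat dX dX. N (A + B) = N A + N B) \<and>
     (\<forall>c. \<forall>A \<in> carrier_mat dX dX. N (c \<cdot>\<^sub>m A) = c \<cdot>\<^sub>m N A)"

text \<open>(id_k \<otimes> N) applied to a (k*dX) x (k*dX) block matrix: N acts on each dX x dX block.\<close>
definition id_tensor :: "nat \<Rightarrow> nat \<Rightarrow> nat \<Rightarrow> qmap \<Rightarrow> qmap" where
  "id_tensor k dX dY N Z = mat (k * dY) (k * dY) (\<lambda>(i,j).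
      N (mat dX dX (\<lambda>(p,q). Z $$ ((i div dY) * dX + p, (j div dY) * dX + q))) $$ (i mod dY, j mod dY))"

definition cp_map :: "nat \<Rightarrow> nat \<Rightarrow> qmap \<Rightarrow> bool" where
  "cp_map dX dY N \<longleftrightarrow> lin_map dX dY N \<and>
     (\<forall>k Z. psd (k * dX) Z \<longrightarrow> psd (k * dY) (id_tensor k dX dY N Z))"

text \<open>Unnormalized maximally entangled operator Phi = sum |x><x'| \<otimes> |x><x'|.\<close>
definition Phi :: "nat \<Rightarrow> complex mat" where
  "Phi dX = mat (dX * dX) (dX * dX) (\<lambda>(i,j).
      if i div dX = i mod dX \<and> j div dX = j mod dX then 1 else 0)"

definition choi :: "nat \<Rightarrow> nat \<Rightarrow> qmap \<Rightarrow> complex mat" where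
  "choi dX dY N = id_tensor dX dX dY N (Phi dX)"

definition map_tensor :: "nat \<Rightarrow> nat \<Rightarrow> nat \<Rightarrow> nat \<Rightarrow> qmap \<Rightarrow> qmap \<Rightarrow> qmap" where
  "map_tensor dX1 dY1 dX2 dY2 N1 N2 Z = mat (dY1 * dY2) (dY1 * dY2) (\<lambda>(p,q).
      \<Sum>i<dX1. \<Sum>j<dX1. \<Sum>k<dX2. \<Sum>l<dX2.
        Z $$ (i * dX2 + k, j * dX2 + l) *
        kron (N1 (munit dX1 i j)) (N2 (munit dX2 k l)) $$ (p, q))"

fun tpow :: "nat \<Rightarrow> nat \<Rightarrow> qmap \<Rightarrow> nat \<Rightarrow> qmap" where
  "tpow dX dY N 0 = (\<lambda>Z. mat 1 1 (\<lambda>_. Z $$ (0,0)))"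
| "tpow dX dY N (Suc m) = map_tensor (dX ^ m) (dY ^ m) dX dY (tpow dX dY N m) N"

definition sandwich_in :: "nat \<Rightarrow> complex mat \<Rightarrow> complex mat \<Rightarrow> complex mat" where
  "sandwich_in dY \<omega> J = kron (mpow (1/2) \<omega>) (1\<^sub>m dY) * J * kron (mpow (1/2) \<omega>) (1\<^sub>m dY)"

definition chan_div :: "(complex mat \<Rightarrow> complex mat \<Rightarrow> ereal) \<Rightarrow> nat \<Rightarrow> nat \<Rightarrow> qmap \<Rightarrow> qmap \<Rightarrow> ereal" where
  "chan_div D dX dY N M = (SUP \<omega> \<in> {\<omega>. density dX \<omega>}.
      D (sandwich_in dY \<omega> (choi dX dY N)) (sandwich_in dY \<omega> (choi dX dY M)))"

definition Dreg :: "real \<Rightarrow> nat \<Rightarrow> nat \<Rightarrow> qmap \<Rightarrow> qmap \<Rightarrow> ereal" where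
  "Dreg \<alpha> dX dY N M = lim (\<lambda>n. ereal (1 / real n) *
      chan_div (sandwiched \<alpha>) (dX ^ n) (dY ^ n) (tpow dX dY N n) (tpow dX dY M n))"

end

theory Submission
  imports Defs "Jordan_Normal_Form.Spectral_Radius" "HOL-Analysis.Analysis"
    "HOL-Combinatorics.Permutations" "HOL-Real_Asymp.Real_Asymp"
begin

text \<open>
  For states, pinching with the spectral projections of \<open>\<sigma>\<close> makes \<open>\<rho>\<close> and \<open>\<sigma>\<close> commute at the cost of a
  factor \<open>v\<close>, the number of distinct eigenvalues of \<open>\<sigma>\<close>. It gives \<open>Q\<^sup># \<le> v\<^sup>\<alpha> Q\<close> for the sandwiched
  quantity \<open>Q\<close>, and also \<open>Q \<le> v\<^sup>\<alpha> Q\<^sup>#\<close>, where the factor disappears on passing to tensor powers.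

  For channels, a minimax argument replaces the operators \<open>A\<close> in the definition of \<open>Q\<^sup>#\<close>, one for each
  input state, by a single \<open>A\<close> whose marginal on the input is bounded by a multiple of the identity. Such
  operators multiply under tensor products, so \<open>Q\<close> of the \<open>nm\<close>-th power is at most the \<open>n\<close>-th power of
  \<open>Q\<^sup>#\<close> of the \<open>m\<close>-th power; this is the upper bound. For the lower bounds one may take a
  permutation-invariant input; the second operator is then permutation-invariant and has at most
  \<open>(m + 1)\<close> to the power \<open>d\<^sup>2\<close> distinct eigenvalues. Finally \<open>log Q\<close> is superadditive in the number of
  copies, so the regularization is a supremum by Fekete's lemma.
\<close>

unbundle no inner_syntax and no vec_syntax
hide_const (open) Finite_Cartesian_Product.mat Finite_Cartesian_Product.vec Finite_Cartesian_Product.transpose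
  Finite_Cartesian_Product.row Finite_Cartesian_Product.rows Determinants.det

hide_type (open) Finite_Cartesian_Product.vec

section \<open>Matrix algebra and quadratic forms\<close>

text \<open>Two obstacles shape the proof. The mean \<open>wgm\<close> is a limit of expressions in
  powers of noncommuting matrices, on which no order property can be read off. It is therefore
  accessed through quadratic forms: for each vector the form of the mean is, up to a constant, an
  integral of infima of linear expressions, and monotonicity, the transformer inequality and
  concavity all follow from that one representation. Secondly, a certificate for one input state
  becomes a certificate for the Choi operators only by undoing the congruence with the square root
  of the state, which requires full rank. Hence states are mixed with the maximally mixed one and
  the perturbation is sent to 0 at the end. Divergences may be infinite of either sign, so they are
  compared only through real thresholds: a bound on a divergence is translated into a bound on a
  trace quantity together with a support condition. The eigenvalue count gives the correction
  \<open>a / (a - 1) * d ^ 2 * log 2 (m + 1)\<close>, where \<open>a\<close> is the order and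
  \<open>d = dX * dY\<close>; the stated one with \<open>d ^ 2 + d\<close> and \<open>m + d\<close>
  majorizes it.\<close>

abbreviation rdiag :: "nat \<Rightarrow> (nat \<Rightarrow> real) \<Rightarrow> complex mat" where
  "rdiag n d \<equiv> mat_diag n (\<lambda>i. complex_of_real (d i))"

text \<open>Phrased with dimension equations instead of carrier membership, so that the simplifier
  can check the side conditions and normalize long products. \<open>carrier_iffs\<close> serves the
  same purpose.\<close>

lemma mult_assoc_dim:
  "dim_col A = dim_row B \<Longrightarrow> dim_col B = dim_row C \<Longrightarrow> (A :: complex mat) * B * C = A * (B * C)"
  by (rule assoc_mult_mat[of _ "dim_row A" "dim_row B" _ "dim_row C" _ "dim_col C"]) auto

lemma carrier_iffs [simp]:
  "A *\<^sub>v v \<in> carrier_vec n \<longleftrightarrow> dim_row A = n"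
  "(A :: complex mat) * B \<in> carrier_mat n m \<longleftrightarrow> dim_row A = n \<and> dim_col B = m"
  "(A :: complex mat) + B \<in> carrier_mat n m \<longleftrightarrow> dim_row B = n \<and> dim_col B = m"
  "(A :: complex mat) - B \<in> carrier_mat n m \<longleftrightarrow> dim_row B = n \<and> dim_col B = m"
  "c \<cdot>\<^sub>m (A :: complex mat) \<in> carrier_mat n m \<longleftrightarrow> dim_row A = n \<and> dim_col A = m"
  unfolding carrier_vec_def carrier_mat_def by auto

lemma mat_diag_dims [simp]: "dim_row (mat_diag n f) = n" "dim_col (mat_diag n f) = n"
  unfolding mat_diag_def by auto

lemma mat_diag_index [simp]:
  "i < n \<Longrightarrow> j < n \<Longrightarrow> mat_diag n f $$ (i,j) = (if i = j then f j else 0)"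
  unfolding mat_diag_def by auto

lemma adj_dim [simp]: "dim_row (adj A) = dim_col A" "dim_col (adj A) = dim_row A"
  unfolding adj_def by auto

lemma adj_carrier [simp, intro]: "A \<in> carrier_mat n m \<Longrightarrow> adj A \<in> carrier_mat m n"
  by (auto intro: carrier_matI)

lemma adj_index [simp]:
  "i < dim_col A \<Longrightarrow> j < dim_row A \<Longrightarrow> adj A $$ (i,j) = cnj (A $$ (j,i))"
  unfolding adj_def by auto

lemma adj_adj [simp]: "adj (adj A) = A"
  by (rule eq_matI) auto

lemma index_mult_sum:
  "i < dim_row A \<Longrightarrow> j < dim_col B \<Longrightarrow> dim_col A = dim_row B \<Longrightarrow>
   (A * B) $$ (i,j) = (\<Sum>k<dim_col A. A $$ (i,k) * B $$ (k,j))"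
  by (simp add: scalar_prod_def lessThan_atLeast0)

lemma adj_mult: "dim_col A = dim_row B \<Longrightarrow> adj (A * B) = adj B * adj A"
  by (rule eq_matI) (auto simp: index_mult_sum mult.commute simp del: index_mult_mat(1))

lemma adj_add: "dim_row A = dim_row B \<Longrightarrow> dim_col A = dim_col B \<Longrightarrow> adj (A + B) = adj A + adj B"
  by (rule eq_matI) auto

lemma adj_minus: "dim_row A = dim_row B \<Longrightarrow> dim_col A = dim_col B \<Longrightarrow> adj (A - B) = adj A - adj B"
  by (rule eq_matI) auto

lemma adj_smult: "adj (c \<cdot>\<^sub>m A) = cnj c \<cdot>\<^sub>m adj A"
  by (rule eq_matI) auto

lemma adj_one [simp]: "adj (1\<^sub>m n) = 1\<^sub>m n"
  by (rule eq_matI) auto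

lemma adj_rdiag [simp]: "adj (rdiag n d) = rdiag n d"
  by (rule eq_matI) auto

lemma unitary_dims [simp]: "unitary n U \<Longrightarrow> dim_row U = n" "unitary n U \<Longrightarrow> dim_col U = n"
  unfolding unitary_def by auto

lemma unitary_carrier: "unitary n U \<Longrightarrow> U \<in> carrier_mat n n"
  unfolding unitary_def by auto

lemma unitary_mult [simp]: "unitary n U \<Longrightarrow> U * adj U = 1\<^sub>m n" "unitary n U \<Longrightarrow> adj U * U = 1\<^sub>m n"
  unfolding unitary_def by auto

lemma unitary_cancel:
  assumes "unitary n U" "dim_row A = n"
  shows "adj U * (U * A) = A" "U * (adj U * A) = A"
  using assms by (simp_all flip: mult_assoc_dim add: carrier_matI[of A n "dim_col A"] left_mult_one_mat)

lemma unitary_adj: "unitary n U \<Longrightarrow> unitary n (adj U)"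
  unfolding unitary_def by auto

lemma unitary_one: "unitary n (1\<^sub>m n)"
  unfolding unitary_def by auto

lemma unitaryI:
  assumes "U \<in> carrier_mat n n" "U * adj U = 1\<^sub>m n"
  shows "unitary n U"
  using assms mat_mult_left_right_inverse[of U n "adj U"] unfolding unitary_def by auto

lemma unitary_times: "unitary n U \<Longrightarrow> unitary n V \<Longrightarrow> unitary n (U * V)"
proof -
  assume a: "unitary n U" "unitary n V"
  have "U * V * adj (U * V) = 1\<^sub>m n"
    using a by (simp add: adj_mult mult_assoc_dim unitary_cancel)
  thus ?thesis
    using a by (intro unitaryI) (auto intro: mult_carrier_mat unitary_carrier)
qed

lemma hermitian_entry:
  assumes "hermitian A" "A \<in> carrier_mat n n" "i < n" "j < n"
  shows "A $$ (j,i) = cnj (A $$ (i,j))"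
proof -
  have "A $$ (j,i) = adj A $$ (j,i)"
    using assms(1) unfolding hermitian_def by (rule arg_cong[of A "adj A" "\<lambda>M. M $$ (j,i)"])
  thus ?thesis using assms by simp
qed

lemma hermitian_gram: "hermitian (B * adj B)"
  unfolding hermitian_def by (simp add: adj_mult)

lemma hermitian_congr:
  "hermitian A \<Longrightarrow> dim_col K = dim_row A \<Longrightarrow> hermitian (K * A * adj K)"
  unfolding hermitian_def
  by (metis adj_adj adj_dim adj_mult index_mult_mat(2,3) mult_assoc_dim)

lemma hermitian_add: "hermitian A \<Longrightarrow> hermitian B \<Longrightarrow> dim_row A = dim_row B \<Longrightarrow> hermitian (A + B)"
  unfolding hermitian_def by (metis adj_add adj_dim(2))

lemma hermitian_minus: "hermitian A \<Longrightarrow> hermitian B \<Longrightarrow> dim_row A = dim_row B \<Longrightarrow> hermitian (A - B)"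
  unfolding hermitian_def by (metis adj_minus adj_dim(2))

lemma hermitian_smult: "hermitian A \<Longrightarrow> hermitian (complex_of_real c \<cdot>\<^sub>m A)"
  unfolding hermitian_def by (metis adj_smult complex_cnj_complex_of_real)

lemma hermitian_rdiag [simp]: "hermitian (rdiag n d)"
  unfolding hermitian_def by simp

lemma hermitian_one [simp]: "hermitian (1\<^sub>m n)"
  unfolding hermitian_def by simp

section \<open>Inner products, quadratic forms and traces\<close>

definition sqn :: "complex vec \<Rightarrow> real" where
  "sqn v = (\<Sum>i<dim_vec v. (cmod (v $ i))\<^sup>2)"

text \<open>Taking the real part gives a real function for every \<open>A\<close>. Order relations,
  limits and identities between Hermitian matrices are reduced to these functions, and
  \<open>qf_eqI\<close> leads back to matrices.\<close>

definition qf :: "complex mat \<Rightarrow> complex vec \<Rightarrow> real" where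
  "qf A v = Re (conjugate v \<bullet> (A *\<^sub>v v))"

lemma sqn_nonneg [simp]: "0 \<le> sqn v"
  unfolding sqn_def by (simp add: sum_nonneg)

lemma ip_self: "conjugate v \<bullet> v = complex_of_real (sqn v)"
  unfolding sqn_def scalar_prod_def
  by (simp add: lessThan_atLeast0 conjugate_vec_def complex_norm_square mult.commute del: of_real_power)

lemma ip_adj:
  assumes "A \<in> carrier_mat n m" "v \<in> carrier_vec n" "w \<in> carrier_vec m"
  shows "conjugate v \<bullet> (A *\<^sub>v w) = conjugate (adj A *\<^sub>v v) \<bullet> w"
proof -
  have "conjugate v \<bullet> (A *\<^sub>v w) = (\<Sum>i<n. \<Sum>j<m. cnj (v $ i) * (A $$ (i,j) * w $ j))"
    using assms by (simp add: scalar_prod_def lessThan_atLeast0 sum_distrib_left)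
  also have "\<dots> = (\<Sum>j<m. \<Sum>i<n. cnj (v $ i) * (A $$ (i,j) * w $ j))"
    by (rule sum.swap)
  also have "\<dots> = conjugate (adj A *\<^sub>v v) \<bullet> w"
    using assms by (simp add: scalar_prod_def lessThan_atLeast0 sum_distrib_right sum_distrib_left mult_ac)
  finally show ?thesis .
qed

lemma qf_sum:
  assumes "A \<in> carrier_mat n n" "v \<in> carrier_vec n"
  shows "qf A v = Re (\<Sum>i<n. \<Sum>j<n. cnj (v $ i) * A $$ (i,j) * v $ j)"
  using assms unfolding qf_def by (simp add: scalar_prod_def lessThan_atLeast0 sum_distrib_left mult_ac)

lemma ip_herm_real:
  assumes "hermitian A" "A \<in> carrier_mat n n" "v \<in> carrier_vec n"
  shows "Im (conjugate v \<bullet> (A *\<^sub>v v)) = 0"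
proof -
  have "conjugate v \<bullet> (A *\<^sub>v v) = conjugate (A *\<^sub>v v) \<bullet> v"
    using ip_adj[OF assms(2,3,3)] assms(1) by (simp add: hermitian_def)
  also have "\<dots> = cnj (conjugate v \<bullet> (A *\<^sub>v v))"
    using assms by (simp add: scalar_prod_def conjugate_vec_def mult.commute)
  finally have "Im (conjugate v \<bullet> (A *\<^sub>v v)) = Im (cnj (conjugate v \<bullet> (A *\<^sub>v v)))"
    by (rule arg_cong)
  thus ?thesis by simp
qed

lemma psd_iff:
  "psd n A \<longleftrightarrow> A \<in> carrier_mat n n \<and> hermitian A \<and> (\<forall>v \<in> carrier_vec n. 0 \<le> qf A v)"
  unfolding psd_def qf_def using ip_herm_real by blast

lemma psdD:
  assumes "psd n A"
  shows "A \<in> carrier_mat n n" "hermitian A" "v \<in> carrier_vec n \<Longrightarrow> 0 \<le> qf A v"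
    "dim_row A = n" "dim_col A = n"
  using assms unfolding psd_iff by auto

lemma qf_congr:
  assumes "A \<in> carrier_mat m m" "K \<in> carrier_mat n m" "v \<in> carrier_vec n"
  shows "qf (K * A * adj K) v = qf A (adj K *\<^sub>v v)"
proof -
  have "(K * A * adj K) *\<^sub>v v = K *\<^sub>v (A *\<^sub>v (adj K *\<^sub>v v))"
    using assms by (smt (verit) adj_carrier assoc_mult_mat_vec mult_carrier_mat mult_mat_vec_carrier)
  thus ?thesis unfolding qf_def
    using ip_adj[OF assms(2,3), of "A *\<^sub>v (adj K *\<^sub>v v)"] assms(1) by simp
qed

lemma qf_add:
  assumes "A \<in> carrier_mat n n" "B \<in> carrier_mat n n" "v \<in> carrier_vec n"
  shows "qf (A + B) v = qf A v + qf B v"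
  using assms unfolding qf_def
  by (simp add: add_mult_distrib_mat_vec[of A n n B v] scalar_prod_add_distrib[of _ n])

lemma qf_minus:
  assumes "A \<in> carrier_mat n n" "B \<in> carrier_mat n n" "v \<in> carrier_vec n"
  shows "qf (A - B) v = qf A v - qf B v"
  using assms unfolding qf_def
  by (simp add: minus_mult_distrib_mat_vec[of A n n B v] scalar_prod_minus_distrib[of _ n])

lemma qf_smult:
  assumes "A \<in> carrier_mat n n" "v \<in> carrier_vec n"
  shows "qf (complex_of_real c \<cdot>\<^sub>m A) v = c * qf A v"
proof -
  have "(\<Sum>i<n. \<Sum>j<n. cnj (v $ i) * (complex_of_real c \<cdot>\<^sub>m A) $$ (i,j) * v $ j)
      = complex_of_real c * (\<Sum>i<n. \<Sum>j<n. cnj (v $ i) * A $$ (i,j) * v $ j)"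
    using assms by (simp add: sum_distrib_left mult_ac)
  thus ?thesis unfolding qf_sum[OF assms] using assms by (subst qf_sum[of _ n]) (simp_all del: index_smult_mat(1))
qed

lemma qf_one: "v \<in> carrier_vec n \<Longrightarrow> qf (1\<^sub>m n) v = sqn v"
  unfolding qf_def by (simp add: ip_self)

lemma qf_rdiag:
  assumes "v \<in> carrier_vec n"
  shows "qf (rdiag n d) v = (\<Sum>i<n. d i * (cmod (v $ i))\<^sup>2)"
proof -
  have "(\<Sum>i<n. \<Sum>j<n. cnj (v $ i) * rdiag n d $$ (i,j) * v $ j)
      = (\<Sum>i<n. complex_of_real (d i * (cmod (v $ i))\<^sup>2))"
    by (rule sum.cong) (auto simp: sum.remove complex_norm_square if_distrib if_distribR mult_ac simp del: of_real_power cong: if_cong)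
  hence "qf (rdiag n d) v = Re (\<Sum>i<n. complex_of_real (d i * (cmod (v $ i))\<^sup>2))"
    using assms by (subst qf_sum[of _ n]) (simp_all del: mat_diag_index)
  thus ?thesis by simp
qed

text \<open>Allowing an arbitrary rectangular \<open>T\<close> covers spectral decompositions as
  well as simultaneous diagonalizations by congruence.\<close>

lemma qf_spec:
  assumes "T \<in> carrier_mat n m" "v \<in> carrier_vec n"
  shows "qf (T * rdiag m d * adj T) v = (\<Sum>i<m. d i * (cmod ((adj T *\<^sub>v v) $ i))\<^sup>2)"
  using assms by (simp add: qf_congr[of _ m] qf_rdiag del: index_mult_mat_vec)

lemma qf_gram:
  assumes "T \<in> carrier_mat n m" "v \<in> carrier_vec n"
  shows "qf (T * adj T) v = sqn (adj T *\<^sub>v v)"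
proof -
  have "T * adj T = T * 1\<^sub>m m * adj T" using assms by simp
  thus ?thesis using qf_congr[of "1\<^sub>m m" m T n v] assms by (simp add: qf_one[of _ m])
qed

lemma psd_gram: "B \<in> carrier_mat n m \<Longrightarrow> psd n (B * adj B)"
  unfolding psd_iff by (auto simp: hermitian_gram qf_gram intro!: mult_carrier_mat)

lemma psd_congr: "psd m A \<Longrightarrow> K \<in> carrier_mat n m \<Longrightarrow> psd n (K * A * adj K)"
  unfolding psd_iff by (auto simp: qf_congr intro!: hermitian_congr mult_carrier_mat)

lemma psd_add: "psd n A \<Longrightarrow> psd n B \<Longrightarrow> psd n (A + B)"
  unfolding psd_iff by (auto simp: qf_add intro!: hermitian_add)

lemma psd_smult: "psd n A \<Longrightarrow> 0 \<le> c \<Longrightarrow> psd n (complex_of_real c \<cdot>\<^sub>m A)"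
  unfolding psd_iff by (auto simp: qf_smult intro!: hermitian_smult)

lemma psd_rdiag: "(\<And>i. i < n \<Longrightarrow> 0 \<le> d i) \<Longrightarrow> psd n (rdiag n d)"
  unfolding psd_iff by (auto simp: qf_rdiag intro!: sum_nonneg)

lemma psd_spec: "(\<And>i. i < m \<Longrightarrow> 0 \<le> d i) \<Longrightarrow> T \<in> carrier_mat n m \<Longrightarrow> psd n (T * rdiag m d * adj T)"
  by (rule psd_congr[OF psd_rdiag])

lemma psd_one [simp]: "psd n (1\<^sub>m n)"
  unfolding psd_iff by (auto simp: qf_one)

lemma psd_zero [simp]: "psd n (0\<^sub>m n n)"
proof -
  have "0\<^sub>m n n = 0\<^sub>m n 1 * adj (0\<^sub>m n 1)" by (rule eq_matI) (auto simp: scalar_prod_def)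
  thus ?thesis using psd_gram[of "0\<^sub>m n 1" n 1] by simp
qed

lemma loewner_iff:
  assumes "A \<in> carrier_mat n n" "hermitian A" "B \<in> carrier_mat n n" "hermitian B"
  shows "loewner_le n A B \<longleftrightarrow> (\<forall>v \<in> carrier_vec n. qf A v \<le> qf B v)"
  using assms unfolding loewner_le_def psd_iff
  by (auto simp: qf_minus hermitian_minus)

lemma loewner_psd_iff:
  assumes "psd n A" "psd n B"
  shows "loewner_le n A B \<longleftrightarrow> (\<forall>v \<in> carrier_vec n. qf A v \<le> qf B v)"
  using loewner_iff assms psdD by blast

lemma loewnerD: "loewner_le n A B \<Longrightarrow> v \<in> carrier_vec n \<Longrightarrow> qf A v \<le> qf B v"
  unfolding loewner_le_def psd_iff using qf_minus by (metis diff_ge_0_iff_ge)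

lemma mtrace_comm:
  assumes "A \<in> carrier_mat n m" "B \<in> carrier_mat m n"
  shows "mtrace (A * B) = mtrace (B * A)"
proof -
  have "mtrace (A * B) = (\<Sum>i<n. \<Sum>j<m. A $$ (i,j) * B $$ (j,i))"
    using assms unfolding mtrace_def by (simp add: scalar_prod_def lessThan_atLeast0)
  also have "\<dots> = (\<Sum>j<m. \<Sum>i<n. A $$ (i,j) * B $$ (j,i))" by (rule sum.swap)
  also have "\<dots> = mtrace (B * A)"
    using assms unfolding mtrace_def by (simp add: scalar_prod_def lessThan_atLeast0 mult.commute)
  finally show ?thesis .
qed

lemma mtrace_add: "dim_row A = n \<Longrightarrow> dim_col A = n \<Longrightarrow> dim_row B = n \<Longrightarrow> dim_col B = n \<Longrightarrow> mtrace (A + B) = mtrace A + mtrace B"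
  unfolding mtrace_def by (simp add: sum.distrib)

lemma mtrace_smult: "dim_row A = dim_col A \<Longrightarrow> mtrace (c \<cdot>\<^sub>m A) = c * mtrace A"
  unfolding mtrace_def by (simp add: sum_distrib_left)

lemma mtrace_rdiag: "mtrace (rdiag n d) = complex_of_real (\<Sum>i<n. d i)"
  unfolding mtrace_def by simp

lemma mtrace_unitary:
  assumes "unitary n U" "A \<in> carrier_mat n n"
  shows "mtrace (U * A * adj U) = mtrace A" "mtrace (adj U * A * U) = mtrace A"
proof -
  have U: "U \<in> carrier_mat n n" using assms unitary_carrier by auto
  show "mtrace (U * A * adj U) = mtrace A"
    using assms U mtrace_comm[of "U * A" n n "adj U"] by (simp add: unitary_cancel)
  show "mtrace (adj U * A * U) = mtrace A"
    using assms U mtrace_comm[of "adj U * A" n n "U"]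
    by (simp add: unitary_cancel mult_carrier_mat[of "adj U" n n A n] adj_carrier)
qed

lemma spec_entry:
  assumes "T \<in> carrier_mat n m" "i < n" "j < n"
  shows "(T * mat_diag m d * adj T) $$ (i,j) = (\<Sum>k<m. T $$ (i,k) * d k * cnj (T $$ (j,k)))"
  using assms by (simp add: mat_diag_mult_right[of T n m] scalar_prod_def lessThan_atLeast0)

lemma mat_diag_cong: "(\<And>i. i < n \<Longrightarrow> f i = g i) \<Longrightarrow> mat_diag n f = mat_diag n g"
  by (auto intro!: eq_matI)

section \<open>Spectral theorem and functional calculus\<close>

text \<open>Complete \<open>v\<close> to a basis, orthogonalize starting from \<open>v\<close>, and
  normalize the columns; \<open>c\<close> is the reciprocal norm of \<open>v\<close>.\<close>

lemma unitary_extend: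
  assumes v: "v \<in> carrier_vec n" and v0: "v \<noteq> 0\<^sub>v n"
  obtains W c where "unitary n W" "c \<noteq> 0" "\<And>i. i < n \<Longrightarrow> W $$ (i,0) = c * v $ i"
proof -
  interpret cof_vec_space n "TYPE(complex)" .
  define b where "b = basis_completion v"
  define ws where "ws = gram_schmidt n b"
  have n: "n \<noteq> 0" using v v0 by auto
  from basis_completion[OF v v0, folded b_def]
  have dist_b: "distinct b" and indep: "\<not> lin_dep (set b)" and b: "set b \<subseteq> carrier_vec n"
    and hdb: "hd b = v" and len_b: "length b = n" by auto
  from hdb len_b n obtain vs where bv: "b = v # vs" by (cases b) auto
  from gram_schmidt_result[OF b dist_b indep refl, folded ws_def]
  have ws: "set ws \<subseteq> carrier_vec n" "corthogonal ws" "length ws = n" by (auto simp: len_b)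
  from gram_schmidt_hd[OF v, of vs, folded bv] have "hd ws = v" unfolding ws_def .
  hence ws0: "ws ! 0 = v" using ws(3) n by (metis hd_conv_nth list.size(3))
  have wc: "ws ! i \<in> carrier_vec n" if "i < n" for i using ws that by auto
  define s where "s i = sqrt (sqn (ws ! i))" for i
  define W where "W = mat n n (\<lambda>(i,j). (ws ! j) $ i / complex_of_real (s j))"
  have orth: "conjugate (ws ! i) \<bullet> (ws ! j) = (if i = j then complex_of_real ((s i)\<^sup>2) else 0)"
    if "i < n" "j < n" for i j
  proof (cases "i = j")
    case True thus ?thesis using that by (simp add: ip_self s_def del: of_real_power)
  next
    case False
    hence "(ws ! j) \<bullet>c (ws ! i) = 0" using corthogonalD[OF ws(2), of j i] ws(3) that by auto
    thus ?thesis using False wc[OF that(1)] wc[OF that(2)] by (simp add: comm_scalar_prod[of _ n])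
  qed
  have s0: "s i \<noteq> 0" if "i < n" for i
  proof -
    have "(ws ! i) \<bullet>c (ws ! i) \<noteq> 0" using corthogonalD[OF ws(2), of i i] ws(3) that by auto
    hence "conjugate (ws ! i) \<bullet> (ws ! i) \<noteq> 0" using wc[OF that] by (simp add: comm_scalar_prod[of _ n])
    thus ?thesis using that orth[of i i] by auto
  qed
  have "adj W * W = 1\<^sub>m n"
  proof (rule eq_matI)
    fix i j assume "i < dim_row (1\<^sub>m n :: complex mat)" "j < dim_col (1\<^sub>m n :: complex mat)"
    hence ij: "i < n" "j < n" by auto
    have "(adj W * W) $$ (i,j) = (\<Sum>k<n. cnj ((ws ! i) $ k) * (ws ! j) $ k / complex_of_real (s i * s j))"
      using ij by (simp add: index_mult_sum W_def mult_ac del: index_mult_mat(1))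
    also have "\<dots> = (conjugate (ws ! i) \<bullet> (ws ! j)) / complex_of_real (s i * s j)"
      using wc[OF ij(1)] wc[OF ij(2)] by (simp add: scalar_prod_def lessThan_atLeast0 sum_divide_distrib)
    also have "\<dots> = 1\<^sub>m n $$ (i,j)" using orth[OF ij] s0 ij by (simp add: power2_eq_square)
    finally show "(adj W * W) $$ (i,j) = 1\<^sub>m n $$ (i,j)" .
  qed (auto simp: W_def)
  moreover have Wc: "W \<in> carrier_mat n n" unfolding W_def by simp
  ultimately have "unitary n W"
    using mat_mult_left_right_inverse[of "adj W" n W] unfolding unitary_def by simp
  moreover have "1 / complex_of_real (s 0) \<noteq> 0" using s0 n by simp
  moreover have "W $$ (i,0) = 1 / complex_of_real (s 0) * v $ i" if "i < n" for i
    using that n by (simp add: W_def ws0)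
  ultimately show ?thesis using that by blast
qed

lemma mult_sandwich_index:
  assumes "U \<in> carrier_mat n m" "A \<in> carrier_mat n n" "i < m" "j < m"
  shows "(adj U * A * U) $$ (i,j) = (\<Sum>k<n. \<Sum>l<n. cnj (U $$ (k,i)) * A $$ (k,l) * U $$ (l,j))"
proof -
  have "(adj U * A * U) $$ (i,j) = (\<Sum>l<n. (\<Sum>k<n. cnj (U $$ (k,i)) * A $$ (k,l)) * U $$ (l,j))"
    using assms by (simp add: index_mult_sum del: index_mult_mat(1))
  also have "\<dots> = (\<Sum>l<n. \<Sum>k<n. cnj (U $$ (k,i)) * A $$ (k,l) * U $$ (l,j))"
    by (simp add: sum_distrib_right)
  finally show ?thesis by (subst (asm) sum.swap)
qed

text \<open>Induction by deflation: a complex matrix has an eigenvector, a unitary with that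
  direction as its first column splits off a 1 by 1 block, and Hermiticity clears the first row
  along with the first column.\<close>

theorem spectral:
  assumes "A \<in> carrier_mat n n" "hermitian A"
  shows "\<exists>U d. unitary n U \<and> A = U * rdiag n d * adj U"
  using assms
proof (induction n arbitrary: A)
  case 0
  have "unitary 0 (1\<^sub>m 0)" by (rule unitary_one)
  moreover have "A = 1\<^sub>m 0 * rdiag 0 (\<lambda>_. 0) * adj (1\<^sub>m 0)" using 0 by (intro eq_matI) auto
  ultimately show ?case by (intro exI[of _ "1\<^sub>m 0"] exI[of _ "\<lambda>_. 0"] conjI)
next
  case (Suc n)
  note A = Suc.prems(1)
  from spectrum_non_empty[OF A] obtain v l where v: "v \<in> carrier_vec (Suc n)" "v \<noteq> 0\<^sub>v (Suc n)"
    and ev: "A *\<^sub>v v = l \<cdot>\<^sub>v v"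
    using A unfolding spectrum_def eigenvalue_def eigenvector_def by auto
  obtain W c where W: "unitary (Suc n) W" "c \<noteq> 0" and Wv: "\<And>i. i < Suc n \<Longrightarrow> W $$ (i,0) = c * v $ i"
    using unitary_extend[OF v] by metis
  have Wc: "W \<in> carrier_mat (Suc n) (Suc n)" using W unitary_carrier by blast
  define B where "B = adj W * A * W"
  have Bc: "B \<in> carrier_mat (Suc n) (Suc n)" unfolding B_def using Wc A by simp
  have Bh: "hermitian B" unfolding B_def
    using hermitian_congr[of A "adj W"] Suc.prems Wc by simp
  have AB: "A = W * B * adj W"
    unfolding B_def using W Wc A by (simp add: mult_assoc_dim unitary_cancel)
  have AW0: "(\<Sum>j<Suc n. A $$ (i,j) * W $$ (j,0)) = l * W $$ (i,0)" if "i < Suc n" for i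
  proof -
    have "(\<Sum>j<Suc n. A $$ (i,j) * W $$ (j,0)) = c * (A *\<^sub>v v) $ i"
      using that A v by (simp add: Wv scalar_prod_def lessThan_atLeast0 sum_distrib_left mult_ac
          del: sum.lessThan_Suc sum.op_ivl_Suc)
    thus ?thesis using ev that v by (simp add: Wv)
  qed
  have B0: "B $$ (i,0) = (if i = 0 then l else 0)" if "i < Suc n" for i
  proof -
    have "B $$ (i,0) = (\<Sum>k<Suc n. cnj (W $$ (k,i)) * (\<Sum>j<Suc n. A $$ (k,j) * W $$ (j,0)))"
      unfolding B_def using Wc A that
      by (subst mult_sandwich_index[of _ "Suc n" "Suc n"])
         (auto simp: sum_distrib_left mult_ac simp del: sum.lessThan_Suc intro!: sum.cong)
    also have "\<dots> = l * (\<Sum>k<Suc n. cnj (W $$ (k,i)) * W $$ (k,0))"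
      using AW0 by (simp add: sum_distrib_left mult_ac del: sum.lessThan_Suc)
    also have "(\<Sum>k<Suc n. cnj (W $$ (k,i)) * W $$ (k,0)) = (adj W * W) $$ (i,0)"
      using Wc that by (simp add: index_mult_sum del: index_mult_mat(1) sum.lessThan_Suc)
    also have "\<dots> = (if i = 0 then 1 else 0)" using W that by simp
    finally show ?thesis by simp
  qed
  have Bsym: "B $$ (j,i) = cnj (B $$ (i,j))" if "i < Suc n" "j < Suc n" for i j
    using Bh Bc that unfolding hermitian_def by (metis adj_index carrier_matD(1) carrier_matD(2))
  have B0': "B $$ (0,i) = (if i = 0 then l else 0)" if "i < Suc n" for i
    using Bsym[OF that, of 0] B0[OF that] Bsym[of 0 0] B0[of 0] by auto
  have lreal: "l = complex_of_real (Re l)"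
    using Bsym[of 0 0] B0[of 0] by (simp add: complex_eq_iff)
  define C where "C = mat n n (\<lambda>(i,j). B $$ (Suc i, Suc j))"
  have Cc: "C \<in> carrier_mat n n" unfolding C_def by simp
  have "hermitian C" unfolding hermitian_def
    by (rule eq_matI) (auto simp: C_def Bsym[symmetric])
  from Suc.IH[OF Cc this] obtain V d where V: "unitary n V" and CV: "C = V * rdiag n d * adj V" by auto
  have Vc: "V \<in> carrier_mat n n" using V unitary_carrier by blast
  \<comment> \<open>The direct sum of the 1 by 1 identity and \<open>V\<close>.\<close>
  define U where "U = mat (Suc n) (Suc n)
     (\<lambda>(i,j). if i = 0 \<and> j = 0 then 1 else if i = 0 \<or> j = 0 then 0 else V $$ (i - 1, j - 1))"
  have Uc: "U \<in> carrier_mat (Suc n) (Suc n)" unfolding U_def by simp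
  define e where "e i = (case i of 0 \<Rightarrow> Re l | Suc j \<Rightarrow> d j)" for i
  have Uent: "(U * rdiag (Suc n) f * adj U) $$ (i,j) =
     (if i = 0 \<and> j = 0 then f 0 else if i = 0 \<or> j = 0 then 0
      else (V * rdiag n (\<lambda>k. f (Suc k)) * adj V) $$ (i - 1, j - 1))"
    if "i < Suc n" "j < Suc n" for f i j
    using that Vc
    by (subst spec_entry[OF Uc that], subst sum.lessThan_Suc_shift)
       (cases i; cases j; auto simp: U_def spec_entry[OF Vc] simp del: index_mult_mat(1))
  \<comment> \<open>With all weights equal to 1, the entry formula \<open>Uent\<close> reduces
    unitarity of \<open>U\<close> to unitarity of \<open>V\<close>.\<close>
  have "U * rdiag (Suc n) (\<lambda>_. 1) * adj U = 1\<^sub>m (Suc n)"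
  proof (rule eq_matI)
    fix i j assume "i < dim_row (1\<^sub>m (Suc n) :: complex mat)" "j < dim_col (1\<^sub>m (Suc n) :: complex mat)"
    hence "i < Suc n" "j < Suc n" by auto
    moreover have "V * rdiag n (\<lambda>k. 1) * adj V = 1\<^sub>m n" using V Vc by simp
    ultimately show "(U * rdiag (Suc n) (\<lambda>_. 1) * adj U) $$ (i,j) = 1\<^sub>m (Suc n) $$ (i,j)"
      by (subst Uent) auto
  qed (use Uc in auto)
  hence Uu: "unitary (Suc n) U" using Uc by (intro unitaryI) simp_all
  have "B = U * rdiag (Suc n) e * adj U"
  proof (rule eq_matI)
    fix i j assume "i < dim_row (U * rdiag (Suc n) e * adj U)" "j < dim_col (U * rdiag (Suc n) e * adj U)"
    hence ij: "i < Suc n" "j < Suc n" using Uc by auto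
    have 1: "(\<lambda>k. complex_of_real (e (Suc k))) = (\<lambda>k. complex_of_real (d k))" by (auto simp: e_def)
    have 2: "(V * rdiag n d * adj V) $$ (i - 1, j - 1) = B $$ (i,j)" if "i \<noteq> 0" "j \<noteq> 0"
      using that ij unfolding CV[symmetric] C_def by simp
    have "e 0 = Re l" by (simp add: e_def)
    thus "B $$ (i,j) = (U * rdiag (Suc n) e * adj U) $$ (i,j)"
      unfolding Uent[OF ij] 1 using 2 B0[OF ij(1)] B0'[OF ij(2)] lreal by auto
  qed (use Uc Bc in auto)
  hence "A = (W * U) * rdiag (Suc n) e * adj (W * U)"
    unfolding AB using Wc Uc by (simp add: adj_mult mult_assoc_dim)
  thus ?case using unitary_times[OF W(1) Uu] by blast
qed

lemma psd_spectral:
  assumes "psd n A"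
  obtains U d where "unitary n U" "A = U * rdiag n d * adj U" "\<And>i. i < n \<Longrightarrow> 0 \<le> d i"
proof -
  obtain U d where U: "unitary n U" and A: "A = U * rdiag n d * adj U"
    using spectral psdD[OF assms] by metis
  have Uc: "U \<in> carrier_mat n n" using U unitary_carrier by blast
  have "0 \<le> d i" if i: "i < n" for i
  proof -
    define v where "v = U *\<^sub>v unit_vec n i"
    have "adj U *\<^sub>v v = (adj U * U) *\<^sub>v unit_vec n i"
      unfolding v_def using Uc by (simp add: assoc_mult_mat_vec[of _ n n _ n])
    hence "adj U *\<^sub>v v = unit_vec n i" using U by simp
    hence "qf A v = (\<Sum>j<n. d j * (cmod (unit_vec n i $ j))\<^sup>2)"
      unfolding A using Uc by (subst qf_spec) (auto simp: v_def)
    also have "\<dots> = d i"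
      using i by (simp add: if_distrib if_distribR unit_vec_def sum.delta cong: if_cong)
    finally show ?thesis using psdD(3)[OF assms, of v] Uc by (simp add: v_def)
  qed
  thus ?thesis using that U A by blast
qed

text \<open>\<open>mat_fun\<close> picks some diagonalization, so independence of the choice has to
  be shown. The unitary \<open>W\<close> between two eigenbases intertwines the two diagonal
  matrices; its entries vanish between different eigenvalues, hence it also intertwines the images
  under \<open>f\<close>.\<close>

lemma mat_fun_spec:
  assumes U: "unitary n U"
  shows "mat_fun f (U * rdiag n d * adj U) = U * rdiag n (\<lambda>i. f (d i)) * adj U"
proof -
  let ?A = "U * rdiag n d * adj U"
  have Uc: "U \<in> carrier_mat n n" using U unitary_carrier by blast
  define P where "P p \<longleftrightarrow> unitary n (fst p) \<and> ?A = fst p * rdiag n (snd p) * adj (fst p)"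
    for p :: "complex mat \<times> (nat \<Rightarrow> real)"
  have "P (U, d)" using U unfolding P_def by simp
  hence P: "P (Eps P)" by (rule someI)
  define V where "V = fst (Eps P)"
  define e where "e = snd (Eps P)"
  have V: "unitary n V" and eq: "?A = V * rdiag n e * adj V" using P unfolding P_def V_def e_def by auto
  have Vc: "V \<in> carrier_mat n n" using V unitary_carrier by blast
  have mf: "mat_fun f ?A = V * rdiag n (\<lambda>i. f (e i)) * adj V"
    unfolding mat_fun_def V_def e_def P_def Let_def using Uc by simp
  define W where "W = adj V * U"
  have Wc: "W \<in> carrier_mat n n" unfolding W_def using Uc Vc by simp
  have "W * rdiag n d = adj V * (?A * U)" unfolding W_def
    using U Uc Vc by (simp add: mult_assoc_dim unitary_cancel)
  also have "\<dots> = rdiag n e * W" unfolding W_def eq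
    using V Uc Vc by (simp add: mult_assoc_dim unitary_cancel)
  finally have comm: "W * rdiag n d = rdiag n e * W" .
  have cm: "W $$ (i,j) * complex_of_real (d j) = complex_of_real (e i) * W $$ (i,j)" if "i < n" "j < n" for i j
    using arg_cong[OF comm, of "\<lambda>M. M $$ (i,j)"] that Wc
    by (simp add: mat_diag_mult_right[of W n n] mat_diag_mult_left[of W n n])
  have "W $$ (i,j) * complex_of_real (f (d j)) = complex_of_real (f (e i)) * W $$ (i,j)" if "i < n" "j < n" for i j
  proof (cases "W $$ (i,j) = 0")
    case False
    with cm[OF that] have "complex_of_real (d j) = complex_of_real (e i)" by (simp add: mult.commute)
    thus ?thesis by simp
  qed simp
  hence commf: "W * rdiag n (\<lambda>i. f (d i)) = rdiag n (\<lambda>i. f (e i)) * W"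
    unfolding mat_diag_mult_right[OF Wc] mat_diag_mult_left[OF Wc] by (intro eq_matI) simp_all
  have "U * rdiag n (\<lambda>i. f (d i)) * adj U = V * (W * rdiag n (\<lambda>i. f (d i))) * adj U"
    unfolding W_def using V Uc Vc by (simp add: mult_assoc_dim unitary_cancel)
  also have "\<dots> = V * rdiag n (\<lambda>i. f (e i)) * adj V"
    unfolding commf unfolding W_def using U Uc Vc by (simp add: mult_assoc_dim)
  finally show ?thesis using mf by simp
qed

lemma psd_imp_gram:
  assumes "psd n A"
  obtains B where "B \<in> carrier_mat n n" "A = B * adj B"
proof -
  obtain U d where U: "unitary n U" and A: "A = U * rdiag n d * adj U" and d: "\<And>i. i < n \<Longrightarrow> 0 \<le> d i"
    using psd_spectral[OF assms] by metis
  have Uc: "U \<in> carrier_mat n n" using U unitary_carrier by blast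
  have "rdiag n d = rdiag n (\<lambda>i. sqrt (d i)) * rdiag n (\<lambda>i. sqrt (d i))"
    using d by (auto intro!: mat_diag_cong simp flip: of_real_mult)
  hence "A = (U * rdiag n (\<lambda>i. sqrt (d i))) * adj (U * rdiag n (\<lambda>i. sqrt (d i)))"
    unfolding A using Uc by (simp add: adj_mult mult_assoc_dim del: mat_diag_diag)
  thus ?thesis using that[of "U * rdiag n (\<lambda>i. sqrt (d i))"] Uc by simp
qed

lemma mat_fun_carrier:
  assumes "hermitian A" "A \<in> carrier_mat n n"
  shows "mat_fun f A \<in> carrier_mat n n" "hermitian (mat_fun f A)"
proof -
  obtain U d where U: "unitary n U" and A: "A = U * rdiag n d * adj U"
    using spectral assms by metis
  show "mat_fun f A \<in> carrier_mat n n" "hermitian (mat_fun f A)"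
    unfolding A mat_fun_spec[OF U] using U unitary_carrier[OF U]
    by (auto intro!: hermitian_congr)
qed

lemma mat_fun_unitary:
  assumes "unitary n V" "hermitian A" "A \<in> carrier_mat n n"
  shows "mat_fun f (V * A * adj V) = V * mat_fun f A * adj V"
proof -
  obtain U d where U: "unitary n U" and A: "A = U * rdiag n d * adj U"
    using spectral assms by metis
  note VU = unitary_times[OF assms(1) U]
  have *: "V * (U * rdiag n f * adj U) * adj V = (V * U) * rdiag n f * adj (V * U)" for f
    using assms(1) U by (simp add: adj_mult mult_assoc_dim)
  show ?thesis unfolding A mat_fun_spec[OF U] * mat_fun_spec[OF VU] ..
qed

text \<open>The scalar function behind \<open>mpow\<close>. It vanishes at 0 for every exponent, so
  \<open>pw 0\<close> is the indicator of the positive reals rather than the constant 1, which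
  encodes a support projection.\<close>

definition pw :: "real \<Rightarrow> real \<Rightarrow> real" where
  "pw t x = (if 0 < x then x powr t else 0)"

lemma mpow_spec:
  "unitary n U \<Longrightarrow> mpow t (U * rdiag n d * adj U) = U * rdiag n (\<lambda>i. pw t (d i)) * adj U"
  unfolding mpow_def pw_def by (subst mat_fun_spec) auto

lemma pw_nonneg [simp]: "0 \<le> pw t x" unfolding pw_def by simp

lemma pw_mult: "0 \<le> x \<Longrightarrow> 0 \<le> y \<Longrightarrow> pw t (x * y) = pw t x * pw t y"
  unfolding pw_def by (auto simp: powr_mult mult_pos_pos zero_less_mult_iff)

lemma pw_add: "pw s x * pw t x = pw (s + t) x"
  unfolding pw_def by (simp add: powr_add)

lemma pw_1: "0 \<le> x \<Longrightarrow> pw 1 x = x" unfolding pw_def by auto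

lemma pw_pw: "pw s (pw t x) = pw (t * s) x"
  unfolding pw_def by (simp add: powr_powr)

lemma psd_mpow: "hermitian A \<Longrightarrow> A \<in> carrier_mat n n \<Longrightarrow> psd n (mpow t A)"
proof -
  assume "hermitian A" "A \<in> carrier_mat n n"
  then obtain U d where U: "unitary n U" and A: "A = U * rdiag n d * adj U"
    using spectral by metis
  show ?thesis unfolding A mpow_spec[OF U] using unitary_carrier[OF U] by (intro psd_spec) auto
qed

lemma mpow_half_square:
  assumes "psd n A"
  shows "mpow (1/2) A * mpow (1/2) A = A"
proof -
  obtain U d where U: "unitary n U" and A: "A = U * rdiag n d * adj U" and d: "\<And>i. i < n \<Longrightarrow> 0 \<le> d i"
    using psd_spectral[OF assms] by metis
  have "rdiag n (\<lambda>i. pw (1/2) (d i)) * rdiag n (\<lambda>i. pw (1/2) (d i)) = rdiag n d"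
    using d by (auto intro!: mat_diag_cong simp: pw_add pw_1 simp flip: of_real_mult)
  thus ?thesis unfolding A mpow_spec[OF U]
    using U unitary_carrier[OF U] by (simp add: mult_assoc_dim unitary_cancel del: mat_diag_diag)
      (simp flip: mult_assoc_dim del: mat_diag_diag)
qed

section \<open>Geometric means as integrals of parallel sums\<close>

text \<open>The factor \<open>l * d / (l + d)\<close> is the parallel sum of \<open>l\<close> and \<open>d\<close>, an infimum of linear expressions
  in \<open>l\<close> and \<open>d\<close>; integrating it yields \<open>d powr \<beta>\<close>.\<close>
definition pker :: "real \<Rightarrow> real \<Rightarrow> real \<Rightarrow> real" where
  "pker \<beta> d l = (if 0 < l then l powr (\<beta> - 2) * (l * d / (l + d)) else 0)"

lemma pker_measurable [measurable]: "pker \<beta> d \<in> borel_measurable borel"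
  unfolding pker_def by measurable

lemma pker_nonneg: "0 \<le> d \<Longrightarrow> 0 \<le> pker \<beta> d l"
  unfolding pker_def by simp

text \<open>A Beta integral of value \<open>pi / sin (pi * \<beta>)\<close> for
  \<open>\<beta>\<close> between 0 and 1. The comparison of means cancels it, for which positivity
  and finiteness are proved below.\<close>

definition pconst :: "real \<Rightarrow> ennreal" where
  "pconst \<beta> = (\<integral>\<^sup>+l. pker \<beta> 1 l \<partial>lborel)"

text \<open>The substitution \<open>l = d * u\<close> pulls \<open>d powr (\<beta> - 1)\<close> out
  of the kernel and \<open>d\<close> out of the measure.\<close>

lemma nn_integral_pker:
  assumes "0 \<le> d"
  shows "(\<integral>\<^sup>+l. pker \<beta> d l \<partial>lborel) = ennreal (pw \<beta> d) * pconst \<beta>"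
proof (cases "d = 0")
  case True
  have "pker \<beta> 0 l = 0" for l unfolding pker_def by simp
  thus ?thesis using True by (simp add: pw_def)
next
  case False
  hence d: "0 < d" using assms by simp
  have eq: "pker \<beta> d (d * u) = d powr (\<beta> - 1) * pker \<beta> 1 u" for u
  proof (cases "0 < u")
    case True
    have "(d * u) * d / (d * u + d) = d * (u / (u + 1))"
    proof -
      have "d * u + d = d * (u + 1)" by (simp add: algebra_simps)
      thus ?thesis using d by simp
    qed
    moreover have "d powr (\<beta> - 2) * d = d powr (\<beta> - 1)"
      using d powr_add[of d "\<beta> - 2" 1] by simp
    ultimately show ?thesis
      using d True by (simp add: pker_def powr_mult mult_ac)
  qed (use d in \<open>auto simp: pker_def zero_less_mult_iff\<close>)
  have "(\<integral>\<^sup>+l. pker \<beta> d l \<partial>lborel) = ennreal d * (\<integral>\<^sup>+u. pker \<beta> d (d * u) \<partial>lborel)"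
    using d nn_integral_real_affine[of "\<lambda>l. ennreal (pker \<beta> d l)" d 0] by simp
  also have "\<dots> = ennreal d * (ennreal (d powr (\<beta> - 1)) * pconst \<beta>)"
    unfolding eq pconst_def by (simp add: ennreal_mult' pker_nonneg nn_integral_cmult)
  also have "\<dots> = ennreal (d * d powr (\<beta> - 1)) * pconst \<beta>"
    using d by (simp add: ennreal_mult mult.assoc)
  also have "d * d powr (\<beta> - 1) = pw \<beta> d"
    using d powr_add[of d 1 "\<beta> - 1"] by (simp add: pw_def)
  finally show ?thesis .
qed

text \<open>The integrand is at most \<open>l powr (\<beta> - 1)\<close> up to 1 and at most
  \<open>l powr (\<beta> - 2)\<close> beyond. Integrability at 0 uses \<open>0 < \<beta>\<close>, at
  infinity \<open>\<beta> < 1\<close>.\<close>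

lemma pconst_finite:
  assumes "0 < \<beta>" "\<beta> < 1"
  shows "pconst \<beta> < \<infinity>"
proof -
  have "pconst \<beta> \<le> (\<integral>\<^sup>+l. ennreal (l powr (\<beta> - 1)) * indicator {0..1} l +
      ennreal (l powr (\<beta> - 2)) * indicator {1..} l \<partial>lborel)"
    unfolding pconst_def
  proof (rule nn_integral_mono)
    fix l :: real
    have 1: "l powr (\<beta> - 2) * (l / (l + 1)) \<le> l powr (\<beta> - 1)" if "0 < l"
    proof -
      have "l powr (\<beta> - 2) * (l / (l + 1)) \<le> l powr (\<beta> - 2) * l"
        using that by (intro mult_left_mono) (auto simp: field_simps)
      also have "\<dots> = l powr (\<beta> - 1)" using that powr_add[of l "\<beta> - 2" 1] by simp
      finally show ?thesis .
    qed
    have 2: "l powr (\<beta> - 2) * (l / (l + 1)) \<le> l powr (\<beta> - 2)" if "0 < l"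
      using that by (intro mult_left_le) (simp_all add: divide_le_eq)
    show "ennreal (pker \<beta> 1 l) \<le> ennreal (l powr (\<beta> - 1)) * indicator {0..1} l +
      ennreal (l powr (\<beta> - 2)) * indicator {1..} l"
    proof (cases "l \<le> 1")
      case True
      hence "ennreal (pker \<beta> 1 l) \<le> ennreal (l powr (\<beta> - 1)) * indicator {0..1} l"
        using 1 by (auto simp: pker_def intro!: ennreal_leI)
      thus ?thesis by (rule order_trans) simp
    next
      case False
      hence "ennreal (pker \<beta> 1 l) \<le> ennreal (l powr (\<beta> - 2))"
        using 2 by (intro ennreal_leI) (simp add: pker_def)
      thus ?thesis using False by simp
    qed
  qed
  also have "\<dots> = ennreal (1 powr (\<beta> - 1 + 1) / (\<beta> - 1 + 1)) + ennreal (- (1 powr (\<beta> - 2 + 1)) / (\<beta> - 2 + 1))"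
  proof (subst nn_integral_add)
    have "((\<lambda>x::real. x powr (\<beta> - 1)) has_integral (1 powr (\<beta> - 1 + 1) / (\<beta> - 1 + 1))) {0..1}"
      using assms by (intro has_integral_powr_from_0) auto
    moreover have "((\<lambda>x::real. x powr (\<beta> - 2)) has_integral (- (1 powr (\<beta> - 2 + 1)) / (\<beta> - 2 + 1))) {1..}"
      using assms by (intro has_integral_powr_to_inf) auto
    ultimately show "(\<integral>\<^sup>+l. ennreal (l powr (\<beta> - 1)) * indicator {0..1} l \<partial>lborel)
      + (\<integral>\<^sup>+l. ennreal (l powr (\<beta> - 2)) * indicator {1..} l \<partial>lborel)
      = ennreal (1 powr (\<beta> - 1 + 1) / (\<beta> - 1 + 1)) + ennreal (- (1 powr (\<beta> - 2 + 1)) / (\<beta> - 2 + 1))"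
      by (intro arg_cong2[of _ _ _ _ "(+)"] nn_integral_has_integral_lebesgue') auto
  qed simp_all
  also have "\<dots> < \<infinity>" by simp
  finally show ?thesis .
qed

lemma pconst_pos:
  assumes "0 < \<beta>" "\<beta> < 1"
  shows "0 < pconst \<beta>"
proof -
  have "ennreal (1/8) * emeasure lborel {1..2::real} = (\<integral>\<^sup>+l. ennreal (1/8) * indicator {1..2::real} l \<partial>lborel)"
    by (rule nn_integral_cmult_indicator[symmetric]) simp
  also have "(\<integral>\<^sup>+l. ennreal (1/8) * indicator {1..2::real} l \<partial>lborel) \<le> pconst \<beta>"
    unfolding pconst_def
  proof (rule nn_integral_mono)
    fix l :: real
    show "ennreal (1/8) * indicator {1..2} l \<le> ennreal (pker \<beta> 1 l)"
    proof (cases "l \<in> {1..2}")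
      case True
      \<comment> \<open>On \<open>{1..2}\<close> the power is at least 1/4 and the fraction at least
        1/2, whence the bound 1/8.\<close>
      have "(1/4::real) = 2 powr (-2)" by (simp add: powr_minus powr_numeral)
      also have "\<dots> \<le> 2 powr (\<beta> - 2)" using assms by (intro powr_mono) auto
      also have "\<dots> \<le> l powr (\<beta> - 2)" using True assms by (intro powr_mono2') auto
      finally have "1/4 * (1/2) \<le> l powr (\<beta> - 2) * (l / (l + 1))"
        using True by (intro mult_mono) (auto simp: field_simps)
      thus ?thesis using True by (auto simp: pker_def intro!: ennreal_leI)
    qed simp
  qed
  finally have "ennreal (1/8) \<le> pconst \<beta>" by simp
  moreover have "0 < ennreal (1/8)" by simp
  ultimately show ?thesis by (metis less_le_trans)
qed

text \<open>\<open>G\<close> is the \<open>\<beta>\<close>-weighted mean of the invertible \<open>A\<close> and of \<open>B\<close>, expressed through an arbitrary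
  simultaneous diagonalization by congruence instead of through \<open>mpow (1/2) A\<close>.\<close>
definition gm_rep :: "real \<Rightarrow> nat \<Rightarrow> complex mat \<Rightarrow> complex mat \<Rightarrow> complex mat \<Rightarrow> bool" where
  "gm_rep \<beta> n A B G \<longleftrightarrow> (\<exists>T S d. T \<in> carrier_mat n n \<and> S \<in> carrier_mat n n \<and> S * T = 1\<^sub>m n \<and>
     (\<forall>i<n. 0 \<le> d i) \<and> A = T * adj T \<and> B = T * rdiag n d * adj T \<and>
     G = T * rdiag n (\<lambda>i. pw \<beta> (d i)) * adj T)"

text \<open>For fixed \<open>l\<close> the value of the infimum over \<open>x + y = v\<close> of \<open>l * qf A x + qf B y\<close>,
  where \<open>A = T * adj T\<close> and \<open>B = T * rdiag n d * adj T\<close>.\<close>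
definition split_val :: "nat \<Rightarrow> complex mat \<Rightarrow> (nat \<Rightarrow> real) \<Rightarrow> real \<Rightarrow> complex vec \<Rightarrow> real" where
  "split_val n T d l v = (\<Sum>i<n. l * d i / (l + d i) * (cmod ((adj T *\<^sub>v v) $ i))\<^sup>2)"

lemma adj_mv_minus:
  assumes "T \<in> carrier_mat n m" "v \<in> carrier_vec n" "x \<in> carrier_vec n" "i < m"
  shows "(adj T *\<^sub>v (v - x)) $ i = (adj T *\<^sub>v v) $ i - (adj T *\<^sub>v x) $ i"
  using assms by (simp add: mult_minus_distrib_mat_vec[of "adj T" m n] del: index_mult_mat_vec)

lemma split_val_le:
  assumes T: "T \<in> carrier_mat n n" and d: "\<And>i. i < n \<Longrightarrow> 0 \<le> d i" and l: "0 < l"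
    and v: "v \<in> carrier_vec n" and x: "x \<in> carrier_vec n"
  shows "split_val n T d l v \<le> l * qf (T * adj T) x + qf (T * rdiag n d * adj T) (v - x)"
proof -
  have "l * d i / (l + d i) * (cmod w)\<^sup>2 \<le> l * (cmod a)\<^sup>2 + d i * (cmod (w - a))\<^sup>2" if "i < n" for i w a
  proof -
    define p q where "p = cmod a" and "q = cmod (w - a)"
    have "cmod w \<le> p + q" unfolding p_def q_def using norm_triangle_ineq[of a "w - a"] by simp
    hence "(cmod w)\<^sup>2 \<le> (p + q)\<^sup>2" by (intro power_mono) auto
    hence "l * d i / (l + d i) * (cmod w)\<^sup>2 \<le> l * d i / (l + d i) * (p + q)\<^sup>2"
      using l d[OF that] by (intro mult_left_mono) auto
    \<comment> \<open>After clearing the denominator, the difference of the two sides is the square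
      of \<open>l * p - d i * q\<close>.\<close>
    also have "\<dots> \<le> l * p\<^sup>2 + d i * q\<^sup>2"
    proof -
      have "(l * p\<^sup>2 + d i * q\<^sup>2) * (l + d i) - l * d i * (p + q)\<^sup>2 = (l * p - d i * q)\<^sup>2"
        by (simp add: power2_eq_square algebra_simps)
      hence "l * d i * (p + q)\<^sup>2 \<le> (l * p\<^sup>2 + d i * q\<^sup>2) * (l + d i)"
        by (metis diff_ge_0_iff_ge zero_le_power2)
      thus ?thesis using l d[OF that] by (simp add: pos_divide_le_eq add_pos_nonneg)
    qed
    finally show ?thesis unfolding p_def q_def .
  qed
  hence "split_val n T d l v \<le> (\<Sum>i<n. l * (cmod ((adj T *\<^sub>v x) $ i))\<^sup>2
      + d i * (cmod ((adj T *\<^sub>v v) $ i - (adj T *\<^sub>v x) $ i))\<^sup>2)"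
    unfolding split_val_def by (intro sum_mono) auto
  also have "\<dots> = l * (\<Sum>i<n. (cmod ((adj T *\<^sub>v x) $ i))\<^sup>2)
      + (\<Sum>i<n. d i * (cmod ((adj T *\<^sub>v (v - x)) $ i))\<^sup>2)"
    using adj_mv_minus[OF T v x]
    by (simp add: sum.distrib sum_distrib_left del: index_mult_mat_vec)
  also have "\<dots> = l * qf (T * adj T) x + qf (T * rdiag n d * adj T) (v - x)"
    using T v x by (simp add: qf_gram[of T n n] qf_spec[of T n n] sqn_def del: index_mult_mat_vec)
  finally show ?thesis .
qed

lemma split_val_attained:
  assumes T: "T \<in> carrier_mat n n" and S: "S \<in> carrier_mat n n" "S * T = 1\<^sub>m n"
    and d: "\<And>i. i < n \<Longrightarrow> 0 \<le> d i" and l: "0 < l" and v: "v \<in> carrier_vec n"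
  obtains x where "x \<in> carrier_vec n"
    "split_val n T d l v = l * qf (T * adj T) x + qf (T * rdiag n d * adj T) (v - x)"
proof -
  define w where "w = adj T *\<^sub>v v"
  \<comment> \<open>The split is optimal when in each coordinate \<open>l\<close> times the
    \<open>x\<close> part equals \<open>d i\<close> times the rest. The inverse \<open>S\<close> of
    \<open>T\<close> turns these coordinates back into a vector.\<close>
  define u where "u = vec n (\<lambda>i. complex_of_real (d i / (l + d i)) * w $ i)"
  define x where "x = adj S *\<^sub>v u"
  have x: "x \<in> carrier_vec n" unfolding x_def using S by simp
  have "adj T * adj S = adj (S * T)" using S T by (intro adj_mult[symmetric]) auto
  hence "adj T *\<^sub>v x = u" unfolding x_def using S T
    by (subst assoc_mult_mat_vec[symmetric, of _ n n _ n]) (auto simp: u_def)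
  hence xi: "(adj T *\<^sub>v x) $ i = complex_of_real (d i / (l + d i)) * w $ i" if "i < n" for i
    using that by (simp add: u_def)
  have scal: "l * d i / (l + d i) * (cmod z)\<^sup>2 = l * (cmod (complex_of_real (d i / (l + d i)) * z))\<^sup>2
      + d i * (cmod (z - complex_of_real (d i / (l + d i)) * z))\<^sup>2" if "i < n" for i z
  proof -
    have "l / (l + d i) = 1 - d i / (l + d i)"
      using l d[OF that] by (simp add: field_simps)
    hence zz: "z - complex_of_real (d i / (l + d i)) * z = complex_of_real (l / (l + d i)) * z"
      by (simp only: of_real_diff of_real_1 left_diff_distrib mult_1_left)
    have "l * (cmod (complex_of_real (d i / (l + d i)) * z))\<^sup>2
      + d i * (cmod (z - complex_of_real (d i / (l + d i)) * z))\<^sup>2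
      = (l * (d i / (l + d i))\<^sup>2 + d i * (l / (l + d i))\<^sup>2) * (cmod z)\<^sup>2"
      unfolding zz norm_mult norm_of_real power_mult_distrib power2_abs by (simp only: algebra_simps)
    also have "l * (d i / (l + d i))\<^sup>2 + d i * (l / (l + d i))\<^sup>2 = l * d i / (l + d i)"
      using l d[OF that] by (simp add: divide_simps power2_eq_square add_pos_nonneg less_imp_neq[symmetric]) (simp add: algebra_simps)
    finally show ?thesis by simp
  qed
  have "split_val n T d l v = (\<Sum>i<n. l * (cmod ((adj T *\<^sub>v x) $ i))\<^sup>2
      + d i * (cmod ((adj T *\<^sub>v v) $ i - (adj T *\<^sub>v x) $ i))\<^sup>2)"
    unfolding split_val_def w_def[symmetric] using scal xi by (intro sum.cong) auto
  also have "\<dots> = l * (\<Sum>i<n. (cmod ((adj T *\<^sub>v x) $ i))\<^sup>2)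
      + (\<Sum>i<n. d i * (cmod ((adj T *\<^sub>v (v - x)) $ i))\<^sup>2)"
    using adj_mv_minus[OF T v x]
    by (simp add: sum.distrib sum_distrib_left del: index_mult_mat_vec)
  also have "\<dots> = l * qf (T * adj T) x + qf (T * rdiag n d * adj T) (v - x)"
    using T v x by (simp add: qf_gram[of T n n] qf_spec[of T n n] sqn_def del: index_mult_mat_vec)
  finally show ?thesis using that x by blast
qed

lemma split_val_nonneg:
  "(\<And>i. i < n \<Longrightarrow> 0 \<le> d i) \<Longrightarrow> 0 < l \<Longrightarrow> 0 \<le> split_val n T d l v"
  unfolding split_val_def by (intro sum_nonneg mult_nonneg_nonneg divide_nonneg_nonneg) (auto intro: add_nonneg_nonneg)

text \<open>Each coordinate contributes the kernel \<open>pker \<beta> (d i)\<close>, whose integral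
  is proportional to \<open>pw \<beta> (d i)\<close>.\<close>

lemma nn_integral_split_val:
  assumes T: "T \<in> carrier_mat n n" and d: "\<And>i. i < n \<Longrightarrow> 0 \<le> d i" and v: "v \<in> carrier_vec n"
  shows "(\<integral>\<^sup>+l. (if 0 < l then ennreal (l powr (\<beta> - 2) * split_val n T d l v) else 0) \<partial>lborel)
    = ennreal (qf (T * rdiag n (\<lambda>i. pw \<beta> (d i)) * adj T) v) * pconst \<beta>"
proof -
  let ?w = "\<lambda>i. (cmod ((adj T *\<^sub>v v) $ i))\<^sup>2"
  have "(if 0 < l then ennreal (l powr (\<beta> - 2) * split_val n T d l v) else 0)
      = (\<Sum>i<n. ennreal (?w i) * ennreal (pker \<beta> (d i) l))" for l
  proof (cases "0 < l")
    case True
    have "l powr (\<beta> - 2) * split_val n T d l v = (\<Sum>i<n. ?w i * pker \<beta> (d i) l)"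
      unfolding split_val_def pker_def using True by (simp add: sum_distrib_left mult_ac del: index_mult_mat_vec)
    also have "ennreal \<dots> = (\<Sum>i<n. ennreal (?w i) * ennreal (pker \<beta> (d i) l))"
      using d pker_nonneg by (subst sum_ennreal[symmetric]) (auto simp: ennreal_mult simp del: index_mult_mat_vec intro!: mult_nonneg_nonneg)
    finally show ?thesis using True by simp
  qed (simp add: pker_def)
  hence "(\<integral>\<^sup>+l. (if 0 < l then ennreal (l powr (\<beta> - 2) * split_val n T d l v) else 0) \<partial>lborel)
      = (\<Sum>i<n. ennreal (?w i) * (\<integral>\<^sup>+l. ennreal (pker \<beta> (d i) l) \<partial>lborel))"
    by (simp add: nn_integral_sum nn_integral_cmult del: index_mult_mat_vec)
  also have "\<dots> = (\<Sum>i<n. ennreal (?w i * pw \<beta> (d i)) * pconst \<beta>)"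
    using d by (intro sum.cong) (auto simp: nn_integral_pker ennreal_mult mult.assoc simp del: index_mult_mat_vec)
  also have "\<dots> = (\<Sum>i<n. ennreal (?w i * pw \<beta> (d i))) * pconst \<beta>" by (simp only: sum_distrib_right)
  also have "(\<Sum>i<n. ennreal (?w i * pw \<beta> (d i))) = ennreal (\<Sum>i<n. ?w i * pw \<beta> (d i))"
    by (subst sum_ennreal) (simp_all del: index_mult_mat_vec)
  also have "(\<Sum>i<n. ?w i * pw \<beta> (d i)) = qf (T * rdiag n (\<lambda>i. pw \<beta> (d i)) * adj T) v"
    using T v by (simp add: qf_spec[of T n n] mult.commute del: index_mult_mat_vec)
  finally show ?thesis .
qed

text \<open>All order properties of the geometric mean come from this comparison: the quadratic form of
  the mean is an integral of infima of linear expressions in the quadratic forms of its arguments.\<close>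
lemma gm_rep_compare_aux:
  assumes \<beta>: "0 < \<beta>" "\<beta> < 1"
    and 1: "T1 \<in> carrier_mat n n" "\<And>i. i < n \<Longrightarrow> 0 \<le> d1 i" "A1 = T1 * adj T1"
    "B1 = T1 * rdiag n d1 * adj T1" "G1 = T1 * rdiag n (\<lambda>i. pw \<beta> (d1 i)) * adj T1"
    and 2: "T2 \<in> carrier_mat n n" "\<And>i. i < n \<Longrightarrow> 0 \<le> d2 i" "A2 = T2 * adj T2"
    "B2 = T2 * rdiag n d2 * adj T2" "G2 = T2 * rdiag n (\<lambda>i. pw \<beta> (d2 i)) * adj T2"
    and 3: "T3 \<in> carrier_mat m m" "\<And>i. i < m \<Longrightarrow> 0 \<le> d3 i" "A3 = T3 * adj T3"
    "B3 = T3 * rdiag m d3 * adj T3" "G3 = T3 * rdiag m (\<lambda>i. pw \<beta> (d3 i)) * adj T3"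
    "S3 \<in> carrier_mat m m" "S3 * T3 = 1\<^sub>m m"
    and L: "L \<in> carrier_mat n m" and c: "0 \<le> c1" "0 \<le> c2"
    and A: "\<And>x. x \<in> carrier_vec m \<Longrightarrow> c1 * qf A1 (L *\<^sub>v x) + c2 * qf A2 (L *\<^sub>v x) \<le> qf A3 x"
    and B: "\<And>x. x \<in> carrier_vec m \<Longrightarrow> c1 * qf B1 (L *\<^sub>v x) + c2 * qf B2 (L *\<^sub>v x) \<le> qf B3 x"
    and v: "v \<in> carrier_vec m"
  shows "c1 * qf G1 (L *\<^sub>v v) + c2 * qf G2 (L *\<^sub>v v) \<le> qf G3 v"
proof -
  have Lv: "L *\<^sub>v v \<in> carrier_vec n" using L by simp
  let ?I = "\<lambda>n T d v. \<lambda>l. if 0 < l then ennreal (l powr (\<beta> - 2) * split_val n T d l v) else 0"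
  have g1: "0 \<le> qf G1 (L *\<^sub>v v)" and g2: "0 \<le> qf G2 (L *\<^sub>v v)" and g3: "0 \<le> qf G3 v"
    unfolding 1(5) 2(5) 3(5) qf_spec[OF 1(1) Lv] qf_spec[OF 2(1) Lv] qf_spec[OF 3(1) v]
    by (intro sum_nonneg mult_nonneg_nonneg pw_nonneg zero_le_power2)+
  \<comment> \<open>For fixed \<open>l\<close>, take the optimal split of \<open>v\<close> for the
    third pair. Its image under \<open>L\<close> is an admissible split for the other two, and the
    hypotheses \<open>A\<close> and \<open>B\<close> compare the linear expressions.\<close>
  have pt: "c1 * split_val n T1 d1 l (L *\<^sub>v v) + c2 * split_val n T2 d2 l (L *\<^sub>v v) \<le> split_val m T3 d3 l v"
    if l: "0 < l" for l
  proof -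
    obtain x where x: "x \<in> carrier_vec m" and eq: "split_val m T3 d3 l v = l * qf A3 x + qf B3 (v - x)"
      unfolding 3(3,4) by (rule split_val_attained[OF 3(1,6,7,2) l v])
    have Lx: "L *\<^sub>v x \<in> carrier_vec n" using L by simp
    have Lvx: "L *\<^sub>v v - L *\<^sub>v x = L *\<^sub>v (v - x)"
      using L v x by (simp add: mult_minus_distrib_mat_vec[of L n m])
    have "c1 * split_val n T1 d1 l (L *\<^sub>v v) \<le> c1 * (l * qf A1 (L *\<^sub>v x) + qf B1 (L *\<^sub>v (v - x)))"
      unfolding 1(3,4) using split_val_le[OF 1(1,2) l Lv Lx] c unfolding Lvx by (intro mult_left_mono) auto
    moreover have "c2 * split_val n T2 d2 l (L *\<^sub>v v) \<le> c2 * (l * qf A2 (L *\<^sub>v x) + qf B2 (L *\<^sub>v (v - x)))"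
      unfolding 2(3,4) using split_val_le[OF 2(1,2) l Lv Lx] c unfolding Lvx by (intro mult_left_mono) auto
    moreover have "l * (c1 * qf A1 (L *\<^sub>v x) + c2 * qf A2 (L *\<^sub>v x)) \<le> l * qf A3 x"
      using A[OF x] l by (intro mult_left_mono) auto
    moreover have "c1 * qf B1 (L *\<^sub>v (v - x)) + c2 * qf B2 (L *\<^sub>v (v - x)) \<le> qf B3 (v - x)"
      using B[of "v - x"] v x by simp
    ultimately show ?thesis unfolding eq by argo
  qed
  have meas: "?I n T d v \<in> borel_measurable lborel" for n T d v
    unfolding split_val_def by measurable
  have "ennreal (c1 * qf G1 (L *\<^sub>v v) + c2 * qf G2 (L *\<^sub>v v)) * pconst \<beta>
      = ennreal c1 * (ennreal (qf G1 (L *\<^sub>v v)) * pconst \<beta>) + ennreal c2 * (ennreal (qf G2 (L *\<^sub>v v)) * pconst \<beta>)"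
    using c g1 g2 by (simp add: ennreal_plus ennreal_mult distrib_right mult.assoc)
  also have "\<dots> = (\<integral>\<^sup>+l. ennreal c1 * ?I n T1 d1 (L *\<^sub>v v) l + ennreal c2 * ?I n T2 d2 (L *\<^sub>v v) l \<partial>lborel)"
  proof -
    have e1: "(\<integral>\<^sup>+l. ?I n T1 d1 (L *\<^sub>v v) l \<partial>lborel) = ennreal (qf G1 (L *\<^sub>v v)) * pconst \<beta>"
      unfolding 1(5) by (rule nn_integral_split_val[OF 1(1,2) Lv])
    have e2: "(\<integral>\<^sup>+l. ?I n T2 d2 (L *\<^sub>v v) l \<partial>lborel) = ennreal (qf G2 (L *\<^sub>v v)) * pconst \<beta>"
      unfolding 2(5) by (rule nn_integral_split_val[OF 2(1,2) Lv])
    show ?thesis unfolding e1[symmetric] e2[symmetric]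
      by (subst nn_integral_add; (intro borel_measurable_times_ennreal borel_measurable_const meas)?)
         (simp only: nn_integral_cmult[OF meas])
  qed
  also have "\<dots> \<le> (\<integral>\<^sup>+l. ?I m T3 d3 v l \<partial>lborel)"
  proof (rule nn_integral_mono)
    fix l :: real
    show "ennreal c1 * ?I n T1 d1 (L *\<^sub>v v) l + ennreal c2 * ?I n T2 d2 (L *\<^sub>v v) l \<le> ?I m T3 d3 v l"
    proof (cases "0 < l")
      case True
      have s1: "0 \<le> split_val n T1 d1 l (L *\<^sub>v v)" and s2: "0 \<le> split_val n T2 d2 l (L *\<^sub>v v)"
        using split_val_nonneg 1(2) 2(2) True by auto
      have "ennreal c1 * ?I n T1 d1 (L *\<^sub>v v) l + ennreal c2 * ?I n T2 d2 (L *\<^sub>v v) l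
        = ennreal (c1 * (l powr (\<beta> - 2) * split_val n T1 d1 l (L *\<^sub>v v))
          + c2 * (l powr (\<beta> - 2) * split_val n T2 d2 l (L *\<^sub>v v)))"
        using True c s1 s2 by (simp add: ennreal_mult ennreal_plus)
      also have "c1 * (l powr (\<beta> - 2) * split_val n T1 d1 l (L *\<^sub>v v))
          + c2 * (l powr (\<beta> - 2) * split_val n T2 d2 l (L *\<^sub>v v))
        = l powr (\<beta> - 2) * (c1 * split_val n T1 d1 l (L *\<^sub>v v) + c2 * split_val n T2 d2 l (L *\<^sub>v v))"
        by (simp only: algebra_simps)
      also have "\<dots> \<le> ?I m T3 d3 v l"
        using mult_left_mono[OF pt[OF True], of "l powr (\<beta> - 2)"] True
        by (simp only: if_True powr_ge_zero ennreal_leI)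
      finally show ?thesis .
    qed simp
  qed
  also have "\<dots> = ennreal (qf G3 v) * pconst \<beta>"
    unfolding 3(5) by (rule nn_integral_split_val[OF 3(1,2) v])
  \<comment> \<open>The common factor is positive and finite, so it cancels in the extended
    nonnegative reals.\<close>
  finally have "pconst \<beta> * ennreal (c1 * qf G1 (L *\<^sub>v v) + c2 * qf G2 (L *\<^sub>v v)) \<le> pconst \<beta> * ennreal (qf G3 v)"
    by (simp only: mult.commute)
  hence "ennreal (c1 * qf G1 (L *\<^sub>v v) + c2 * qf G2 (L *\<^sub>v v)) \<le> ennreal (qf G3 v)"
    using pconst_finite[OF \<beta>] pconst_pos[OF \<beta>]
    by (subst (asm) ennreal_mult_le_mult_iff) auto
  thus ?thesis by (rule iffD1[OF ennreal_le_iff[OF g3]])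
qed

text \<open>One inequality serves three purposes: monotonicity with \<open>L\<close> the identity,
  the transformer inequality with \<open>L\<close> an adjoint, and concavity with weights that sum
  to 1.\<close>

lemma gm_rep_compare:
  assumes \<beta>: "0 < \<beta>" "\<beta> < 1"
    and r1: "gm_rep \<beta> n A1 B1 G1" and r2: "gm_rep \<beta> n A2 B2 G2" and r3: "gm_rep \<beta> m A3 B3 G3"
    and L: "L \<in> carrier_mat n m" and c: "0 \<le> c1" "0 \<le> c2"
    and A: "\<And>x. x \<in> carrier_vec m \<Longrightarrow> c1 * qf A1 (L *\<^sub>v x) + c2 * qf A2 (L *\<^sub>v x) \<le> qf A3 x"
    and B: "\<And>x. x \<in> carrier_vec m \<Longrightarrow> c1 * qf B1 (L *\<^sub>v x) + c2 * qf B2 (L *\<^sub>v x) \<le> qf B3 x"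
    and v: "v \<in> carrier_vec m"
  shows "c1 * qf G1 (L *\<^sub>v v) + c2 * qf G2 (L *\<^sub>v v) \<le> qf G3 v"
proof -
  obtain T1 d1 where 1: "T1 \<in> carrier_mat n n" "\<forall>i<n. 0 \<le> d1 i" "A1 = T1 * adj T1"
    "B1 = T1 * rdiag n d1 * adj T1" "G1 = T1 * rdiag n (\<lambda>i. pw \<beta> (d1 i)) * adj T1"
    using r1 unfolding gm_rep_def by blast
  obtain T2 d2 where 2: "T2 \<in> carrier_mat n n" "\<forall>i<n. 0 \<le> d2 i" "A2 = T2 * adj T2"
    "B2 = T2 * rdiag n d2 * adj T2" "G2 = T2 * rdiag n (\<lambda>i. pw \<beta> (d2 i)) * adj T2"
    using r2 unfolding gm_rep_def by blast
  obtain T3 S3 d3 where 3: "T3 \<in> carrier_mat m m" "\<forall>i<m. 0 \<le> d3 i" "A3 = T3 * adj T3"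
    "B3 = T3 * rdiag m d3 * adj T3" "G3 = T3 * rdiag m (\<lambda>i. pw \<beta> (d3 i)) * adj T3"
    "S3 \<in> carrier_mat m m" "S3 * T3 = 1\<^sub>m m"
    using r3 unfolding gm_rep_def by blast
  from gm_rep_compare_aux[OF \<beta> 1(1) _ 1(3,4,5) 2(1) _ 2(3,4,5) 3(1) _ 3(3-7) L c A B v] 1(2) 2(2) 3(2)
  show ?thesis by blast
qed

section \<open>Kronecker products\<close>

lemma div_mod_less:
  fixes i n m :: nat
  assumes "i < n * m"
  shows "i div m < n" "i mod m < m"
  using assms by (auto simp: less_mult_imp_div_less) (metis assms mod_less_divisor mult_0_right not_gr_zero not_less_zero)

lemma mult_add_less:
  fixes a b n m :: nat
  assumes "a < n" "b < m"
  shows "a * m + b < n * m"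
proof -
  have "a * m + b < Suc a * m" using assms by simp
  also have "\<dots> \<le> n * m" using assms by (intro mult_le_mono1) auto
  finally show ?thesis .
qed

lemma sum_div_mod:
  fixes f :: "nat \<Rightarrow> nat \<Rightarrow> 'a :: comm_monoid_add"
  shows "(\<Sum>k<n * m. f (k div m) (k mod m)) = (\<Sum>i<n. \<Sum>j<m. f i j)"
proof -
  have "(\<Sum>k<n * m. f (k div m) (k mod m)) = (\<Sum>i<n. \<Sum>k\<in>{i*m..<i*m+m}. f (k div m) (k mod m))"
    by (rule sum.nat_group[symmetric])
  also have "\<dots> = (\<Sum>i<n. \<Sum>j<m. f i j)"
  proof (rule sum.cong[OF refl])
    fix i
    have "(\<Sum>k\<in>{i*m..<i*m+m}. f (k div m) (k mod m)) = (\<Sum>j\<in>{0..<m}. f ((j + i*m) div m) ((j + i*m) mod m))"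
      using sum.shift_bounds_nat_ivl[of "\<lambda>k. f (k div m) (k mod m)" 0 "i*m" m] by (simp add: add.commute)
    also have "\<dots> = (\<Sum>j<m. f i j)" by (simp add: lessThan_atLeast0)
    finally show "(\<Sum>k\<in>{i*m..<i*m+m}. f (k div m) (k mod m)) = (\<Sum>j<m. f i j)" .
  qed
  finally show ?thesis .
qed

lemma kron_dim [simp]:
  "dim_row (kron A B) = dim_row A * dim_row B" "dim_col (kron A B) = dim_col A * dim_col B"
  unfolding kron_def by auto

lemma kron_carrier:
  "A \<in> carrier_mat n m \<Longrightarrow> B \<in> carrier_mat k l \<Longrightarrow> kron A B \<in> carrier_mat (n * k) (m * l)"
  by (auto intro: carrier_matI)

lemma kron_index [simp]:
  "i < dim_row A * dim_row B \<Longrightarrow> j < dim_col A * dim_col B \<Longrightarrow>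
   kron A B $$ (i,j) = A $$ (i div dim_row B, j div dim_col B) * B $$ (i mod dim_row B, j mod dim_col B)"
  unfolding kron_def by auto

lemma kron_mult:
  assumes "dim_col A = dim_row C" "dim_col B = dim_row D"
  shows "kron A B * kron C D = kron (A * C) (B * D)"
proof (rule eq_matI)
  fix i j assume "i < dim_row (kron (A * C) (B * D))" "j < dim_col (kron (A * C) (B * D))"
  hence ij: "i < dim_row A * dim_row B" "j < dim_col C * dim_col D" by auto
  note d = div_mod_less[OF ij(1)] div_mod_less[OF ij(2)]
  have "(kron A B * kron C D) $$ (i,j) = (\<Sum>k<dim_row C * dim_row D.
      A $$ (i div dim_row B, k div dim_row D) * B $$ (i mod dim_row B, k mod dim_row D) *
      (C $$ (k div dim_row D, j div dim_col D) * D $$ (k mod dim_row D, j mod dim_col D)))"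
    using ij assms by (subst index_mult_sum) auto
  also have "\<dots> = (\<Sum>k<dim_row C. \<Sum>l<dim_row D.
      A $$ (i div dim_row B, k) * B $$ (i mod dim_row B, l) *
      (C $$ (k, j div dim_col D) * D $$ (l, j mod dim_col D)))"
    by (rule sum_div_mod)
  also have "\<dots> = (\<Sum>k<dim_row C. A $$ (i div dim_row B, k) * C $$ (k, j div dim_col D)) *
      (\<Sum>l<dim_row D. B $$ (i mod dim_row B, l) * D $$ (l, j mod dim_col D))"
    by (simp add: sum_product mult_ac)
  also have "\<dots> = kron (A * C) (B * D) $$ (i,j)"
    using ij d assms by (simp add: index_mult_sum del: index_mult_mat(1))
  finally show "(kron A B * kron C D) $$ (i,j) = kron (A * C) (B * D) $$ (i,j)" .
qed auto

lemma adj_kron: "adj (kron A B) = kron (adj A) (adj B)"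
  by (rule eq_matI) (auto simp: div_mod_less)

lemma kron_diag: "kron (mat_diag n f) (mat_diag m g) = mat_diag (n * m) (\<lambda>k. f (k div m) * g (k mod m))"
proof (rule eq_matI)
  fix i j assume "i < dim_row (mat_diag (n * m) (\<lambda>k. f (k div m) * g (k mod m)))"
    "j < dim_col (mat_diag (n * m) (\<lambda>k. f (k div m) * g (k mod m)))"
  hence ij: "i < n * m" "j < n * m" by auto
  have "i div m = j div m \<and> i mod m = j mod m \<longleftrightarrow> i = j" by (metis div_mod_decomp)
  thus "kron (mat_diag n f) (mat_diag m g) $$ (i,j) = mat_diag (n * m) (\<lambda>k. f (k div m) * g (k mod m)) $$ (i,j)"
    using ij div_mod_less[OF ij(1)] div_mod_less[OF ij(2)] by auto
qed auto

lemma kron_rdiag: "kron (rdiag n f) (rdiag m g) = rdiag (n * m) (\<lambda>k. f (k div m) * g (k mod m))"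
  by (simp add: kron_diag)

lemma kron_one [simp]: "kron (1\<^sub>m n) (1\<^sub>m m) = 1\<^sub>m (n * m)"
  using kron_diag[of n "\<lambda>_. 1" m "\<lambda>_. 1"] by simp

lemma kron_add_left: "dim_row A = dim_row B \<Longrightarrow> dim_col A = dim_col B \<Longrightarrow> kron (A + B) C = kron A C + kron B C"
  by (rule eq_matI) (auto simp: div_mod_less algebra_simps)

lemma kron_smult_left: "kron (c \<cdot>\<^sub>m A) B = c \<cdot>\<^sub>m kron A B"
  by (rule eq_matI) (auto simp: div_mod_less algebra_simps)

lemma kron_smult_right: "kron A (c \<cdot>\<^sub>m B) = c \<cdot>\<^sub>m kron A B"
  by (rule eq_matI) (auto simp: div_mod_less algebra_simps)

lemma unitary_kron: "unitary n U \<Longrightarrow> unitary m V \<Longrightarrow> unitary (n * m) (kron U V)"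
  by (intro unitaryI) (auto simp: adj_kron kron_mult intro: kron_carrier unitary_carrier)

lemma kron_spec:
  assumes "U \<in> carrier_mat n n" "V \<in> carrier_mat m m"
  shows "kron (U * rdiag n d * adj U) (V * rdiag m e * adj V) =
    kron U V * rdiag (n * m) (\<lambda>k. d (k div m) * e (k mod m)) * adj (kron U V)"
  unfolding adj_kron kron_rdiag[symmetric] using assms by (simp add: kron_mult)

lemma psd_kron:
  assumes "psd n A" "psd m B"
  shows "psd (n * m) (kron A B)"
proof -
  obtain C where C: "C \<in> carrier_mat n n" "A = C * adj C" using psd_imp_gram[OF assms(1)] by blast
  obtain D where D: "D \<in> carrier_mat m m" "B = D * adj D" using psd_imp_gram[OF assms(2)] by blast
  have "kron A B = kron C D * adj (kron C D)" using C D by (simp add: adj_kron kron_mult)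
  thus ?thesis using psd_gram[OF kron_carrier[OF C(1) D(1)]] by simp
qed

lemma mtrace_kron:
  assumes "A \<in> carrier_mat n n" "B \<in> carrier_mat m m"
  shows "mtrace (kron A B) = mtrace A * mtrace B"
proof -
  have "mtrace (kron A B) = (\<Sum>k<n * m. A $$ (k div m, k div m) * B $$ (k mod m, k mod m))"
    unfolding mtrace_def using assms by simp
  also have "\<dots> = (\<Sum>i<n. \<Sum>j<m. A $$ (i, i) * B $$ (j, j))"
    by (rule sum_div_mod)
  finally show ?thesis using assms by (simp add: mtrace_def sum_product)
qed

lemma mpow_kron:
  assumes "psd n A" "psd m B"
  shows "mpow t (kron A B) = kron (mpow t A) (mpow t B)"
proof -
  obtain U d where U: "unitary n U" "A = U * rdiag n d * adj U" "\<And>i. i < n \<Longrightarrow> 0 \<le> d i"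
    using psd_spectral[OF assms(1)] by metis
  obtain V e where V: "unitary m V" "B = V * rdiag m e * adj V" "\<And>i. i < m \<Longrightarrow> 0 \<le> e i"
    using psd_spectral[OF assms(2)] by metis
  note c = unitary_carrier[OF U(1)] unitary_carrier[OF V(1)]
  have "rdiag (n * m) (\<lambda>k. pw t (d (k div m) * e (k mod m)))
      = rdiag (n * m) (\<lambda>k. pw t (d (k div m)) * pw t (e (k mod m)))"
    by (rule mat_diag_cong) (simp add: pw_mult U(3) V(3) div_mod_less)
  thus ?thesis unfolding U(2) V(2) mpow_spec[OF U(1)] mpow_spec[OF V(1)] kron_spec[OF c]
      mpow_spec[OF unitary_kron[OF U(1) V(1)]] by simp
qed

section \<open>Polarization, limits and bounds of quadratic forms\<close>

lemma qf_plus_smult: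
  assumes "hermitian A" "A \<in> carrier_mat n n" "x \<in> carrier_vec n" "y \<in> carrier_vec n"
  shows "qf A (x + c \<cdot>\<^sub>v y) = qf A x + (cmod c)\<^sup>2 * qf A y + 2 * Re (c * (conjugate x \<bullet> (A *\<^sub>v y)))"
proof -
  define p where "p u w = conjugate u \<bullet> (A *\<^sub>v w)" for u w
  have pyx: "p y x = cnj (p x y)"
  proof -
    have "p y x = conjugate (A *\<^sub>v y) \<bullet> x"
      unfolding p_def using ip_adj[OF assms(2,4,3)] assms(1) by (simp add: hermitian_def)
    also have "\<dots> = cnj (p x y)"
      using assms unfolding p_def by (simp add: scalar_prod_def conjugate_vec_def mult.commute)
    finally show ?thesis .
  qed
  have "A *\<^sub>v (x + c \<cdot>\<^sub>v y) = A *\<^sub>v x + c \<cdot>\<^sub>v (A *\<^sub>v y)"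
    using assms by (simp add: mult_add_distrib_mat_vec[of A n n] mult_mat_vec[of A n n])
  moreover have "conjugate (x + c \<cdot>\<^sub>v y) = conjugate x + cnj c \<cdot>\<^sub>v conjugate y"
    using assms by (intro eq_vecI) auto
  ultimately have "conjugate (x + c \<cdot>\<^sub>v y) \<bullet> (A *\<^sub>v (x + c \<cdot>\<^sub>v y))
      = p x x + c * p x y + cnj c * p y x + cnj c * c * p y y"
    using assms unfolding p_def
    by (simp add: add_scalar_prod_distrib[of _ n] scalar_prod_add_distrib[of _ n] algebra_simps)
  hence "qf A (x + c \<cdot>\<^sub>v y) = Re (p x x) + Re (c * p x y) + Re (cnj (c * p x y)) + Re (cnj c * c * p y y)"
    unfolding qf_def pyx by simp
  also have "cnj c * c = complex_of_real ((cmod c)\<^sup>2)"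
    by (simp add: complex_norm_square mult.commute del: of_real_power)
  finally show ?thesis unfolding qf_def p_def by (simp del: of_real_power)
qed

text \<open>Polarization: adding the \<open>j\<close>-th unit vector yields twice the real part of
  the entry, adding \<open>\<i>\<close> times it minus twice the imaginary part. Thereby convergence
  of quadratic forms gives convergence of entries.\<close>

lemma qf_entry:
  assumes "hermitian A" "A \<in> carrier_mat n n" "i < n" "j < n"
  shows "A $$ (i,j) = Complex
    ((qf A (unit_vec n i + 1 \<cdot>\<^sub>v unit_vec n j) - qf A (unit_vec n i) - qf A (unit_vec n j)) / 2)
    (- (qf A (unit_vec n i + \<i> \<cdot>\<^sub>v unit_vec n j) - qf A (unit_vec n i) - qf A (unit_vec n j)) / 2)"
proof -
  have "conjugate (unit_vec n i) = (unit_vec n i :: complex vec)"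
    using assms by (intro eq_vecI) (auto simp: unit_vec_def)
  hence "conjugate (unit_vec n i) \<bullet> (A *\<^sub>v unit_vec n j) = A $$ (i,j)"
    using assms by simp
  thus ?thesis using assms
    by (subst (1 2) qf_plus_smult) (auto simp: complex_eq_iff)
qed

lemma qf_eqI:
  assumes "hermitian A" "A \<in> carrier_mat n n" "hermitian B" "B \<in> carrier_mat n n"
    "\<And>v. v \<in> carrier_vec n \<Longrightarrow> qf A v = qf B v"
  shows "A = B"
proof (rule eq_matI)
  fix i j assume "i < dim_row B" "j < dim_col B"
  hence ij: "i < n" "j < n" using assms by auto
  show "A $$ (i,j) = B $$ (i,j)"
    unfolding qf_entry[OF assms(1,2) ij] qf_entry[OF assms(3,4) ij] by (simp add: assms(5))
qed (use assms in auto)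

lemma qf_tendsto:
  assumes "\<And>e. F e \<in> carrier_mat n n" "A \<in> carrier_mat n n" "v \<in> carrier_vec n"
    "\<And>i j. i < n \<Longrightarrow> j < n \<Longrightarrow> ((\<lambda>e. F e $$ (i,j)) \<longlongrightarrow> A $$ (i,j)) net"
  shows "((\<lambda>e. qf (F e) v) \<longlongrightarrow> qf A v) net"
  unfolding qf_sum[OF assms(1,3)] qf_sum[OF assms(2,3)]
  by (intro tendsto_intros assms(4)) auto

lemma at_right_mono_limit:
  fixes f :: "real \<Rightarrow> real"
  assumes mono: "\<And>e e'. 0 < e \<Longrightarrow> e \<le> e' \<Longrightarrow> f e \<le> f e'" and nonneg: "\<And>e. 0 < e \<Longrightarrow> 0 \<le> f e"
  shows "\<exists>l. (f \<longlongrightarrow> l) (at_right 0)"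
proof -
  let ?S = "f ` {0<..}"
  have bdd: "bdd_below ?S" using nonneg by (intro bdd_belowI[of _ 0]) auto
  have ne: "?S \<noteq> {}" by auto
  have "(f \<longlongrightarrow> Inf ?S) (at_right 0)"
  proof (rule order_tendstoI)
    fix a assume "a < Inf ?S"
    hence "a < f e" if "0 < e" for e
      using cInf_lower[OF _ bdd, of "f e"] that by (meson greaterThan_iff imageI less_le_trans)
    thus "eventually (\<lambda>e. a < f e) (at_right 0)"
      by (auto simp: eventually_at_right_field intro: exI[of _ 1])
  next
    fix a assume "Inf ?S < a"
    then obtain e where e: "0 < e" "f e < a" using cInf_lessD[OF ne] by auto
    hence "f x < a" if "0 < x" "x < e" for x using mono[of x e] that by linarith
    thus "eventually (\<lambda>e. f e < a) (at_right 0)"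
      using e(1) by (auto simp: eventually_at_right_field)
  qed
  thus ?thesis by blast
qed

text \<open>In an eigenbasis, the sum of the absolute eigenvalues is a crude bound for each of
  them.\<close>

lemma qf_bound:
  assumes "hermitian A" "A \<in> carrier_mat n n"
  obtains K where "0 \<le> K" "\<And>v. v \<in> carrier_vec n \<Longrightarrow> qf A v \<le> K * sqn v"
proof -
  obtain U d where U: "unitary n U" and A: "A = U * rdiag n d * adj U"
    using spectral assms by metis
  have Uc: "U \<in> carrier_mat n n" using U unitary_carrier by blast
  have "qf A v \<le> (\<Sum>i<n. \<bar>d i\<bar>) * sqn v" if v: "v \<in> carrier_vec n" for v
  proof -
    have "sqn v = qf (U * adj U) v" using U v by (simp add: qf_one)
    hence s: "sqn v = (\<Sum>i<n. (cmod ((adj U *\<^sub>v v) $ i))\<^sup>2)"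
      using Uc v by (simp add: qf_gram[of U n n] sqn_def del: index_mult_mat_vec)
    have "qf A v = (\<Sum>i<n. d i * (cmod ((adj U *\<^sub>v v) $ i))\<^sup>2)"
      unfolding A using Uc v by (rule qf_spec)
    also have "\<dots> \<le> (\<Sum>i<n. (\<Sum>i<n. \<bar>d i\<bar>) * (cmod ((adj U *\<^sub>v v) $ i))\<^sup>2)"
    proof (intro sum_mono mult_right_mono)
      fix i assume "i \<in> {..<n}"
      hence "\<bar>d i\<bar> \<le> (\<Sum>i<n. \<bar>d i\<bar>)" by (intro member_le_sum) auto
      thus "d i \<le> (\<Sum>i<n. \<bar>d i\<bar>)" by linarith
    qed simp
    also have "\<dots> = (\<Sum>i<n. \<bar>d i\<bar>) * sqn v" unfolding s by (simp only: sum_distrib_left)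
    finally show ?thesis .
  qed
  thus ?thesis using that[of "\<Sum>i<n. \<bar>d i\<bar>"] by (simp add: sum_nonneg)
qed

lemma sqn_bound:
  assumes "L \<in> carrier_mat n m"
  obtains K where "0 \<le> K" "\<And>v. v \<in> carrier_vec m \<Longrightarrow> sqn (L *\<^sub>v v) \<le> K * sqn v"
proof -
  have "hermitian (adj L * L)" using hermitian_gram[of "adj L"] by simp
  from qf_bound[OF this, of m] assms obtain K
    where K: "0 \<le> K" "\<And>v. v \<in> carrier_vec m \<Longrightarrow> qf (adj L * L) v \<le> K * sqn v" by auto
  have "qf (adj L * L) v = sqn (L *\<^sub>v v)" if "v \<in> carrier_vec m" for v
    using qf_gram[of "adj L" m n v] assms that by simp
  thus ?thesis using that K by metis
qed

section \<open>Order properties of the geometric mean\<close>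

abbreviation eps :: "nat \<Rightarrow> real \<Rightarrow> complex mat \<Rightarrow> complex mat" where
  "eps n e A \<equiv> A + complex_of_real e \<cdot>\<^sub>m 1\<^sub>m n"

lemma eps_spec:
  assumes "unitary n U"
  shows "eps n e (U * rdiag n d * adj U) = U * rdiag n (\<lambda>i. d i + e) * adj U"
proof -
  have Uc: "U \<in> carrier_mat n n" using assms unitary_carrier by blast
  have "rdiag n (\<lambda>i. d i + e) = rdiag n d + complex_of_real e \<cdot>\<^sub>m 1\<^sub>m n"
    by (rule eq_matI) auto
  thus ?thesis using assms Uc
    by (simp add: mult_add_distrib_mat[of _ n n _ n] add_mult_distrib_mat[of _ n n _ _ n] mult_smult_distrib[of _ n n _ n]
        mult_smult_assoc_mat[of _ n n _ n])
qed

lemma qf_eps: "A \<in> carrier_mat n n \<Longrightarrow> v \<in> carrier_vec n \<Longrightarrow> qf (eps n e A) v = qf A v + e * sqn v"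
  by (simp add: qf_add[of _ n] qf_smult[of _ n] qf_one)

lemma psd_eps: "psd n A \<Longrightarrow> 0 \<le> e \<Longrightarrow> psd n (eps n e A)"
  by (intro psd_add psd_smult psd_one)

definition gexpr :: "real \<Rightarrow> complex mat \<Rightarrow> complex mat \<Rightarrow> complex mat" where
  "gexpr \<beta> A B = mpow (1/2) A * mpow \<beta> (mpow (-1/2) A * B * mpow (-1/2) A) * mpow (1/2) A"

text \<open>\<open>T\<close> is the square root of \<open>A\<close> times an eigenbasis
  \<open>V\<close> of the operator whose power is taken. It diagonalizes \<open>A\<close> and
  \<open>B\<close> by one congruence and carries the powered eigenvalues to the mean.\<close>

lemma gm_rep_gexpr:
  assumes U: "unitary n U" and a: "\<And>i. i < n \<Longrightarrow> 0 < a i" and A: "A = U * rdiag n a * adj U" and B: "psd n B"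
  shows "gm_rep \<beta> n A B (gexpr \<beta> A B)"
proof -
  have Uc: "U \<in> carrier_mat n n" using U unitary_carrier by blast
  define H where "H = mpow (1/2) A"
  define Hi where "Hi = mpow (-1/2) A"
  have H: "H = U * rdiag n (\<lambda>i. pw (1/2) (a i)) * adj U" and Hi: "Hi = U * rdiag n (\<lambda>i. pw (-1/2) (a i)) * adj U"
    unfolding H_def Hi_def A mpow_spec[OF U] by simp_all
  have Hc: "H \<in> carrier_mat n n" "Hi \<in> carrier_mat n n" unfolding H Hi using Uc by simp_all
  have Hh: "adj H = H" "adj Hi = Hi"
    using hermitian_congr[of "rdiag n _" U] Uc unfolding H Hi hermitian_def by auto
  have pd: "psd n A" unfolding A using a Uc by (intro psd_spec) (auto simp: less_imp_le)
  have HH: "H * H = A" unfolding H_def by (rule mpow_half_square[OF pd])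
  have "rdiag n (\<lambda>i. pw (-1/2) (a i)) * rdiag n (\<lambda>i. pw (1/2) (a i)) = 1\<^sub>m n"
    unfolding mat_diag_diag mat_diag_one[symmetric]
    by (rule mat_diag_cong) (simp add: a less_imp_neq[OF a, symmetric] pw_def flip: of_real_mult powr_add)
  hence HiH: "Hi * H = 1\<^sub>m n" unfolding H Hi using U Uc
    by (simp add: mult_assoc_dim unitary_cancel del: mat_diag_diag) (simp flip: mult_assoc_dim del: mat_diag_diag)
  hence HHi: "H * Hi = 1\<^sub>m n" using mat_mult_left_right_inverse[of Hi n H] Hc by simp
  define M where "M = Hi * B * Hi"
  have "psd n M" unfolding M_def using psd_congr[OF B, of Hi n] Hh Hc by simp
  then obtain V d where V: "unitary n V" and M: "M = V * rdiag n d * adj V" and d: "\<And>i. i < n \<Longrightarrow> 0 \<le> d i"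
    using psd_spectral by metis
  have Vc: "V \<in> carrier_mat n n" using V unitary_carrier by blast
  have Bc: "B \<in> carrier_mat n n" using B psdD by blast
  define T where "T = H * V"
  define S where "S = adj V * Hi"
  have Tc: "T \<in> carrier_mat n n" "S \<in> carrier_mat n n" unfolding T_def S_def using Hc Vc by simp_all
  have adjT: "adj T = adj V * H" unfolding T_def using Hc Vc Hh by (simp add: adj_mult)
  have ST: "S * T = 1\<^sub>m n"
  proof -
    have "S * T = adj V * ((Hi * H) * V)" unfolding S_def T_def using Hc Vc by (simp add: mult_assoc_dim)
    thus ?thesis using HiH V Vc by simp
  qed
  have conj: "T * rdiag n f * adj T = H * (V * rdiag n f * adj V) * H" for f
    unfolding adjT unfolding T_def using Hc Vc by (simp add: mult_assoc_dim)
  have 1: "A = T * adj T" unfolding adjT unfolding T_def using Hc Vc V HH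
    by (simp add: mult_assoc_dim unitary_cancel)
  have "H * M * H = (H * Hi) * B * (Hi * H)" unfolding M_def using Hc Bc by (simp add: mult_assoc_dim)
  hence 2: "B = T * rdiag n d * adj T" unfolding conj M[symmetric] using HiH HHi Bc by simp
  have 3: "gexpr \<beta> A B = T * rdiag n (\<lambda>i. pw \<beta> (d i)) * adj T"
    unfolding conj mpow_spec[OF V, symmetric] M[symmetric] unfolding gexpr_def H_def Hi_def M_def ..
  show ?thesis unfolding gm_rep_def using Tc ST d 1 2 3 by blast
qed

lemma gm_rep_eps:
  assumes "psd n A" "psd n B" "0 < e"
  shows "gm_rep \<beta> n (eps n e A) (eps n e B) (gexpr \<beta> (eps n e A) (eps n e B))"
proof -
  obtain U d where U: "unitary n U" "A = U * rdiag n d * adj U" "\<And>i. i < n \<Longrightarrow> 0 \<le> d i"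
    using psd_spectral[OF assms(1)] by metis
  show ?thesis
    by (rule gm_rep_gexpr[OF U(1), of "\<lambda>i. d i + e"])
       (use U(3) assms in \<open>auto simp: U(2) eps_spec[OF U(1)] add_nonneg_pos intro!: psd_eps\<close>)
qed

lemma gm_rep_psd: "gm_rep \<beta> n A B G \<Longrightarrow> psd n G"
  unfolding gm_rep_def using psd_spec by fastforce

lemma gm_rep_mono:
  assumes "0 < \<beta>" "\<beta> < 1" "gm_rep \<beta> n A1 B1 G1" "gm_rep \<beta> n A2 B2 G2"
    "\<And>x. x \<in> carrier_vec n \<Longrightarrow> qf A1 x \<le> qf A2 x" "\<And>x. x \<in> carrier_vec n \<Longrightarrow> qf B1 x \<le> qf B2 x"
    "v \<in> carrier_vec n"
  shows "qf G1 v \<le> qf G2 v"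
  using gm_rep_compare[OF assms(1,2,3,3,4), of "1\<^sub>m n" 1 0 v] assms(5-7) by simp

context
  fixes \<beta> :: real
  assumes \<beta>: "0 < \<beta>" "\<beta> < 1"
begin

text \<open>Monotonicity in both directions shows that the mean depends only on \<open>A\<close> and
  \<open>B\<close>. It may thus be computed with whichever congruence is convenient, as in
  \<open>wgm_diag\<close>.\<close>

lemma gm_rep_unique:
  assumes "gm_rep \<beta> n A B G1" "gm_rep \<beta> n A B G2"
  shows "G1 = G2"
proof (rule qf_eqI)
  fix v :: "complex vec" assume v: "v \<in> carrier_vec n"
  show "qf G1 v = qf G2 v"
    using gm_rep_mono[OF \<beta> assms _ _ v] gm_rep_mono[OF \<beta> assms(2,1) _ _ v] by fastforce
qed (use assms gm_rep_psd psdD in blast)+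

text \<open>The regularized arguments increase with \<open>e\<close>, hence so do the quadratic
  forms of the means. Being nonnegative, these converge as \<open>e\<close> decreases to 0, and
  polarization transfers the convergence to the entries.\<close>

lemma wgm_tendsto_ex:
  assumes A: "psd n A" and B: "psd n B"
  shows "\<exists>L. L \<in> carrier_mat n n \<and> (\<forall>i<n. \<forall>j<n.
    ((\<lambda>e. gexpr \<beta> (eps n e A) (eps n e B) $$ (i,j)) \<longlongrightarrow> L $$ (i,j)) (at_right 0))"
proof -
  let ?G = "\<lambda>e. gexpr \<beta> (eps n e A) (eps n e B)"
  have rep: "gm_rep \<beta> n (eps n e A) (eps n e B) (?G e)" if "0 < e" for e
    using gm_rep_eps A B that by blast
  have Gp: "psd n (?G e)" if "0 < e" for e using gm_rep_psd[OF rep[OF that]] .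
  have Ac: "A \<in> carrier_mat n n" "B \<in> carrier_mat n n" using A B psdD by auto
  have "\<exists>l. ((\<lambda>e. qf (?G e) v) \<longlongrightarrow> l) (at_right 0)" if v: "v \<in> carrier_vec n" for v
  proof (rule at_right_mono_limit)
    fix e e' :: real assume e: "0 < e" "e \<le> e'"
    show "qf (?G e) v \<le> qf (?G e') v"
      by (rule gm_rep_mono[OF \<beta> rep rep _ _ v])
         (use e Ac in \<open>auto simp: qf_eps intro!: mult_right_mono\<close>)
  qed (use Gp psdD(3) v in blast)
  hence "\<forall>v\<in>carrier_vec n. \<exists>l. ((\<lambda>e. qf (?G e) v) \<longlongrightarrow> l) (at_right 0)" by blast
  from bchoice[OF this] obtain l
    where "\<forall>v\<in>carrier_vec n. ((\<lambda>e. qf (?G e) v) \<longlongrightarrow> l v) (at_right 0)" by blast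
  hence l: "v \<in> carrier_vec n \<Longrightarrow> ((\<lambda>e. qf (?G e) v) \<longlongrightarrow> l v) (at_right 0)" for v
    by blast
  define L where "L = mat n n (\<lambda>(i,j). Complex
    ((l (unit_vec n i + 1 \<cdot>\<^sub>v unit_vec n j) - l (unit_vec n i) - l (unit_vec n j)) / 2)
    (- (l (unit_vec n i + \<i> \<cdot>\<^sub>v unit_vec n j) - l (unit_vec n i) - l (unit_vec n j)) / 2))"
  have "((\<lambda>e. ?G e $$ (i,j)) \<longlongrightarrow> L $$ (i,j)) (at_right 0)" if ij: "i < n" "j < n" for i j
  proof -
    have "((\<lambda>e. Complex
     ((qf (?G e) (unit_vec n i + 1 \<cdot>\<^sub>v unit_vec n j) - qf (?G e) (unit_vec n i) - qf (?G e) (unit_vec n j)) / 2)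
     (- (qf (?G e) (unit_vec n i + \<i> \<cdot>\<^sub>v unit_vec n j) - qf (?G e) (unit_vec n i) - qf (?G e) (unit_vec n j)) / 2))
     \<longlongrightarrow> L $$ (i,j)) (at_right 0)"
      unfolding L_def using ij by (auto intro!: tendsto_Complex tendsto_intros l)
    moreover have "eventually (\<lambda>e. Complex
     ((qf (?G e) (unit_vec n i + 1 \<cdot>\<^sub>v unit_vec n j) - qf (?G e) (unit_vec n i) - qf (?G e) (unit_vec n j)) / 2)
     (- (qf (?G e) (unit_vec n i + \<i> \<cdot>\<^sub>v unit_vec n j) - qf (?G e) (unit_vec n i) - qf (?G e) (unit_vec n j)) / 2)
      = ?G e $$ (i,j)) (at_right 0)"
      using eventually_at_right_less[of 0]
    proof eventually_elim
      case (elim e)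
      show ?case using qf_entry[OF psdD(2,1)[OF Gp[OF elim]] ij] by simp
    qed
    ultimately show ?thesis by (rule Lim_transform_eventually)
  qed
  moreover have "L \<in> carrier_mat n n" unfolding L_def by simp
  ultimately show ?thesis by blast
qed

text \<open>\<open>mat_lim0\<close> is a definite description; uniqueness of limits, entry by entry,
  makes it denote the limit.\<close>

lemma wgm_tendsto:
  assumes A: "psd n A" and B: "psd n B"
  shows "wgm \<beta> A B \<in> carrier_mat n n"
    "i < n \<Longrightarrow> j < n \<Longrightarrow> ((\<lambda>e. gexpr \<beta> (eps n e A) (eps n e B) $$ (i,j)) \<longlongrightarrow> wgm \<beta> A B $$ (i,j)) (at_right 0)"
proof -
  let ?P = "\<lambda>L. L \<in> carrier_mat n n \<and> (\<forall>i<n. \<forall>j<n.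
    ((\<lambda>e. gexpr \<beta> (eps n e A) (eps n e B) $$ (i,j)) \<longlongrightarrow> L $$ (i,j)) (at_right 0))"
  have "\<exists>!L. ?P L"
  proof (rule ex_ex1I)
    show "\<exists>L. ?P L" by (rule wgm_tendsto_ex[OF A B])
    fix L L' assume L: "?P L" "?P L'"
    show "L = L'"
    proof (rule eq_matI)
      fix i j assume "i < dim_row L'" "j < dim_col L'"
      hence "i < n" "j < n" using L by auto
      thus "L $$ (i,j) = L' $$ (i,j)"
        using L tendsto_unique[OF trivial_limit_at_right_real[of 0]] by blast
    qed (use L in auto)
  qed
  moreover have "wgm \<beta> A B = (THE L. ?P L)"
    using psdD(4)[OF A] unfolding wgm_def Let_def mat_lim0_def gexpr_def by simp
  ultimately have P: "?P (wgm \<beta> A B)" using theI'[of ?P] by simp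
  show "wgm \<beta> A B \<in> carrier_mat n n" using P by blast
  show "((\<lambda>e. gexpr \<beta> (eps n e A) (eps n e B) $$ (i,j)) \<longlongrightarrow> wgm \<beta> A B $$ (i,j)) (at_right 0)"
    if "i < n" "j < n" using P that by blast
qed

lemma gexpr_carrier: "psd n A \<Longrightarrow> psd n B \<Longrightarrow> 0 < e \<Longrightarrow> psd n (gexpr \<beta> (eps n e A) (eps n e B))"
  using gm_rep_eps gm_rep_psd by blast

lemma wgm_qf_tendsto:
  assumes A: "psd n A" and B: "psd n B" and v: "v \<in> carrier_vec n"
  shows "((\<lambda>e. qf (gexpr \<beta> (eps n e A) (eps n e B)) v) \<longlongrightarrow> qf (wgm \<beta> A B) v) (at_right 0)"
proof -
  \<comment> \<open>The dimensions of the regularized mean are known for positive \<open>e\<close>.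
    The zero matrix fills in elsewhere because \<open>qf_tendsto\<close> asks for a carrier at every
    \<open>e\<close>.\<close>
  let ?F = "\<lambda>e. if 0 < e then gexpr \<beta> (eps n e A) (eps n e B) else 0\<^sub>m n n"
  have ev: "eventually (\<lambda>e. ?F e = gexpr \<beta> (eps n e A) (eps n e B)) (at_right 0)"
    using eventually_at_right_less[of 0] by eventually_elim simp
  have "((\<lambda>e. qf (?F e) v) \<longlongrightarrow> qf (wgm \<beta> A B) v) (at_right 0)"
  proof (rule qf_tendsto)
    show "?F e \<in> carrier_mat n n" for e using gexpr_carrier[OF A B] psdD by auto
    show "((\<lambda>e. ?F e $$ (i,j)) \<longlongrightarrow> wgm \<beta> A B $$ (i,j)) (at_right 0)" if "i < n" "j < n" for i j
      by (rule Lim_transform_eventually[OF wgm_tendsto(2)[OF A B that]])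
         (use ev in eventually_elim, simp)
  qed (use wgm_tendsto(1)[OF A B] v in auto)
  thus ?thesis by (rule Lim_transform_eventually) (use ev in eventually_elim, simp)
qed

lemma psd_wgm:
  assumes A: "psd n A" and B: "psd n B"
  shows "psd n (wgm \<beta> A B)"
  unfolding psd_iff
proof (intro conjI ballI)
  show c: "wgm \<beta> A B \<in> carrier_mat n n" by (rule wgm_tendsto(1)[OF A B])
  show "hermitian (wgm \<beta> A B)" unfolding hermitian_def
  proof (rule eq_matI)
    fix i j assume "i < dim_row (adj (wgm \<beta> A B))" "j < dim_col (adj (wgm \<beta> A B))"
    hence ij: "i < n" "j < n" using c by auto
    let ?G = "\<lambda>e. gexpr \<beta> (eps n e A) (eps n e B)"
    have "((\<lambda>e. cnj (?G e $$ (j,i))) \<longlongrightarrow> cnj (wgm \<beta> A B $$ (j,i))) (at_right 0)"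
      by (intro tendsto_cnj wgm_tendsto(2)[OF A B] ij)
    moreover have "eventually (\<lambda>e. cnj (?G e $$ (j,i)) = ?G e $$ (i,j)) (at_right 0)"
      using eventually_at_right_less[of 0]
    proof eventually_elim
      case (elim e)
      note G = gexpr_carrier[OF A B elim]
      have "?G e $$ (i,j) = adj (?G e) $$ (i,j)" using psdD(2)[OF G] unfolding hermitian_def by simp
      thus ?case using psdD(4,5)[OF G] ij by simp
    qed
    ultimately have "((\<lambda>e. ?G e $$ (i,j)) \<longlongrightarrow> cnj (wgm \<beta> A B $$ (j,i))) (at_right 0)"
      by (rule Lim_transform_eventually)
    hence "wgm \<beta> A B $$ (i,j) = cnj (wgm \<beta> A B $$ (j,i))"
      using tendsto_unique[OF trivial_limit_at_right_real[of 0] wgm_tendsto(2)[OF A B ij]] by blast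
    thus "wgm \<beta> A B $$ (i,j) = adj (wgm \<beta> A B) $$ (i,j)" using c ij by simp
  qed (use c in auto)
  fix v :: "complex vec" assume v: "v \<in> carrier_vec n"
  have "eventually (\<lambda>e. 0 \<le> qf (gexpr \<beta> (eps n e A) (eps n e B)) v) (at_right 0)"
    using eventually_at_right_less[of 0] by eventually_elim (rule psdD(3)[OF gexpr_carrier[OF A B] v])
  thus "0 \<le> qf (wgm \<beta> A B) v"
    by (rule tendsto_lowerbound[OF wgm_qf_tendsto[OF A B v] _ trivial_limit_at_right_real])
qed

lemma filterlim_times_at_right: "0 < k \<Longrightarrow> filterlim (\<lambda>e. k * e) (at_right 0) (at_right (0::real))"
  unfolding filterlim_at using eventually_at_right_less[of "0::real"]
  by (auto intro!: tendsto_eq_intros elim!: eventually_mono)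

text \<open>The comparison survives the limit, but \<open>L\<close> may lengthen vectors: a shift by
  \<open>e\<close> on the left has to be matched by a shift by \<open>k * e\<close> on the
  right.\<close>

lemma wgm_compare:
  assumes p: "psd n A1" "psd n B1" "psd n A2" "psd n B2" "psd m A3" "psd m B3"
    and L: "L \<in> carrier_mat n m" and c: "0 \<le> c1" "0 \<le> c2"
    and A: "\<And>x. x \<in> carrier_vec m \<Longrightarrow> c1 * qf A1 (L *\<^sub>v x) + c2 * qf A2 (L *\<^sub>v x) \<le> qf A3 x"
    and B: "\<And>x. x \<in> carrier_vec m \<Longrightarrow> c1 * qf B1 (L *\<^sub>v x) + c2 * qf B2 (L *\<^sub>v x) \<le> qf B3 x"
    and v: "v \<in> carrier_vec m"
  shows "c1 * qf (wgm \<beta> A1 B1) (L *\<^sub>v v) + c2 * qf (wgm \<beta> A2 B2) (L *\<^sub>v v) \<le> qf (wgm \<beta> A3 B3) v"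
proof -
  obtain K where K: "0 \<le> K" "\<And>x. x \<in> carrier_vec m \<Longrightarrow> sqn (L *\<^sub>v x) \<le> K * sqn x"
    using sqn_bound[OF L] by metis
  \<comment> \<open>\<open>K\<close> bounds the squared stretching by \<open>L\<close>, and the
    summand 1 keeps \<open>k\<close> positive.\<close>
  define k where "k = (c1 + c2) * K + 1"
  have k: "0 < k" unfolding k_def using K c by (intro add_nonneg_pos mult_nonneg_nonneg) auto
  note C = psdD(1)[OF p(1)] psdD(1)[OF p(2)] psdD(1)[OF p(3)] psdD(1)[OF p(4)] psdD(1)[OF p(5)] psdD(1)[OF p(6)]
  have Lx: "L *\<^sub>v x \<in> carrier_vec n" for x using L by simp
  have epsb: "c1 * qf (eps n e X1) (L *\<^sub>v x) + c2 * qf (eps n e X2) (L *\<^sub>v x) \<le> qf (eps m (k * e) X3) x"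
    if "0 < e" "x \<in> carrier_vec m" "c1 * qf X1 (L *\<^sub>v x) + c2 * qf X2 (L *\<^sub>v x) \<le> qf X3 x"
      "X1 \<in> carrier_mat n n" "X2 \<in> carrier_mat n n" "X3 \<in> carrier_mat m m" for e x X1 X2 X3
  proof -
    have "(c1 + c2) * sqn (L *\<^sub>v x) \<le> (c1 + c2) * (K * sqn x)"
      using K(2)[OF that(2)] c by (intro mult_left_mono) auto
    also have "\<dots> \<le> k * sqn x" unfolding k_def by (simp add: algebra_simps)
    finally have "e * ((c1 + c2) * sqn (L *\<^sub>v x)) \<le> e * (k * sqn x)"
      using that(1) by (intro mult_left_mono) auto
    moreover have "qf (eps m (k * e) X3) x = qf X3 x + e * (k * sqn x)"
      using that by (subst qf_eps) auto
    moreover have "c1 * qf (eps n e X1) (L *\<^sub>v x) + c2 * qf (eps n e X2) (L *\<^sub>v x)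
      = c1 * qf X1 (L *\<^sub>v x) + c2 * qf X2 (L *\<^sub>v x) + e * ((c1 + c2) * sqn (L *\<^sub>v x))"
      unfolding qf_eps[OF that(4) Lx] qf_eps[OF that(5) Lx] by (simp only: algebra_simps)
    ultimately show ?thesis using that(3) by linarith
  qed
  have "c1 * qf (gexpr \<beta> (eps n e A1) (eps n e B1)) (L *\<^sub>v v) + c2 * qf (gexpr \<beta> (eps n e A2) (eps n e B2)) (L *\<^sub>v v)
      \<le> qf (gexpr \<beta> (eps m (k * e) A3) (eps m (k * e) B3)) v" if e: "0 < e" for e
  proof -
    have ke: "0 < k * e" using k e by simp
    show ?thesis
      by (rule gm_rep_compare[OF \<beta> gm_rep_eps[OF p(1,2) e] gm_rep_eps[OF p(3,4) e] gm_rep_eps[OF p(5,6) ke] L c _ _ v])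
         (intro epsb e A B C; assumption)+
  qed
  hence ev: "eventually (\<lambda>e. c1 * qf (gexpr \<beta> (eps n e A1) (eps n e B1)) (L *\<^sub>v v)
      + c2 * qf (gexpr \<beta> (eps n e A2) (eps n e B2)) (L *\<^sub>v v)
      \<le> qf (gexpr \<beta> (eps m (k * e) A3) (eps m (k * e) B3)) v) (at_right 0)"
    using eventually_at_right_less[of 0] by (rule eventually_mono[rotated])
  have "((\<lambda>e. qf (gexpr \<beta> (eps m (k * e) A3) (eps m (k * e) B3)) v) \<longlongrightarrow> qf (wgm \<beta> A3 B3) v) (at_right 0)"
    by (rule filterlim_compose[OF wgm_qf_tendsto[OF p(5,6) v] filterlim_times_at_right[OF k]])
  thus ?thesis
    by (rule tendsto_le[OF trivial_limit_at_right_real _ _ ev])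
       (intro tendsto_intros wgm_qf_tendsto p Lx)
qed

text \<open>Comparison along \<open>adj K\<close> with one weight set to 0. It lets congruences act
  on feasible operators.\<close>

lemma wgm_transformer:
  assumes p: "psd n A" "psd n B" and K: "K \<in> carrier_mat m n" and v: "v \<in> carrier_vec m"
  shows "qf (K * wgm \<beta> A B * adj K) v \<le> qf (wgm \<beta> (K * A * adj K) (K * B * adj K)) v"
proof -
  have "1 * qf (wgm \<beta> A B) (adj K *\<^sub>v v) + 0 * qf (wgm \<beta> A B) (adj K *\<^sub>v v)
    \<le> qf (wgm \<beta> (K * A * adj K) (K * B * adj K)) v"
    by (rule wgm_compare[OF p p psd_congr[OF p(1) K] psd_congr[OF p(2) K] adj_carrier[OF K] _ _ _ _ v])
       (auto simp: qf_congr[OF psdD(1)[OF p(1)] K] qf_congr[OF psdD(1)[OF p(2)] K])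
  thus ?thesis using qf_congr[OF wgm_tendsto(1)[OF p] K v] by simp
qed

lemma wgm_concave:
  assumes p: "psd n A" "psd n B1" "psd n B2" and c: "0 \<le> c1" "0 \<le> c2" "c1 + c2 = 1" and v: "v \<in> carrier_vec n"
  shows "c1 * qf (wgm \<beta> A B1) v + c2 * qf (wgm \<beta> A B2) v
    \<le> qf (wgm \<beta> A (complex_of_real c1 \<cdot>\<^sub>m B1 + complex_of_real c2 \<cdot>\<^sub>m B2)) v"
proof -
  have B3: "psd n (complex_of_real c1 \<cdot>\<^sub>m B1 + complex_of_real c2 \<cdot>\<^sub>m B2)"
    using p c by (intro psd_add psd_smult)
  have 1: "c1 * qf A (1\<^sub>m n *\<^sub>v x) + c2 * qf A (1\<^sub>m n *\<^sub>v x) \<le> qf A x" if "x \<in> carrier_vec n" for x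
  proof -
    have "c1 * qf A x + c2 * qf A x = (c1 + c2) * qf A x" by (simp add: algebra_simps)
    thus ?thesis using c that by simp
  qed
  have 2: "c1 * qf B1 (1\<^sub>m n *\<^sub>v x) + c2 * qf B2 (1\<^sub>m n *\<^sub>v x)
      \<le> qf (complex_of_real c1 \<cdot>\<^sub>m B1 + complex_of_real c2 \<cdot>\<^sub>m B2) x" if "x \<in> carrier_vec n" for x
    using that psdD(1)[OF p(2)] psdD(1)[OF p(3)] by (simp add: qf_add[of _ n] qf_smult[of _ n])
  show ?thesis
    using wgm_compare[OF p(1,2,1,3,1) B3, of "1\<^sub>m n" c1 c2 v] c 1 2 v by simp
qed

text \<open>The commuting case. The regularized mean is read off from an explicit congruence built
  from square roots of the shifted eigenvalues of the first argument. Both exponents are positive,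
  so the scalar functions are continuous down to 0 and the limit can be taken.\<close>

lemma wgm_diag:
  assumes U: "unitary n U" and s: "\<And>i. i < n \<Longrightarrow> 0 \<le> s i" and a: "\<And>i. i < n \<Longrightarrow> 0 \<le> a i"
  shows "wgm \<beta> (U * rdiag n s * adj U) (U * rdiag n a * adj U)
    = U * rdiag n (\<lambda>i. pw (1 - \<beta>) (s i) * pw \<beta> (a i)) * adj U"
proof -
  have Uc: "U \<in> carrier_mat n n" using U unitary_carrier by blast
  let ?A = "U * rdiag n s * adj U" and ?B = "U * rdiag n a * adj U"
  have p: "psd n ?A" "psd n ?B" using s a Uc by (auto intro!: psd_spec)
  have G: "gexpr \<beta> (eps n e ?A) (eps n e ?B) = U * rdiag n (\<lambda>i. pw (1 - \<beta>) (s i + e) * pw \<beta> (a i + e)) * adj U"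
    if e: "0 < e" for e
  proof (rule gm_rep_unique[OF gm_rep_eps[OF p e]])
    define T where "T = U * rdiag n (\<lambda>i. sqrt (s i + e))"
    define S where "S = rdiag n (\<lambda>i. 1 / sqrt (s i + e)) * adj U"
    define d where "d i = (a i + e) / (s i + e)" for i
    have pos: "0 < s i + e" "0 < a i + e" if "i < n" for i using s[OF that] a[OF that] e by auto
    have Tc: "T \<in> carrier_mat n n" "S \<in> carrier_mat n n" unfolding T_def S_def using Uc by simp_all
    have TT: "T * rdiag n f * adj T = U * rdiag n (\<lambda>i. (s i + e) * f i) * adj U" for f
    proof -
      have "rdiag n (\<lambda>i. sqrt (s i + e)) * rdiag n f * rdiag n (\<lambda>i. sqrt (s i + e)) = rdiag n (\<lambda>i. (s i + e) * f i)"
        unfolding mat_diag_diag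
      proof (rule mat_diag_cong)
        fix i assume "i < n"
        hence "sqrt (s i + e) * sqrt (s i + e) = s i + e" using pos(1)[of i] by simp
        hence "sqrt (s i + e) * f i * sqrt (s i + e) = (s i + e) * f i"
          by (metis mult.assoc mult.commute)
        thus "complex_of_real (sqrt (s i + e)) * complex_of_real (f i) * complex_of_real (sqrt (s i + e))
          = complex_of_real ((s i + e) * f i)" by (metis of_real_mult)
      qed
      moreover have "T * rdiag n f * adj T
        = U * (rdiag n (\<lambda>i. sqrt (s i + e)) * rdiag n f * rdiag n (\<lambda>i. sqrt (s i + e))) * adj U"
        unfolding T_def using Uc by (simp add: adj_mult mult_assoc_dim del: mat_diag_diag)
      ultimately show ?thesis by simp
    qed
    have "S * T = rdiag n (\<lambda>i. 1 / sqrt (s i + e)) * rdiag n (\<lambda>i. sqrt (s i + e))"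
      unfolding S_def T_def using U Uc by (simp add: mult_assoc_dim unitary_cancel del: mat_diag_diag)
    also have "\<dots> = rdiag n (\<lambda>_. 1)"
      unfolding mat_diag_diag
      by (rule mat_diag_cong) (use pos(1) in \<open>force simp flip: of_real_mult\<close>)
    also have "\<dots> = 1\<^sub>m n" by simp
    finally have "S * T = 1\<^sub>m n" .
    moreover have "eps n e ?A = T * adj T"
      using TT[of "\<lambda>_. 1"] Tc unfolding eps_spec[OF U] by simp
    moreover have "eps n e ?B = T * rdiag n d * adj T"
      unfolding TT eps_spec[OF U] d_def using pos(1)
      by (intro arg_cong[of _ _ "\<lambda>X. U * X * adj U"] mat_diag_cong) (simp add: less_imp_neq[symmetric])
    moreover have "U * rdiag n (\<lambda>i. pw (1 - \<beta>) (s i + e) * pw \<beta> (a i + e)) * adj U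
        = T * rdiag n (\<lambda>i. pw \<beta> (d i)) * adj T"
      unfolding TT
    proof (intro arg_cong[of _ _ "\<lambda>X. U * X * adj U"] mat_diag_cong)
      fix i assume i: "i < n"
      have "(s i + e) * pw \<beta> (d i) = (s i + e) powr 1 * ((a i + e) powr \<beta> / (s i + e) powr \<beta>)"
        unfolding d_def pw_def using pos[OF i] by (simp add: powr_divide)
      also have "\<dots> = pw (1 - \<beta>) (s i + e) * pw \<beta> (a i + e)"
        unfolding pw_def using pos[OF i] by (simp add: powr_diff)
      finally show "complex_of_real (pw (1 - \<beta>) (s i + e) * pw \<beta> (a i + e))
        = complex_of_real ((s i + e) * pw \<beta> (d i))" by simp
    qed
    moreover have "\<forall>i<n. 0 \<le> d i" unfolding d_def using pos by (auto intro!: divide_nonneg_pos less_imp_le)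
    ultimately show "gm_rep \<beta> n (eps n e ?A) (eps n e ?B)
      (U * rdiag n (\<lambda>i. pw (1 - \<beta>) (s i + e) * pw \<beta> (a i + e)) * adj U)"
      unfolding gm_rep_def using Tc by blast
  qed
  have pwlim: "((\<lambda>e. pw t (x + e)) \<longlongrightarrow> pw t x) (at_right 0)" if "0 \<le> x" "0 < t" for x t
  proof -
    have "((\<lambda>e. (x + e) powr t) \<longlongrightarrow> (x + 0) powr t) (at_right 0)"
    proof (rule tendsto_powr2)
      show "((\<lambda>e. x + e) \<longlongrightarrow> x + 0) (at_right 0)" by (intro tendsto_intros)
      show "\<forall>\<^sub>F e in at_right 0. 0 \<le> x + e"
        using eventually_at_right_less[of 0] by eventually_elim (use that in simp)
    qed (use that in auto)
    moreover have "eventually (\<lambda>e. (x + e) powr t = pw t (x + e)) (at_right 0)"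
      using eventually_at_right_less[of 0] by eventually_elim (use that in \<open>simp add: pw_def\<close>)
    ultimately have "((\<lambda>e. pw t (x + e)) \<longlongrightarrow> (x + 0) powr t) (at_right 0)"
      by (rule Lim_transform_eventually)
    moreover have "(x + 0) powr t = pw t x" using that by (auto simp: pw_def)
    ultimately show ?thesis by simp
  qed
  show ?thesis
  proof (rule qf_eqI[OF psdD(2)[OF psd_wgm[OF p]] psdD(1)[OF psd_wgm[OF p]]])
    fix v :: "complex vec" assume v: "v \<in> carrier_vec n"
    let ?w = "\<lambda>i. (cmod ((adj U *\<^sub>v v) $ i))\<^sup>2"
    have "((\<lambda>e. \<Sum>i<n. pw (1 - \<beta>) (s i + e) * pw \<beta> (a i + e) * ?w i)
      \<longlongrightarrow> (\<Sum>i<n. pw (1 - \<beta>) (s i) * pw \<beta> (a i) * ?w i)) (at_right 0)"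
      using \<beta> s a by (intro tendsto_intros pwlim) auto
    moreover have "eventually (\<lambda>e. (\<Sum>i<n. pw (1 - \<beta>) (s i + e) * pw \<beta> (a i + e) * ?w i)
       = qf (gexpr \<beta> (eps n e ?A) (eps n e ?B)) v) (at_right 0)"
      using eventually_at_right_less[of 0]
    proof eventually_elim
      case (elim e)
      show ?case unfolding G[OF elim] by (rule qf_spec[OF Uc v, symmetric])
    qed
    ultimately have "((\<lambda>e. qf (gexpr \<beta> (eps n e ?A) (eps n e ?B)) v)
      \<longlongrightarrow> (\<Sum>i<n. pw (1 - \<beta>) (s i) * pw \<beta> (a i) * ?w i)) (at_right 0)"
      by (rule Lim_transform_eventually)
    hence "qf (wgm \<beta> ?A ?B) v = (\<Sum>i<n. pw (1 - \<beta>) (s i) * pw \<beta> (a i) * ?w i)"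
      using tendsto_unique[OF trivial_limit_at_right_real[of 0] wgm_qf_tendsto[OF p v]] by blast
    thus "qf (wgm \<beta> ?A ?B) v = qf (U * rdiag n (\<lambda>i. pw (1 - \<beta>) (s i) * pw \<beta> (a i)) * adj U) v"
      by (simp only: qf_spec[OF Uc v])
  qed (use Uc in \<open>auto intro!: hermitian_congr hermitian_rdiag simp del: of_real_mult\<close>)
qed

end

lemma gm_rep_kron:
  assumes "gm_rep \<beta> n A1 B1 G1" "gm_rep \<beta> m A2 B2 G2"
  shows "gm_rep \<beta> (n * m) (kron A1 A2) (kron B1 B2) (kron G1 G2)"
proof -
  obtain T1 S1 d1 where 1: "T1 \<in> carrier_mat n n" "S1 \<in> carrier_mat n n" "S1 * T1 = 1\<^sub>m n"
    "\<forall>i<n. 0 \<le> d1 i" "A1 = T1 * adj T1" "B1 = T1 * rdiag n d1 * adj T1"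
    "G1 = T1 * rdiag n (\<lambda>i. pw \<beta> (d1 i)) * adj T1"
    using assms(1) unfolding gm_rep_def by blast
  obtain T2 S2 d2 where 2: "T2 \<in> carrier_mat m m" "S2 \<in> carrier_mat m m" "S2 * T2 = 1\<^sub>m m"
    "\<forall>i<m. 0 \<le> d2 i" "A2 = T2 * adj T2" "B2 = T2 * rdiag m d2 * adj T2"
    "G2 = T2 * rdiag m (\<lambda>i. pw \<beta> (d2 i)) * adj T2"
    using assms(2) unfolding gm_rep_def by blast
  have "kron S1 S2 * kron T1 T2 = 1\<^sub>m (n * m)" using 1 2 by (simp add: kron_mult)
  moreover have "kron A1 A2 = kron T1 T2 * adj (kron T1 T2)"
    unfolding 1(5) 2(5) using 1(1) 2(1) by (simp add: adj_kron kron_mult)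
  moreover have "kron B1 B2 = kron T1 T2 * rdiag (n * m) (\<lambda>k. d1 (k div m) * d2 (k mod m)) * adj (kron T1 T2)"
    unfolding 1(6) 2(6) by (rule kron_spec[OF 1(1) 2(1)])
  moreover have "rdiag (n * m) (\<lambda>k. pw \<beta> (d1 (k div m)) * pw \<beta> (d2 (k mod m)))
      = rdiag (n * m) (\<lambda>k. pw \<beta> (d1 (k div m) * d2 (k mod m)))"
    using 1(4) 2(4) by (intro mat_diag_cong) (simp add: pw_mult div_mod_less)
  hence "kron G1 G2 = kron T1 T2 * rdiag (n * m) (\<lambda>k. pw \<beta> (d1 (k div m) * d2 (k mod m))) * adj (kron T1 T2)"
    unfolding 1(7) 2(7) kron_spec[OF 1(1) 2(1)] by simp
  moreover have "\<forall>k<n*m. 0 \<le> d1 (k div m) * d2 (k mod m)"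
    using 1(4) 2(4) by (auto simp: div_mod_less)
  ultimately show ?thesis
    unfolding gm_rep_def using kron_carrier[OF 1(1) 2(1)] kron_carrier[OF 1(2) 2(2)]
    by (intro exI[of _ "kron T1 T2"] exI[of _ "kron S1 S2"]
        exI[of _ "\<lambda>k. d1 (k div m) * d2 (k mod m)"] conjI)
qed

text \<open>Expanding the product gives cross terms of first order in \<open>e\<close> and a term
  \<open>e * e\<close>, which is at most \<open>e\<close> here. All are absorbed in a multiple of
  \<open>e\<close>.\<close>

lemma kron_eps_bound:
  assumes "psd n A" "psd m B"
  obtains k where "0 < k" "\<And>e v. 0 < e \<Longrightarrow> e < 1 \<Longrightarrow> v \<in> carrier_vec (n * m) \<Longrightarrow>
    qf (kron (eps n e A) (eps m e B)) v \<le> qf (eps (n * m) (k * e) (kron A B)) v"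
proof -
  note c = psdD(1)[OF assms(1)] psdD(1)[OF assms(2)]
  obtain K1 where K1: "0 \<le> K1" "\<And>v. v \<in> carrier_vec (n * m) \<Longrightarrow> qf (kron A (1\<^sub>m m)) v \<le> K1 * sqn v"
    by (rule qf_bound[OF psdD(2,1)[OF psd_kron[OF assms(1) psd_one]]]) blast
  obtain K2 where K2: "0 \<le> K2" "\<And>v. v \<in> carrier_vec (n * m) \<Longrightarrow> qf (kron (1\<^sub>m n) B) v \<le> K2 * sqn v"
    by (rule qf_bound[OF psdD(2,1)[OF psd_kron[OF psd_one assms(2)]]]) blast
  show ?thesis
  proof (rule that)
    show "0 < K1 + K2 + 1" using K1 K2 by simp
    fix e :: real and v :: "complex vec" assume e: "0 < e" "e < 1" and v: "v \<in> carrier_vec (n * m)"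
    have "kron (eps n e A) (eps m e B) = kron A B + complex_of_real e \<cdot>\<^sub>m kron A (1\<^sub>m m)
      + complex_of_real e \<cdot>\<^sub>m kron (1\<^sub>m n) B + complex_of_real (e * e) \<cdot>\<^sub>m 1\<^sub>m (n * m)"
    proof -
      have "kron (eps n e A) (eps m e B) = kron A B + complex_of_real e \<cdot>\<^sub>m kron A (1\<^sub>m m)
        + complex_of_real e \<cdot>\<^sub>m kron (1\<^sub>m n) B + complex_of_real (e * e) \<cdot>\<^sub>m kron (1\<^sub>m n) (1\<^sub>m m)"
        by (rule eq_matI) (use c in \<open>auto simp: div_mod_less algebra_simps simp del: index_one_mat(1) kron_one\<close>)
      thus ?thesis by simp
    qed
    hence "qf (kron (eps n e A) (eps m e B)) v = qf (kron A B) v + e * qf (kron A (1\<^sub>m m)) v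
      + e * qf (kron (1\<^sub>m n) B) v + e * e * sqn v"
      using c v kron_carrier[OF c] kron_carrier[OF c(1), of "1\<^sub>m m" m m] kron_carrier[OF _ c(2), of "1\<^sub>m n" n n]
      by (simp add: qf_add[of _ "n * m"] qf_smult[of _ "n * m"] qf_one del: of_real_mult)
    also have "\<dots> \<le> qf (kron A B) v + e * (K1 * sqn v) + e * (K2 * sqn v) + e * (1 * sqn v)"
    proof -
      have "e * qf (kron A (1\<^sub>m m)) v \<le> e * (K1 * sqn v)" using e K1(2)[OF v] by (intro mult_left_mono) auto
      moreover have "e * qf (kron (1\<^sub>m n) B) v \<le> e * (K2 * sqn v)" using e K2(2)[OF v] by (intro mult_left_mono) auto
      moreover have "e * e * sqn v \<le> e * (1 * sqn v)"
        unfolding mult.assoc using e by (intro mult_left_mono mult_right_mono) auto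
      ultimately show ?thesis by linarith
    qed
    also have "\<dots> = qf (eps (n * m) ((K1 + K2 + 1) * e) (kron A B)) v"
      using kron_carrier[OF c] v by (subst qf_eps) (simp_all add: algebra_simps)
    finally show "qf (kron (eps n e A) (eps m e B)) v \<le> qf (eps (n * m) ((K1 + K2 + 1) * e) (kron A B)) v" .
  qed
qed

text \<open>For regularized arguments the mean is multiplicative by \<open>gm_rep_kron\<close>, but
  the product of regularizations is not the regularization of the product. It lies below one with
  rescaled \<open>e\<close>, so monotonicity gives the direction that preserves feasibility.\<close>

lemma wgm_kron:
  assumes \<beta>: "0 < \<beta>" "\<beta> < 1" and p: "psd n A1" "psd n B1" "psd m A2" "psd m B2" and v: "v \<in> carrier_vec (n * m)"
  shows "qf (kron (wgm \<beta> A1 B1) (wgm \<beta> A2 B2)) v \<le> qf (wgm \<beta> (kron A1 A2) (kron B1 B2)) v"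
proof -
  obtain k where k: "0 < k" "\<And>e v. 0 < e \<Longrightarrow> e < 1 \<Longrightarrow> v \<in> carrier_vec (n * m) \<Longrightarrow>
    qf (kron (eps n e A1) (eps m e A2)) v \<le> qf (eps (n * m) (k * e) (kron A1 A2)) v"
    using kron_eps_bound[OF p(1,3)] by blast
  obtain l where l: "0 < l" "\<And>e v. 0 < e \<Longrightarrow> e < 1 \<Longrightarrow> v \<in> carrier_vec (n * m) \<Longrightarrow>
    qf (kron (eps n e B1) (eps m e B2)) v \<le> qf (eps (n * m) (l * e) (kron B1 B2)) v"
    using kron_eps_bound[OF p(2,4)] by blast
  define h where "h = max k l"
  have h: "0 < h" using k by (simp add: h_def)
  note pk = psd_kron[OF p(1,3)] psd_kron[OF p(2,4)]
  let ?G1 = "\<lambda>e. gexpr \<beta> (eps n e A1) (eps n e B1)" and ?G2 = "\<lambda>e. gexpr \<beta> (eps m e A2) (eps m e B2)"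
  let ?G = "\<lambda>e. gexpr \<beta> (eps (n * m) e (kron A1 A2)) (eps (n * m) e (kron B1 B2))"
  have lt1: "eventually (\<lambda>e::real. 0 < e \<and> e < 1) (at_right 0)"
    by (auto simp: eventually_at_right_field intro: exI[of _ 1])
  have le: "qf (kron (?G1 e) (?G2 e)) v \<le> qf (?G (h * e)) v" if e: "0 < e" "e < 1" for e
  proof (rule gm_rep_mono[OF \<beta> gm_rep_kron[OF gm_rep_eps[OF p(1,2) e(1)] gm_rep_eps[OF p(3,4) e(1)]]
      gm_rep_eps[OF pk] _ _ v])
    show "0 < h * e" using h e by simp
    fix x :: "complex vec" assume x: "x \<in> carrier_vec (n * m)"
    have 1: "k * e * sqn x \<le> h * e * sqn x" and 2: "l * e * sqn x \<le> h * e * sqn x"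
      unfolding h_def using e by (intro mult_right_mono; simp)+
    show "qf (kron (eps n e A1) (eps m e A2)) x \<le> qf (eps (n * m) (h * e) (kron A1 A2)) x"
      using k(2)[OF e x] 1 unfolding qf_eps[OF psdD(1)[OF pk(1)] x] by linarith
    show "qf (kron (eps n e B1) (eps m e B2)) x \<le> qf (eps (n * m) (h * e) (kron B1 B2)) x"
      using l(2)[OF e x] 2 unfolding qf_eps[OF psdD(1)[OF pk(2)] x] by linarith
  qed
  have ev: "eventually (\<lambda>e. qf (kron (?G1 e) (?G2 e)) v \<le> qf (?G (h * e)) v) (at_right 0)"
    using lt1 by eventually_elim (use le in blast)
  let ?F = "\<lambda>e. if 0 < e then kron (?G1 e) (?G2 e) else 0\<^sub>m (n * m) (n * m)"
  have lim1: "((\<lambda>e. qf (?F e) v) \<longlongrightarrow> qf (kron (wgm \<beta> A1 B1) (wgm \<beta> A2 B2)) v) (at_right 0)"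
  proof (rule qf_tendsto[OF _ _ v])
    note w = wgm_tendsto(1)[OF \<beta> p(1,2)] wgm_tendsto(1)[OF \<beta> p(3,4)]
    show "?F e \<in> carrier_mat (n * m) (n * m)" for e
      using psdD(1)[OF gexpr_carrier[OF \<beta> p(1,2)]] psdD(1)[OF gexpr_carrier[OF \<beta> p(3,4)]] by (auto intro: kron_carrier)
    show "kron (wgm \<beta> A1 B1) (wgm \<beta> A2 B2) \<in> carrier_mat (n * m) (n * m)" using w by (rule kron_carrier)
    fix i j assume ij: "i < n * m" "j < n * m"
    note d = div_mod_less[OF ij(1)] div_mod_less[OF ij(2)]
    have "((\<lambda>e. ?G1 e $$ (i div m, j div m) * ?G2 e $$ (i mod m, j mod m))
      \<longlongrightarrow> wgm \<beta> A1 B1 $$ (i div m, j div m) * wgm \<beta> A2 B2 $$ (i mod m, j mod m)) (at_right 0)"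
      by (intro tendsto_mult wgm_tendsto(2)[OF \<beta>] p d)
    moreover have "eventually (\<lambda>e. ?G1 e $$ (i div m, j div m) * ?G2 e $$ (i mod m, j mod m) = ?F e $$ (i,j)) (at_right 0)"
      using eventually_at_right_less[of 0]
    proof eventually_elim
      case (elim e)
      show ?case using elim ij psdD(4,5)[OF gexpr_carrier[OF \<beta> p(1,2) elim]] psdD(4,5)[OF gexpr_carrier[OF \<beta> p(3,4) elim]]
        by simp
    qed
    moreover have "kron (wgm \<beta> A1 B1) (wgm \<beta> A2 B2) $$ (i,j)
       = wgm \<beta> A1 B1 $$ (i div m, j div m) * wgm \<beta> A2 B2 $$ (i mod m, j mod m)"
      using w ij by simp
    ultimately show "((\<lambda>e. ?F e $$ (i,j)) \<longlongrightarrow> kron (wgm \<beta> A1 B1) (wgm \<beta> A2 B2) $$ (i,j)) (at_right 0)"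
      by (simp only: Lim_transform_eventually)
  qed
  have lim1': "((\<lambda>e. qf (kron (?G1 e) (?G2 e)) v) \<longlongrightarrow> qf (kron (wgm \<beta> A1 B1) (wgm \<beta> A2 B2)) v) (at_right 0)"
    by (rule Lim_transform_eventually[OF lim1]) (use eventually_at_right_less[of 0] in eventually_elim, simp)
  have lim2: "((\<lambda>e. qf (?G (h * e)) v) \<longlongrightarrow> qf (wgm \<beta> (kron A1 A2) (kron B1 B2)) v) (at_right 0)"
    by (rule filterlim_compose[OF wgm_qf_tendsto[OF \<beta> pk v] filterlim_times_at_right[OF \<beta> h]])
  show ?thesis
    by (rule tendsto_le[OF trivial_limit_at_right_real lim2 lim1' ev])
qed

section \<open>Convexity and monotonicity of the trace of a power\<close>

text \<open>With \<open>A = B * adj B\<close>, a vanishing quadratic form forces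
  \<open>adj B\<close> to annihilate \<open>u\<close>.\<close>

lemma psd_zero_vec:
  assumes "psd n A" "u \<in> carrier_vec n" "qf A u = 0" "x \<in> carrier_vec n"
  shows "conjugate u \<bullet> (A *\<^sub>v x) = 0" "conjugate x \<bullet> (A *\<^sub>v u) = 0"
proof -
  obtain B where B: "B \<in> carrier_mat n n" "A = B * adj B" using psd_imp_gram[OF assms(1)] by blast
  define w where "w = adj B *\<^sub>v u"
  have wc: "w \<in> carrier_vec n" unfolding w_def using B by simp
  have "sqn w = 0" using assms(2,3) unfolding B(2) qf_gram[OF B(1) assms(2)] w_def by simp
  hence "\<forall>i<n. w $ i = 0" using wc unfolding sqn_def by (simp add: sum_nonneg_eq_0_iff)
  hence w: "w = 0\<^sub>v n" using wc by (intro eq_vecI) auto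
  have Ax: "A *\<^sub>v x = B *\<^sub>v (adj B *\<^sub>v x)" and Au: "A *\<^sub>v u = B *\<^sub>v w"
    unfolding B(2) w_def using B assms by (auto simp: assoc_mult_mat_vec[of _ n n _ n])
  have "conjugate u \<bullet> (A *\<^sub>v x) = conjugate w \<bullet> (adj B *\<^sub>v x)"
    unfolding Ax w_def using ip_adj[OF B(1) assms(2), of "adj B *\<^sub>v x"] B by simp
  also have "\<dots> = 0" unfolding w using B assms by (simp add: scalar_prod_def)
  finally show "conjugate u \<bullet> (A *\<^sub>v x) = 0" .
  show "conjugate x \<bullet> (A *\<^sub>v u) = 0" unfolding Au w using B assms by (simp add: scalar_prod_def)
qed

lemma qf_col:
  assumes "V \<in> carrier_mat n m" "A \<in> carrier_mat n n" "i < m"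
  shows "qf A (col V i) = Re ((adj V * A * V) $$ (i,i))"
proof -
  have c: "col V i \<in> carrier_vec n" using assms by (auto intro: carrier_vecI)
  show ?thesis
    unfolding qf_sum[OF assms(2) c] mult_sandwich_index[OF assms(1,2,3,3)] using assms by simp
qed

lemma unitary_row_sum:
  assumes "unitary n U" "i < n"
  shows "(\<Sum>j<n. (cmod (U $$ (i,j)))\<^sup>2) = 1" "(\<Sum>j<n. (cmod (U $$ (j,i)))\<^sup>2) = 1"
proof -
  have Uc: "U \<in> carrier_mat n n" using assms unitary_carrier by blast
  have "complex_of_real (\<Sum>j<n. (cmod (U $$ (i,j)))\<^sup>2) = (U * adj U) $$ (i,i)"
    using Uc assms(2) by (simp add: index_mult_sum complex_norm_square del: index_mult_mat(1) of_real_power)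
  also have "\<dots> = 1" using assms by simp
  finally show "(\<Sum>j<n. (cmod (U $$ (i,j)))\<^sup>2) = 1" by (simp only: of_real_eq_1_iff)
  have "complex_of_real (\<Sum>j<n. (cmod (U $$ (j,i)))\<^sup>2) = (adj U * U) $$ (i,i)"
    using Uc assms(2) by (simp add: index_mult_sum complex_norm_square mult.commute del: index_mult_mat(1) of_real_power)
  also have "\<dots> = 1" using assms by simp
  finally show "(\<Sum>j<n. (cmod (U $$ (j,i)))\<^sup>2) = 1" by (simp only: of_real_eq_1_iff)
qed

lemma pw_mono: "x \<le> y \<Longrightarrow> 0 \<le> t \<Longrightarrow> pw t x \<le> pw t y"
  unfolding pw_def by (auto intro: powr_mono2)

lemma pw_convex:
  assumes "1 \<le> a"
  shows "convex_on {0..} (pw a)"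
proof (rule convex_onI)
  fix t x y :: real assume t: "0 < t" "t < 1" and x: "x \<in> {0..}" and y: "y \<in> {0..}"
  \<comment> \<open>When one endpoint is 0, convexity amounts to \<open>pw a s \<le> s\<close> for
    \<open>s\<close> below 1.\<close>
  have z: "pw a (s * u) \<le> s * pw a u" if "0 < s" "s < 1" "0 \<le> u" for s u
  proof -
    have "s powr a \<le> s powr 1" using that assms by (intro powr_mono') auto
    hence "pw a s \<le> s" using that by (simp add: pw_def)
    thus ?thesis using that by (auto simp: pw_mult intro!: mult_right_mono)
  qed
  show "pw a ((1 - t) *\<^sub>R x + t *\<^sub>R y) \<le> (1 - t) * pw a x + t * pw a y"
  proof (cases "0 < x \<and> 0 < y")
    case True
    have "((1 - t) *\<^sub>R x + t *\<^sub>R y) powr a \<le> (1 - t) * x powr a + t * y powr a"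
      using convex_onD[OF powr_convex[OF assms], of t x y] t True by simp
    moreover have "0 < (1 - t) * x + t * y" using t True by (intro add_pos_pos mult_pos_pos) auto
    ultimately show ?thesis using True by (simp add: pw_def)
  next
    case False
    then consider "x = 0" | "y = 0" using x y by fastforce
    thus ?thesis
    proof cases
      case 1 thus ?thesis using z[of t y] t y by (simp add: pw_def)
    next
      case 2 thus ?thesis using z[of "1 - t" x] t x by (simp add: pw_def)
    qed
  qed
qed simp

lemma trace_mpow_spec:
  assumes "unitary n U"
  shows "Re (mtrace (mpow a (U * rdiag n d * adj U))) = (\<Sum>i<n. pw a (d i))"
  unfolding mpow_spec[OF assms] using mtrace_unitary(1)[OF assms, of "rdiag n _"] by (simp add: mtrace_rdiag)

text \<open>The diagonal of \<open>Y\<close> in the basis \<open>V\<close> averages the eigenvalues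
  of \<open>Y\<close> with doubly stochastic weights, the squared moduli of the entries of
  \<open>W\<close>. Jensen's inequality uses the row sums, the final summation the column
  sums.\<close>

lemma peierls:
  assumes Y: "psd n Y" and V: "unitary n V" and a: "1 \<le> a"
  shows "(\<Sum>i<n. pw a (qf Y (col V i))) \<le> Re (mtrace (mpow a Y))"
proof -
  obtain U y where U: "unitary n U" and Yd: "Y = U * rdiag n y * adj U" and y: "\<And>i. i < n \<Longrightarrow> 0 \<le> y i"
    using psd_spectral[OF Y] by metis
  have c: "U \<in> carrier_mat n n" "V \<in> carrier_mat n n" using U V unitary_carrier by auto
  define W where "W = adj V * U"
  have W: "unitary n W" unfolding W_def using unitary_times[OF unitary_adj[OF V] U] .
  have Wc: "W \<in> carrier_mat n n" using W unitary_carrier by blast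
  have qfc: "qf Y (col V i) = (\<Sum>k<n. (cmod (W $$ (i,k)))\<^sup>2 * y k)" if "i < n" for i
  proof -
    have "adj V * Y * V = W * rdiag n y * adj W"
      unfolding Yd W_def using c by (simp add: adj_mult mult_assoc_dim)
    moreover have "qf Y (col V i) = Re ((adj V * Y * V) $$ (i,i))"
      by (rule qf_col[OF c(2) psdD(1)[OF Y] that])
    moreover have "(W * rdiag n y * adj W) $$ (i,i) = (\<Sum>k<n. W $$ (i,k) * complex_of_real (y k) * cnj (W $$ (i,k)))"
      by (rule spec_entry[OF Wc that that])
    moreover have "\<dots> = complex_of_real (\<Sum>k<n. (cmod (W $$ (i,k)))\<^sup>2 * y k)"
      by (simp add: complex_norm_square mult_ac del: of_real_power)
    ultimately show ?thesis by simp
  qed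
  have "(\<Sum>i<n. pw a (qf Y (col V i))) \<le> (\<Sum>i<n. \<Sum>k<n. (cmod (W $$ (i,k)))\<^sup>2 * pw a (y k))"
  proof (rule sum_mono)
    fix i assume "i \<in> {..<n}"
    hence i: "i < n" by simp
    have "pw a (\<Sum>k<n. (cmod (W $$ (i,k)))\<^sup>2 *\<^sub>R y k) \<le> (\<Sum>k<n. (cmod (W $$ (i,k)))\<^sup>2 * pw a (y k))"
      using i y unitary_row_sum(1)[OF W i] by (intro convex_on_sum[OF _ _ pw_convex[OF a]]) auto
    thus "pw a (qf Y (col V i)) \<le> (\<Sum>k<n. (cmod (W $$ (i,k)))\<^sup>2 * pw a (y k))"
      using qfc[OF i] by simp
  qed
  also have "\<dots> = (\<Sum>k<n. \<Sum>i<n. (cmod (W $$ (i,k)))\<^sup>2 * pw a (y k))" by (rule sum.swap)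
  also have "\<dots> = (\<Sum>k<n. pw a (y k))"
    using unitary_row_sum(2)[OF W] by (simp flip: sum_distrib_right)
  finally show ?thesis unfolding Yd trace_mpow_spec[OF U] .
qed

text \<open>In an eigenbasis of \<open>X\<close> the trace is a sum over quadratic forms, where
  monotonicity is scalar; \<open>peierls\<close> then returns to \<open>Y\<close>. Without the trace
  this fails for exponents above 1.\<close>

lemma trace_mpow_mono:
  assumes X: "psd n X" and Y: "psd n Y" and le: "\<And>v. v \<in> carrier_vec n \<Longrightarrow> qf X v \<le> qf Y v" and a: "1 \<le> a"
  shows "Re (mtrace (mpow a X)) \<le> Re (mtrace (mpow a Y))"
proof -
  obtain U x where U: "unitary n U" and Xd: "X = U * rdiag n x * adj U"
    using psd_spectral[OF X] by metis
  have c: "U \<in> carrier_mat n n" using U unitary_carrier by auto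
  have "qf X (col U i) = x i" if "i < n" for i
  proof -
    have "adj U * X * U = rdiag n x" unfolding Xd using U c by (simp add: mult_assoc_dim unitary_cancel)
    thus ?thesis using qf_col[OF c psdD(1)[OF X] that] that by simp
  qed
  hence "Re (mtrace (mpow a X)) = (\<Sum>i<n. pw a (qf X (col U i)))"
    unfolding Xd trace_mpow_spec[OF U] by simp
  also have "\<dots> \<le> (\<Sum>i<n. pw a (qf Y (col U i)))"
    using c a by (intro sum_mono pw_mono le) (auto intro: carrier_vecI)
  also have "\<dots> \<le> Re (mtrace (mpow a Y))" by (rule peierls[OF Y U a])
  finally show ?thesis .
qed

section \<open>Pinching\<close>

lemma finite_gap:
  fixes S :: "real set"
  assumes "finite S"
  obtains g where "0 < g" "\<And>c c'. c \<in> S \<Longrightarrow> c' \<in> S \<Longrightarrow> c < c' \<Longrightarrow> g \<le> c' - c"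
proof -
  \<comment> \<open>The inserted 1 keeps the set nonempty when \<open>S\<close> has at most one
    element.\<close>
  define D where "D = insert 1 ((\<lambda>(c,c'). c' - c) ` {p \<in> S \<times> S. fst p < snd p})"
  have fin: "finite D" unfolding D_def using assms by (intro finite.insertI finite_imageI) auto
  have "Min D \<in> D" using fin by (intro Min_in) (auto simp: D_def)
  hence "0 < Min D" unfolding D_def by auto
  moreover have "Min D \<le> c' - c" if "c \<in> S" "c' \<in> S" "c < c'" for c c'
    using fin that by (intro Min_le) (force simp: D_def)+
  ultimately show ?thesis using that by blast
qed

lemma sqn_sum_le:
  assumes S: "finite S" and x: "\<And>i. i < n \<Longrightarrow> x $ i = (\<Sum>c\<in>S. f c $ i)"
    and c: "x \<in> carrier_vec n" "\<And>c. f c \<in> carrier_vec n"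
  shows "sqn x \<le> real (card S) * (\<Sum>c\<in>S. sqn (f c))"
proof -
  have "sqn x = (\<Sum>i<n. (cmod (\<Sum>c\<in>S. f c $ i))\<^sup>2)"
    using c x unfolding sqn_def by simp
  also have "\<dots> \<le> (\<Sum>i<n. (\<Sum>c\<in>S. (cmod (f c $ i))\<^sup>2) * real (card S))"
  proof (rule sum_mono)
    fix i
    have "(cmod (\<Sum>c\<in>S. f c $ i))\<^sup>2 \<le> (\<Sum>c\<in>S. cmod (f c $ i))\<^sup>2"
      by (intro power_mono norm_sum) auto
    also have "\<dots> \<le> (\<Sum>c\<in>S. (cmod (f c $ i))\<^sup>2) * real (card S)"
      by (rule sum_squared_le_sum_of_squares)
    finally show "(cmod (\<Sum>c\<in>S. f c $ i))\<^sup>2 \<le> (\<Sum>c\<in>S. (cmod (f c $ i))\<^sup>2) * real (card S)" .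
  qed
  also have "\<dots> = real (card S) * (\<Sum>c\<in>S. \<Sum>i<n. (cmod (f c $ i))\<^sup>2)"
    unfolding sum_distrib_right[symmetric] by (subst sum.swap) simp
  also have "(\<Sum>c\<in>S. \<Sum>i<n. (cmod (f c $ i))\<^sup>2) = (\<Sum>c\<in>S. sqn (f c))"
    unfolding sqn_def using carrier_vecD[OF c(2)] by simp
  finally show ?thesis .
qed

context
  fixes n :: nat and s :: "nat \<Rightarrow> real" and R :: "complex mat"
  assumes R: "psd n R"
begin

definition blk :: "real \<Rightarrow> complex vec \<Rightarrow> complex vec" where
  "blk c x = vec n (\<lambda>i. if s i = c then x $ i else 0)"

text \<open>The pinching of \<open>R\<close> by the spectral projections of
  \<open>rdiag n s\<close>, written as deletion of the entries between different
  eigenvalues.\<close>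

definition bdiag :: "complex mat" where
  "bdiag = mat n n (\<lambda>(i,j). if s i = s j then R $$ (i,j) else 0)"

lemma blk_carrier [simp]: "blk c x \<in> carrier_vec n" unfolding blk_def by simp

lemma blk_dim [simp]: "dim_vec (blk c x) = n" unfolding blk_def by simp

lemma bdiag_carrier [simp]: "bdiag \<in> carrier_mat n n" unfolding bdiag_def by simp

lemma bdiag_dims [simp]: "dim_row bdiag = n" "dim_col bdiag = n" unfolding bdiag_def by simp_all

lemma qf_bdiag:
  assumes "x \<in> carrier_vec n"
  shows "qf bdiag x = (\<Sum>c\<in>s ` {..<n}. qf R (blk c x))"
proof -
  have "(\<Sum>c\<in>s ` {..<n}. qf R (blk c x))
      = Re (\<Sum>c\<in>s ` {..<n}. \<Sum>i<n. \<Sum>j<n. cnj (blk c x $ i) * R $$ (i,j) * blk c x $ j)"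
    by (subst qf_sum[OF psdD(1)[OF R] blk_carrier]) (simp only: Re_sum)
  also have "(\<Sum>c\<in>s ` {..<n}. \<Sum>i<n. \<Sum>j<n. cnj (blk c x $ i) * R $$ (i,j) * blk c x $ j)
      = (\<Sum>i<n. \<Sum>j<n. \<Sum>c\<in>s ` {..<n}. cnj (blk c x $ i) * R $$ (i,j) * blk c x $ j)"
    by (subst sum.swap, rule sum.cong[OF refl], rule sum.swap)
  also have "\<dots> = (\<Sum>i<n. \<Sum>j<n. cnj (x $ i) * bdiag $$ (i,j) * x $ j)"
  proof (intro sum.cong refl)
    fix i j assume "i \<in> {..<n}" "j \<in> {..<n}"
    hence ij: "i < n" "j < n" by auto
    have "(\<Sum>c\<in>s ` {..<n}. cnj (blk c x $ i) * R $$ (i,j) * blk c x $ j)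
        = (\<Sum>c\<in>s ` {..<n}. if c = s i then cnj (x $ i) * R $$ (i,j) * (if s j = s i then x $ j else 0) else 0)"
      using ij by (intro sum.cong) (auto simp: blk_def)
    also have "\<dots> = cnj (x $ i) * bdiag $$ (i,j) * x $ j"
      using ij by (subst sum.delta) (auto simp: bdiag_def)
    finally show "(\<Sum>c\<in>s ` {..<n}. cnj (blk c x $ i) * R $$ (i,j) * blk c x $ j)
      = cnj (x $ i) * bdiag $$ (i,j) * x $ j" .
  qed
  finally show ?thesis using qf_sum[OF bdiag_carrier assms] by simp
qed

lemma psd_bdiag: "psd n bdiag"
  unfolding psd_iff
proof (intro conjI ballI)
  show "hermitian bdiag" unfolding hermitian_def
  proof (rule eq_matI)
    fix i j assume "i < dim_row (adj bdiag)" "j < dim_col (adj bdiag)"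
    hence ij: "i < n" "j < n" by auto
    show "bdiag $$ (i,j) = adj bdiag $$ (i,j)"
      using ij hermitian_entry[OF psdD(2,1)[OF R] ij(2,1)] by (auto simp: bdiag_def)
  qed auto
  show "0 \<le> qf bdiag x" if "x \<in> carrier_vec n" for x
    unfolding qf_bdiag[OF that] using psdD(3)[OF R blk_carrier] by (intro sum_nonneg) auto
qed simp

text \<open>The pinching inequality. A vector is the sum of its blocks, and Cauchy-Schwarz over the
  distinct values of \<open>s\<close>, applied after the Gram factor of \<open>R\<close>, costs
  their number.\<close>

lemma qf_le_bdiag:
  assumes x: "x \<in> carrier_vec n"
  shows "qf R x \<le> real (card (s ` {..<n})) * qf bdiag x"
proof -
  obtain B where B: "B \<in> carrier_mat n n" "R = B * adj B" using psd_imp_gram[OF R] by blast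
  have "sqn (adj B *\<^sub>v x) \<le> real (card (s ` {..<n})) * (\<Sum>c\<in>s ` {..<n}. sqn (adj B *\<^sub>v blk c x))"
  proof (rule sqn_sum_le)
    fix i assume i: "i < n"
    have "(\<Sum>c\<in>s ` {..<n}. (adj B *\<^sub>v blk c x) $ i)
        = (\<Sum>c\<in>s ` {..<n}. \<Sum>j<n. adj B $$ (i,j) * blk c x $ j)"
      using i B(1) carrier_vecD[OF blk_carrier] by (simp add: scalar_prod_def lessThan_atLeast0)
    also have "\<dots> = (\<Sum>j<n. adj B $$ (i,j) * (\<Sum>c\<in>s ` {..<n}. blk c x $ j))"
      by (subst sum.swap) (simp add: sum_distrib_left)
    also have "\<dots> = (\<Sum>j<n. adj B $$ (i,j) * x $ j)"
      by (intro sum.cong refl) (auto simp: blk_def sum.delta')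
    also have "\<dots> = (adj B *\<^sub>v x) $ i"
      using i B(1) x by (simp add: scalar_prod_def lessThan_atLeast0)
    finally show "(adj B *\<^sub>v x) $ i = (\<Sum>c\<in>s ` {..<n}. (adj B *\<^sub>v blk c x) $ i)" by simp
  qed (use B in auto)
  thus ?thesis unfolding qf_bdiag[OF x] using B x by (simp add: qf_gram[of B n n])
qed

text \<open>The common eigenbasis is the one of \<open>rdiag n s + d * bdiag\<close>, where \<open>d\<close> is so small that the
  clusters of eigenvalues around the values of \<open>s\<close> remain apart.\<close>
lemma bdiag_simul:
  obtains W c p where "unitary n W" "rdiag n s = W * rdiag n c * adj W"
    "bdiag = W * rdiag n p * adj W" "\<And>k. k < n \<Longrightarrow> c k \<in> s ` {..<n}"
    "\<And>k. k < n \<Longrightarrow> p k = qf R (col W k)"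
proof -
  let ?S = "s ` {..<n}"
  obtain g where g: "0 < g" "\<And>c c'. c \<in> ?S \<Longrightarrow> c' \<in> ?S \<Longrightarrow> c < c' \<Longrightarrow> g \<le> c' - c"
    by (rule finite_gap[of ?S]) auto
  obtain K where K: "0 \<le> K" "\<And>v. v \<in> carrier_vec n \<Longrightarrow> qf bdiag v \<le> K * sqn v"
    by (rule qf_bound[OF psdD(2,1)[OF psd_bdiag]]) blast
  \<comment> \<open>Chosen such that \<open>d * K < g\<close>: eigenvalues of \<open>H\<close> that
    belong to different values of \<open>s\<close> cannot meet.\<close>
  define d where "d = g / (K + 1)"
  have d: "0 < d" unfolding d_def using g K by simp
  have dK: "d * K < g" unfolding d_def using g K by (simp add: field_simps)
  define H where "H = rdiag n s + complex_of_real d \<cdot>\<^sub>m bdiag"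
  have Hc: "H \<in> carrier_mat n n" unfolding H_def by simp
  have Hh: "hermitian H" unfolding H_def
    by (intro hermitian_add hermitian_smult psdD(2)[OF psd_bdiag]) (auto simp: bdiag_def)
  obtain W h where W: "unitary n W" and HW: "H = W * rdiag n h * adj W"
    using spectral[OF Hc Hh] by blast
  have Wc: "W \<in> carrier_mat n n" using W unitary_carrier by blast
  have bij: "bdiag $$ (i,j) = (if s i = s j then R $$ (i,j) else 0)" if "i < n" "j < n" for i j
    using that unfolding bdiag_def by simp
  have "H * W = W * rdiag n h" unfolding HW using W Wc by (simp add: mult_assoc_dim)
  have ent: "complex_of_real (s i) * W $$ (i,k) + complex_of_real d * (\<Sum>j<n. bdiag $$ (i,j) * W $$ (j,k))
      = complex_of_real (h k) * W $$ (i,k)" if ik: "i < n" "k < n" for i k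
  proof -
    have "(H * W) $$ (i,k) = (\<Sum>j<n. (rdiag n s $$ (i,j) + complex_of_real d * bdiag $$ (i,j)) * W $$ (j,k))"
      using ik Wc Hc unfolding H_def
      by (subst index_mult_sum) (auto intro!: sum.cong)
    also have "\<dots> = (\<Sum>j<n. rdiag n s $$ (i,j) * W $$ (j,k)) + complex_of_real d * (\<Sum>j<n. bdiag $$ (i,j) * W $$ (j,k))"
      by (simp only: distrib_right sum.distrib sum_distrib_left mult.assoc)
    also have "(\<Sum>j<n. rdiag n s $$ (i,j) * W $$ (j,k)) = (\<Sum>j<n. if j = i then complex_of_real (s i) * W $$ (i,k) else 0)"
      using ik by (intro sum.cong) auto
    also have "\<dots> = complex_of_real (s i) * W $$ (i,k)" using ik by (subst sum.delta) auto
    finally have "(H * W) $$ (i,k) = complex_of_real (s i) * W $$ (i,k)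
      + complex_of_real d * (\<Sum>j<n. bdiag $$ (i,j) * W $$ (j,k))" .
    moreover have "(W * rdiag n h) $$ (i,k) = complex_of_real (h k) * W $$ (i,k)"
      using ik unfolding mat_diag_mult_right[OF Wc] by simp
    ultimately show ?thesis using \<open>H * W = W * rdiag n h\<close> by simp
  qed
  \<comment> \<open>\<open>H\<close> respects the blocks, so every block of an eigenvector satisfies
    the eigenvalue equation. Pairing it with itself expresses \<open>h k - c\<close> through
    \<open>bdiag\<close>.\<close>
  have block: "(h k - c) * sqn (blk c (col W k)) = d * qf bdiag (blk c (col W k))" if k: "k < n" for k c
  proof -
    let ?w = "blk c (col W k)"
    have wi: "?w $ i = (if s i = c then W $$ (i,k) else 0)" if "i < n" for i
      using that k Wc by (simp add: blk_def)
    have e: "cnj (?w $ i) * (complex_of_real d * (\<Sum>j<n. bdiag $$ (i,j) * ?w $ j))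
        = complex_of_real ((h k - c) * (cmod (?w $ i))\<^sup>2)" if i: "i < n" for i
    proof (cases "s i = c")
      case True
      have "(\<Sum>j<n. bdiag $$ (i,j) * ?w $ j) = (\<Sum>j<n. bdiag $$ (i,j) * W $$ (j,k))"
        using i True by (intro sum.cong) (auto simp: wi bij)
      hence "complex_of_real d * (\<Sum>j<n. bdiag $$ (i,j) * ?w $ j) = complex_of_real (h k - c) * W $$ (i,k)"
        using ent[OF i k] True by (simp add: algebra_simps)
      thus ?thesis using True i by (simp add: wi complex_norm_square mult_ac del: of_real_power of_real_diff)
    qed (use i in \<open>simp add: wi\<close>)
    have "complex_of_real ((h k - c) * sqn ?w) = (\<Sum>i<n. complex_of_real ((h k - c) * (cmod (?w $ i))\<^sup>2))"
      unfolding sqn_def carrier_vecD[OF blk_carrier] by (simp only: sum_distrib_left of_real_sum)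
    also have "\<dots> = (\<Sum>i<n. cnj (?w $ i) * (complex_of_real d * (\<Sum>j<n. bdiag $$ (i,j) * ?w $ j)))"
      using e by (intro sum.cong) auto
    also have "\<dots> = complex_of_real d * (\<Sum>i<n. \<Sum>j<n. cnj (?w $ i) * bdiag $$ (i,j) * ?w $ j)"
      by (simp add: sum_distrib_left mult_ac)
    finally have "Re (complex_of_real ((h k - c) * sqn ?w))
      = Re (complex_of_real d * (\<Sum>i<n. \<Sum>j<n. cnj (?w $ i) * bdiag $$ (i,j) * ?w $ j))" by (rule arg_cong)
    thus ?thesis unfolding qf_sum[OF bdiag_carrier blk_carrier] by simp
  qed
  have range: "s i \<le> h k \<and> h k \<le> s i + d * K" if ik: "i < n" "k < n" and nz: "W $$ (i,k) \<noteq> 0" for i k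
  proof -
    let ?w = "blk (s i) (col W k)"
    have "0 < (cmod (?w $ i))\<^sup>2" using ik nz Wc by (simp add: blk_def)
    also have "\<dots> \<le> sqn ?w" unfolding sqn_def carrier_vecD[OF blk_carrier]
      using ik by (intro member_le_sum) auto
    finally have pos: "0 < sqn ?w" .
    have "0 \<le> d * qf bdiag ?w" using d psdD(3)[OF psd_bdiag blk_carrier] by simp
    hence "0 \<le> (h k - s i) * sqn ?w" unfolding block[OF ik(2)] .
    hence 1: "0 \<le> h k - s i" using pos by (simp add: zero_le_mult_iff)
    have "d * qf bdiag ?w \<le> d * (K * sqn ?w)" using d K(2)[OF blk_carrier] by (intro mult_left_mono) auto
    hence "(h k - s i) * sqn ?w \<le> (d * K) * sqn ?w" unfolding block[OF ik(2)] by simp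
    hence "h k - s i \<le> d * K" using pos by simp
    thus ?thesis using 1 by linarith
  qed
  \<comment> \<open>The intervals that \<open>range\<close> allows for \<open>h k\<close> are
    disjoint for different values of \<open>s\<close>, so every column of \<open>W\<close> lives in
    a single block.\<close>
  have same: "s i = s i'" if "i < n" "i' < n" "k < n" "W $$ (i,k) \<noteq> 0" "W $$ (i',k) \<noteq> 0" for i i' k
  proof (rule ccontr)
    assume "s i \<noteq> s i'"
    then consider "s i < s i'" | "s i' < s i" by linarith
    thus False
    proof cases
      case 1
      thus False using g(2)[of "s i" "s i'"] range[OF that(1,3,4)] range[OF that(2,3,5)] that dK by auto
    next
      case 2
      thus False using g(2)[of "s i'" "s i"] range[OF that(1,3,4)] range[OF that(2,3,5)] that dK by auto
    qed
  qed
  have ex: "\<exists>i<n. W $$ (i,k) \<noteq> 0" if k: "k < n" for k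
  proof (rule ccontr)
    assume "\<not> ?thesis"
    hence "(\<Sum>j<n. (cmod (W $$ (j,k)))\<^sup>2) = 0" by (intro sum.neutral) auto
    thus False using unitary_row_sum(2)[OF W k] by simp
  qed
  define c where "c k = s (SOME i. i < n \<and> W $$ (i,k) \<noteq> 0)" for k
  have cS: "c k \<in> ?S" and csame: "\<And>i. i < n \<Longrightarrow> W $$ (i,k) \<noteq> 0 \<Longrightarrow> s i = c k" if k: "k < n" for k
  proof -
    have P: "(SOME i. i < n \<and> W $$ (i,k) \<noteq> 0) < n \<and> W $$ (SOME i. i < n \<and> W $$ (i,k) \<noteq> 0, k) \<noteq> 0"
      using someI_ex[OF ex[OF k]] by blast
    show "c k \<in> ?S" unfolding c_def using P by blast
    show "s i = c k" if "i < n" "W $$ (i,k) \<noteq> 0" for i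
      unfolding c_def using same[OF that(1) _ k that(2)] P by blast
  qed
  have sW: "rdiag n s * W = W * rdiag n c"
    unfolding mat_diag_mult_right[OF Wc] mat_diag_mult_left[OF Wc]
  proof (rule cong_mat[OF refl refl])
    fix i k assume "i < n" "k < n"
    thus "(case (i, k) of (i, j) \<Rightarrow> complex_of_real (s i) * W $$ (i, j)) = (case (i, k) of (i, j) \<Rightarrow> W $$ (i, j) * complex_of_real (c j))"
      using csame[of k i] by (cases "W $$ (i,k) = 0") auto
  qed
  define p where "p k = (h k - c k) / d" for k
  have PW: "bdiag * W = W * rdiag n p"
    unfolding mat_diag_mult_right[OF Wc]
  proof (rule eq_matI)
    fix i k assume "i < dim_row (mat n n (\<lambda>(i, j). W $$ (i, j) * complex_of_real (p j)))"
      "k < dim_col (mat n n (\<lambda>(i, j). W $$ (i, j) * complex_of_real (p j)))"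
    hence ik: "i < n" "k < n" by auto
    have "complex_of_real (s i) * W $$ (i,k) = complex_of_real (c k) * W $$ (i,k)"
      using csame[OF ik(2,1)] by (cases "W $$ (i,k) = 0") auto
    hence "complex_of_real d * (\<Sum>j<n. bdiag $$ (i,j) * W $$ (j,k)) = complex_of_real (h k - c k) * W $$ (i,k)"
      using ent[OF ik] by (simp only: of_real_diff left_diff_distrib eq_diff_eq add.commute)
    hence "(\<Sum>j<n. bdiag $$ (i,j) * W $$ (j,k)) = W $$ (i,k) * complex_of_real (p k)"
      using d by (simp add: p_def field_simps)
    thus "(bdiag * W) $$ (i,k) = mat n n (\<lambda>(i, j). W $$ (i, j) * complex_of_real (p j)) $$ (i,k)"
      using ik Wc by (subst index_mult_sum) (auto simp: bdiag_def)
  qed (use Wc in auto)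
  have "rdiag n s = rdiag n s * W * adj W" "bdiag = bdiag * W * adj W"
    using W Wc by (simp_all add: mult_assoc_dim right_mult_one_mat[OF bdiag_carrier] right_mult_one_mat[of _ n n])
  hence 1: "rdiag n s = W * rdiag n c * adj W" and 2: "bdiag = W * rdiag n p * adj W"
    unfolding sW PW by simp_all
  \<comment> \<open>Within a single block \<open>bdiag\<close> and \<open>R\<close> agree, so the
    eigenvalue of the pinched operator is a quadratic form of \<open>R\<close> itself.\<close>
  have pk: "p k = qf R (col W k)" if k: "k < n" for k
  proof -
    have "adj W * bdiag * W = rdiag n p"
      unfolding 2 using W Wc by (simp add: mult_assoc_dim unitary_cancel)
    hence "complex_of_real (p k) = (adj W * bdiag * W) $$ (k,k)" using k by simp
    also have "\<dots> = (\<Sum>i<n. \<Sum>j<n. cnj (W $$ (i,k)) * bdiag $$ (i,j) * W $$ (j,k))"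
      by (rule mult_sandwich_index[OF Wc bdiag_carrier k k])
    also have "\<dots> = (\<Sum>i<n. \<Sum>j<n. cnj (W $$ (i,k)) * R $$ (i,j) * W $$ (j,k))"
    proof (intro sum.cong refl)
      fix i j assume "i \<in> {..<n}" "j \<in> {..<n}"
      thus "cnj (W $$ (i,k)) * bdiag $$ (i,j) * W $$ (j,k) = cnj (W $$ (i,k)) * R $$ (i,j) * W $$ (j,k)"
        using same[of i j k] k bij[of i j] by (cases "W $$ (i,k) = 0 \<or> W $$ (j,k) = 0") auto
    qed
    also have "\<dots> = (adj W * R * W) $$ (k,k)"
      by (rule mult_sandwich_index[OF Wc psdD(1)[OF R] k k, symmetric])
    finally have "Re (complex_of_real (p k)) = Re ((adj W * R * W) $$ (k,k))" by (rule arg_cong)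
    thus ?thesis using qf_col[OF Wc psdD(1)[OF R] k] by simp
  qed
  show ?thesis by (rule that[OF W 1 2 cS pk])
qed

end

text \<open>Pinching: the eigenvectors of \<open>\<sigma>\<close> can be chosen such that the off-diagonal part of \<open>\<rho>\<close>
  costs only a factor, the number of distinct eigenvalues of \<open>\<sigma>\<close>.\<close>
lemma pinch:
  assumes V: "unitary n V" and \<sigma>: "\<sigma> = V * rdiag n s * adj V" and s: "\<And>i. i < n \<Longrightarrow> 0 \<le> s i" and \<rho>: "psd n \<rho>"
  obtains U c where "unitary n U" "\<sigma> = U * rdiag n c * adj U" "\<forall>i<n. 0 \<le> c i"
    "\<forall>x \<in> carrier_vec n. qf \<rho> x \<le> real (card (s ` {..<n})) * qf (U * rdiag n (\<lambda>i. qf \<rho> (col U i)) * adj U) x"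
proof -
  have Vc: "V \<in> carrier_mat n n" using V unitary_carrier by blast
  note \<rho>c = psdD(1)[OF \<rho>]
  define R where "R = adj V * \<rho> * V"
  have R: "psd n R" unfolding R_def using psd_congr[OF \<rho>, of "adj V" n] Vc by simp
  have \<rho>R: "\<rho> = V * R * adj V" unfolding R_def using V Vc \<rho>c by (simp add: mult_assoc_dim unitary_cancel)
  obtain W c p where W: "unitary n W" "rdiag n s = W * rdiag n c * adj W"
    "bdiag n s R = W * rdiag n p * adj W" "\<And>k. k < n \<Longrightarrow> c k \<in> s ` {..<n}"
    "\<And>k. k < n \<Longrightarrow> p k = qf R (col W k)" by (rule bdiag_simul[OF R, of s]) blast
  have Wc: "W \<in> carrier_mat n n" using W unitary_carrier by blast
  define U where "U = V * W"
  have U: "unitary n U" unfolding U_def by (rule unitary_times[OF V W(1)])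
  have Uc: "U \<in> carrier_mat n n" using U unitary_carrier by blast
  have conj: "V * (W * rdiag n f * adj W) * adj V = U * rdiag n f * adj U" for f
    unfolding U_def using Vc Wc by (simp add: adj_mult mult_assoc_dim)
  have 1: "\<sigma> = U * rdiag n c * adj U" unfolding \<sigma> W(2) conj ..
  have p: "p k = qf \<rho> (col U k)" if k: "k < n" for k
  proof -
    have "adj U * \<rho> * U = adj W * R * W"
      unfolding R_def U_def using Vc Wc \<rho>c by (simp add: adj_mult mult_assoc_dim)
    thus ?thesis unfolding W(5)[OF k] qf_col[OF Wc psdD(1)[OF R] k] qf_col[OF Uc \<rho>c k] by simp
  qed
  have 2: "0 \<le> c i" if "i < n" for i using W(4)[OF that] s by auto
  have "qf \<rho> x \<le> real (card (s ` {..<n})) * qf (U * rdiag n (\<lambda>i. qf \<rho> (col U i)) * adj U) x"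
    if x: "x \<in> carrier_vec n" for x
  proof -
    have Vx: "adj V *\<^sub>v x \<in> carrier_vec n" using Vc by simp
    have "qf \<rho> x = qf R (adj V *\<^sub>v x)"
      unfolding \<rho>R by (rule qf_congr[OF psdD(1)[OF R] Vc x])
    also have "\<dots> \<le> real (card (s ` {..<n})) * qf (bdiag n s R) (adj V *\<^sub>v x)"
      by (rule qf_le_bdiag[OF R Vx])
    also have "qf (bdiag n s R) (adj V *\<^sub>v x) = qf (V * bdiag n s R * adj V) x"
      by (rule qf_congr[OF psdD(1)[OF psd_bdiag[OF R]] Vc x, symmetric])
    also have "V * bdiag n s R * adj V = U * rdiag n p * adj U" unfolding W(3) conj ..
    also have "rdiag n p = rdiag n (\<lambda>i. qf \<rho> (col U i))" using p by (intro mat_diag_cong) simp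
    finally show ?thesis .
  qed
  with that[OF U 1] 2 show ?thesis by blast
qed

section \<open>Comparison of sandwiched and geometric quantities\<close>

text \<open>The trace inside the logarithm of \<open>sandwiched\<close>. It is a real number also
  when the supports are not nested, so the support condition is carried separately.\<close>

definition Qs :: "real \<Rightarrow> complex mat \<Rightarrow> complex mat \<Rightarrow> real" where
  "Qs a \<rho> \<sigma> = Re (mtrace (mpow a (mpow ((1 - a) / (2 * a)) \<sigma> * \<rho> * mpow ((1 - a) / (2 * a)) \<sigma>)))"

lemma col_carrier: "U \<in> carrier_mat n m \<Longrightarrow> col U i \<in> carrier_vec n"
  by (auto intro: carrier_vecI)

lemma spec_mult_col:
  assumes U: "unitary n U" and i: "i < n"
  shows "(U * mat_diag n f * adj U) *\<^sub>v col U i = f i \<cdot>\<^sub>v col U i"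
proof -
  have Uc: "U \<in> carrier_mat n n" using U unitary_carrier by blast
  have "(U * mat_diag n f * adj U) * U = U * mat_diag n f"
    using U Uc by (simp add: mult_assoc_dim)
  hence "col ((U * mat_diag n f * adj U) * U) i = col (U * mat_diag n f) i" by simp
  moreover have "col ((U * mat_diag n f * adj U) * U) i = (U * mat_diag n f * adj U) *\<^sub>v col U i"
    using Uc i by (intro col_mult2[of _ n n _ n]) auto
  moreover have "col (U * mat_diag n f) i = f i \<cdot>\<^sub>v col U i"
    unfolding mat_diag_mult_right[OF Uc] using Uc i by (intro eq_vecI) auto
  ultimately show ?thesis by simp
qed

lemma qf_smult_vec:
  assumes "A \<in> carrier_mat n n" "v \<in> carrier_vec n"
  shows "qf A (complex_of_real t \<cdot>\<^sub>v v) = t\<^sup>2 * qf A v"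
proof -
  have "conjugate (complex_of_real t \<cdot>\<^sub>v v) = complex_of_real t \<cdot>\<^sub>v conjugate v"
    using assms by (intro eq_vecI) auto
  thus ?thesis using assms unfolding qf_def
    by (simp add: mult_mat_vec[of A n n] power2_eq_square mult.assoc)
qed

lemma qf_spec_col:
  assumes U: "unitary n U" and i: "i < n"
  shows "qf (U * rdiag n f * adj U) (col U i) = f i"
proof -
  have Uc: "U \<in> carrier_mat n n" using U unitary_carrier by blast
  have "adj U * (U * rdiag n f * adj U) * U = rdiag n f"
    using U Uc by (simp add: mult_assoc_dim unitary_cancel)
  thus ?thesis using qf_col[OF Uc, of "U * rdiag n f * adj U" i] Uc i by simp
qed

lemma trace_col:
  assumes U: "unitary n U" and A: "A \<in> carrier_mat n n"
  shows "Re (mtrace A) = (\<Sum>i<n. qf A (col U i))"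
proof -
  have Uc: "U \<in> carrier_mat n n" using U unitary_carrier by blast
  have "Re (mtrace A) = Re (mtrace (adj U * A * U))" using mtrace_unitary(2)[OF U A] by simp
  also have "\<dots> = (\<Sum>i<n. qf A (col U i))"
    unfolding mtrace_def using Uc A by (simp add: qf_col del: index_mult_mat(1))
  finally show ?thesis .
qed

context
  fixes n :: nat and U :: "complex mat" and c :: "nat \<Rightarrow> real" and \<sigma> \<rho> :: "complex mat" and s :: real
  assumes U: "unitary n U" and \<sigma>: "\<sigma> = U * rdiag n c * adj U" and \<rho>: "psd n \<rho>"
begin

private lemma Uc: "U \<in> carrier_mat n n" using U unitary_carrier by blast

private lemma K: "mpow s \<sigma> = U * rdiag n (\<lambda>i. pw s (c i)) * adj U"
  unfolding \<sigma> mpow_spec[OF U] ..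

private lemma Kc: "mpow s \<sigma> \<in> carrier_mat n n" unfolding K using Uc by simp

private lemma Kadj: "adj (mpow s \<sigma>) = mpow s \<sigma>"
  unfolding K using hermitian_congr[of "rdiag n _" U] Uc unfolding hermitian_def by simp

lemma psd_sandwich: "psd n (mpow s \<sigma> * \<rho> * mpow s \<sigma>)"
  using psd_congr[OF \<rho> Kc] unfolding Kadj .

lemma qf_sandwich_col:
  assumes i: "i < n"
  shows "qf (mpow s \<sigma> * \<rho> * mpow s \<sigma>) (col U i) = pw (2 * s) (c i) * qf \<rho> (col U i)"
proof -
  have "qf (mpow s \<sigma> * \<rho> * mpow s \<sigma>) (col U i) = qf \<rho> (mpow s \<sigma> *\<^sub>v col U i)"
    using qf_congr[OF psdD(1)[OF \<rho>] Kc col_carrier[OF Uc]] unfolding Kadj .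
  also have "mpow s \<sigma> *\<^sub>v col U i = complex_of_real (pw s (c i)) \<cdot>\<^sub>v col U i"
    unfolding K by (rule spec_mult_col[OF U i])
  also have "qf \<rho> \<dots> = pw (2 * s) (c i) * qf \<rho> (col U i)"
    unfolding qf_smult_vec[OF psdD(1)[OF \<rho>] col_carrier[OF Uc]] using pw_add[of s "c i" s]
    by (simp add: power2_eq_square)
  finally show ?thesis .
qed

lemma qf_sandwich_le:
  assumes le: "\<And>x. x \<in> carrier_vec n \<Longrightarrow> qf \<rho> x \<le> N * qf (U * rdiag n p * adj U) x" and x: "x \<in> carrier_vec n"
  shows "qf (mpow s \<sigma> * \<rho> * mpow s \<sigma>) x \<le> qf (U * rdiag n (\<lambda>i. N * (pw (2 * s) (c i) * p i)) * adj U) x"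
proof -
  have Kx: "mpow s \<sigma> *\<^sub>v x \<in> carrier_vec n" using Kc by simp
  have Pc: "U * rdiag n p * adj U \<in> carrier_mat n n" using Uc by simp
  have "qf (mpow s \<sigma> * \<rho> * mpow s \<sigma>) x = qf \<rho> (mpow s \<sigma> *\<^sub>v x)"
    using qf_congr[OF psdD(1)[OF \<rho>] Kc x] unfolding Kadj .
  also have "\<dots> \<le> N * qf (U * rdiag n p * adj U) (mpow s \<sigma> *\<^sub>v x)" by (rule le[OF Kx])
  also have "qf (U * rdiag n p * adj U) (mpow s \<sigma> *\<^sub>v x)
      = qf (mpow s \<sigma> * (U * rdiag n p * adj U) * mpow s \<sigma>) x"
    using qf_congr[OF Pc Kc x] unfolding Kadj by simp
  also have "mpow s \<sigma> * (U * rdiag n p * adj U) * mpow s \<sigma>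
      = U * (rdiag n (\<lambda>i. pw s (c i)) * rdiag n p * rdiag n (\<lambda>i. pw s (c i))) * adj U"
    unfolding K using U Uc by (simp add: mult_assoc_dim unitary_cancel del: mat_diag_diag)
  also have "rdiag n (\<lambda>i. pw s (c i)) * rdiag n p * rdiag n (\<lambda>i. pw s (c i)) = rdiag n (\<lambda>i. pw (2 * s) (c i) * p i)"
    unfolding mat_diag_diag
  proof (rule mat_diag_cong)
    fix i
    have "pw s (c i) * p i * pw s (c i) = pw (2 * s) (c i) * p i"
      using pw_add[of s "c i" s] by simp
    thus "complex_of_real (pw s (c i)) * complex_of_real (p i) * complex_of_real (pw s (c i))
      = complex_of_real (pw (2 * s) (c i) * p i)" by (metis of_real_mult)
  qed
  also have "N * qf (U * rdiag n (\<lambda>i. pw (2 * s) (c i) * p i) * adj U) x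
      = qf (U * rdiag n (\<lambda>i. N * (pw (2 * s) (c i) * p i)) * adj U) x"
    by (simp only: qf_spec[OF Uc x] sum_distrib_left mult.assoc)
  finally show ?thesis .
qed

end

text \<open>Comparison along the embedding \<open>L\<close> of the line spanned by \<open>u\<close>
  reduces the mean to that of two numbers, which \<open>wgm_diag\<close> evaluates in dimension
  1.\<close>

lemma wgm_scalar:
  assumes \<beta>: "0 < \<beta>" "\<beta> < 1" and p: "psd n A" "psd n B" and u: "u \<in> carrier_vec n"
  shows "qf (wgm \<beta> A B) u \<le> pw (1 - \<beta>) (qf A u) * pw \<beta> (qf B u)"
proof -
  define L where "L = mat n 1 (\<lambda>(i,j). u $ i)"
  have Lc: "L \<in> carrier_mat n 1" unfolding L_def by simp
  have L: "L *\<^sub>v x = (x $ 0) \<cdot>\<^sub>v u" if "x \<in> carrier_vec 1" for x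
    using that u unfolding L_def by (intro eq_vecI) (auto simp: scalar_prod_def mult.commute)
  have q: "0 \<le> qf A u" "0 \<le> qf B u" using psdD(3) p u by auto
  define D where "D f = 1\<^sub>m 1 * rdiag 1 (\<lambda>_. f) * adj (1\<^sub>m 1)" for f
  have pD: "psd 1 (D f)" if "0 \<le> f" for f unfolding D_def using that by (intro psd_spec) auto
  have qfD: "qf (D f) x = f * (cmod (x $ 0))\<^sup>2" if "x \<in> carrier_vec 1" for f x
    unfolding D_def using that by (subst qf_spec[of _ 1 1]) (auto simp: scalar_prod_def)
  have qL: "qf X (L *\<^sub>v x) = qf X u * (cmod (x $ 0))\<^sup>2" if "x \<in> carrier_vec 1" "X \<in> carrier_mat n n" for X x
  proof -
    have "conjugate ((x $ 0) \<cdot>\<^sub>v u) = cnj (x $ 0) \<cdot>\<^sub>v conjugate u" by (intro eq_vecI) auto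
    hence "qf X (L *\<^sub>v x) = Re (cnj (x $ 0) * (x $ 0) * (conjugate u \<bullet> (X *\<^sub>v u)))"
      unfolding qf_def L[OF that(1)] using that u by (simp add: mult_mat_vec[of X n n] mult_ac)
    also have "cnj (x $ 0) * (x $ 0) = complex_of_real ((cmod (x $ 0))\<^sup>2)"
      by (simp add: complex_norm_square mult.commute del: of_real_power)
    finally show ?thesis unfolding qf_def by (simp del: of_real_power)
  qed
  let ?e = "unit_vec 1 0 :: complex vec"
  have e: "?e \<in> carrier_vec 1" by simp
  have "1 * qf (wgm \<beta> A B) (L *\<^sub>v ?e) + 0 * qf (wgm \<beta> A B) (L *\<^sub>v ?e) \<le> qf (wgm \<beta> (D (qf A u)) (D (qf B u))) ?e"
    by (rule wgm_compare[OF \<beta> p p pD[OF q(1)] pD[OF q(2)] Lc _ _ _ _ e])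
       (simp_all add: qL qfD psdD(1)[OF p(1)] psdD(1)[OF p(2)])
  moreover have "wgm \<beta> (D (qf A u)) (D (qf B u)) = D (pw (1 - \<beta>) (qf A u) * pw \<beta> (qf B u))"
    unfolding D_def by (rule wgm_diag[OF \<beta> unitary_one]) (use q in auto)
  ultimately show ?thesis
    using qL[OF e wgm_tendsto(1)[OF \<beta> p]] qfD[OF e] by simp
qed

text \<open>Inclusion of ranges is dual to reverse inclusion of kernels, and the kernel of a
  positive semidefinite operator is the zero set of its quadratic form.\<close>

lemma supp_le_iff:
  assumes \<rho>: "psd n \<rho>" and \<sigma>: "psd n \<sigma>"
  shows "supp_le \<rho> \<sigma> \<longleftrightarrow> (\<forall>u \<in> carrier_vec n. qf \<sigma> u = 0 \<longrightarrow> qf \<rho> u = 0)"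
proof
  assume S: "supp_le \<rho> \<sigma>"
  show "\<forall>u \<in> carrier_vec n. qf \<sigma> u = 0 \<longrightarrow> qf \<rho> u = 0"
  proof (intro ballI impI)
    fix u :: "complex vec" assume u: "u \<in> carrier_vec n" "qf \<sigma> u = 0"
    obtain w where w: "w \<in> carrier_vec n" "\<rho> *\<^sub>v u = \<sigma> *\<^sub>v w"
      using S u psdD(5)[OF \<rho>] psdD(5)[OF \<sigma>] unfolding supp_le_def by auto
    show "qf \<rho> u = 0" unfolding qf_def w(2) using psd_zero_vec(1)[OF \<sigma> u w(1)] by simp
  qed
next
  assume S: "\<forall>u \<in> carrier_vec n. qf \<sigma> u = 0 \<longrightarrow> qf \<rho> u = 0"
  obtain U c where U: "unitary n U" and Us: "\<sigma> = U * rdiag n c * adj U"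
    using psd_spectral[OF \<sigma>] by metis
  have Uc: "U \<in> carrier_mat n n" using U unitary_carrier by blast
  show "supp_le \<rho> \<sigma>" unfolding supp_le_def
  proof (intro ballI)
    fix x :: "complex vec" assume "x \<in> carrier_vec (dim_col \<rho>)"
    hence x: "x \<in> carrier_vec n" using psdD(5)[OF \<rho>] by simp
    define y where "y = adj U *\<^sub>v (\<rho> *\<^sub>v x)"
    have yc: "y \<in> carrier_vec n" unfolding y_def using Uc by simp
    have rx: "\<rho> *\<^sub>v x \<in> carrier_vec n" using psdD(4)[OF \<rho>] by simp
    have y0: "y $ i = 0" if i: "i < n" "c i = 0" for i
    proof -
      have "qf \<sigma> (col U i) = 0" unfolding Us using qf_spec_col[OF U i(1)] i by simp
      hence z: "conjugate (col U i) \<bullet> (\<rho> *\<^sub>v x) = 0"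
        using S psd_zero_vec(1)[OF \<rho> col_carrier[OF Uc] _ x] col_carrier[OF Uc] by blast
      have "row (adj U) i = conjugate (col U i)" using Uc i by (intro eq_vecI) auto
      thus ?thesis unfolding y_def using z Uc i by simp
    qed
    \<comment> \<open>The generalized inverse of \<open>\<sigma>\<close> applied to the target:
      \<open>1 / c i\<close> is 0 when \<open>c i = 0\<close>, and there the coordinate of
      \<open>y\<close> vanishes by \<open>y0\<close>.\<close>
    define w where "w = U *\<^sub>v (rdiag n (\<lambda>i. 1 / c i) *\<^sub>v y)"
    have wc: "w \<in> carrier_vec n" unfolding w_def using Uc by simp
    have dm: "mat_diag n f *\<^sub>v z = vec n (\<lambda>i. f i * z $ i)" if z: "z \<in> carrier_vec n" for f :: "nat \<Rightarrow> complex" and z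
    proof (rule eq_vecI)
      fix i assume "i < dim_vec (vec n (\<lambda>i. f i * z $ i))"
      hence i: "i < n" by simp
      have "(mat_diag n f *\<^sub>v z) $ i = (\<Sum>j\<in>{0..<n}. (if i = j then f j else 0) * z $ j)"
        using i z by (simp add: scalar_prod_def)
      also have "\<dots> = (\<Sum>j\<in>{0..<n}. if j = i then f i * z $ i else 0)" by (intro sum.cong) auto
      finally show "(mat_diag n f *\<^sub>v z) $ i = vec n (\<lambda>i. f i * z $ i) $ i" using i by simp
    qed simp
    have "\<sigma> *\<^sub>v w = U *\<^sub>v (rdiag n c *\<^sub>v (adj U *\<^sub>v w))"
      unfolding Us using Uc wc by (simp add: assoc_mult_mat_vec[of _ n n _ n])
    also have "adj U *\<^sub>v w = (adj U * U) *\<^sub>v (rdiag n (\<lambda>i. 1 / c i) *\<^sub>v y)"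
      unfolding w_def using Uc yc by (intro assoc_mult_mat_vec[symmetric, of _ n n _ n]) auto
    also have "\<dots> = rdiag n (\<lambda>i. 1 / c i) *\<^sub>v y" using U by simp
    also have "rdiag n c *\<^sub>v \<dots> = y"
    proof -
      have "rdiag n c *\<^sub>v (rdiag n (\<lambda>i. 1 / c i) *\<^sub>v y) = vec n (\<lambda>i. complex_of_real (c i) * (complex_of_real (1 / c i) * y $ i))"
        by (subst dm, simp, subst dm[OF yc], rule eq_vecI) auto
      also have "\<dots> = y"
      proof (rule eq_vecI)
        fix i assume "i < dim_vec y"
        hence i: "i < n" using yc by simp
        show "vec n (\<lambda>i. complex_of_real (c i) * (complex_of_real (1 / c i) * y $ i)) $ i = y $ i"
          using y0[OF i] i by (cases "c i = 0") auto
      qed (use yc in simp)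
      finally show ?thesis .
    qed
    also have "U *\<^sub>v y = (U * adj U) *\<^sub>v (\<rho> *\<^sub>v x)"
      unfolding y_def using Uc rx by (intro assoc_mult_mat_vec[symmetric, of _ n n _ n]) auto
    also have "\<dots> = \<rho> *\<^sub>v x" using U rx by simp
    finally show "\<exists>w\<in>carrier_vec (dim_col \<sigma>). \<rho> *\<^sub>v x = \<sigma> *\<^sub>v w"
      using wc psdD(5)[OF \<sigma>] by (intro bexI[of _ w]) simp_all
  qed
qed

text \<open>The scalar bound contains \<open>qf \<sigma> u\<close> with the positive exponent
  \<open>1 - 1/a\<close>, so it vanishes on the kernel of \<open>\<sigma>\<close>.\<close>

lemma feasible_supp_le:
  assumes a: "1 < a" and p: "psd n \<rho>" "psd n \<sigma>" "psd n A" and le: "loewner_le n \<rho> (wgm (1/a) \<sigma> A)"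
  shows "supp_le \<rho> \<sigma>"
  unfolding supp_le_iff[OF p(1,2)]
proof (intro ballI impI)
  fix u :: "complex vec" assume u: "u \<in> carrier_vec n" "qf \<sigma> u = 0"
  have \<beta>: "0 < 1/a" "1/a < 1" using a by auto
  have "qf \<rho> u \<le> qf (wgm (1/a) \<sigma> A) u" by (rule loewnerD[OF le u(1)])
  also have "\<dots> \<le> pw (1 - 1/a) (qf \<sigma> u) * pw (1/a) (qf A u)" by (rule wgm_scalar[OF \<beta> p(2,3) u(1)])
  also have "\<dots> = 0" using u by (simp add: pw_def)
  finally show "qf \<rho> u = 0" using psdD(3)[OF p(1) u(1)] by simp
qed

lemma sandwich_exponents:
  fixes a :: real
  assumes "1 < a"
  shows "2 * ((1 - a) / (2 * a)) = - (1 - 1/a)" "a * (1/a) = 1" "(1/a) * a = 1"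
  using assms by (simp_all add: field_simps)

text \<open>In the pinched eigenbasis the sandwiched operator lies below a diagonal one. Feasibility
  bounds its entries through \<open>wgm_scalar\<close>, and the powers of the eigenvalues of
  \<open>\<sigma>\<close> cancel.\<close>

lemma Qs_le_feasible:
  assumes a: "1 < a" and V: "unitary n V" and \<sigma>: "\<sigma> = V * rdiag n s * adj V" and s: "\<And>i. i < n \<Longrightarrow> 0 \<le> s i"
    and \<rho>: "psd n \<rho>" and A: "psd n A" and le: "loewner_le n \<rho> (wgm (1/a) \<sigma> A)"
  shows "Qs a \<rho> \<sigma> \<le> pw a (real (card (s ` {..<n}))) * Re (mtrace A)"
proof -
  have \<beta>: "0 < 1/a" "1/a < 1" using a by auto
  let ?N = "real (card (s ` {..<n}))" and ?t = "(1 - a) / (2 * a)"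
  obtain U c where U: "unitary n U" and Us: "\<sigma> = U * rdiag n c * adj U" and c': "\<forall>i<n. 0 \<le> c i"
    and pin': "\<forall>x \<in> carrier_vec n. qf \<rho> x \<le> ?N * qf (U * rdiag n (\<lambda>i. qf \<rho> (col U i)) * adj U) x"
    by (rule pinch[OF V \<sigma> s \<rho>]) blast
  have c: "0 \<le> c i" if "i < n" for i using c' that by blast
  have pin: "qf \<rho> x \<le> ?N * qf (U * rdiag n (\<lambda>i. qf \<rho> (col U i)) * adj U) x" if "x \<in> carrier_vec n" for x
    using pin' that by blast
  have Uc: "U \<in> carrier_mat n n" using U unitary_carrier by blast
  have \<sigma>p: "psd n \<sigma>" unfolding Us using c Uc by (rule psd_spec)
  define d where "d i = ?N * (pw (2 * ?t) (c i) * qf \<rho> (col U i))" for i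
  have \<rho>u: "0 \<le> qf \<rho> (col U i)" for i using psdD(3)[OF \<rho> col_carrier[OF Uc]] .
  have Au: "0 \<le> qf A (col U i)" for i using psdD(3)[OF A col_carrier[OF Uc]] .
  have "Qs a \<rho> \<sigma> \<le> Re (mtrace (mpow a (U * rdiag n d * adj U)))"
    unfolding Qs_def
  proof (rule trace_mpow_mono[OF psd_sandwich[OF U Us \<rho>]])
    show "psd n (U * rdiag n d * adj U)" using Uc \<rho>u unfolding d_def by (intro psd_spec) auto
    show "qf (mpow ?t \<sigma> * \<rho> * mpow ?t \<sigma>) v \<le> qf (U * rdiag n d * adj U) v" if "v \<in> carrier_vec n" for v
      unfolding d_def by (rule qf_sandwich_le[OF U Us \<rho> pin that])
  qed (use a in simp)
  also have "\<dots> = (\<Sum>i<n. pw a (d i))" by (rule trace_mpow_spec[OF U])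
  also have "\<dots> \<le> (\<Sum>i<n. pw a ?N * qf A (col U i))"
  proof (rule sum_mono)
    fix i assume "i \<in> {..<n}"
    hence i: "i < n" by simp
    have "qf \<rho> (col U i) \<le> qf (wgm (1/a) \<sigma> A) (col U i)" by (rule loewnerD[OF le col_carrier[OF Uc]])
    also have "\<dots> \<le> pw (1 - 1/a) (qf \<sigma> (col U i)) * pw (1/a) (qf A (col U i))"
      by (rule wgm_scalar[OF \<beta> \<sigma>p A col_carrier[OF Uc]])
    also have "qf \<sigma> (col U i) = c i" unfolding Us by (rule qf_spec_col[OF U i])
    finally have "pw (2 * ?t) (c i) * qf \<rho> (col U i)
        \<le> pw (2 * ?t) (c i) * (pw (1 - 1/a) (c i) * pw (1/a) (qf A (col U i)))"
      by (intro mult_left_mono) auto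
    \<comment> \<open>The cancellation leaves \<open>pw 0 (c i)\<close>, which is 0 on the kernel of
      \<open>\<sigma>\<close> and 1 elsewhere.\<close>
    also have "\<dots> = pw 0 (c i) * pw (1/a) (qf A (col U i))"
      unfolding sandwich_exponents(1)[OF a] mult.assoc[symmetric] pw_add by simp
    also have "\<dots> \<le> 1 * pw (1/a) (qf A (col U i))" by (intro mult_right_mono) (auto simp: pw_def)
    finally have "d i \<le> ?N * pw (1/a) (qf A (col U i))" unfolding d_def by (intro mult_left_mono) auto
    hence "pw a (d i) \<le> pw a (?N * pw (1/a) (qf A (col U i)))" using a by (intro pw_mono) auto
    also have "\<dots> = pw a ?N * qf A (col U i)"
      using a Au by (simp add: pw_mult pw_pw pw_1)
    finally show "pw a (d i) \<le> pw a ?N * qf A (col U i)" .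
  qed
  also have "\<dots> = pw a ?N * Re (mtrace A)"
    unfolding trace_col[OF U psdD(1)[OF A]] by (simp only: sum_distrib_left)
  finally show ?thesis .
qed

text \<open>\<open>A\<close> is taken diagonal in the pinched eigenbasis, with entries such that its
  mean with \<open>\<sigma>\<close> is exactly the number of eigenvalues times the pinched
  \<open>\<rho>\<close>. This dominates \<open>\<rho>\<close>, and \<open>peierls\<close> bounds the
  trace.\<close>

lemma feasible_exists:
  assumes a: "1 < a" and V: "unitary n V" and \<sigma>: "\<sigma> = V * rdiag n s * adj V" and s: "\<And>i. i < n \<Longrightarrow> 0 \<le> s i"
    and \<rho>: "psd n \<rho>" and supp: "supp_le \<rho> \<sigma>"
  obtains A where "psd n A" "loewner_le n \<rho> (wgm (1/a) \<sigma> A)"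
    "Re (mtrace A) \<le> pw a (real (card (s ` {..<n}))) * Qs a \<rho> \<sigma>"
proof -
  have \<beta>: "0 < 1/a" "1/a < 1" using a by auto
  let ?N = "real (card (s ` {..<n}))" and ?t = "(1 - a) / (2 * a)"
  obtain U c where U: "unitary n U" and Us: "\<sigma> = U * rdiag n c * adj U" and c': "\<forall>i<n. 0 \<le> c i"
    and pin': "\<forall>x \<in> carrier_vec n. qf \<rho> x \<le> ?N * qf (U * rdiag n (\<lambda>i. qf \<rho> (col U i)) * adj U) x"
    by (rule pinch[OF V \<sigma> s \<rho>]) blast
  have c: "0 \<le> c i" if "i < n" for i using c' that by blast
  have pin: "qf \<rho> x \<le> ?N * qf (U * rdiag n (\<lambda>i. qf \<rho> (col U i)) * adj U) x" if "x \<in> carrier_vec n" for x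
    using pin' that by blast
  have Uc: "U \<in> carrier_mat n n" using U unitary_carrier by blast
  have \<sigma>p: "psd n \<sigma>" unfolding Us using c Uc by (rule psd_spec)
  define x where "x i = pw (2 * ?t) (c i) * qf \<rho> (col U i)" for i
  have \<rho>u: "0 \<le> qf \<rho> (col U i)" for i using psdD(3)[OF \<rho> col_carrier[OF Uc]] .
  have x0: "0 \<le> x i" for i unfolding x_def using \<rho>u by simp
  define A where "A = U * rdiag n (\<lambda>i. pw a (?N * x i)) * adj U"
  have Ap: "psd n A" unfolding A_def using Uc by (intro psd_spec) auto
  have "pw (1 - 1/a) (c i) * pw (1/a) (pw a (?N * x i)) = ?N * qf \<rho> (col U i)" if i: "i < n" for i
  proof -
    have "pw (1/a) (pw a (?N * x i)) = ?N * x i"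
      using a x0 by (simp add: pw_pw pw_1)
    hence "pw (1 - 1/a) (c i) * pw (1/a) (pw a (?N * x i)) = ?N * ((pw (1 - 1/a) (c i) * pw (2 * ?t) (c i)) * qf \<rho> (col U i))"
      unfolding x_def by simp
    also have "pw (1 - 1/a) (c i) * pw (2 * ?t) (c i) = pw 0 (c i)"
      unfolding sandwich_exponents(1)[OF a] pw_add by simp
    \<comment> \<open>Here the support condition enters: a zero eigenvalue of
      \<open>\<sigma>\<close> forces the entry of \<open>\<rho>\<close> to vanish.\<close>
    also have "pw 0 (c i) * qf \<rho> (col U i) = qf \<rho> (col U i)"
    proof (cases "c i = 0")
      case True
      hence "qf \<sigma> (col U i) = 0" unfolding Us qf_spec_col[OF U i] .
      hence "qf \<rho> (col U i) = 0" using supp unfolding supp_le_iff[OF \<rho> \<sigma>p] using col_carrier[OF Uc] by blast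
      thus ?thesis by simp
    next
      case False
      thus ?thesis using c[OF i] by (simp add: pw_def)
    qed
    finally show ?thesis .
  qed
  hence "rdiag n (\<lambda>i. pw (1 - 1/a) (c i) * pw (1/a) (pw a (?N * x i))) = rdiag n (\<lambda>i. ?N * qf \<rho> (col U i))"
    by (intro mat_diag_cong) simp
  moreover have "wgm (1/a) \<sigma> A = U * rdiag n (\<lambda>i. pw (1 - 1/a) (c i) * pw (1/a) (pw a (?N * x i))) * adj U"
    unfolding Us A_def by (rule wgm_diag[OF \<beta> U c]) auto
  ultimately have w: "wgm (1/a) \<sigma> A = U * rdiag n (\<lambda>i. ?N * qf \<rho> (col U i)) * adj U"
    by simp
  have "loewner_le n \<rho> (wgm (1/a) \<sigma> A)"
    unfolding loewner_psd_iff[OF \<rho> psd_wgm[OF \<beta> \<sigma>p Ap]]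
  proof (intro ballI)
    fix v :: "complex vec" assume v: "v \<in> carrier_vec n"
    show "qf \<rho> v \<le> qf (wgm (1/a) \<sigma> A) v"
      unfolding w using pin[OF v] by (simp only: qf_spec[OF Uc v] sum_distrib_left mult.assoc)
  qed
  moreover have "Re (mtrace A) \<le> pw a ?N * Qs a \<rho> \<sigma>"
  proof -
    have "Re (mtrace A) = (\<Sum>i<n. pw a ?N * pw a (x i))"
      unfolding A_def using mtrace_unitary(1)[OF U, of "rdiag n _"] x0 by (simp add: mtrace_rdiag pw_mult del: of_real_mult)
    also have "\<dots> = pw a ?N * (\<Sum>i<n. pw a (qf (mpow ?t \<sigma> * \<rho> * mpow ?t \<sigma>) (col U i)))"
      unfolding sum_distrib_left by (intro sum.cong) (auto simp: qf_sandwich_col[OF U Us \<rho>] x_def)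
    also have "\<dots> \<le> pw a ?N * Qs a \<rho> \<sigma>"
      unfolding Qs_def using a by (intro mult_left_mono peierls[OF psd_sandwich[OF U Us \<rho>] U]) auto
    finally show ?thesis .
  qed
  ultimately show ?thesis using that[OF Ap] by blast
qed

lemma mtrace_psd:
  assumes "psd n A"
  shows "mtrace A = complex_of_real (Re (mtrace A))" "0 \<le> Re (mtrace A)"
proof -
  have e: "qf A (unit_vec n i) = Re (A $$ (i,i))" "Im (A $$ (i,i)) = 0" if "i < n" for i
  proof -
    have "conjugate (unit_vec n i) = (unit_vec n i :: complex vec)"
      using that by (intro eq_vecI) (auto simp: unit_vec_def)
    thus "qf A (unit_vec n i) = Re (A $$ (i,i))"
      unfolding qf_def using psdD(1)[OF assms] that by simp
    show "Im (A $$ (i,i)) = 0"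
      using arg_cong[OF hermitian_entry[OF psdD(2,1)[OF assms] that that], of Im] by simp
  qed
  show "mtrace A = complex_of_real (Re (mtrace A))"
    unfolding mtrace_def using psdD(4)[OF assms] e by (simp add: complex_eq_iff)
  show "0 \<le> Re (mtrace A)"
    unfolding mtrace_def Re_sum using psdD(4)[OF assms] psdD(3)[OF assms, of "unit_vec n _"] e(1) 
    by (intro sum_nonneg) (metis lessThan_iff unit_vec_carrier)
qed

lemma Qs_nonneg:
  assumes "psd n \<rho>" "psd n \<sigma>"
  shows "0 \<le> Qs a \<rho> \<sigma>"
proof -
  obtain U c where U: "unitary n U" "\<sigma> = U * rdiag n c * adj U"
    using spectral psdD[OF assms(2)] by blast
  note p = psd_sandwich[OF U assms(1), of "(1 - a) / (2 * a)"]
  show ?thesis unfolding Qs_def by (rule mtrace_psd(2)[OF psd_mpow[OF psdD(2,1)[OF p]]])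
qed

lemma Qs_kron:
  assumes "psd n \<rho>1" "psd n \<sigma>1" "psd m \<rho>2" "psd m \<sigma>2"
  shows "Qs a (kron \<rho>1 \<rho>2) (kron \<sigma>1 \<sigma>2) = Qs a \<rho>1 \<sigma>1 * Qs a \<rho>2 \<sigma>2"
proof -
  let ?t = "(1 - a) / (2 * a)"
  obtain U c where U: "unitary n U" "\<sigma>1 = U * rdiag n c * adj U"
    using spectral psdD[OF assms(2)] by blast
  obtain V e where V: "unitary m V" "\<sigma>2 = V * rdiag m e * adj V"
    using spectral psdD[OF assms(4)] by blast
  note p1 = psd_sandwich[OF U assms(1), of ?t]
  note p2 = psd_sandwich[OF V assms(3), of ?t]
  note q1 = psd_mpow[OF psdD(2,1)[OF p1], of a]
  note q2 = psd_mpow[OF psdD(2,1)[OF p2], of a]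
  note c = psdD(1)[OF assms(1)] psdD(1)[OF assms(3)]
    psdD(1)[OF psd_mpow[OF psdD(2,1)[OF assms(2)], of ?t]] psdD(1)[OF psd_mpow[OF psdD(2,1)[OF assms(4)], of ?t]]
  have "mpow ?t (kron \<sigma>1 \<sigma>2) * kron \<rho>1 \<rho>2 * mpow ?t (kron \<sigma>1 \<sigma>2)
      = kron (mpow ?t \<sigma>1 * \<rho>1 * mpow ?t \<sigma>1) (mpow ?t \<sigma>2 * \<rho>2 * mpow ?t \<sigma>2)"
    unfolding mpow_kron[OF assms(2,4)] using c by (simp add: kron_mult)
  hence "mtrace (mpow a (mpow ?t (kron \<sigma>1 \<sigma>2) * kron \<rho>1 \<rho>2 * mpow ?t (kron \<sigma>1 \<sigma>2)))
      = mtrace (mpow a (mpow ?t \<sigma>1 * \<rho>1 * mpow ?t \<sigma>1)) * mtrace (mpow a (mpow ?t \<sigma>2 * \<rho>2 * mpow ?t \<sigma>2))"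
    by (simp add: mpow_kron[OF p1 p2] mtrace_kron[OF psdD(1)[OF q1] psdD(1)[OF q2]])
  thus ?thesis unfolding Qs_def
    using mtrace_psd(1)[OF q1] mtrace_psd(1)[OF q2] by (metis Re_complex_of_real of_real_mult)
qed

lemma kron_mono:
  assumes "psd n X1" "psd n Y1" "psd m X2" "psd m Y2" "loewner_le n X1 Y1" "loewner_le m X2 Y2"
  shows "loewner_le (n * m) (kron X1 X2) (kron Y1 Y2)"
proof -
  note c = psdD(1)[OF assms(1)] psdD(1)[OF assms(2)] psdD(1)[OF assms(3)] psdD(1)[OF assms(4)]
  \<comment> \<open>Changing one factor at a time leaves tensor products of positive semidefinite
    operators.\<close>
  have "kron Y1 Y2 - kron X1 X2 = kron (Y1 - X1) Y2 + kron X1 (Y2 - X2)"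
    by (rule eq_matI) (use c in \<open>auto simp: div_mod_less algebra_simps\<close>)
  moreover have "psd (n * m) (kron (Y1 - X1) Y2)" "psd (n * m) (kron X1 (Y2 - X2))"
    using assms unfolding loewner_le_def by (auto intro: psd_kron)
  ultimately show ?thesis unfolding loewner_le_def using c by (simp add: kron_carrier psd_add)
qed

lemma loewner_trans:
  assumes "loewner_le n A B" "psd n A" "psd n B" "psd n C" "\<And>v. v \<in> carrier_vec n \<Longrightarrow> qf B v \<le> qf C v"
  shows "loewner_le n A C"
  unfolding loewner_psd_iff[OF assms(2,4)] using loewnerD[OF assms(1)] assms(5) order_trans by blast

lemma feasible_kron:
  assumes \<beta>: "0 < \<beta>" "\<beta> < 1" and p1: "psd n \<rho>1" "psd n \<sigma>1" "psd n A1" and p2: "psd m \<rho>2" "psd m \<sigma>2" "psd m A2"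
    and le: "loewner_le n \<rho>1 (wgm \<beta> \<sigma>1 A1)" "loewner_le m \<rho>2 (wgm \<beta> \<sigma>2 A2)"
  shows "loewner_le (n * m) (kron \<rho>1 \<rho>2) (wgm \<beta> (kron \<sigma>1 \<sigma>2) (kron A1 A2))"
proof -
  note w = psd_wgm[OF \<beta> p1(2,3)] psd_wgm[OF \<beta> p2(2,3)]
  show ?thesis
    by (rule loewner_trans[OF kron_mono[OF p1(1) w(1) p2(1) w(2) le]])
       (intro psd_kron psd_wgm \<beta> p1 p2 w wgm_kron[OF \<beta> p1(2,3) p2(2,3)]; assumption)+
qed

section \<open>Tensor powers of states\<close>

fun kpw :: "nat \<Rightarrow> complex mat \<Rightarrow> complex mat" where
  "kpw 0 A = 1\<^sub>m 1"
| "kpw (Suc k) A = kron (kpw k A) A"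

lemma kpw_psd: "psd n A \<Longrightarrow> psd (n ^ k) (kpw k A)"
  by (induction k) (auto simp: mult.commute[of n] intro: psd_kron simp del: One_nat_def)

lemma kpw_carrier: "A \<in> carrier_mat n n \<Longrightarrow> kpw k A \<in> carrier_mat (n ^ k) (n ^ k)"
  by (induction k) (auto simp: mult.commute[of n] intro: kron_carrier)

lemma mtrace_kpw: "A \<in> carrier_mat n n \<Longrightarrow> mtrace (kpw k A) = mtrace A ^ k"
proof (induction k)
  case 0
  show ?case by (simp add: mtrace_def)
next
  case (Suc k)
  thus ?case using mtrace_kron[OF kpw_carrier[OF Suc.prems] Suc.prems, of k] by (simp add: mult.commute)
qed

lemma Qs_one: "Qs a (1\<^sub>m 1) (1\<^sub>m 1) = 1"
proof -
  have m: "mpow t (1\<^sub>m 1) = 1\<^sub>m 1" for t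
    using mpow_spec[OF unitary_one[of 1], of t "\<lambda>_. 1"] by (simp add: pw_def)
  show ?thesis unfolding Qs_def m right_mult_one_mat[OF one_carrier_mat] m by (simp add: mtrace_def)
qed

lemma Qs_kpw:
  assumes "psd n \<rho>" "psd n \<sigma>"
  shows "Qs a (kpw k \<rho>) (kpw k \<sigma>) = Qs a \<rho> \<sigma> ^ k"
proof (induction k)
  case 0
  show ?case using Qs_one by simp
next
  case (Suc k)
  thus ?case using Qs_kron[OF kpw_psd[OF assms(1), of k] kpw_psd[OF assms(2), of k] assms, where a = a] by (simp add: mult.commute)
qed

lemma feasible_one:
  assumes "0 < \<beta>" "\<beta> < 1"
  shows "loewner_le 1 (1\<^sub>m 1) (wgm \<beta> (1\<^sub>m 1) (1\<^sub>m 1))"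
proof -
  have "wgm \<beta> (1\<^sub>m 1) (1\<^sub>m 1) = 1\<^sub>m 1"
    using wgm_diag[OF assms unitary_one[of 1], of "\<lambda>_. 1" "\<lambda>_. 1"] by (simp add: pw_def)
  thus ?thesis unfolding loewner_le_def
    using psd_zero[of 1] by (metis minus_r_inv_mat one_carrier_mat)
qed

lemma feasible_kpw:
  assumes \<beta>: "0 < \<beta>" "\<beta> < 1" and p: "psd n \<rho>" "psd n \<sigma>" "psd n A" and le: "loewner_le n \<rho> (wgm \<beta> \<sigma> A)"
  shows "loewner_le (n ^ k) (kpw k \<rho>) (wgm \<beta> (kpw k \<sigma>) (kpw k A))"
proof (induction k)
  case 0
  show ?case using feasible_one[OF \<beta>] by simp
next
  case (Suc k)
  show ?case
    using feasible_kron[OF \<beta> kpw_psd[OF p(1)] kpw_psd[OF p(2)] kpw_psd[OF p(3)] p Suc le]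
    by (simp add: mult.commute)
qed

text \<open>The eigenvalues of a tensor power, indexed as in the Kronecker product: the residue
  modulo \<open>n\<close> belongs to the last factor.\<close>

fun kprod :: "nat \<Rightarrow> (nat \<Rightarrow> real) \<Rightarrow> nat \<Rightarrow> nat \<Rightarrow> real" where
  "kprod n s 0 i = 1"
| "kprod n s (Suc k) i = kprod n s k (i div n) * s (i mod n)"

lemma kpw_spec:
  assumes V: "unitary n V"
  shows "unitary (n ^ k) (kpw k V) \<and>
    kpw k (V * rdiag n s * adj V) = kpw k V * rdiag (n ^ k) (kprod n s k) * adj (kpw k V)"
proof (induction k)
  case 0
  show ?case using unitary_one[of 1] by simp
next
  case (Suc k)
  note c = unitary_carrier[OF conjunct1[OF Suc]] unitary_carrier[OF V]
  have "unitary (n ^ k * n) (kron (kpw k V) V)" using Suc V by (intro unitary_kron) auto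
  moreover have "kron (kpw k (V * rdiag n s * adj V)) (V * rdiag n s * adj V)
     = kron (kpw k V) V * rdiag (n ^ k * n) (kprod n s (Suc k)) * adj (kron (kpw k V) V)"
    unfolding conjunct2[OF Suc] by (subst kron_spec[OF c]) simp
  ultimately show ?case by (simp add: mult.commute)
qed

text \<open>An eigenvalue of the \<open>k\<close>-th power is a monomial in the \<open>n\<close>
  numbers \<open>s j\<close>, determined by \<open>n\<close> exponents of at most \<open>k\<close>
  each.\<close>

lemma card_kprod: "card (kprod n s k ` {..<n ^ k}) \<le> (k + 1) ^ n"
proof -
  have sub: "kprod n s k ` {..<n ^ k} \<subseteq> (\<lambda>f. \<Prod>j<n. s j ^ f j) ` (PiE {..<n} (\<lambda>_. {..k}))"
  proof (induction k)
    case 0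
    have "1 = (\<Prod>j<n. s j ^ (\<lambda>j\<in>{..<n}. 0) j)" by simp
    moreover have "(\<lambda>j\<in>{..<n}. 0) \<in> PiE {..<n} (\<lambda>_. {..0::nat})" by auto
    ultimately show ?case by auto
  next
    case (Suc k)
    show ?case
    proof (rule image_subsetI)
      fix i assume "i \<in> {..<n ^ Suc k}"
      hence "i < n ^ k * n" by (simp add: mult.commute)
      note i = div_mod_less[OF this]
      obtain f where f: "f \<in> PiE {..<n} (\<lambda>_. {..k})" "kprod n s k (i div n) = (\<Prod>j<n. s j ^ f j)"
        using Suc i(1) by blast
      define g where "g = f(i mod n := Suc (f (i mod n)))"
      have "g \<in> PiE {..<n} (\<lambda>_. {..Suc k})" unfolding g_def
        using f(1) i(2) by (auto simp: PiE_iff extensional_def le_SucI)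
      moreover have "kprod n s (Suc k) i = (\<Prod>j<n. s j ^ g j)"
      proof -
        have "(\<Prod>j<n. s j ^ g j) = s (i mod n) ^ g (i mod n) * (\<Prod>j\<in>{..<n} - {i mod n}. s j ^ g j)"
          using i(2) by (intro prod.remove) auto
        also have "(\<Prod>j\<in>{..<n} - {i mod n}. s j ^ g j) = (\<Prod>j\<in>{..<n} - {i mod n}. s j ^ f j)"
          unfolding g_def by (intro prod.cong) auto
        also have "s (i mod n) ^ g (i mod n) * \<dots> = s (i mod n) * (\<Prod>j<n. s j ^ f j)"
          using i(2) by (subst prod.remove[of "{..<n}" "i mod n"]) (auto simp: g_def)
        finally show ?thesis using f(2) by (simp add: mult.commute)
      qed
      ultimately show "kprod n s (Suc k) i \<in> (\<lambda>f. \<Prod>j<n. s j ^ f j) ` (PiE {..<n} (\<lambda>_. {..Suc k}))"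
        by blast
    qed
  qed
  have "finite (PiE {..<n} (\<lambda>_. {..k}))" by (intro finite_PiE) auto
  hence "card (kprod n s k ` {..<n ^ k}) \<le> card (PiE {..<n} (\<lambda>_. {..k}))"
    using surj_card_le[OF _ sub] by blast
  also have "\<dots> = (k + 1) ^ n" by (subst card_PiE) auto
  finally show ?thesis .
qed

lemma kprod_nonneg:
  assumes "\<And>i. i < n \<Longrightarrow> 0 \<le> s i"
  shows "i < n ^ k \<Longrightarrow> 0 \<le> kprod n s k i"
proof (induction k arbitrary: i)
  case (Suc k)
  hence "i < n ^ k * n" by (simp add: mult.commute)
  note i = div_mod_less[OF this]
  show ?case using Suc.IH[OF i(1)] assms[OF i(2)] by simp
qed simp

text \<open>If \<open>x\<close> exceeded \<open>y\<close>, the powers of their ratio would grow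
  exponentially against a polynomial bound.\<close>

lemma power_poly_le:
  fixes x y c :: real
  assumes "0 \<le> x" "0 \<le> y" and le: "\<And>k. x ^ k \<le> (real k + 1) powr c * y ^ k"
  shows "x \<le> y"
proof (rule ccontr)
  assume "\<not> x \<le> y"
  hence xy: "y < x" by simp
  have y0: "0 < y"
  proof (rule ccontr)
    assume "\<not> 0 < y"
    hence "y = 0" using assms(2) by simp
    thus False using le[of 1] xy by simp
  qed
  define r where "r = x / y"
  have r: "1 < r" unfolding r_def using xy y0 by simp
  have le': "r ^ k \<le> (real k + 1) powr c" for k
    unfolding r_def power_divide using le[of k] y0 by (simp add: divide_le_eq)
  define l where "l = ln r"
  have l: "0 < l" unfolding l_def using r by simp
  have "exp (l * real k) = r ^ k" for k
    unfolding l_def using r by (simp add: exp_of_nat2_mult)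
  hence le2: "exp (l * real k) \<le> (real k + 1) powr c" for k using le' by simp

  have "filterlim (\<lambda>k::nat. l * real k - c * ln (real k + 1)) at_top at_top"
    using l by real_asymp
  hence "eventually (\<lambda>k::nat. 0 < l * real k - c * ln (real k + 1)) at_top"
    by (rule filterlim_at_top_dense[THEN iffD1, rule_format])
  then obtain k :: nat where "c * ln (real k + 1) < l * real k"
    unfolding eventually_at_top_linorder by fastforce
  hence "exp (c * ln (real k + 1)) < exp (l * real k)" by simp
  moreover have "exp (c * ln (real k + 1)) = (real k + 1) powr c" by (simp add: powr_def)
  ultimately show False using le2[of k] by simp
qed

text \<open>The factor in \<open>Qs_le_feasible\<close> grows polynomially in the number of tensor copies, both sides
  exponentially: passing to tensor powers removes the factor.\<close>
theorem Qs_le_trace: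
  assumes a: "1 < a" and p: "psd n \<rho>" "psd n \<sigma>" "psd n A" and le: "loewner_le n \<rho> (wgm (1/a) \<sigma> A)"
  shows "Qs a \<rho> \<sigma> \<le> Re (mtrace A)"
proof (rule power_poly_le)
  show "0 \<le> Qs a \<rho> \<sigma>" by (rule Qs_nonneg[OF p(1,2)])
  show "0 \<le> Re (mtrace A)" by (rule mtrace_psd(2)[OF p(3)])
  fix k :: nat
  have \<beta>: "0 < 1/a" "1/a < 1" using a by auto
  obtain V s where V: "unitary n V" and \<sigma>: "\<sigma> = V * rdiag n s * adj V" and s: "\<And>i. i < n \<Longrightarrow> 0 \<le> s i"
    using psd_spectral[OF p(2)] by metis
  have V': "unitary (n ^ k) (kpw k V)"
    and \<sigma>': "kpw k \<sigma> = kpw k V * rdiag (n ^ k) (kprod n s k) * adj (kpw k V)"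
    unfolding \<sigma> using kpw_spec[OF V, of k s] by auto
  have "Qs a \<rho> \<sigma> ^ k \<le> pw a (real (card (kprod n s k ` {..<n ^ k}))) * Re (mtrace (kpw k A))"
    unfolding Qs_kpw[OF p(1,2), symmetric]
    by (rule Qs_le_feasible[OF a V' \<sigma>' kprod_nonneg[OF s] kpw_psd[OF p(1)] kpw_psd[OF p(3)]
          feasible_kpw[OF \<beta> p le]])
  also have "Re (mtrace (kpw k A)) = Re (mtrace A) ^ k"
    unfolding mtrace_kpw[OF psdD(1)[OF p(3)]] by (subst mtrace_psd(1)[OF p(3)]) (simp only: Re_complex_of_real flip: of_real_power)
  also have "pw a (real (card (kprod n s k ` {..<n ^ k}))) \<le> pw a (real ((k + 1) ^ n))"
    using a card_kprod[of n s k] by (intro pw_mono) (auto simp del: of_nat_power)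
  also have "pw a (real ((k + 1) ^ n)) = (real k + 1) powr (real n * a)"
  proof -
    have "real ((k + 1) ^ n) = (real k + 1) powr real n" by (simp add: powr_realpow add.commute)
    thus ?thesis by (simp add: pw_def powr_powr)
  qed
  finally show "Qs a \<rho> \<sigma> ^ k \<le> (real k + 1) powr (real n * a) * Re (mtrace A) ^ k"
    using mtrace_psd(2)[OF p(3)] by (simp add: mult_right_mono)
qed

section \<open>Permutation-invariant operators\<close>

text \<open>\<open>card S\<close> is the sum of the squared norms of the vectors. Regrouped by
  coordinate, each coordinate contributes at most 1 by Bessel's inequality.\<close>

lemma orthonormal_card_le:
  fixes M :: "'s \<Rightarrow> 't \<Rightarrow> complex"
  assumes fin: "finite S" "finite T"
    and orth: "\<And>c c'. c \<in> S \<Longrightarrow> c' \<in> S \<Longrightarrow> (\<Sum>t\<in>T. cnj (M c t) * M c' t) = (if c = c' then 1 else 0)"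
  shows "card S \<le> card T"
proof -
  define p where "p t = (\<Sum>c\<in>S. (cmod (M c t))\<^sup>2)" for t
  have p1: "p t \<le> 1" if t: "t \<in> T" for t
  proof -
    \<comment> \<open>The orthogonal projection of the \<open>t\<close>-th unit vector onto the
      span. Its squared norm and its \<open>t\<close>-th coordinate both equal \<open>p t\<close>,
      which gives \<open>p t * p t \<le> p t\<close>.\<close>
    define q where "q u = (\<Sum>c\<in>S. M c u * cnj (M c t))" for u
    have qt: "q t = complex_of_real (p t)"
      unfolding q_def p_def by (simp add: complex_norm_square del: of_real_power)
    have "(\<Sum>u\<in>T. cnj (q u) * q u) = (\<Sum>u\<in>T. \<Sum>c\<in>S. \<Sum>c'\<in>S. cnj (M c u) * M c' u * (M c t * cnj (M c' t)))"
      unfolding q_def by (simp only: cnj_sum sum_product complex_cnj_mult complex_cnj_cnj) (simp only: mult_ac)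
    also have "\<dots> = (\<Sum>c\<in>S. \<Sum>c'\<in>S. \<Sum>u\<in>T. cnj (M c u) * M c' u * (M c t * cnj (M c' t)))"
      by (subst sum.swap, rule sum.cong[OF refl], rule sum.swap)
    also have "\<dots> = (\<Sum>c\<in>S. \<Sum>c'\<in>S. (if c = c' then 1 else 0) * (M c t * cnj (M c' t)))"
      by (simp only: sum_distrib_right[symmetric] orth cong: sum.cong)
    also have "\<dots> = (\<Sum>c\<in>S. \<Sum>c'\<in>S. if c' = c then M c t * cnj (M c t) else 0)"
      by (intro sum.cong) auto
    also have "\<dots> = complex_of_real (p t)"
      unfolding p_def using fin by (simp add: complex_norm_square del: of_real_power)
    finally have "complex_of_real (\<Sum>u\<in>T. (cmod (q u))\<^sup>2) = complex_of_real (p t)"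
      by (simp add: complex_norm_square mult.commute del: of_real_power)
    hence "(\<Sum>u\<in>T. (cmod (q u))\<^sup>2) = p t" by (simp only: of_real_eq_iff)
    moreover have "(cmod (q t))\<^sup>2 \<le> (\<Sum>u\<in>T. (cmod (q u))\<^sup>2)"
      using fin t by (intro member_le_sum) auto
    ultimately have pp: "p t * p t \<le> p t" unfolding qt by (simp add: power2_eq_square)
    show ?thesis
    proof (rule ccontr)
      assume "\<not> p t \<le> 1"
      hence "1 * p t < p t * p t" by (intro mult_strict_right_mono) auto
      thus False using pp by simp
    qed
  qed
  have "real (card S) = (\<Sum>c\<in>S. \<Sum>t\<in>T. (cmod (M c t))\<^sup>2)"
  proof -
    have "(\<Sum>t\<in>T. (cmod (M c t))\<^sup>2) = 1" if "c \<in> S" for c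
    proof -
      have "complex_of_real (\<Sum>t\<in>T. (cmod (M c t))\<^sup>2) = (\<Sum>t\<in>T. cnj (M c t) * M c t)"
        by (simp add: complex_norm_square mult.commute del: of_real_power)
      also have "\<dots> = 1" using orth[OF that that] by simp
      finally show ?thesis by (simp only: of_real_eq_1_iff)
    qed
    thus ?thesis by simp
  qed
  also have "\<dots> = (\<Sum>t\<in>T. p t)" unfolding p_def by (rule sum.swap)
  also have "\<dots> \<le> (\<Sum>t\<in>T. 1)" by (intro sum_mono p1)
  finally show ?thesis by simp
qed

section \<open>Digits of tensor indices and permutation matrices\<close>

definition dig :: "nat \<Rightarrow> nat \<Rightarrow> nat \<Rightarrow> nat" where
  "dig d k i = (i div d ^ k) mod d"

text \<open>Inverse to reading off digits. Digit 0 is the least significant one and belongs to the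
  factor that \<open>tpow\<close> adds last.\<close>

definition und :: "nat \<Rightarrow> nat \<Rightarrow> (nat \<Rightarrow> nat) \<Rightarrow> nat" where
  "und d m f = (\<Sum>k<m. f k * d ^ k)"

lemma dig_less: "0 < d \<Longrightarrow> dig d k i < d"
  unfolding dig_def by simp

lemma und_less: "(\<And>k. k < m \<Longrightarrow> f k < d) \<Longrightarrow> und d m f < d ^ m"
proof (induction m)
  case (Suc m)
  have "und d m f + f m * d ^ m < Suc (f m) * d ^ m" using Suc by simp
  also have "\<dots> \<le> d * d ^ m" using Suc.prems[of m] by (intro mult_le_mono1) simp
  finally show ?case by (simp add: und_def)
qed (simp add: und_def)

lemma dig_und: "(\<And>k. k < m \<Longrightarrow> f k < d) \<Longrightarrow> k < m \<Longrightarrow> dig d k (und d m f) = f k"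
proof (induction m)
  case (Suc m)
  have u: "und d (Suc m) f = und d m f + f m * d ^ m" by (simp add: und_def)
  have d: "0 < d" using Suc.prems(1)[of m] by simp
  show ?case
  proof (cases "k = m")
    case True
    have "und d m f < d ^ m" using Suc.prems by (intro und_less) simp
    thus ?thesis using True d Suc.prems(1)[of m] unfolding u dig_def by simp
  next
    case False
    hence k: "k < m" using Suc.prems by simp
    have "d ^ m = d * d ^ (m - Suc k) * d ^ k"
      using k power_add[of d "m - Suc k" "Suc k"] by simp
    hence "und d (Suc m) f = und d m f + (d * (f m * d ^ (m - Suc k))) * d ^ k"
      unfolding u by simp
    hence "dig d k (und d (Suc m) f) = dig d k (und d m f)"
      unfolding dig_def using d by simp
    thus ?thesis using Suc.IH Suc.prems k by simp
  qed
qed simp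

lemma und_dig: "i < d ^ m \<Longrightarrow> und d m (\<lambda>k. dig d k i) = i"
proof (induction m arbitrary: i)
  case (Suc m)
  have d: "0 < d" using Suc.prems by (cases d) auto
  have "i mod d ^ m < d ^ m" using d by simp
  moreover have "dig d k (i mod d ^ m) = dig d k i" if "k < m" for k
  proof -
    have "d ^ m = d ^ k * (d * d ^ (m - Suc k))"
      using that power_add[of d "Suc k" "m - Suc k"] by simp
    thus ?thesis unfolding dig_def using d by (simp add: mod_mult2_eq)
  qed
  ultimately have "und d m (\<lambda>k. dig d k i) = i mod d ^ m"
    using Suc.IH[of "i mod d ^ m"] unfolding und_def by simp
  moreover have "dig d m i = i div d ^ m"
    unfolding dig_def using Suc.prems by (simp add: less_mult_imp_div_less)
  ultimately show ?case by (simp add: und_def mod_div_mult_eq)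
qed (simp add: und_def)

lemma dig_inj: "i < d ^ m \<Longrightarrow> j < d ^ m \<Longrightarrow> (\<And>k. k < m \<Longrightarrow> dig d k i = dig d k j) \<Longrightarrow> i = j"
proof -
  assume ij: "i < d ^ m" "j < d ^ m" and eq: "\<And>k. k < m \<Longrightarrow> dig d k i = dig d k j"
  have "und d m (\<lambda>k. dig d k i) = und d m (\<lambda>k. dig d k j)"
    unfolding und_def using eq by (intro sum.cong) auto
  thus "i = j" unfolding und_dig[OF ij(1)] und_dig[OF ij(2)] .
qed

text \<open>The action of the permutation \<open>p\<close> of the tensor factors on the indices of \<open>X\<^sup>m\<close>.\<close>
definition actd :: "nat \<Rightarrow> nat \<Rightarrow> (nat \<Rightarrow> nat) \<Rightarrow> nat \<Rightarrow> nat" where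
  "actd d m p i = und d m (\<lambda>k. dig d (p k) i)"

lemma actd_less: "0 < d \<Longrightarrow> actd d m p i < d ^ m"
  unfolding actd_def by (intro und_less dig_less)

lemma dig_actd: "0 < d \<Longrightarrow> k < m \<Longrightarrow> dig d k (actd d m p i) = dig d (p k) i"
  unfolding actd_def by (rule dig_und) (auto intro: dig_less)

lemma actd_inj:
  assumes "0 < d" "p permutes {..<m}"
  shows "inj_on (actd d m p) {..<d ^ m}"
proof (rule inj_onI)
  fix i j assume ij: "i \<in> {..<d ^ m}" "j \<in> {..<d ^ m}" and eq: "actd d m p i = actd d m p j"
  have "dig d k i = dig d k j" if "k < m" for k
  proof -
    define l where "l = inv_into UNIV p k"
    have l: "l < m" "p l = k"
      using permutes_in_image[OF permutes_inv[OF assms(2)], of k] permutes_inverses(1)[OF assms(2)] that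
      unfolding l_def by auto
    have "dig d l (actd d m p i) = dig d l (actd d m p j)" unfolding eq ..
    thus ?thesis unfolding dig_actd[OF assms(1) l(1)] l(2) .
  qed
  thus "i = j" using dig_inj ij by auto
qed

text \<open>With this orientation, conjugation by \<open>pm n f\<close> replaces the entry at
  \<open>(i,j)\<close> by the one at \<open>(f i, f j)\<close>.\<close>

definition pm :: "nat \<Rightarrow> (nat \<Rightarrow> nat) \<Rightarrow> complex mat" where
  "pm n f = mat n n (\<lambda>(i,j). if j = f i then 1 else 0)"

lemma pm_carrier [simp]: "pm n f \<in> carrier_mat n n" "dim_row (pm n f) = n" "dim_col (pm n f) = n"
  unfolding pm_def by simp_all

lemma pm_mult_index:
  assumes "A \<in> carrier_mat n k" "i < n" "j < k" "f i < n"
  shows "(pm n f * A) $$ (i,j) = A $$ (f i, j)"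
proof -
  have "(pm n f * A) $$ (i,j) = (\<Sum>l<n. pm n f $$ (i,l) * A $$ (l,j))"
    using assms by (simp add: index_mult_sum del: index_mult_mat(1))
  also have "\<dots> = (\<Sum>l<n. if l = f i then A $$ (f i, j) else 0)"
    using assms by (intro sum.cong) (auto simp: pm_def)
  finally show ?thesis using assms by simp
qed

lemma pm_conj_index:
  assumes "A \<in> carrier_mat n n" "i < n" "j < n" "f i < n" "f j < n"
  shows "(pm n f * A * adj (pm n f)) $$ (i,j) = A $$ (f i, f j)"
proof -
  have "(pm n f * A * adj (pm n f)) $$ (i,j) = (\<Sum>l<n. (pm n f * A) $$ (i,l) * adj (pm n f) $$ (l,j))"
    using assms by (subst index_mult_sum) auto
  also have "\<dots> = (\<Sum>l<n. if l = f j then A $$ (f i, f j) else 0)"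
  proof (intro sum.cong refl)
    fix l assume "l \<in> {..<n}"
    hence l: "l < n" by simp
    have "adj (pm n f) $$ (l,j) = (if l = f j then 1 else 0)" using l assms by (simp add: pm_def)
    thus "(pm n f * A) $$ (i,l) * adj (pm n f) $$ (l,j) = (if l = f j then A $$ (f i, f j) else 0)"
      using pm_mult_index[OF assms(1,2) l, of f] assms(4) by (simp del: index_mult_mat(1))
  qed
  finally show ?thesis using assms by simp
qed

lemma unitary_pm:
  assumes "\<And>i. i < n \<Longrightarrow> f i < n" "inj_on f {..<n}"
  shows "unitary n (pm n f)"
proof (rule unitaryI)
  show "pm n f * adj (pm n f) = 1\<^sub>m n"
  proof (rule eq_matI)
    fix i j assume "i < dim_row (1\<^sub>m n :: complex mat)" "j < dim_col (1\<^sub>m n :: complex mat)"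
    hence ij: "i < n" "j < n" by auto
    have "(pm n f * 1\<^sub>m n * adj (pm n f)) $$ (i,j) = 1\<^sub>m n $$ (f i, f j)"
      using ij assms(1) by (intro pm_conj_index) auto
    thus "(pm n f * adj (pm n f)) $$ (i,j) = 1\<^sub>m n $$ (i,j)"
      using ij assms by (simp add: inj_on_eq_iff[OF assms(2)] del: index_mult_mat(1))
  qed auto
qed simp

lemma pm_kron:
  assumes "\<And>i. i < m \<Longrightarrow> g i < m"
  shows "pm (n * m) (\<lambda>i. f (i div m) * m + g (i mod m)) = kron (pm n f) (pm m g)"
proof (rule eq_matI)
  fix i j assume "i < dim_row (kron (pm n f) (pm m g))" "j < dim_col (kron (pm n f) (pm m g))"
  hence ij: "i < n * m" "j < n * m" by auto
  note d = div_mod_less[OF ij(1)] div_mod_less[OF ij(2)]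
  have "j = f (i div m) * m + g (i mod m) \<longleftrightarrow> j div m = f (i div m) \<and> j mod m = g (i mod m)"
  proof
    assume "j = f (i div m) * m + g (i mod m)"
    thus "j div m = f (i div m) \<and> j mod m = g (i mod m)" using assms[OF d(2)] by simp
  next
    assume "j div m = f (i div m) \<and> j mod m = g (i mod m)"
    thus "j = f (i div m) * m + g (i mod m)" using div_mult_mod_eq[of j m] by simp
  qed
  thus "pm (n * m) (\<lambda>i. f (i div m) * m + g (i mod m)) $$ (i,j) = kron (pm n f) (pm m g) $$ (i,j)"
    using ij d by (auto simp: pm_def)
qed auto

text \<open>The spectral projections of \<open>\<sigma>\<close> are orthogonal in the Hilbert-Schmidt inner product and are constant
  on the fibres of \<open>\<tau>\<close>, so there are at most as many of them as fibres.\<close>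
lemma card_eigen_le:
  fixes \<tau> :: "nat \<times> nat \<Rightarrow> 't"
  assumes V: "unitary n V" and \<sigma>: "\<sigma> = V * rdiag n s * adj V"
    and inv: "\<And>g i j i' j'. i < n \<Longrightarrow> j < n \<Longrightarrow> i' < n \<Longrightarrow> j' < n \<Longrightarrow> \<tau> (i,j) = \<tau> (i',j') \<Longrightarrow>
      mat_fun g \<sigma> $$ (i,j) = mat_fun g \<sigma> $$ (i',j')"
  shows "card (s ` {..<n}) \<le> card (\<tau> ` ({..<n} \<times> {..<n}))"
proof (rule orthonormal_card_le)
  define Dm where "Dm = {..<n} \<times> {..<n}"
  define E where "E c = mat_fun (\<lambda>x. if x = c then 1 else 0) \<sigma>" for c
  have Vc: "V \<in> carrier_mat n n" using V unitary_carrier by blast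
  have E: "E c = V * rdiag n (\<lambda>i. if s i = c then 1 else 0) * adj V" for c
    unfolding E_def \<sigma> mat_fun_spec[OF V] ..
  have Ec: "E c \<in> carrier_mat n n" for c unfolding E using Vc by simp
  have Eh: "hermitian (E c)" for c unfolding E using Vc by (intro hermitian_congr hermitian_rdiag) simp
  \<comment> \<open>The multiplicity of \<open>c\<close>, which is the squared Hilbert-Schmidt norm
    of the projection \<open>E c\<close>.\<close>
  define mu where "mu c = real (card {i. i < n \<and> s i = c})" for c
  have mu: "0 < mu c" if c: "c \<in> s ` {..<n}" for c
  proof -
    have "{i. i < n \<and> s i = c} \<noteq> {}" using c by auto
    thus ?thesis unfolding mu_def by (simp add: card_gt_0_iff)
  qed
  have tr: "(\<Sum>p\<in>Dm. cnj (E c $$ p) * E c' $$ p) = (if c = c' then complex_of_real (mu c) else 0)" for c c'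
  proof -
    have "(\<Sum>p\<in>Dm. cnj (E c $$ p) * E c' $$ p) = (\<Sum>i<n. \<Sum>j<n. cnj (E c $$ (i,j)) * E c' $$ (i,j))"
      unfolding Dm_def by (simp add: sum.cartesian_product)
    also have "\<dots> = (\<Sum>j<n. \<Sum>i<n. E c $$ (j,i) * E c' $$ (i,j))"
    proof (subst sum.swap, intro sum.cong refl)
      fix i j assume "j \<in> {..<n}" "i \<in> {..<n}"
      hence "E c $$ (j,i) = cnj (E c $$ (i,j))" by (intro hermitian_entry[OF Eh Ec]) auto
      thus "cnj (E c $$ (i,j)) * E c' $$ (i,j) = E c $$ (j,i) * E c' $$ (i,j)" by simp
    qed
    also have "\<dots> = mtrace (E c * E c')"
      unfolding mtrace_def using Ec carrier_matD[OF Ec] by (simp add: index_mult_sum del: index_mult_mat(1))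
    also have "E c * E c' = V * (rdiag n (\<lambda>i. if s i = c then 1 else 0) * rdiag n (\<lambda>i. if s i = c' then 1 else 0)) * adj V"
      unfolding E using V Vc by (simp add: mult_assoc_dim unitary_cancel del: mat_diag_diag)
    also have "\<dots> = V * rdiag n (\<lambda>i. if s i = c \<and> c = c' then 1 else 0) * adj V"
      unfolding mat_diag_diag by (intro arg_cong[of _ _ "\<lambda>X. V * X * adj V"] mat_diag_cong) auto
    also have "mtrace \<dots> = complex_of_real (\<Sum>i<n. if s i = c \<and> c = c' then 1 else 0)"
      by (subst mtrace_unitary(1)[OF V mat_diag_dim]) (rule mtrace_rdiag)
    also have "(\<Sum>i<n. if s i = c \<and> c = c' then 1 else 0) = (if c = c' then mu c else 0)"
      unfolding mu_def by (auto simp: sum.If_cases lessThan_def Int_def)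
    finally show ?thesis by simp
  qed
  define K where "K t = {p \<in> Dm. \<tau> p = t}" for t
  define e where "e c t = E c $$ (SOME p. p \<in> K t)" for c t
  have e: "E c $$ p = e c (\<tau> p)" if p: "p \<in> Dm" for c p
  proof -
    define q where "q = (SOME q. q \<in> K (\<tau> p))"
    have "q \<in> K (\<tau> p)" unfolding q_def by (rule someI[of _ p]) (use p in \<open>simp add: K_def\<close>)
    hence q: "q \<in> Dm" "\<tau> p = \<tau> q" unfolding K_def by auto
    have "E c $$ (fst p, snd p) = E c $$ (fst q, snd q)"
      unfolding E_def by (rule inv) (use p q in \<open>auto simp: Dm_def\<close>)
    thus ?thesis unfolding e_def q_def by simp
  qed
  \<comment> \<open>The weight lets one coordinate stand for all entries in a fibre and divides by
    the norm of the projection.\<close>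
  define M where "M c t = complex_of_real (sqrt (real (card (K t)) / mu c)) * e c t" for c t
  show "(\<Sum>t\<in>\<tau> ` ({..<n} \<times> {..<n}). cnj (M c t) * M c' t) = (if c = c' then 1 else 0)"
    if c: "c \<in> s ` {..<n}" "c' \<in> s ` {..<n}" for c c'
  proof -
    have "cnj (M c t) * M c' t = (\<Sum>p\<in>K t. cnj (E c $$ p) * E c' $$ p) / complex_of_real (sqrt (mu c) * sqrt (mu c'))" for t
    proof -
      have "(\<Sum>p\<in>K t. cnj (E c $$ p) * E c' $$ p) = (\<Sum>p\<in>K t. cnj (e c t) * e c' t)"
        by (intro sum.cong refl) (simp add: e K_def)
      also have "\<dots> = complex_of_real (real (card (K t))) * (cnj (e c t) * e c' t)" by simp
      also have "complex_of_real (real (card (K t))) = complex_of_real (sqrt (real (card (K t))) * sqrt (real (card (K t))))"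
        by simp
      finally have eq: "(\<Sum>p\<in>K t. cnj (E c $$ p) * E c' $$ p)
        = complex_of_real (sqrt (real (card (K t))) * sqrt (real (card (K t)))) * (cnj (e c t) * e c' t)" .
      show ?thesis unfolding M_def eq
        by (simp only: real_sqrt_divide of_real_divide of_real_mult complex_cnj_mult complex_cnj_complex_of_real
            complex_cnj_divide) (simp only: times_divide_eq_left times_divide_eq_right divide_divide_eq_left mult_ac)
    qed
    hence "(\<Sum>t\<in>\<tau> ` Dm. cnj (M c t) * M c' t)
        = (\<Sum>t\<in>\<tau> ` Dm. \<Sum>p\<in>K t. cnj (E c $$ p) * E c' $$ p) / complex_of_real (sqrt (mu c) * sqrt (mu c'))"
      by (simp add: sum_divide_distrib)
    also have "(\<Sum>t\<in>\<tau> ` Dm. \<Sum>p\<in>K t. cnj (E c $$ p) * E c' $$ p) = (\<Sum>p\<in>Dm. cnj (E c $$ p) * E c' $$ p)"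
      unfolding K_def by (rule sum.image_gen[symmetric]) (simp add: Dm_def)
    also have "\<dots> / complex_of_real (sqrt (mu c) * sqrt (mu c')) = (if c = c' then 1 else 0)"
    proof (cases "c = c'")
      case True
      have "sqrt (mu c) * sqrt (mu c) = mu c" using mu[OF c(1)] by simp
      thus ?thesis unfolding tr using True mu[OF c(1)] by (simp del: real_sqrt_mult_self of_real_mult)
    qed (simp add: tr)
    finally show ?thesis unfolding Dm_def .
  qed
qed auto

text \<open>An entry of a permutation-invariant operator depends only on how often each pair of letters occurs
  in its row and column index.\<close>
lemma card_eigen_perm:
  fixes enc :: "nat \<Rightarrow> nat \<Rightarrow> 'c"
  assumes V: "unitary n V" and \<sigma>: "\<sigma> = V * rdiag n s * adj V"
    and C: "finite C" "\<And>i k. i < n \<Longrightarrow> k < m \<Longrightarrow> enc i k \<in> C"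
    and inj: "\<And>i j. i < n \<Longrightarrow> j < n \<Longrightarrow> (\<And>k. k < m \<Longrightarrow> enc i k = enc j k) \<Longrightarrow> i = j"
    and act: "\<And>p i. p permutes {..<m} \<Longrightarrow> i < n \<Longrightarrow> act p i < n"
      "\<And>p i k. p permutes {..<m} \<Longrightarrow> i < n \<Longrightarrow> k < m \<Longrightarrow> enc (act p i) k = enc i (p k)"
    and u: "\<And>p. p permutes {..<m} \<Longrightarrow> unitary n (pm n (act p))"
    and inv: "\<And>p. p permutes {..<m} \<Longrightarrow> pm n (act p) * \<sigma> * adj (pm n (act p)) = \<sigma>"
  shows "card (s ` {..<n}) \<le> (m + 1) ^ (card C * card C)"
proof -
  have Vc: "V \<in> carrier_mat n n" using V unitary_carrier by blast
  have \<sigma>h: "hermitian \<sigma>" "\<sigma> \<in> carrier_mat n n" unfolding \<sigma> using Vc by (auto intro!: hermitian_congr)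
  define L where "L i j = map (\<lambda>k. (enc i k, enc j k)) [0..<m]" for i j
  define \<tau> where "\<tau> q = mset (L (fst q) (snd q))" for q
  have "card (s ` {..<n}) \<le> card (\<tau> ` ({..<n} \<times> {..<n}))"
  proof (rule card_eigen_le[OF V \<sigma>])
    fix g i j i' j' assume ij: "i < n" "j < n" "i' < n" "j' < n" and eq: "\<tau> (i,j) = \<tau> (i',j')"
    \<comment> \<open>Equal multisets mean that a single permutation of the positions turns one list
      of letter pairs into the other; it acts on the row and the column index at once.\<close>
    have "mset (L i' j') = mset (L i j)" using eq unfolding \<tau>_def by simp
    then obtain p where p: "p permutes {..<length (L i j)}" "permute_list p (L i j) = L i' j'"
      by (rule mset_eq_permutation)
    have len: "length (L i j) = m" unfolding L_def by simp
    have p': "p permutes {..<m}" using p(1) len by simp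
    have nth: "(enc i' k, enc j' k) = (enc i (p k), enc j (p k))" if k: "k < m" for k
    proof -
      have pk: "p k < m" using permutes_in_image[OF p', of k] k by simp
      have "L i' j' ! k = L i j ! (p k)"
        unfolding p(2)[symmetric] using permute_list_nth[OF p(1), of k] k len by simp
      thus ?thesis unfolding L_def using k pk by simp
    qed
    have "act p i = i'" by (rule inj[OF act(1)[OF p' ij(1)] ij(3)]) (use act(2)[OF p' ij(1)] nth in auto)
    moreover have "act p j = j'" by (rule inj[OF act(1)[OF p' ij(2)] ij(4)]) (use act(2)[OF p' ij(2)] nth in auto)
    moreover have "mat_fun g \<sigma> = pm n (act p) * mat_fun g \<sigma> * adj (pm n (act p))"
      using mat_fun_unitary[OF u[OF p'] \<sigma>h, of g] unfolding inv[OF p'] .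
    ultimately show "mat_fun g \<sigma> $$ (i,j) = mat_fun g \<sigma> $$ (i',j')"
      using pm_conj_index[OF mat_fun_carrier(1)[OF \<sigma>h, of g] ij(1,2), of "act p"] act(1)[OF p'] ij by simp
  qed
  \<comment> \<open>A multiset of \<open>m\<close> letter pairs is determined by its multiplicities,
    each of which is at most \<open>m\<close>.\<close>
  also have "\<dots> \<le> card (PiE (C \<times> C) (\<lambda>_. {..m}))"
  proof (rule card_inj_on_le)
    have sub: "set_mset t \<subseteq> C \<times> C" if "t \<in> \<tau> ` ({..<n} \<times> {..<n})" for t
      using that C(2) unfolding \<tau>_def L_def by auto
    show "inj_on (\<lambda>t. restrict (count t) (C \<times> C)) (\<tau> ` ({..<n} \<times> {..<n}))"
    proof (rule inj_onI)
      fix t t' assume t: "t \<in> \<tau> ` ({..<n} \<times> {..<n})" "t' \<in> \<tau> ` ({..<n} \<times> {..<n})"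
        and eq: "restrict (count t) (C \<times> C) = restrict (count t') (C \<times> C)"
      show "t = t'"
      proof (rule multiset_eqI)
        fix x
        show "count t x = count t' x"
        proof (cases "x \<in> C \<times> C")
          case True thus ?thesis using fun_cong[OF eq, of x] by simp
        next
          case False
          hence "x \<notin># t" "x \<notin># t'" using sub[OF t(1)] sub[OF t(2)] by auto
          thus ?thesis by (simp add: not_in_iff)
        qed
      qed
    qed
    show "(\<lambda>t. restrict (count t) (C \<times> C)) ` \<tau> ` ({..<n} \<times> {..<n}) \<subseteq> PiE (C \<times> C) (\<lambda>_. {..m})"
    proof -
      have "count (\<tau> q) x \<le> m" for q x
      proof -
        have "count (\<tau> q) x \<le> size (\<tau> q)" by (rule count_le_size)
        also have "\<dots> = m" unfolding \<tau>_def L_def by simp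
        finally show ?thesis .
      qed
      hence "restrict (count (\<tau> q)) (C \<times> C) \<in> PiE (C \<times> C) (\<lambda>_. {..m})" for q
        by (intro restrict_PiE_iff[THEN iffD2] ballI) simp
      thus ?thesis by (intro image_subsetI) blast
    qed
    show "finite (PiE (C \<times> C) (\<lambda>_. {..m}))" using C(1) by (intro finite_PiE) auto
  qed
  also have "\<dots> = (m + 1) ^ (card C * card C)"
    using C(1) by (subst card_PiE) (auto simp: card_cartesian_product)
  finally show ?thesis .
qed

section \<open>Choi operators of tensor powers\<close>

lemma munit_carrier [simp]: "munit n i j \<in> carrier_mat n n"
  unfolding munit_def by simp

lemma Phi_block:
  assumes "a < n" "b < n"
  shows "mat n n (\<lambda>(p,q). Phi n $$ (a * n + p, b * n + q)) = munit n a b"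
proof (rule eq_matI)
  fix p q assume "p < dim_row (munit n a b)" "q < dim_col (munit n a b)"
  hence pq: "p < n" "q < n" unfolding munit_def by auto
  show "mat n n (\<lambda>(p,q). Phi n $$ (a * n + p, b * n + q)) $$ (p,q) = munit n a b $$ (p,q)"
    using pq mult_add_less[OF assms(1) pq(1)] mult_add_less[OF assms(2) pq(2)]
    by (auto simp: Phi_def munit_def)
qed (auto simp: munit_def)

lemma choi_index:
  assumes "i < dX * dY" "j < dX * dY"
  shows "choi dX dY N $$ (i,j) = N (munit dX (i div dY) (j div dY)) $$ (i mod dY, j mod dY)"
  using assms div_mod_less[OF assms(1)] div_mod_less[OF assms(2)]
  unfolding choi_def id_tensor_def by (simp add: Phi_block)

lemma psd_Phi: "psd (n * n) (Phi n)"
proof -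
  define w where "w = mat (n * n) 1 (\<lambda>(i,j). if i div n = i mod n then 1 else 0 :: complex)"
  have "Phi n = w * adj w"
  proof (rule eq_matI)
    fix i j assume "i < dim_row (w * adj w)" "j < dim_col (w * adj w)"
    hence "i < n * n" "j < n * n" unfolding w_def by auto
    thus "Phi n $$ (i,j) = (w * adj w) $$ (i,j)"
      by (subst index_mult_sum) (auto simp: w_def Phi_def)
  qed (auto simp: w_def Phi_def)
  thus ?thesis using psd_gram[of w "n * n" 1] by (simp add: w_def)
qed

lemma psd_choi: "cp_map dX dY N \<Longrightarrow> psd (dX * dY) (choi dX dY N)"
  unfolding choi_def cp_map_def using psd_Phi by blast

lemma lin_map_carrier: "cp_map dX dY N \<Longrightarrow> A \<in> carrier_mat dX dX \<Longrightarrow> N A \<in> carrier_mat dY dY"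
  unfolding cp_map_def lin_map_def by blast

lemma tpow_carrier: "tpow dX dY N m Z \<in> carrier_mat (dY ^ m) (dY ^ m)"
  by (cases m) (auto simp: map_tensor_def mult.commute)

lemma sum4_delta:
  fixes F :: "nat \<Rightarrow> nat \<Rightarrow> nat \<Rightarrow> nat \<Rightarrow> complex"
  assumes "i0 < n" "j0 < n" "s0 < m" "t0 < m"
  shows "(\<Sum>i<n. \<Sum>j<n. \<Sum>s<m. \<Sum>t<m. if i = i0 \<and> j = j0 \<and> s = s0 \<and> t = t0 then F i j s t else 0) = F i0 j0 s0 t0"
proof -
  have 1: "(\<Sum>t<m. if i = i0 \<and> j = j0 \<and> s = s0 \<and> t = t0 then F i j s t else 0)
     = (if i = i0 \<and> j = j0 \<and> s = s0 then F i j s t0 else 0)" for i j s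
    using assms by (cases "i = i0 \<and> j = j0 \<and> s = s0") auto
  have 2: "(\<Sum>s<m. if i = i0 \<and> j = j0 \<and> s = s0 then F i j s t0 else 0)
     = (if i = i0 \<and> j = j0 then F i j s0 t0 else 0)" for i j
    using assms by (cases "i = i0 \<and> j = j0") auto
  have 3: "(\<Sum>j<n. if i = i0 \<and> j = j0 then F i j s0 t0 else 0) = (if i = i0 then F i j0 s0 t0 else 0)" for i
    using assms by (cases "i = i0") auto
  show ?thesis unfolding 1 2 3 using assms by simp
qed

lemma mult_add_div_mod:
  fixes a b m :: nat
  assumes "b < m"
  shows "(a * m + b) div m = a" "(a * m + b) mod m = b"
  using assms by (cases "m = 0"; simp)+

text \<open>A matrix unit of the product space is a tensor product of matrix units, so a single term
  of the fourfold sum survives.\<close>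

lemma map_tensor_munit:
  assumes "a < n * m" "b < n * m" "p < k * l" "q < k * l"
    and c: "\<And>i j. N1 (munit n i j) \<in> carrier_mat k k" "\<And>i j. N2 (munit m i j) \<in> carrier_mat l l"
  shows "map_tensor n k m l N1 N2 (munit (n * m) a b) $$ (p,q)
    = N1 (munit n (a div m) (b div m)) $$ (p div l, q div l) * N2 (munit m (a mod m) (b mod m)) $$ (p mod l, q mod l)"
proof -
  note d = div_mod_less[OF assms(1)] div_mod_less[OF assms(2)]
  let ?F = "\<lambda>i j s t. kron (N1 (munit n i j)) (N2 (munit m s t)) $$ (p, q)"
  have eq: "munit (n * m) a b $$ (i * m + s, j * m + t) * ?F i j s t
    = (if i = a div m \<and> j = b div m \<and> s = a mod m \<and> t = b mod m then ?F i j s t else 0)"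
    if "i < n" "j < n" "s < m" "t < m" for i j s t
  proof -
    have "i * m + s = a \<longleftrightarrow> i = a div m \<and> s = a mod m" "j * m + t = b \<longleftrightarrow> j = b div m \<and> t = b mod m"
      using that by (auto simp: div_mult_mod_eq)
    thus ?thesis using mult_add_less[OF that(1,3)] mult_add_less[OF that(2,4)] by (auto simp: munit_def)
  qed
  have "map_tensor n k m l N1 N2 (munit (n * m) a b) $$ (p,q)
     = (\<Sum>i<n. \<Sum>j<n. \<Sum>s<m. \<Sum>t<m. munit (n * m) a b $$ (i * m + s, j * m + t) * ?F i j s t)"
    unfolding map_tensor_def using assms by simp
  also have "\<dots> = (\<Sum>i<n. \<Sum>j<n. \<Sum>s<m. \<Sum>t<m.
     (if i = a div m \<and> j = b div m \<and> s = a mod m \<and> t = b mod m then ?F i j s t else 0))"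
    by (intro sum.cong refl eq) auto
  also have "\<dots> = ?F (a div m) (b div m) (a mod m) (b mod m)"
    by (rule sum4_delta[OF d(1,3,2,4)])
  also have "\<dots> = N1 (munit n (a div m) (b div m)) $$ (p div l, q div l) * N2 (munit m (a mod m) (b mod m)) $$ (p mod l, q mod l)"
    using assms(3,4) carrier_matD[OF c(1)] carrier_matD[OF c(2)] by simp
  finally show ?thesis .
qed

lemma dig_Suc: "dig d (Suc k) i = dig d k (i div d)"
  unfolding dig_def by (simp add: div_mult2_eq)

text \<open>Peeling off the last factor consumes digit 0 and shifts the remaining digits down by
  one.\<close>

lemma tpow_entry:
  assumes N: "cp_map dX dY N"
  shows "a < dX ^ m \<Longrightarrow> b < dX ^ m \<Longrightarrow> p < dY ^ m \<Longrightarrow> q < dY ^ m \<Longrightarrow>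
    tpow dX dY N m (munit (dX ^ m) a b) $$ (p,q) =
    (\<Prod>k<m. N (munit dX (dig dX k a) (dig dX k b)) $$ (dig dY k p, dig dY k q))"
proof (induction m arbitrary: a b p q)
  case 0
  thus ?case by (simp add: munit_def)
next
  case (Suc m)
  have l: "a < dX ^ m * dX" "b < dX ^ m * dX" "p < dY ^ m * dY" "q < dY ^ m * dY"
    using Suc.prems by (auto simp: mult.commute)
  have "tpow dX dY N (Suc m) (munit (dX ^ Suc m) a b) $$ (p,q)
      = tpow dX dY N m (munit (dX ^ m) (a div dX) (b div dX)) $$ (p div dY, q div dY)
        * N (munit dX (a mod dX) (b mod dX)) $$ (p mod dY, q mod dY)"
    using map_tensor_munit[OF l, of "tpow dX dY N m" N] tpow_carrier lin_map_carrier[OF N]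
    by (simp add: mult.commute)
  also have "tpow dX dY N m (munit (dX ^ m) (a div dX) (b div dX)) $$ (p div dY, q div dY)
     = (\<Prod>k<m. N (munit dX (dig dX (Suc k) a) (dig dX (Suc k) b)) $$ (dig dY (Suc k) p, dig dY (Suc k) q))"
    unfolding dig_Suc by (intro Suc.IH div_mod_less(1) l)
  also have "\<dots> * N (munit dX (a mod dX) (b mod dX)) $$ (p mod dY, q mod dY)
     = (\<Prod>k<Suc m. N (munit dX (dig dX k a) (dig dX k b)) $$ (dig dY k p, dig dY k q))"
    by (subst prod.lessThan_Suc_shift) (simp add: dig_def mult.commute)
  finally show ?case .
qed

text \<open>The \<open>k\<close>-th letter, in the alphabet \<open>X \<times> Y\<close>, of an index of \<open>X\<^sup>m \<otimes> Y\<^sup>m\<close>.\<close>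
definition enc :: "nat \<Rightarrow> nat \<Rightarrow> nat \<Rightarrow> nat \<Rightarrow> nat \<Rightarrow> nat" where
  "enc dX dY m i k = dig dX k (i div dY ^ m) * dY + dig dY k (i mod dY ^ m)"

text \<open>The \<open>m\<close>-th tensor power of \<open>J\<close> with the tensor factors reordered from \<open>(X \<otimes> Y)\<^sup>m\<close> into \<open>X\<^sup>m \<otimes> Y\<^sup>m\<close>.\<close>
definition JP :: "nat \<Rightarrow> nat \<Rightarrow> complex mat \<Rightarrow> nat \<Rightarrow> complex mat" where
  "JP dX dY J m = mat (dX ^ m * dY ^ m) (dX ^ m * dY ^ m)
     (\<lambda>(i,j). \<Prod>k<m. J $$ (enc dX dY m i k, enc dX dY m j k))"

lemma JP_carrier [simp]: "JP dX dY J m \<in> carrier_mat (dX ^ m * dY ^ m) (dX ^ m * dY ^ m)"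
  unfolding JP_def by simp

lemma enc_less: "0 < dX \<Longrightarrow> 0 < dY \<Longrightarrow> enc dX dY m i k < dX * dY"
  unfolding enc_def by (intro mult_add_less dig_less)

lemma choi_tpow:
  assumes N: "cp_map dX dY N" and d: "0 < dX" "0 < dY"
  shows "choi (dX ^ m) (dY ^ m) (tpow dX dY N m) = JP dX dY (choi dX dY N) m"
proof (rule eq_matI)
  fix i j assume "i < dim_row (JP dX dY (choi dX dY N) m)" "j < dim_col (JP dX dY (choi dX dY N) m)"
  hence ij: "i < dX ^ m * dY ^ m" "j < dX ^ m * dY ^ m" unfolding JP_def by auto
  have dv: "enc dX dY m l k div dY = dig dX k (l div dY ^ m)" "enc dX dY m l k mod dY = dig dY k (l mod dY ^ m)" for l k
    unfolding enc_def by (rule mult_add_div_mod[OF dig_less[OF d(2)]])+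
  have "choi (dX ^ m) (dY ^ m) (tpow dX dY N m) $$ (i,j)
      = tpow dX dY N m (munit (dX ^ m) (i div dY ^ m) (j div dY ^ m)) $$ (i mod dY ^ m, j mod dY ^ m)"
    by (rule choi_index[OF ij])
  also have "\<dots> = (\<Prod>k<m. choi dX dY N $$ (enc dX dY m i k, enc dX dY m j k))"
    unfolding tpow_entry[OF N div_mod_less(1)[OF ij(1)] div_mod_less(1)[OF ij(2)] div_mod_less(2)[OF ij(1)] div_mod_less(2)[OF ij(2)]]
    by (intro prod.cong refl) (simp add: choi_index enc_less[OF d] dv)
  finally show "choi (dX ^ m) (dY ^ m) (tpow dX dY N m) $$ (i,j) = JP dX dY (choi dX dY N) m $$ (i,j)"
    using ij by (simp add: JP_def)
qed (simp_all add: JP_def choi_def id_tensor_def)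

section \<open>Splitting a tensor power into two blocks of factors\<close>

lemma dig_mod: "k < n \<Longrightarrow> dig d k (i mod d ^ n) = dig d k i"
proof (cases "d = 0")
  case True
  thus "k < n \<Longrightarrow> dig d k (i mod d ^ n) = dig d k i" by (cases n) (auto simp: dig_def)
next
  case False
  assume k: "k < n"
  have "d ^ n = d ^ k * (d * d ^ (n - Suc k))"
    using k power_add[of d "Suc k" "n - Suc k"] by simp
  thus ?thesis unfolding dig_def using False by (simp add: mod_mult2_eq)
qed

lemma dig_div: "dig d k (i div d ^ n) = dig d (n + k) i"
  unfolding dig_def by (simp add: power_add div_mult2_eq)

text \<open>The \<open>m\<close> outer letters of an index with \<open>m + n\<close> letters, as an
  index of the smaller space. \<open>xylo\<close> holds the \<open>n\<close> inner letters, which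
  are the low digits.\<close>

definition xyhi :: "nat \<Rightarrow> nat \<Rightarrow> nat \<Rightarrow> nat \<Rightarrow> nat \<Rightarrow> nat" where
  "xyhi dX dY m n i = (i div dY ^ (m + n)) div dX ^ n * dY ^ m + (i mod dY ^ (m + n)) div dY ^ n"

definition xylo :: "nat \<Rightarrow> nat \<Rightarrow> nat \<Rightarrow> nat \<Rightarrow> nat \<Rightarrow> nat" where
  "xylo dX dY m n i = (i div dY ^ (m + n)) mod dX ^ n * dY ^ n + (i mod dY ^ (m + n)) mod dY ^ n"

text \<open>Rearranges \<open>X\<^sup>m X\<^sup>n Y\<^sup>m Y\<^sup>n\<close> into \<open>X\<^sup>m Y\<^sup>m X\<^sup>n Y\<^sup>n\<close>.\<close>
definition rix :: "nat \<Rightarrow> nat \<Rightarrow> nat \<Rightarrow> nat \<Rightarrow> nat \<Rightarrow> nat" where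
  "rix dX dY m n i = xyhi dX dY m n i * (dX ^ n * dY ^ n) + xylo dX dY m n i"

context
  fixes dX dY :: nat
  assumes d: "0 < dX" "0 < dY"
begin

abbreviation "dd m \<equiv> dX ^ m * dY ^ m"

lemma dd_add: "dd m * dd n = dd (m + n)"
  by (simp add: power_add mult_ac)

lemma xy_bounds:
  assumes i: "i < dd (m + n)"
  shows "i div dY ^ (m + n) div dX ^ n < dX ^ m" "i div dY ^ (m + n) mod dX ^ n < dX ^ n"
    "i mod dY ^ (m + n) div dY ^ n < dY ^ m" "i mod dY ^ (m + n) mod dY ^ n < dY ^ n"
    "xyhi dX dY m n i < dd m" "xylo dX dY m n i < dd n"
proof -
  have 1: "i div dY ^ (m + n) < dX ^ m * dX ^ n" "i mod dY ^ (m + n) < dY ^ m * dY ^ n"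
    using div_mod_less[OF i] by (simp_all add: power_add)
  show a: "i div dY ^ (m + n) div dX ^ n < dX ^ m" "i div dY ^ (m + n) mod dX ^ n < dX ^ n"
    using div_mod_less[OF 1(1)] by auto
  show b: "i mod dY ^ (m + n) div dY ^ n < dY ^ m" "i mod dY ^ (m + n) mod dY ^ n < dY ^ n"
    using div_mod_less[OF 1(2)] by auto
  show "xyhi dX dY m n i < dd m" "xylo dX dY m n i < dd n"
    unfolding xyhi_def xylo_def using mult_add_less[OF a(1) b(1)] mult_add_less[OF a(2) b(2)] by auto
qed

lemma rix_less:
  assumes "i < dd (m + n)"
  shows "rix dX dY m n i < dd (m + n)"
  unfolding rix_def dd_add[symmetric] using xy_bounds[OF assms] by (intro mult_add_less)

lemma rix_div_mod:
  assumes "i < dd (m + n)"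
  shows "rix dX dY m n i div dd n = xyhi dX dY m n i" "rix dX dY m n i mod dd n = xylo dX dY m n i"
  unfolding rix_def by (rule mult_add_div_mod[OF xy_bounds(6)[OF assms]])+

lemma xyhi_div_mod:
  assumes "i < dd (m + n)"
  shows "xyhi dX dY m n i div dY ^ m = i div dY ^ (m + n) div dX ^ n" "xyhi dX dY m n i mod dY ^ m = i mod dY ^ (m + n) div dY ^ n"
  unfolding xyhi_def by (rule mult_add_div_mod[OF xy_bounds(3)[OF assms]])+

lemma xylo_div_mod:
  assumes "i < dd (m + n)"
  shows "xylo dX dY m n i div dY ^ n = i div dY ^ (m + n) mod dX ^ n" "xylo dX dY m n i mod dY ^ n = i mod dY ^ (m + n) mod dY ^ n"
  unfolding xylo_def by (rule mult_add_div_mod[OF xy_bounds(4)[OF assms]])+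

lemma rix_inj: "inj_on (rix dX dY m n) {..<dd (m + n)}"
proof (rule inj_onI)
  fix i j assume "i \<in> {..<dd (m + n)}" "j \<in> {..<dd (m + n)}" and eq: "rix dX dY m n i = rix dX dY m n j"
  hence ij: "i < dd (m + n)" "j < dd (m + n)" by auto
  have hi: "xyhi dX dY m n i = xyhi dX dY m n j" and lo: "xylo dX dY m n i = xylo dX dY m n j"
    using eq rix_div_mod[OF ij(1)] rix_div_mod[OF ij(2)] by auto
  have "i div dY ^ (m + n) = j div dY ^ (m + n)"
    using hi lo xyhi_div_mod(1)[OF ij(1)] xyhi_div_mod(1)[OF ij(2)] xylo_div_mod(1)[OF ij(1)] xylo_div_mod(1)[OF ij(2)]
      div_mult_mod_eq[of "i div dY ^ (m + n)" "dX ^ n"] div_mult_mod_eq[of "j div dY ^ (m + n)" "dX ^ n"] by argo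
  moreover have "i mod dY ^ (m + n) = j mod dY ^ (m + n)"
    using hi lo xyhi_div_mod(2)[OF ij(1)] xyhi_div_mod(2)[OF ij(2)] xylo_div_mod(2)[OF ij(1)] xylo_div_mod(2)[OF ij(2)]
      div_mult_mod_eq[of "i mod dY ^ (m + n)" "dY ^ n"] div_mult_mod_eq[of "j mod dY ^ (m + n)" "dY ^ n"] by argo
  ultimately show "i = j"
    using div_mult_mod_eq[of i "dY ^ (m + n)"] div_mult_mod_eq[of j "dY ^ (m + n)"] by argo
qed

definition rpm :: "nat \<Rightarrow> nat \<Rightarrow> complex mat" where
  "rpm m n = pm (dd (m + n)) (rix dX dY m n)"

lemma unitary_rpm: "unitary (dd (m + n)) (rpm m n)"
  unfolding rpm_def using rix_less rix_inj by (intro unitary_pm) auto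

lemma rpm_carrier: "rpm m n \<in> carrier_mat (dd (m + n)) (dd (m + n))"
  unfolding rpm_def by simp

lemma rpm_conj_kron:
  assumes A: "A \<in> carrier_mat (dd m) (dd m)" and B: "B \<in> carrier_mat (dd n) (dd n)"
    and i: "i < dd (m + n)" and j: "j < dd (m + n)"
  shows "(rpm m n * kron A B * adj (rpm m n)) $$ (i,j)
    = A $$ (xyhi dX dY m n i, xyhi dX dY m n j) * B $$ (xylo dX dY m n i, xylo dX dY m n j)"
proof -
  have AB: "kron A B \<in> carrier_mat (dd (m + n)) (dd (m + n))" using kron_carrier[OF A B] unfolding dd_add .
  have l: "rix dX dY m n i < dd m * dd n" "rix dX dY m n j < dd m * dd n"
    using rix_less[OF i] rix_less[OF j] unfolding dd_add by auto
  show ?thesis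
    unfolding rpm_def pm_conj_index[OF AB i j rix_less[OF i] rix_less[OF j]]
    using l A B by (simp add: rix_div_mod[OF i] rix_div_mod[OF j])
qed

lemma enc_lo: "i < dd (m + n) \<Longrightarrow> k < n \<Longrightarrow> enc dX dY n (xylo dX dY m n i) k = enc dX dY (m + n) i k"
  unfolding enc_def xylo_div_mod by (simp add: dig_mod)

lemma enc_hi: "i < dd (m + n) \<Longrightarrow> enc dX dY m (xyhi dX dY m n i) k = enc dX dY (m + n) i (n + k)"
  unfolding enc_def xyhi_div_mod by (simp add: dig_div)

text \<open>As all inputs precede all outputs in an index, \<open>JP\<close> does not split
  literally into a Kronecker product. It does after conjugation with the unitary \<open>rpm\<close>,
  and this carries multiplicativity over from states to channels.\<close>

lemma JP_add: "JP dX dY J (m + n) = rpm m n * kron (JP dX dY J m) (JP dX dY J n) * adj (rpm m n)"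
proof (rule eq_matI)
  fix i j assume "i < dim_row (rpm m n * kron (JP dX dY J m) (JP dX dY J n) * adj (rpm m n))"
    "j < dim_col (rpm m n * kron (JP dX dY J m) (JP dX dY J n) * adj (rpm m n))"
  hence ij: "i < dd (m + n)" "j < dd (m + n)" by (auto simp: rpm_def)
  have "JP dX dY J (m + n) $$ (i,j) = (\<Prod>k<n + m. J $$ (enc dX dY (m + n) i k, enc dX dY (m + n) j k))"
    using ij unfolding JP_def by (simp add: add.commute)
  also have "\<dots> = (\<Prod>k<n. J $$ (enc dX dY (m + n) i k, enc dX dY (m + n) j k))
     * (\<Prod>k<m. J $$ (enc dX dY (m + n) i (n + k), enc dX dY (m + n) j (n + k)))"
  proof -
    have "(\<Prod>k<n + m. g k) = (\<Prod>k<n. g k) * (\<Prod>k<m. g (n + k))" for g :: "nat \<Rightarrow> complex"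
      by (induction m) (auto simp: mult.assoc)
    thus ?thesis .
  qed
  also have "\<dots> = JP dX dY J n $$ (xylo dX dY m n i, xylo dX dY m n j) * JP dX dY J m $$ (xyhi dX dY m n i, xyhi dX dY m n j)"
    using xy_bounds(5,6)[OF ij(1)] xy_bounds(5,6)[OF ij(2)] unfolding JP_def
    by (simp add: enc_lo[OF ij(1)] enc_lo[OF ij(2)] enc_hi[OF ij(1)] enc_hi[OF ij(2)])
  finally show "JP dX dY J (m + n) $$ (i,j) = (rpm m n * kron (JP dX dY J m) (JP dX dY J n) * adj (rpm m n)) $$ (i,j)"
    unfolding rpm_conj_kron[OF JP_carrier JP_carrier ij] by simp
qed (auto simp: rpm_def JP_def)

lemma JP_0: "JP dX dY J 0 = 1\<^sub>m 1"
  unfolding JP_def by (rule eq_matI) auto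

lemma JP_1:
  assumes "J \<in> carrier_mat (dX * dY) (dX * dY)"
  shows "JP dX dY J 1 = J"
proof (rule eq_matI)
  fix i j assume "i < dim_row J" "j < dim_col J"
  hence ij: "i < dX * dY" "j < dX * dY" using assms by auto
  have "enc dX dY 1 l 0 = l" if "l < dX * dY" for l
    unfolding enc_def dig_def using div_mod_less[OF that] div_mult_mod_eq[of l dY] by simp
  thus "JP dX dY J 1 $$ (i,j) = J $$ (i,j)" unfolding JP_def using ij by simp
qed (use assms in \<open>auto simp: JP_def\<close>)

lemma psd_JP:
  assumes "psd (dX * dY) J"
  shows "psd (dd m) (JP dX dY J m)"
proof (induction m)
  case 0
  show ?case unfolding JP_0 by simp
next
  case (Suc m)
  have "psd (dd m * dd 1) (kron (JP dX dY J m) (JP dX dY J 1))"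
    using Suc assms JP_1[OF psdD(1)[OF assms]] by (intro psd_kron) simp_all
  hence "psd (dd (m + 1)) (kron (JP dX dY J m) (JP dX dY J 1))" unfolding dd_add .
  hence "psd (dd (m + 1)) (JP dX dY J (m + 1))" unfolding JP_add[of J m 1] by (rule psd_congr[OF _ rpm_carrier])
  thus ?case by simp
qed

text \<open>Operators on the input alone split under the same reordering, which is required for the
  roots of product input states.\<close>

lemma kron_one_add:
  assumes "W1 \<in> carrier_mat (dX ^ m) (dX ^ m)" "W2 \<in> carrier_mat (dX ^ n) (dX ^ n)"
  shows "kron (kron W1 W2) (1\<^sub>m (dY ^ (m + n)))
    = rpm m n * kron (kron W1 (1\<^sub>m (dY ^ m))) (kron W2 (1\<^sub>m (dY ^ n))) * adj (rpm m n)"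
proof (rule eq_matI)
  have c: "kron W1 (1\<^sub>m (dY ^ m)) \<in> carrier_mat (dd m) (dd m)" "kron W2 (1\<^sub>m (dY ^ n)) \<in> carrier_mat (dd n) (dd n)"
    using assms by (auto intro: kron_carrier)
  fix i j assume "i < dim_row (rpm m n * kron (kron W1 (1\<^sub>m (dY ^ m))) (kron W2 (1\<^sub>m (dY ^ n))) * adj (rpm m n))"
    "j < dim_col (rpm m n * kron (kron W1 (1\<^sub>m (dY ^ m))) (kron W2 (1\<^sub>m (dY ^ n))) * adj (rpm m n))"
  hence ij: "i < dd (m + n)" "j < dd (m + n)" by (auto simp: rpm_def)
  have l: "i div dY ^ (m + n) < dX ^ m * dX ^ n" "j div dY ^ (m + n) < dX ^ m * dX ^ n"
    using div_mod_less(1)[OF ij(1)] div_mod_less(1)[OF ij(2)] by (simp_all add: power_add)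
  note b = xy_bounds[OF ij(1)] xy_bounds[OF ij(2)]
  have one: "(1\<^sub>m (dY ^ (m + n)) :: complex mat) $$ (i mod dY ^ (m + n), j mod dY ^ (m + n))
     = 1\<^sub>m (dY ^ m) $$ (i mod dY ^ (m + n) div dY ^ n, j mod dY ^ (m + n) div dY ^ n)
     * 1\<^sub>m (dY ^ n) $$ (i mod dY ^ (m + n) mod dY ^ n, j mod dY ^ (m + n) mod dY ^ n)"
  proof -
    have "1\<^sub>m (dY ^ (m + n)) = kron (1\<^sub>m (dY ^ m)) (1\<^sub>m (dY ^ n))" by (simp add: power_add)
    moreover have "i mod dY ^ (m + n) < dY ^ m * dY ^ n" "j mod dY ^ (m + n) < dY ^ m * dY ^ n"
      using div_mod_less(2)[OF ij(1)] div_mod_less(2)[OF ij(2)] by (simp_all add: power_add)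
    ultimately show ?thesis by (simp del: kron_one)
  qed
  have "kron (kron W1 W2) (1\<^sub>m (dY ^ (m + n))) $$ (i,j)
    = kron W1 W2 $$ (i div dY ^ (m + n), j div dY ^ (m + n)) * 1\<^sub>m (dY ^ (m + n)) $$ (i mod dY ^ (m + n), j mod dY ^ (m + n))"
    using ij assms by (simp add: power_add del: index_one_mat(1))
  also have "\<dots> = kron W1 (1\<^sub>m (dY ^ m)) $$ (xyhi dX dY m n i, xyhi dX dY m n j)
     * kron W2 (1\<^sub>m (dY ^ n)) $$ (xylo dX dY m n i, xylo dX dY m n j)"
    unfolding one using l b assms
    by (simp add: xyhi_div_mod[OF ij(1)] xyhi_div_mod[OF ij(2)] xylo_div_mod[OF ij(1)] xylo_div_mod[OF ij(2)] del: index_one_mat(1))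
  finally show "kron (kron W1 W2) (1\<^sub>m (dY ^ (m + n))) $$ (i,j)
    = (rpm m n * kron (kron W1 (1\<^sub>m (dY ^ m))) (kron W2 (1\<^sub>m (dY ^ n))) * adj (rpm m n)) $$ (i,j)"
    unfolding rpm_conj_kron[OF c ij] .
qed (use assms in \<open>auto simp: rpm_def power_add\<close>)

end

section \<open>A minimax theorem\<close>

text \<open>Cyclicity turns the product into a congruence of \<open>Q\<close> by a Gram factor of
  \<open>P\<close>.\<close>

lemma trace_psd_mult_nonneg:
  assumes "psd n P" "psd n Q"
  shows "0 \<le> Re (mtrace (P * Q))"
proof -
  obtain B where B: "B \<in> carrier_mat n n" "P = B * adj B" using psd_imp_gram[OF assms(1)] by blast
  have Q: "Q \<in> carrier_mat n n" using psdD(1)[OF assms(2)] .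
  have "mtrace (P * Q) = mtrace (B * (adj B * Q))" unfolding B(2) using B Q by (simp add: mult_assoc_dim)
  also have "\<dots> = mtrace (adj B * Q * B)" using B Q by (intro mtrace_comm[of _ n n]) auto
  finally have "mtrace (P * Q) = mtrace (adj B * Q * adj (adj B))" by simp
  thus ?thesis using mtrace_psd(2)[OF psd_congr[OF assms(2) adj_carrier[OF B(1)]]] by simp
qed

lemma mult_minus_right: "dim_col A = dim_row B \<Longrightarrow> dim_row B = dim_row C \<Longrightarrow> dim_col B = dim_col C \<Longrightarrow>
  (A :: complex mat) * (B - C) = A * B - A * C"
  by (rule mult_minus_distrib_mat[of _ "dim_row A" "dim_row B" _ "dim_col B"]) auto

lemma mtrace_minus: "A \<in> carrier_mat n n \<Longrightarrow> B \<in> carrier_mat n n \<Longrightarrow> mtrace (A - B) = mtrace A - mtrace B"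
  unfolding mtrace_def by (simp add: sum_subtractf)

lemma trace_mult_mono:
  assumes "psd n P" "loewner_le n X Y"
  shows "Re (mtrace (P * X)) \<le> Re (mtrace (P * Y))"
proof -
  have c: "P \<in> carrier_mat n n" "X \<in> carrier_mat n n" "Y \<in> carrier_mat n n" and p: "psd n (Y - X)"
    using assms psdD(1) unfolding loewner_le_def by auto
  have "0 \<le> Re (mtrace (P * (Y - X)))" by (rule trace_psd_mult_nonneg[OF assms(1) p])
  also have "mtrace (P * (Y - X)) = mtrace (P * Y) - mtrace (P * X)"
    using c by (simp add: mult_minus_right mtrace_minus[of _ n])
  finally show ?thesis by simp
qed

definition colmat :: "nat \<Rightarrow> complex vec \<Rightarrow> complex mat" where
  "colmat n v = mat n 1 (\<lambda>(i,j). v $ i)"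

lemma colmat_carrier [simp]: "colmat n v \<in> carrier_mat n 1" unfolding colmat_def by simp

lemma qf_trace:
  assumes "A \<in> carrier_mat n n" "v \<in> carrier_vec n"
  shows "qf A v = Re (mtrace (colmat n v * adj (colmat n v) * A))"
proof -
  have "mtrace (colmat n v * adj (colmat n v) * A)
     = (\<Sum>i<n. \<Sum>j<n. v $ i * cnj (v $ j) * A $$ (j,i))"
    unfolding mtrace_def using assms
    by (simp add: index_mult_sum colmat_def del: index_mult_mat(1))
  also have "\<dots> = (\<Sum>j<n. \<Sum>i<n. cnj (v $ j) * A $$ (j,i) * v $ i)"
    by (subst sum.swap) (simp add: mult_ac)
  finally show ?thesis unfolding qf_sum[OF assms] by simp
qed

lemma mult_add_right: "dim_col A = dim_row B \<Longrightarrow> dim_row B = dim_row C \<Longrightarrow> dim_col B = dim_col C \<Longrightarrow>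
  (A :: complex mat) * (B + C) = A * B + A * C"
  by (rule mult_add_distrib_mat[of _ "dim_row A" "dim_row B" _ "dim_col B"]) auto

lemma mult_smult_right: "dim_col A = dim_row B \<Longrightarrow> (A :: complex mat) * (c \<cdot>\<^sub>m B) = c \<cdot>\<^sub>m (A * B)"
  by (rule mult_smult_distrib[of _ "dim_row A" "dim_row B" _ "dim_col B"]) auto

lemma mult_add_left: "dim_col A = dim_row C \<Longrightarrow> dim_row A = dim_row B \<Longrightarrow> dim_col A = dim_col B \<Longrightarrow>
  ((A :: complex mat) + B) * C = A * C + B * C"
  by (rule add_mult_distrib_mat[of _ "dim_row A" "dim_col A" _ _ "dim_col C"]) auto

lemma mult_smult_left: "dim_col A = dim_row B \<Longrightarrow> (c \<cdot>\<^sub>m (A :: complex mat)) * B = c \<cdot>\<^sub>m (A * B)"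
  by (rule mult_smult_assoc_mat[of _ "dim_row A" "dim_col A" _ "dim_col B"]) auto

text \<open>\<open>p\<close> is the point of minimal norm in the closure of the convex set \<open>S\<close>.\<close>
lemma min_norm_point:
  fixes S :: "('i \<Rightarrow> real) set"
  assumes I: "finite I" and ne: "S \<noteq> {}"
    and conv: "\<And>x y t. x \<in> S \<Longrightarrow> y \<in> S \<Longrightarrow> 0 \<le> t \<Longrightarrow> t \<le> 1 \<Longrightarrow> (\<lambda>i. (1 - t) * x i + t * y i) \<in> S"
  obtains p c where "\<forall>k::nat. c k \<in> S" "\<forall>i\<in>I. (\<lambda>k. c k i) \<longlonglongrightarrow> p i"
    "\<forall>x\<in>S. (\<Sum>i\<in>I. (p i)\<^sup>2) \<le> (\<Sum>i\<in>I. p i * x i)"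
proof -
  define N where "N x = (\<Sum>i\<in>I. (x i)\<^sup>2)" for x :: "'i \<Rightarrow> real"
  define \<delta> where "\<delta> = Inf (N ` S)"
  have N0: "0 \<le> N x" for x unfolding N_def by (simp add: sum_nonneg)
  have bdd: "bdd_below (N ` S)" using N0 by (intro bdd_belowI[of _ 0]) auto
  have \<delta>le: "\<delta> \<le> N x" if "x \<in> S" for x unfolding \<delta>_def using that bdd by (intro cInf_lower) auto
  have "\<exists>x\<in>S. N x < \<delta> + 1 / real (Suc k)" for k
  proof -
    have "\<delta> < \<delta> + 1 / real (Suc k)" by simp
    thus ?thesis unfolding \<delta>_def using ne by (subst (asm) cInf_less_iff[OF _ bdd]) auto
  qed
  hence "\<forall>k. \<exists>x. x \<in> S \<and> N x < \<delta> + 1 / real (Suc k)" by blast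
  from choice[OF this] obtain c where c: "\<forall>k. c k \<in> S \<and> N (c k) < \<delta> + 1 / real (Suc k)" by blast
  \<comment> \<open>The parallelogram identity. The midpoint lies in \<open>S\<close>, so its norm
    is bounded below, which forces near-minimizers to be close and the sequence to be
    Cauchy.\<close>
  have par: "N (\<lambda>i. x i - y i) = 2 * N x + 2 * N y - 4 * N (\<lambda>i. (1 - 1/2) * x i + 1/2 * y i)" for x y
  proof -
    have "(x i - y i)\<^sup>2 = 2 * (x i)\<^sup>2 + 2 * (y i)\<^sup>2 - 4 * ((1 - 1/2) * x i + 1/2 * y i)\<^sup>2" for i
      by (simp add: power2_eq_square field_simps)
    thus ?thesis unfolding N_def by (simp only: sum.distrib sum_subtractf sum_distrib_left)
  qed
  have close: "N (\<lambda>i. c k i - c l i) \<le> 4 / real (Suc n)" if "n \<le> k" "n \<le> l" for k l n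
  proof -
    have "\<delta> \<le> N (\<lambda>i. (1 - 1/2) * c k i + 1/2 * c l i)" using c by (intro \<delta>le conv) auto
    moreover have "1 / real (Suc k) \<le> 1 / real (Suc n)" "1 / real (Suc l) \<le> 1 / real (Suc n)"
      using that by (auto intro!: divide_left_mono)
    moreover have "N (c k) < \<delta> + 1 / real (Suc k)" "N (c l) < \<delta> + 1 / real (Suc l)" using c by auto
    ultimately have "N (\<lambda>i. c k i - c l i) \<le> 4 * (1 / real (Suc n))" unfolding par by linarith
    thus ?thesis by simp
  qed
  have "convergent (\<lambda>k. c k i)" if i: "i \<in> I" for i
  proof (rule Cauchy_convergent, rule metric_CauchyI)
    fix e :: real assume e: "0 < e"
    obtain n where "4 / e\<^sup>2 < real n" using reals_Archimedean2 by blast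
    hence n: "4 / e\<^sup>2 < real (Suc n)" by simp
    have n': "4 / real (Suc n) < e\<^sup>2" using n e by (simp add: field_simps)
    show "\<exists>M. \<forall>k\<ge>M. \<forall>l\<ge>M. dist (c k i) (c l i) < e"
    proof (intro exI allI impI)
      fix k l assume kl: "n \<le> k" "n \<le> l"
      have "(c k i - c l i)\<^sup>2 \<le> N (\<lambda>i. c k i - c l i)"
        unfolding N_def using I i by (intro member_le_sum[of i I "\<lambda>i. (c k i - c l i)\<^sup>2"]) auto
      hence "\<bar>c k i - c l i\<bar>\<^sup>2 < e\<^sup>2" using close[OF kl] n' by simp
      hence "\<bar>c k i - c l i\<bar> < e" by (rule power2_less_imp_less) (use e in simp)
      thus "dist (c k i) (c l i) < e" by (simp add: dist_real_def)
    qed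
  qed
  define p where "p i = lim (\<lambda>k. c k i)" for i
  have lim: "(\<lambda>k. c k i) \<longlonglongrightarrow> p i" if "i \<in> I" for i
    unfolding p_def using \<open>\<And>i. i \<in> I \<Longrightarrow> convergent (\<lambda>k. c k i)\<close>[OF that] by (simp add: convergent_LIMSEQ_iff)
  have Nlim: "(\<lambda>k. N (c k)) \<longlonglongrightarrow> N p" unfolding N_def by (intro tendsto_intros lim)
  have "N p \<le> \<delta>"
  proof (rule LIMSEQ_le[OF Nlim])
    have "(\<lambda>k. \<delta> + 1 / real (Suc k)) \<longlonglongrightarrow> \<delta> + 0"
      by (intro tendsto_add tendsto_const) (rule LIMSEQ_Suc[OF lim_1_over_n])
    thus "(\<lambda>k. \<delta> + 1 / real (Suc k)) \<longlonglongrightarrow> \<delta>" by simp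
    show "\<exists>M. \<forall>k\<ge>M. N (c k) \<le> \<delta> + 1 / real (Suc k)" using c less_imp_le by blast
  qed
  have main: "N p \<le> (\<Sum>i\<in>I. p i * x i)" if x: "x \<in> S" for x
  proof -
    \<comment> \<open>Moving from \<open>p\<close> a fraction \<open>t\<close> towards
      \<open>x\<close> cannot go below the minimal norm. After division by \<open>t\<close>, letting
      it tend to 0 leaves the first-order term.\<close>
    have step: "0 \<le> 2 * ((\<Sum>i\<in>I. p i * x i) - N p) + t * N (\<lambda>i. x i - p i)" if t: "0 < t" "t \<le> 1" for t
    proof -
      have "(\<lambda>k. N (\<lambda>i. (1 - t) * c k i + t * x i)) \<longlonglongrightarrow> N (\<lambda>i. (1 - t) * p i + t * x i)"
        unfolding N_def by (intro tendsto_intros lim)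
      moreover have "\<delta> \<le> N (\<lambda>i. (1 - t) * c k i + t * x i)" for k
        using c x t by (intro \<delta>le conv) auto
      ultimately have "\<delta> \<le> N (\<lambda>i. (1 - t) * p i + t * x i)"
        by (intro LIMSEQ_le_const) auto
      also have "\<dots> = N p + t * (2 * ((\<Sum>i\<in>I. p i * x i) - N p) + t * N (\<lambda>i. x i - p i))"
      proof -
        have "((1 - t) * p i + t * x i)\<^sup>2 = (p i)\<^sup>2 + (2 * t) * (p i * x i) - (2 * t) * (p i)\<^sup>2 + (t * t) * (x i - p i)\<^sup>2" for i
          by (simp add: power2_eq_square algebra_simps)
        hence "N (\<lambda>i. (1 - t) * p i + t * x i)
          = N p + (2 * t) * (\<Sum>i\<in>I. p i * x i) - (2 * t) * N p + (t * t) * N (\<lambda>i. x i - p i)"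
          unfolding N_def by (simp only: sum.distrib sum_subtractf sum_distrib_left)
        thus ?thesis by (simp add: algebra_simps)
      qed
      finally have "0 \<le> t * (2 * ((\<Sum>i\<in>I. p i * x i) - N p) + t * N (\<lambda>i. x i - p i))"
        using \<open>N p \<le> \<delta>\<close> by linarith
      thus ?thesis using t by (simp add: zero_le_mult_iff)
    qed
    have "((\<lambda>t. 2 * ((\<Sum>i\<in>I. p i * x i) - N p) + t * N (\<lambda>i. x i - p i))
      \<longlongrightarrow> 2 * ((\<Sum>i\<in>I. p i * x i) - N p) + 0 * N (\<lambda>i. x i - p i)) (at_right 0)"
      by (intro tendsto_intros)
    moreover have "eventually (\<lambda>t. 0 \<le> 2 * ((\<Sum>i\<in>I. p i * x i) - N p) + t * N (\<lambda>i. x i - p i)) (at_right 0)"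
      using step by (auto simp: eventually_at_right_field intro: exI[of _ 1])
    ultimately have "0 \<le> 2 * ((\<Sum>i\<in>I. p i * x i) - N p) + 0 * N (\<lambda>i. x i - p i)"
      by (intro tendsto_lowerbound[where F = "at_right 0"]) (auto simp: trivial_limit_at_right_real)
    thus ?thesis by simp
  qed
  show ?thesis
    by (rule that[of c p]) (use c lim main in \<open>auto simp: N_def\<close>)
qed

text \<open>Coordinates of a matrix as a real vector, so that \<open>min_norm_point\<close> applies.\<close>
definition reval :: "nat \<Rightarrow> complex mat \<Rightarrow> nat \<times> nat \<times> bool \<Rightarrow> real" where
  "reval n A = (\<lambda>(i,j,b). if i < n \<and> j < n then if b then Re (A $$ (i,j)) else Im (A $$ (i,j)) else 0)"

text \<open>For Hermitian \<open>P\<close> the Euclidean product of the coordinates is the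
  Hilbert-Schmidt product.\<close>

lemma sum_reval:
  assumes "hermitian P" "P \<in> carrier_mat n n" "A \<in> carrier_mat n n"
  shows "(\<Sum>q\<in>{..<n} \<times> {..<n} \<times> UNIV. reval n P q * reval n A q) = Re (mtrace (P * A))"
proof -
  have "(\<Sum>q\<in>{..<n} \<times> {..<n} \<times> UNIV. reval n P q * reval n A q)
     = (\<Sum>i<n. \<Sum>j<n. Re (P $$ (i,j)) * Re (A $$ (i,j)) + Im (P $$ (i,j)) * Im (A $$ (i,j)))"
    unfolding sum.cartesian_product' by (intro sum.cong refl) (auto simp: reval_def UNIV_bool)
  also have "\<dots> = (\<Sum>i<n. \<Sum>j<n. Re (P $$ (j,i) * A $$ (i,j)))"
  proof (intro sum.cong refl)
    fix i j assume "i \<in> {..<n}" "j \<in> {..<n}"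
    hence "P $$ (j,i) = cnj (P $$ (i,j))" by (intro hermitian_entry[OF assms(1,2)]) auto
    thus "Re (P $$ (i,j)) * Re (A $$ (i,j)) + Im (P $$ (i,j)) * Im (A $$ (i,j)) = Re (P $$ (j,i) * A $$ (i,j))" by simp
  qed
  also have "\<dots> = Re (mtrace (P * A))"
    unfolding mtrace_def using assms(2,3)
    by (subst sum.swap) (simp add: index_mult_sum del: index_mult_mat(1) times_complex.sel)
  finally show ?thesis .
qed

lemma qf_le_entries:
  assumes A: "A \<in> carrier_mat n n" and v: "v \<in> carrier_vec n"
    and e: "\<And>i j. i < n \<Longrightarrow> j < n \<Longrightarrow> cmod (A $$ (i,j)) \<le> e" and e0: "0 \<le> e"
  shows "qf A v \<le> real n * e * sqn v"
proof -
  have "qf A v \<le> cmod (\<Sum>i<n. \<Sum>j<n. cnj (v $ i) * A $$ (i,j) * v $ j)"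
    unfolding qf_sum[OF A v] by (rule complex_Re_le_cmod)
  also have "\<dots> \<le> (\<Sum>i<n. \<Sum>j<n. cmod (cnj (v $ i) * A $$ (i,j) * v $ j))"
    by (intro order_trans[OF norm_sum] sum_mono norm_sum)
  also have "\<dots> \<le> (\<Sum>i<n. \<Sum>j<n. e * (cmod (v $ i) * cmod (v $ j)))"
  proof (intro sum_mono)
    fix i j assume "i \<in> {..<n}" "j \<in> {..<n}"
    hence "cmod (A $$ (i,j)) * (cmod (v $ i) * cmod (v $ j)) \<le> e * (cmod (v $ i) * cmod (v $ j))"
      using e by (intro mult_right_mono) auto
    thus "cmod (cnj (v $ i) * A $$ (i,j) * v $ j) \<le> e * (cmod (v $ i) * cmod (v $ j))"
      by (simp add: norm_mult mult_ac)
  qed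
  also have "\<dots> = e * (\<Sum>i<n. cmod (v $ i))\<^sup>2"
    unfolding power2_eq_square sum_product by (simp only: sum_distrib_left)
  also have "\<dots> \<le> e * ((\<Sum>i<n. (cmod (v $ i))\<^sup>2) * real n)"
    using sum_squared_le_sum_of_squares[of "\<lambda>i. cmod (v $ i)" "{..<n}"] e0 by (intro mult_left_mono) auto
  also have "\<dots> = real n * e * sqn v" unfolding sqn_def using v by simp
  finally show ?thesis .
qed

text \<open>If no \<open>X\<close> is below \<open>T\<close> approximately, the point of minimal norm of the set of all \<open>X + R - T\<close> with \<open>R\<close>
  positive semidefinite is a nonzero positive semidefinite \<open>P\<close>, and a full-rank perturbation of the
  state proportional to \<open>P\<close> violates the hypothesis.\<close>
lemma minimax:
  fixes C :: "complex mat set"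
  assumes n: "0 < n" and C: "\<And>X. X \<in> C \<Longrightarrow> psd n X"
    and conv: "\<And>X Y t. X \<in> C \<Longrightarrow> Y \<in> C \<Longrightarrow> 0 \<le> t \<Longrightarrow> t \<le> 1 \<Longrightarrow>
      complex_of_real (1 - t) \<cdot>\<^sub>m X + complex_of_real t \<cdot>\<^sub>m Y \<in> C"
    and H: "\<And>\<omega> \<eta> \<epsilon>. psd n \<omega> \<Longrightarrow> Re (mtrace \<omega>) = 1 \<Longrightarrow> 0 < \<eta> \<Longrightarrow> (\<And>v. v \<in> carrier_vec n \<Longrightarrow> \<eta> * sqn v \<le> qf \<omega> v) \<Longrightarrow>
      0 < \<epsilon> \<Longrightarrow> \<exists>X\<in>C. Re (mtrace (\<omega> * X)) \<le> T + \<epsilon>"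
    and \<epsilon>: "0 < \<epsilon>"
  shows "\<exists>X\<in>C. loewner_le n X (complex_of_real (T + \<epsilon>) \<cdot>\<^sub>m 1\<^sub>m n)"
proof -
  let ?I = "{..<n} \<times> {..<n} \<times> (UNIV :: bool set)"
  define sh where "sh X R = X + R - complex_of_real T \<cdot>\<^sub>m 1\<^sub>m n" for X R
  define S where "S = {reval n (sh X R) | X R. X \<in> C \<and> psd n R}"
  have shc: "sh X R \<in> carrier_mat n n" "hermitian (sh X R)" if "X \<in> C" "psd n R" for X R
    using psdD[OF C[OF that(1)]] psdD[OF that(2)] unfolding sh_def
    by (auto intro!: hermitian_minus hermitian_add hermitian_smult)
  have trs: "Re (mtrace (P * sh X R)) = Re (mtrace (P * X)) + Re (mtrace (P * R)) - T * Re (mtrace P)"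
    if "X \<in> C" "psd n R" "P \<in> carrier_mat n n" for P X R
    using psdD(1)[OF C[OF that(1)]] psdD(1)[OF that(2)] that(3) unfolding sh_def
    by (simp add: mult_minus_right mult_add_right mult_smult_right mtrace_minus[of _ n] mtrace_add[of _ n] mtrace_smult
       right_mult_one_mat[of _ n n])
  \<comment> \<open>The maximally mixed state. It supplies an element of \<open>C\<close> and later
    the full-rank perturbation.\<close>
  let ?u = "complex_of_real (1 / real n) \<cdot>\<^sub>m 1\<^sub>m n"
  have up: "psd n ?u" by (intro psd_smult psd_one) auto
  have tr1: "mtrace (1\<^sub>m n) = of_nat n" unfolding mtrace_def by simp
  have tru: "Re (mtrace ?u) = 1" using n by (simp add: mtrace_smult tr1)
  have uq: "qf ?u v = 1 / real n * sqn v" if "v \<in> carrier_vec n" for v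
    using that by (simp only: qf_smult[OF one_carrier_mat that] qf_one)
  obtain X0 where X0: "X0 \<in> C"
    using H[OF up tru, of "1 / real n" 1] uq n by fastforce
  have Sne: "S \<noteq> {}" unfolding S_def using X0 psd_zero by blast
  have Sconv: "(\<lambda>q. (1 - t) * x q + t * y q) \<in> S" if xy: "x \<in> S" "y \<in> S" and t: "0 \<le> t" "t \<le> 1" for x y t
  proof -
    obtain X R where x: "x = reval n (sh X R)" "X \<in> C" "psd n R" using xy(1) unfolding S_def by blast
    obtain Y Q where y: "y = reval n (sh Y Q)" "Y \<in> C" "psd n Q" using xy(2) unfolding S_def by blast
    let ?c = "\<lambda>A B. complex_of_real (1 - t) \<cdot>\<^sub>m A + complex_of_real t \<cdot>\<^sub>m B"
    have Z: "?c X Y \<in> C" "psd n (?c R Q)"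
      by (rule conv[OF x(2) y(2) t]) (intro psd_add psd_smult x(3) y(3); use t in simp)
    note c = psdD(1)[OF C[OF x(2)]] psdD(1)[OF C[OF y(2)]] psdD(1)[OF x(3)] psdD(1)[OF y(3)]
    have "sh (?c X Y) (?c R Q) = ?c (sh X R) (sh Y Q)"
      unfolding sh_def using c by (intro eq_matI) (auto simp: algebra_simps)
    moreover have "reval n (?c (sh X R) (sh Y Q)) = (\<lambda>q. (1 - t) * x q + t * y q)"
      using shc(1)[OF x(2,3)] shc(1)[OF y(2,3)] unfolding x(1) y(1) by (auto simp: reval_def fun_eq_iff)
    ultimately show ?thesis unfolding S_def using Z by (intro CollectI exI[of _ "?c X Y"] exI[of _ "?c R Q"]) simp
  qed
  have fin: "finite ?I" by simp
  obtain p c where *: "\<forall>k::nat. c k \<in> S" "\<forall>q\<in>?I. (\<lambda>k. c k q) \<longlonglongrightarrow> p q"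
    "\<forall>x\<in>S. (\<Sum>q\<in>?I. (p q)\<^sup>2) \<le> (\<Sum>q\<in>?I. p q * x q)"
    by (rule min_norm_point[OF fin Sne Sconv]) blast
  have cS: "c k \<in> S" for k using *(1) by blast
  have clim: "(\<lambda>k. c k q) \<longlonglongrightarrow> p q" if "q \<in> ?I" for q using *(2) that by blast
  have pmin: "(\<Sum>q\<in>?I. (p q)\<^sup>2) \<le> (\<Sum>q\<in>?I. p q * x q)" if "x \<in> S" for x using *(3) that by blast
  have "\<forall>k. \<exists>Z. c k = reval n (sh (fst Z) (snd Z)) \<and> fst Z \<in> C \<and> psd n (snd Z)"
    using cS unfolding S_def by fastforce
  from choice[OF this] obtain Z
    where Z: "\<forall>k. c k = reval n (sh (fst (Z k)) (snd (Z k))) \<and> fst (Z k) \<in> C \<and> psd n (snd (Z k))" by blast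
  define Q where "Q k = sh (fst (Z k)) (snd (Z k))" for k
  have Qc: "Q k \<in> carrier_mat n n" "hermitian (Q k)" for k unfolding Q_def using shc Z by auto
  have cQ: "c k = reval n (Q k)" for k using Z unfolding Q_def by simp
  define P where "P = mat n n (\<lambda>(i,j). Complex (p (i,j,True)) (p (i,j,False)))"
  have Pc: "P \<in> carrier_mat n n" unfolding P_def by simp
  have Pp: "reval n P q = p q" if "q \<in> ?I" for q
    using that unfolding P_def reval_def by (auto split: prod.splits)
  have Qlim: "(\<lambda>k. Q k $$ (i,j)) \<longlonglongrightarrow> P $$ (i,j)" if ij: "i < n" "j < n" for i j
  proof -
    have "(\<lambda>k. Complex (c k (i,j,True)) (c k (i,j,False))) \<longlonglongrightarrow> Complex (p (i,j,True)) (p (i,j,False))"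
      using ij by (intro tendsto_Complex clim) auto
    moreover have "Complex (c k (i,j,True)) (c k (i,j,False)) = Q k $$ (i,j)" for k
      unfolding cQ reval_def using ij by simp
    ultimately show ?thesis unfolding P_def using ij by simp
  qed
  have Ph: "hermitian P" unfolding hermitian_def
  proof (rule eq_matI)
    fix i j assume "i < dim_row (adj P)" "j < dim_col (adj P)"
    hence ij: "i < n" "j < n" using Pc by auto
    have "Q k $$ (i,j) = cnj (Q k $$ (j,i))" for k by (rule hermitian_entry[OF Qc(2,1) ij(2,1)])
    hence "(\<lambda>k. Q k $$ (i,j)) \<longlonglongrightarrow> cnj (P $$ (j,i))" using tendsto_cnj[OF Qlim[OF ij(2,1)]] by simp
    hence "P $$ (i,j) = cnj (P $$ (j,i))" using LIMSEQ_unique[OF Qlim[OF ij]] by blast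
    thus "P $$ (i,j) = adj P $$ (i,j)" using ij Pc by simp
  qed (use Pc in auto)
  define N where "N = (\<Sum>q\<in>?I. (p q)\<^sup>2)"
  have NP: "N = Re (mtrace (P * P))"
    unfolding N_def sum_reval[OF Ph Pc Pc, symmetric] by (intro sum.cong refl) (simp add: Pp power2_eq_square)
  have main: "N \<le> Re (mtrace (P * X)) + Re (mtrace (P * R)) - T * Re (mtrace P)" if "X \<in> C" "psd n R" for X R
  proof -
    have "N \<le> (\<Sum>q\<in>?I. p q * reval n (sh X R) q)"
      unfolding N_def using that by (intro pmin) (auto simp: S_def)
    also have "\<dots> = (\<Sum>q\<in>?I. reval n P q * reval n (sh X R) q)" by (intro sum.cong refl) (simp add: Pp)
    also have "\<dots> = Re (mtrace (P * sh X R))" by (rule sum_reval[OF Ph Pc shc(1)[OF that]])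
    finally show ?thesis unfolding trs[OF that Pc] .
  qed
  have N0: "0 \<le> N" unfolding N_def by (simp add: sum_nonneg)
  have Ppsd: "psd n P" unfolding psd_iff
  proof (intro conjI ballI Pc Ph)
    fix v :: "complex vec" assume v: "v \<in> carrier_vec n"
    let ?V = "colmat n v * adj (colmat n v)"
    have V: "psd n ?V" by (rule psd_gram[OF colmat_carrier])
    have Vc: "?V \<in> carrier_mat n n" using psdD(1)[OF V] .
    have tv: "Re (mtrace (P * (complex_of_real s \<cdot>\<^sub>m ?V))) = s * qf P v" for s
      using Pc Vc mtrace_comm[OF Pc Vc] qf_trace[OF Pc v] by (simp add: mult_smult_right mtrace_smult)
    show "0 \<le> qf P v"
    proof (rule ccontr)
      assume "\<not> 0 \<le> qf P v"
      hence neg: "qf P v < 0" by simp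
      \<comment> \<open>A large multiple of a rank-one operator on which \<open>P\<close> is
        negative would push the linear functional below its lower bound \<open>N\<close>.\<close>
      define K where "K = Re (mtrace (P * X0)) - T * Re (mtrace P)"
      define s where "s = (\<bar>K\<bar> + 1) / (- qf P v)"
      have s: "0 \<le> s" unfolding s_def using neg by (intro divide_nonneg_pos) auto
      have "s * qf P v = - (\<bar>K\<bar> + 1)" unfolding s_def using neg by simp
      hence "N \<le> K - (\<bar>K\<bar> + 1)" using main[OF X0 psd_smult[OF V s]] unfolding tv K_def by simp
      thus False using N0 by linarith
    qed
  qed
  have P0: "psd n (0\<^sub>m n n)" by simp
  have mainX: "N + T * Re (mtrace P) \<le> Re (mtrace (P * X))" if "X \<in> C" for X
  proof -
    have "P * 0\<^sub>m n n = 0\<^sub>m n n" using Pc by simp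
    thus ?thesis using main[OF that P0] by (simp add: mtrace_def)
  qed
  show ?thesis
  proof (cases "N = 0")
    case False
    hence Npos: "0 < N" using N0 by simp
    define tP where "tP = Re (mtrace P)"
    \<comment> \<open>\<open>N\<close> is the trace of \<open>P * P\<close>, at most
      \<open>K\<close> times the trace of \<open>P\<close>.\<close>
    have tP: "0 < tP"
    proof -
      obtain K where K: "0 \<le> K" "\<forall>v\<in>carrier_vec n. qf P v \<le> K * sqn v"
        by (rule qf_bound[OF Ph Pc]) blast
      have "loewner_le n P (complex_of_real K \<cdot>\<^sub>m 1\<^sub>m n)"
        unfolding loewner_psd_iff[OF Ppsd psd_smult[OF psd_one K(1)]]
      proof (intro ballI)
        fix v :: "complex vec" assume v: "v \<in> carrier_vec n"
        show "qf P v \<le> qf (complex_of_real K \<cdot>\<^sub>m 1\<^sub>m n) v"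
          unfolding qf_smult[OF one_carrier_mat v] qf_one[OF v] using K(2) v by blast
      qed
      hence "N \<le> Re (mtrace (P * (complex_of_real K \<cdot>\<^sub>m 1\<^sub>m n)))"
        unfolding NP by (rule trace_mult_mono[OF Ppsd])
      also have "\<dots> = K * tP" using Pc unfolding tP_def by (simp add: mult_smult_right mtrace_smult)
      finally have "0 < K * tP" using Npos by simp
      thus ?thesis using K(1) mtrace_psd(2)[OF Ppsd] unfolding tP_def by (simp add: zero_less_mult_iff)
    qed
    \<comment> \<open>For the state proportional to \<open>P\<close>, every \<open>X\<close> in
      \<open>C\<close> has value at least \<open>T + \<kappa>\<close>. The admixture of weight
      \<open>\<eta>\<close> costs at most \<open>\<kappa> / 4\<close>, and \<open>H\<close> is
      applied with slack \<open>\<kappa> / 4\<close>, which still contradicts this lower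
      bound.\<close>
    define \<kappa> where "\<kappa> = N / tP"
    have \<kappa>: "0 < \<kappa>" unfolding \<kappa>_def using Npos tP by simp
    define A where "A = \<bar>\<kappa> + T\<bar> + 1"
    have A: "0 < A" "\<kappa> + T \<le> A" unfolding A_def by linarith+
    define \<eta> where "\<eta> = min (1/2) (\<kappa> / (4 * A))"
    have "0 < \<kappa> / (4 * A)" using \<kappa> A by simp
    hence \<eta>: "0 < \<eta>" "\<eta> < 1" "\<eta> \<le> \<kappa> / (4 * A)" unfolding \<eta>_def by auto
    have \<eta>T: "\<eta> * (\<kappa> + T) \<le> \<kappa> / 4"
    proof -
      have "\<eta> * (\<kappa> + T) \<le> \<eta> * A" using \<eta>(1) A(2) by (intro mult_left_mono) auto
      also have "\<dots> \<le> \<kappa> / (4 * A) * A" using \<eta>(3) A(1) by (intro mult_right_mono) auto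
      also have "\<dots> = \<kappa> / 4" using A(1) by simp
      finally show ?thesis .
    qed
    define \<omega> where "\<omega> = complex_of_real ((1 - \<eta>) / tP) \<cdot>\<^sub>m P + complex_of_real \<eta> \<cdot>\<^sub>m ?u"
    have \<omega>: "psd n \<omega>" unfolding \<omega>_def using \<eta> tP by (intro psd_add psd_smult Ppsd up) auto
    have tu: "Re (mtrace \<omega>) = 1"
      unfolding \<omega>_def using Pc tP tru by (simp add: mtrace_add[of _ n] mtrace_smult tP_def[symmetric])
    have pd: "\<eta> / real n * sqn v \<le> qf \<omega> v" if v: "v \<in> carrier_vec n" for v
    proof -
      have "qf \<omega> v = (1 - \<eta>) / tP * qf P v + \<eta> * (1 / real n * sqn v)"
      proof -
        have c: "complex_of_real ((1 - \<eta>) / tP) \<cdot>\<^sub>m P \<in> carrier_mat n n" "complex_of_real \<eta> \<cdot>\<^sub>m ?u \<in> carrier_mat n n"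
          using Pc by simp_all
        show ?thesis unfolding \<omega>_def qf_add[OF c v] qf_smult[OF Pc v] qf_smult[OF psdD(1)[OF up] v] uq[OF v] ..
      qed
      moreover have "0 \<le> (1 - \<eta>) / tP * qf P v" using \<eta> tP psdD(3)[OF Ppsd v] by simp
      ultimately show ?thesis by simp
    qed
    obtain X where X: "X \<in> C" "Re (mtrace (\<omega> * X)) \<le> T + \<kappa> / 4"
      using H[OF \<omega> tu _ pd, of "\<kappa> / 4"] \<eta> n \<kappa> by auto
    have Xc: "X \<in> carrier_mat n n" using psdD(1)[OF C[OF X(1)]] .
    have "\<omega> * X = complex_of_real ((1 - \<eta>) / tP) \<cdot>\<^sub>m (P * X) + complex_of_real \<eta> \<cdot>\<^sub>m (?u * X)"
      unfolding \<omega>_def using Pc Xc by (simp add: mult_add_left mult_smult_left)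
    hence "Re (mtrace (\<omega> * X)) = (1 - \<eta>) / tP * Re (mtrace (P * X)) + \<eta> * Re (mtrace (?u * X))"
      using Pc Xc by (simp add: mtrace_add[of _ n] mtrace_smult del: of_real_divide)
    moreover have "0 \<le> \<eta> * Re (mtrace (?u * X))"
      using \<eta> trace_psd_mult_nonneg[OF up C[OF X(1)]] by simp
    moreover have "(1 - \<eta>) / tP * (N + T * tP) \<le> (1 - \<eta>) / tP * Re (mtrace (P * X))"
      using \<eta> tP mainX[OF X(1)] unfolding tP_def by (intro mult_left_mono) auto
    moreover have "(1 - \<eta>) / tP * (N + T * tP) = (1 - \<eta>) * (\<kappa> + T)"
      unfolding \<kappa>_def using tP by (simp add: field_simps)
    ultimately have "(1 - \<eta>) * (\<kappa> + T) \<le> T + \<kappa> / 4" using X(2) by linarith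
    hence "\<kappa> + T - \<eta> * (\<kappa> + T) \<le> T + \<kappa> / 4" by (simp add: algebra_simps)
    hence False using \<eta>T \<kappa> by linarith
    thus ?thesis ..
  next
    case True
    have p0: "p q = 0" if "q \<in> ?I" for q
      using True that unfolding N_def by (subst (asm) sum_nonneg_eq_0_iff) auto
    \<comment> \<open>Real and imaginary parts below \<open>e\<close> give entries of modulus at
      most \<open>\<epsilon> / real n\<close>, hence a quadratic form of at most
      \<open>\<epsilon> * sqn v\<close>.\<close>
    define e where "e = \<epsilon> / (2 * real n)"
    have e: "0 < e" unfolding e_def using \<epsilon> n by simp
    have "eventually (\<lambda>k. \<bar>c k q\<bar> < e) sequentially" if q: "q \<in> ?I" for q
      using tendstoD[OF clim[OF q] e] unfolding p0[OF q] by (simp add: dist_real_def)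
    hence "eventually (\<lambda>k. \<forall>q\<in>?I. \<bar>c k q\<bar> < e) sequentially"
      by (intro eventually_ball_finite) auto
    then obtain k where k: "\<forall>q\<in>?I. \<bar>c k q\<bar> < e" unfolding eventually_sequentially by blast
    have ent: "cmod (Q k $$ (i,j)) \<le> \<epsilon> / real n" if ij: "i < n" "j < n" for i j
    proof -
      have "\<bar>c k (i,j,True)\<bar> < e" "\<bar>c k (i,j,False)\<bar> < e" using k ij by auto
      hence "\<bar>Re (Q k $$ (i,j))\<bar> < e" "\<bar>Im (Q k $$ (i,j))\<bar> < e"
        using ij unfolding cQ by (auto simp: reval_def)
      moreover have "cmod (Q k $$ (i,j)) \<le> \<bar>Re (Q k $$ (i,j))\<bar> + \<bar>Im (Q k $$ (i,j))\<bar>" by (rule cmod_le)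
      moreover have "e + e = \<epsilon> / real n" unfolding e_def by simp
      ultimately show ?thesis by linarith
    qed
    define X where "X = fst (Z k)"
    have X: "X \<in> C" "psd n (snd (Z k))" unfolding X_def using Z by auto
    have Xc: "X \<in> carrier_mat n n" "snd (Z k) \<in> carrier_mat n n" using psdD(1)[OF C[OF X(1)]] psdD(1)[OF X(2)] .
    have one: "complex_of_real s \<cdot>\<^sub>m 1\<^sub>m n \<in> carrier_mat n n" "hermitian (complex_of_real s \<cdot>\<^sub>m 1\<^sub>m n)" for s
      by (auto intro: hermitian_smult)
    have "qf X v \<le> qf (complex_of_real (T + \<epsilon>) \<cdot>\<^sub>m 1\<^sub>m n) v" if v: "v \<in> carrier_vec n" for v
    proof -
      have "qf (Q k) v \<le> real n * (\<epsilon> / real n) * sqn v"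
        using \<epsilon> by (intro qf_le_entries[OF Qc(1) v ent]) auto
      moreover have "qf (Q k) v = qf X v + qf (snd (Z k)) v - T * sqn v"
        unfolding Q_def sh_def X_def[symmetric]
        by (subst qf_minus[OF _ one(1) v], use Xc in simp, subst qf_add[OF Xc v],
            simp only: qf_smult[OF one_carrier_mat v] qf_one[OF v])
      moreover have "0 \<le> qf (snd (Z k)) v" by (rule psdD(3)[OF X(2) v])
      moreover have "qf (complex_of_real (T + \<epsilon>) \<cdot>\<^sub>m 1\<^sub>m n) v = T * sqn v + \<epsilon> * sqn v"
        unfolding qf_smult[OF one_carrier_mat v] qf_one[OF v] by (rule distrib_right)
      ultimately show ?thesis using n by simp
    qed
    hence "loewner_le n X (complex_of_real (T + \<epsilon>) \<cdot>\<^sub>m 1\<^sub>m n)"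
      unfolding loewner_iff[OF Xc(1) psdD(2)[OF C[OF X(1)]] one] by blast
    thus ?thesis using X(1) by blast
  qed
qed

section \<open>Congruences and partial traces\<close>

lemma feasible_congr:
  assumes \<beta>: "0 < \<beta>" "\<beta> < 1" and p: "psd n \<rho>" "psd n \<sigma>" "psd n A" and le: "loewner_le n \<rho> (wgm \<beta> \<sigma> A)"
    and K: "K \<in> carrier_mat k n"
  shows "loewner_le k (K * \<rho> * adj K) (wgm \<beta> (K * \<sigma> * adj K) (K * A * adj K))"
  unfolding loewner_psd_iff[OF psd_congr[OF p(1) K] psd_wgm[OF \<beta> psd_congr[OF p(2) K] psd_congr[OF p(3) K]]]
proof (intro ballI)
  fix v :: "complex vec" assume v: "v \<in> carrier_vec k"
  have Kv: "adj K *\<^sub>v v \<in> carrier_vec n" using K by simp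
  have "qf (K * \<rho> * adj K) v = qf \<rho> (adj K *\<^sub>v v)" by (rule qf_congr[OF psdD(1)[OF p(1)] K v])
  also have "\<dots> \<le> qf (wgm \<beta> \<sigma> A) (adj K *\<^sub>v v)" by (rule loewnerD[OF le Kv])
  also have "\<dots> = qf (K * wgm \<beta> \<sigma> A * adj K) v"
    by (rule qf_congr[OF psdD(1)[OF psd_wgm[OF \<beta> p(2,3)]] K v, symmetric])
  also have "\<dots> \<le> qf (wgm \<beta> (K * \<sigma> * adj K) (K * A * adj K)) v" by (rule wgm_transformer[OF \<beta> p(2,3) K v])
  finally show "qf (K * \<rho> * adj K) v \<le> qf (wgm \<beta> (K * \<sigma> * adj K) (K * A * adj K)) v" .
qed

definition ptr :: "nat \<Rightarrow> nat \<Rightarrow> complex mat \<Rightarrow> complex mat" where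
  "ptr n k A = mat n n (\<lambda>(x,x'). \<Sum>y<k. A $$ (x * k + y, x' * k + y))"

lemma ptr_carrier [simp]: "ptr n k A \<in> carrier_mat n n"
  unfolding ptr_def by simp

text \<open>The partial trace is adjoint to tensoring with the identity. It makes the trace of a
  certificate, weighted by an input state, a linear function of the input marginal.\<close>

lemma trace_ptr:
  assumes W: "W \<in> carrier_mat n n" and A: "A \<in> carrier_mat (n * k) (n * k)"
  shows "mtrace (kron W (1\<^sub>m k) * A) = mtrace (W * ptr n k A)"
proof -
  have e: "i div k * k + i mod k = i" for i :: nat by simp
  have "mtrace (kron W (1\<^sub>m k) * A) = (\<Sum>i<n * k. \<Sum>l<n * k. W $$ (i div k, l div k) * (if i mod k = l mod k then 1 else 0)
      * A $$ (l div k * k + l mod k, i div k * k + i mod k))"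
    unfolding mtrace_def e using W A by (simp add: index_mult_sum div_mod_less del: index_mult_mat(1))
  also have "\<dots> = (\<Sum>i<n * k. \<Sum>x'<n. \<Sum>y'<k. W $$ (i div k, x') * (if i mod k = y' then 1 else 0)
      * A $$ (x' * k + y', i div k * k + i mod k))"
    by (intro sum.cong refl sum_div_mod)
  also have "\<dots> = (\<Sum>x<n. \<Sum>y<k. \<Sum>x'<n. \<Sum>y'<k. W $$ (x, x') * (if y = y' then 1 else 0) * A $$ (x' * k + y', x * k + y))"
    by (rule sum_div_mod)
  also have "\<dots> = (\<Sum>x<n. \<Sum>y<k. \<Sum>x'<n. W $$ (x, x') * A $$ (x' * k + y, x * k + y))"
  proof (intro sum.cong refl)
    fix x y x' assume y: "y \<in> {..<k}"
    have "(\<Sum>y'<k. W $$ (x, x') * (if y = y' then 1 else 0) * A $$ (x' * k + y', x * k + y))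
      = (\<Sum>y'<k. if y' = y then W $$ (x, x') * A $$ (x' * k + y, x * k + y) else 0)"
      by (intro sum.cong) auto
    thus "(\<Sum>y'<k. W $$ (x, x') * (if y = y' then 1 else 0) * A $$ (x' * k + y', x * k + y))
      = W $$ (x, x') * A $$ (x' * k + y, x * k + y)" using y by simp
  qed
  also have "\<dots> = (\<Sum>x<n. \<Sum>x'<n. W $$ (x, x') * (\<Sum>y<k. A $$ (x' * k + y, x * k + y)))"
    unfolding sum_distrib_left by (rule sum.cong[OF refl]) (rule sum.swap)
  also have "\<dots> = mtrace (W * ptr n k A)"
    unfolding mtrace_def using W by (simp add: index_mult_sum ptr_def del: index_mult_mat(1))
  finally show ?thesis .
qed

lemma hermitian_ptr:
  assumes "hermitian A" "A \<in> carrier_mat (n * k) (n * k)"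
  shows "hermitian (ptr n k A)"
  unfolding hermitian_def
proof (rule eq_matI)
  fix x x' assume "x < dim_row (adj (ptr n k A))" "x' < dim_col (adj (ptr n k A))"
  hence x: "x < n" "x' < n" by (auto simp: ptr_def)
  have "A $$ (x * k + y, x' * k + y) = cnj (A $$ (x' * k + y, x * k + y))" if "y < k" for y
    by (rule hermitian_entry[OF assms mult_add_less[OF x(2) that] mult_add_less[OF x(1) that]])
  hence "(\<Sum>y<k. A $$ (x * k + y, x' * k + y)) = (\<Sum>y<k. cnj (A $$ (x' * k + y, x * k + y)))"
    by (intro sum.cong refl) auto
  thus "ptr n k A $$ (x,x') = adj (ptr n k A) $$ (x,x')" using x by (simp add: ptr_def)
qed (auto simp: ptr_def)

lemma psd_ptr:
  assumes A: "psd (n * k) A"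
  shows "psd n (ptr n k A)"
  unfolding psd_iff
proof (intro conjI ballI ptr_carrier hermitian_ptr[OF psdD(2,1)[OF A]])
  fix v :: "complex vec" assume v: "v \<in> carrier_vec n"
  let ?V = "colmat n v * adj (colmat n v)"
  have V: "psd n ?V" by (rule psd_gram[OF colmat_carrier])
  have "qf (ptr n k A) v = Re (mtrace (kron ?V (1\<^sub>m k) * A))"
    unfolding qf_trace[OF ptr_carrier v] trace_ptr[OF psdD(1)[OF V] psdD(1)[OF A]] ..
  thus "0 \<le> qf (ptr n k A) v" using trace_psd_mult_nonneg[OF psd_kron[OF V psd_one] A] by simp
qed

lemma ptr_lincomb:
  assumes "A \<in> carrier_mat (n * k) (n * k)" "B \<in> carrier_mat (n * k) (n * k)"
  shows "ptr n k (c \<cdot>\<^sub>m A + e \<cdot>\<^sub>m B) = c \<cdot>\<^sub>m ptr n k A + e \<cdot>\<^sub>m ptr n k B"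
proof (rule eq_matI)
  fix x x' assume "x < dim_row (c \<cdot>\<^sub>m ptr n k A + e \<cdot>\<^sub>m ptr n k B)" "x' < dim_col (c \<cdot>\<^sub>m ptr n k A + e \<cdot>\<^sub>m ptr n k B)"
  hence x: "x < n" "x' < n" by (auto simp: ptr_def)
  have "(\<Sum>y<k. (c \<cdot>\<^sub>m A + e \<cdot>\<^sub>m B) $$ (x * k + y, x' * k + y))
     = (\<Sum>y<k. c * A $$ (x * k + y, x' * k + y) + e * B $$ (x * k + y, x' * k + y))"
  proof (intro sum.cong refl)
    fix y assume "y \<in> {..<k}"
    hence "x * k + y < n * k" "x' * k + y < n * k" using x by (auto intro: mult_add_less)
    thus "(c \<cdot>\<^sub>m A + e \<cdot>\<^sub>m B) $$ (x * k + y, x' * k + y) = c * A $$ (x * k + y, x' * k + y) + e * B $$ (x * k + y, x' * k + y)"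
      using assms by simp
  qed
  thus "ptr n k (c \<cdot>\<^sub>m A + e \<cdot>\<^sub>m B) $$ (x,x') = (c \<cdot>\<^sub>m ptr n k A + e \<cdot>\<^sub>m ptr n k B) $$ (x,x')"
    using x by (simp add: ptr_def sum.distrib sum_distrib_left)
qed (auto simp: ptr_def)

lemma mpow_minus_mult:
  assumes U: "unitary n U" and A: "A = U * rdiag n d * adj U" and d: "\<And>i. i < n \<Longrightarrow> 0 < d i"
  shows "mpow (- t) A * mpow t A = 1\<^sub>m n"
proof -
  have Uc: "U \<in> carrier_mat n n" using U unitary_carrier by blast
  have "rdiag n (\<lambda>i. pw (- t) (d i)) * rdiag n (\<lambda>i. pw t (d i)) = 1\<^sub>m n"
    unfolding mat_diag_diag mat_diag_one[symmetric]
  proof (rule mat_diag_cong)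
    fix i assume "i < n"
    hence "pw (- t) (d i) * pw t (d i) = 1" using d[of i] by (simp add: pw_def powr_minus)
    thus "complex_of_real (pw (- t) (d i)) * complex_of_real (pw t (d i)) = 1" by (metis of_real_1 of_real_mult)
  qed
  moreover have "mpow (- t) A * mpow t A = U * (rdiag n (\<lambda>i. pw (- t) (d i)) * rdiag n (\<lambda>i. pw t (d i))) * adj U"
    unfolding A mpow_spec[OF U] using U Uc by (simp add: mult_assoc_dim unitary_cancel del: mat_diag_diag)
  ultimately show ?thesis using U Uc by simp
qed

lemma pd_spectral:
  assumes "psd n A" "0 < \<eta>" "\<And>v. v \<in> carrier_vec n \<Longrightarrow> \<eta> * sqn v \<le> qf A v"
  obtains U d where "unitary n U" "A = U * rdiag n d * adj U" "\<forall>i<n. 0 < d i"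
proof -
  obtain U d where U: "unitary n U" and A: "A = U * rdiag n d * adj U"
    using psd_spectral[OF assms(1)] by metis
  have Uc: "U \<in> carrier_mat n n" using U unitary_carrier by blast
  have "0 < d i" if i: "i < n" for i
  proof -
    have "sqn (col U i) = 1"
      using unitary_row_sum(2)[OF U i] Uc i unfolding sqn_def by simp
    thus ?thesis using assms(2) assms(3)[OF col_carrier[OF Uc, of i]] qf_spec_col[OF U i, of d] unfolding A by simp
  qed
  thus ?thesis using that[OF U A] by blast
qed

section \<open>Symmetrization over the tensor factors\<close>

text \<open>The same permutation acts on inputs and outputs, which occupy separate parts of the
  index.\<close>

definition actXY :: "nat \<Rightarrow> nat \<Rightarrow> nat \<Rightarrow> (nat \<Rightarrow> nat) \<Rightarrow> nat \<Rightarrow> nat" where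
  "actXY dX dY m p i = actd dX m p (i div dY ^ m) * dY ^ m + actd dY m p (i mod dY ^ m)"

text \<open>\<open>actd\<close> reads digit \<open>p k\<close> at position \<open>k\<close>, which
  makes it a right action and reverses the order of composition.\<close>

lemma actd_comp:
  assumes "0 < e" "p permutes {..<m}"
  shows "actd e m p (actd e m q i) = actd e m (q \<circ> p) i"
proof (rule dig_inj[OF actd_less[OF assms(1)] actd_less[OF assms(1)]])
  fix k assume k: "k < m"
  have "p k < m" using permutes_in_image[OF assms(2), of k] k by simp
  thus "dig e k (actd e m p (actd e m q i)) = dig e k (actd e m (q \<circ> p) i)"
    using k by (simp add: dig_actd[OF assms(1)])
qed

context
  fixes dX dY :: nat
  assumes d: "0 < dX" "0 < dY"
begin

lemma actXY_less: "actXY dX dY m p i < dX ^ m * dY ^ m"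
  unfolding actXY_def by (intro mult_add_less actd_less d)

lemma pm_actXY: "pm (dX ^ m * dY ^ m) (actXY dX dY m p) = kron (pm (dX ^ m) (actd dX m p)) (pm (dY ^ m) (actd dY m p))"
  unfolding actXY_def using actd_less[OF d(2)] by (intro pm_kron) auto

lemma unitary_pm_actd: "0 < e \<Longrightarrow> p permutes {..<m} \<Longrightarrow> unitary (e ^ m) (pm (e ^ m) (actd e m p))"
  using actd_less actd_inj by (intro unitary_pm) auto

lemma unitary_pm_actXY: "p permutes {..<m} \<Longrightarrow> unitary (dX ^ m * dY ^ m) (pm (dX ^ m * dY ^ m) (actXY dX dY m p))"
  unfolding pm_actXY using unitary_pm_actd d by (intro unitary_kron) auto

lemma enc_actXY: "k < m \<Longrightarrow> enc dX dY m (actXY dX dY m p i) k = enc dX dY m i (p k)"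
  unfolding enc_def actXY_def mult_add_div_mod[OF actd_less[OF d(2)]] by (simp add: dig_actd[OF d(1)] dig_actd[OF d(2)])

lemma enc_inj:
  assumes i: "i < dX ^ m * dY ^ m" and j: "j < dX ^ m * dY ^ m" and eq: "\<And>k. k < m \<Longrightarrow> enc dX dY m i k = enc dX dY m j k"
  shows "i = j"
proof -
  have "dig dX k (i div dY ^ m) = dig dX k (j div dY ^ m)" "dig dY k (i mod dY ^ m) = dig dY k (j mod dY ^ m)" if "k < m" for k
    using arg_cong[OF eq[OF that], of "\<lambda>z. z div dY"] arg_cong[OF eq[OF that], of "\<lambda>z. z mod dY"]
    unfolding enc_def mult_add_div_mod[OF dig_less[OF d(2)]] by auto
  hence "i div dY ^ m = j div dY ^ m" "i mod dY ^ m = j mod dY ^ m"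
    using dig_inj[OF div_mod_less(1)[OF i] div_mod_less(1)[OF j]] dig_inj[OF div_mod_less(2)[OF i] div_mod_less(2)[OF j]] by auto
  thus ?thesis using div_mult_mod_eq[of i "dY ^ m"] div_mult_mod_eq[of j "dY ^ m"] by argo
qed

text \<open>Each entry is a commutative product over the tensor factors, so permuting the factors
  only reindexes it.\<close>

lemma JP_perm:
  assumes p: "p permutes {..<m}"
  shows "pm (dX ^ m * dY ^ m) (actXY dX dY m p) * JP dX dY J m * adj (pm (dX ^ m * dY ^ m) (actXY dX dY m p)) = JP dX dY J m"
proof (rule eq_matI)
  let ?U = "pm (dX ^ m * dY ^ m) (actXY dX dY m p)"
  fix i j assume "i < dim_row (JP dX dY J m)" "j < dim_col (JP dX dY J m)"
  hence ij: "i < dX ^ m * dY ^ m" "j < dX ^ m * dY ^ m" by (auto simp: JP_def)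
  have "(?U * JP dX dY J m * adj ?U) $$ (i,j) = JP dX dY J m $$ (actXY dX dY m p i, actXY dX dY m p j)"
    by (rule pm_conj_index[OF JP_carrier ij actXY_less actXY_less])
  also have "\<dots> = (\<Prod>k<m. J $$ (enc dX dY m i (p k), enc dX dY m j (p k)))"
    unfolding JP_def using actXY_less by (simp add: enc_actXY)
  also have "\<dots> = (\<Prod>k<m. J $$ (enc dX dY m i k, enc dX dY m j k))"
    using prod.permute[OF p, of "\<lambda>k. J $$ (enc dX dY m i k, enc dX dY m j k)"] by (simp add: o_def)
  finally show "(?U * JP dX dY J m * adj ?U) $$ (i,j) = JP dX dY J m $$ (i,j)" using ij by (simp add: JP_def)
qed (auto simp: JP_def)

end

definition avg :: "nat \<Rightarrow> nat \<Rightarrow> complex mat \<Rightarrow> complex mat" where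
  "avg e m \<omega> = mat (e ^ m) (e ^ m) (\<lambda>(i,j). complex_of_real (1 / fact m) *
     (\<Sum>p | p permutes {..<m}. \<omega> $$ (actd e m p i, actd e m p j)))"

context
  fixes e m :: nat and \<omega> :: "complex mat"
  assumes e: "0 < e" and \<omega>: "psd (e ^ m) \<omega>"
begin

private lemma wc: "\<omega> \<in> carrier_mat (e ^ m) (e ^ m)" using psdD(1)[OF \<omega>] .

lemma avg_carrier: "avg e m \<omega> \<in> carrier_mat (e ^ m) (e ^ m)"
  unfolding avg_def by simp

lemma avg_entry:
  assumes "i < e ^ m" "j < e ^ m"
  shows "avg e m \<omega> $$ (i,j) = complex_of_real (1 / fact m) *
    (\<Sum>p | p permutes {..<m}. (pm (e ^ m) (actd e m p) * \<omega> * adj (pm (e ^ m) (actd e m p))) $$ (i,j))"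
  unfolding avg_def using assms pm_conj_index[OF wc assms actd_less[OF e] actd_less[OF e]] by simp

lemma trace_avg:
  assumes Z: "Z \<in> carrier_mat (e ^ m) (e ^ m)"
  shows "mtrace (avg e m \<omega> * Z) = complex_of_real (1 / fact m) *
    (\<Sum>p | p permutes {..<m}. mtrace (pm (e ^ m) (actd e m p) * \<omega> * adj (pm (e ^ m) (actd e m p)) * Z))"
proof -
  let ?X = "\<lambda>p. pm (e ^ m) (actd e m p) * \<omega> * adj (pm (e ^ m) (actd e m p))"
  have X: "?X p \<in> carrier_mat (e ^ m) (e ^ m)" for p by simp
  have "mtrace (avg e m \<omega> * Z) = (\<Sum>i<e ^ m. \<Sum>j<e ^ m. avg e m \<omega> $$ (i,j) * Z $$ (j,i))"
    unfolding mtrace_def using avg_carrier Z carrier_matD[OF avg_carrier] by (simp add: index_mult_sum del: index_mult_mat(1))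
  also have "\<dots> = (\<Sum>i<e ^ m. \<Sum>j<e ^ m. \<Sum>p | p permutes {..<m}. complex_of_real (1 / fact m) * (?X p $$ (i,j) * Z $$ (j,i)))"
    by (intro sum.cong refl) (simp only: avg_entry sum_distrib_left sum_distrib_right mult.assoc lessThan_iff)
  also have "\<dots> = (\<Sum>p | p permutes {..<m}. \<Sum>i<e ^ m. \<Sum>j<e ^ m. complex_of_real (1 / fact m) * (?X p $$ (i,j) * Z $$ (j,i)))"
  proof -
    have "(\<Sum>i<e ^ m. \<Sum>j<e ^ m. \<Sum>p | p permutes {..<m}. F i j p)
      = (\<Sum>p | p permutes {..<m}. \<Sum>i<e ^ m. \<Sum>j<e ^ m. F i j p)" for F :: "nat \<Rightarrow> nat \<Rightarrow> (nat \<Rightarrow> nat) \<Rightarrow> complex"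
    proof -
      have "(\<Sum>i<e ^ m. \<Sum>j<e ^ m. \<Sum>p | p permutes {..<m}. F i j p)
        = (\<Sum>i<e ^ m. \<Sum>p | p permutes {..<m}. \<Sum>j<e ^ m. F i j p)"
        by (rule sum.cong[OF refl], rule sum.swap)
      also have "\<dots> = (\<Sum>p | p permutes {..<m}. \<Sum>i<e ^ m. \<Sum>j<e ^ m. F i j p)" by (rule sum.swap)
      finally show ?thesis .
    qed
    thus ?thesis .
  qed
  also have "\<dots> = complex_of_real (1 / fact m) * (\<Sum>p | p permutes {..<m}. \<Sum>i<e ^ m. \<Sum>j<e ^ m. ?X p $$ (i,j) * Z $$ (j,i))"
    by (simp only: sum_distrib_left)
  also have "(\<Sum>p | p permutes {..<m}. \<Sum>i<e ^ m. \<Sum>j<e ^ m. ?X p $$ (i,j) * Z $$ (j,i))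
     = (\<Sum>p | p permutes {..<m}. mtrace (?X p * Z))"
  proof (intro sum.cong refl)
    fix p
    show "(\<Sum>i<e ^ m. \<Sum>j<e ^ m. ?X p $$ (i,j) * Z $$ (j,i)) = mtrace (?X p * Z)"
      unfolding mtrace_def using carrier_matD[OF X] Z by (simp add: index_mult_sum[of _ "?X p"] del: index_mult_mat(1))
  qed
  finally show ?thesis .
qed

lemma hermitian_avg: "hermitian (avg e m \<omega>)"
  unfolding hermitian_def
proof (rule eq_matI)
  fix i j assume "i < dim_row (adj (avg e m \<omega>))" "j < dim_col (adj (avg e m \<omega>))"
  hence ij: "i < e ^ m" "j < e ^ m" by (auto simp: avg_def)
  have "\<omega> $$ (actd e m p i, actd e m p j) = cnj (\<omega> $$ (actd e m p j, actd e m p i))" for p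
    by (rule hermitian_entry[OF psdD(2,1)[OF \<omega>] actd_less[OF e] actd_less[OF e]])
  hence "(\<Sum>p | p permutes {..<m}. \<omega> $$ (actd e m p i, actd e m p j))
    = (\<Sum>p | p permutes {..<m}. cnj (\<omega> $$ (actd e m p j, actd e m p i)))" by (intro sum.cong refl)
  thus "avg e m \<omega> $$ (i,j) = adj (avg e m \<omega>) $$ (i,j)" using ij by (simp add: avg_def)
qed (auto simp: avg_def)

lemma qf_avg:
  assumes v: "v \<in> carrier_vec (e ^ m)"
  shows "qf (avg e m \<omega>) v = 1 / fact m * (\<Sum>p | p permutes {..<m}. qf (pm (e ^ m) (actd e m p) * \<omega> * adj (pm (e ^ m) (actd e m p))) v)"
proof -
  let ?V = "colmat (e ^ m) v * adj (colmat (e ^ m) v)"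
  have V: "?V \<in> carrier_mat (e ^ m) (e ^ m)" by (rule psdD(1)[OF psd_gram[OF colmat_carrier]])
  have q: "qf A v = Re (mtrace (A * ?V))" if "A \<in> carrier_mat (e ^ m) (e ^ m)" for A
    unfolding qf_trace[OF that v] mtrace_comm[OF that V] ..
  have "qf (avg e m \<omega>) v = 1 / fact m * (\<Sum>p | p permutes {..<m}. Re (mtrace (pm (e ^ m) (actd e m p) * \<omega> * adj (pm (e ^ m) (actd e m p)) * ?V)))"
    unfolding q[OF avg_carrier] trace_avg[OF V] by (simp del: of_real_divide)
  also have "(\<Sum>p | p permutes {..<m}. Re (mtrace (pm (e ^ m) (actd e m p) * \<omega> * adj (pm (e ^ m) (actd e m p)) * ?V)))
    = (\<Sum>p | p permutes {..<m}. qf (pm (e ^ m) (actd e m p) * \<omega> * adj (pm (e ^ m) (actd e m p))) v)"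
    by (intro sum.cong refl q[symmetric]) simp
  finally show ?thesis .
qed

lemma card_perms: "card {p. p permutes {..<m}} = fact m" "finite {p. p permutes {..<m}}"
  using card_permutations[of "{..<m}" m] finite_permutations[of "{..<m}"] by auto

text \<open>Conjugation with unitaries preserves the lower bound, so averaging keeps full
  rank.\<close>

lemma avg_lower:
  assumes \<eta>: "\<And>v. v \<in> carrier_vec (e ^ m) \<Longrightarrow> \<eta> * sqn v \<le> qf \<omega> v" and v: "v \<in> carrier_vec (e ^ m)"
  shows "\<eta> * sqn v \<le> qf (avg e m \<omega>) v"
proof -
  have "\<eta> * sqn v \<le> qf (pm (e ^ m) (actd e m p) * \<omega> * adj (pm (e ^ m) (actd e m p))) v" if p: "p permutes {..<m}" for p
  proof -
    let ?X = "pm (e ^ m) (actd e m p)"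
    have u: "unitary (e ^ m) ?X" by (rule unitary_pm_actd[OF e e e p])
    have Xv: "adj ?X *\<^sub>v v \<in> carrier_vec (e ^ m)" by simp
    have "sqn v = qf (?X * adj ?X) v" using u qf_one[OF v] by simp
    also have "\<dots> = sqn (adj ?X *\<^sub>v v)" by (rule qf_gram[OF pm_carrier(1) v])
    finally show ?thesis using \<eta>[OF Xv] qf_congr[OF wc pm_carrier(1) v, of "actd e m p"] by simp
  qed
  hence "(\<Sum>p | p permutes {..<m}. \<eta> * sqn v) \<le> (\<Sum>p | p permutes {..<m}. qf (pm (e ^ m) (actd e m p) * \<omega> * adj (pm (e ^ m) (actd e m p))) v)"
    by (intro sum_mono) auto
  hence "fact m * (\<eta> * sqn v) \<le> (\<Sum>p | p permutes {..<m}. qf (pm (e ^ m) (actd e m p) * \<omega> * adj (pm (e ^ m) (actd e m p))) v)"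
    by (simp add: card_perms)
  hence "1 / fact m * (fact m * (\<eta> * sqn v)) \<le> qf (avg e m \<omega>) v"
    unfolding qf_avg[OF v] by (intro mult_left_mono) auto
  thus ?thesis by simp
qed

lemma psd_avg: "psd (e ^ m) (avg e m \<omega>)"
  unfolding psd_iff using avg_carrier hermitian_avg avg_lower[of 0] psdD(3)[OF \<omega>] by simp

lemma trace_avg_one: "mtrace (avg e m \<omega>) = mtrace \<omega>"
proof -
  have "mtrace (avg e m \<omega>) = mtrace (avg e m \<omega> * 1\<^sub>m (e ^ m))" using avg_carrier by simp
  also have "\<dots> = complex_of_real (1 / fact m) * (\<Sum>p | p permutes {..<m}. mtrace \<omega>)"
    unfolding trace_avg[OF one_carrier_mat]
  proof (intro arg_cong[of _ _ "\<lambda>z. complex_of_real (1 / fact m) * z"] sum.cong refl)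
    fix p assume "p \<in> {p. p permutes {..<m}}"
    hence u: "unitary (e ^ m) (pm (e ^ m) (actd e m p))" using unitary_pm_actd[OF e e e] by blast
    show "mtrace (pm (e ^ m) (actd e m p) * \<omega> * adj (pm (e ^ m) (actd e m p)) * 1\<^sub>m (e ^ m)) = mtrace \<omega>"
      using mtrace_unitary(1)[OF u wc] by (simp add: right_mult_one_mat[of _ "e ^ m" "e ^ m"])
  qed
  also have "\<dots> = mtrace \<omega>" by (simp add: card_perms)
  finally show ?thesis .
qed

text \<open>Conjugation by \<open>q\<close> composes every permutation in the sum with
  \<open>q\<close>, which is a bijection of the group.\<close>

lemma avg_perm:
  assumes q: "q permutes {..<m}"
  shows "pm (e ^ m) (actd e m q) * avg e m \<omega> * adj (pm (e ^ m) (actd e m q)) = avg e m \<omega>"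
proof (rule eq_matI)
  fix i j assume "i < dim_row (avg e m \<omega>)" "j < dim_col (avg e m \<omega>)"
  hence ij: "i < e ^ m" "j < e ^ m" by (auto simp: avg_def)
  have "(pm (e ^ m) (actd e m q) * avg e m \<omega> * adj (pm (e ^ m) (actd e m q))) $$ (i,j)
    = avg e m \<omega> $$ (actd e m q i, actd e m q j)"
    by (rule pm_conj_index[OF avg_carrier ij actd_less[OF e] actd_less[OF e]])
  also have "\<dots> = complex_of_real (1 / fact m) * (\<Sum>p | p permutes {..<m}. \<omega> $$ (actd e m (q \<circ> p) i, actd e m (q \<circ> p) j))"
    unfolding avg_def using actd_less[OF e]
    by (simp add: actd_comp[OF e] del: of_real_divide)
  also have "(\<Sum>p | p permutes {..<m}. \<omega> $$ (actd e m (q \<circ> p) i, actd e m (q \<circ> p) j))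
    = (\<Sum>p | p permutes {..<m}. \<omega> $$ (actd e m p i, actd e m p j))"
    by (rule setum_permutations_compose_left[OF q, symmetric])
  finally show "(pm (e ^ m) (actd e m q) * avg e m \<omega> * adj (pm (e ^ m) (actd e m q))) $$ (i,j) = avg e m \<omega> $$ (i,j)"
    using ij by (simp add: avg_def)
qed (auto simp: avg_def)

end

section \<open>Supports, unitary invariance and sublevel sets\<close>

lemma qf_kron_vec:
  assumes A: "psd n A" and B: "psd m B" and u: "u \<in> carrier_vec n" and v: "v \<in> carrier_vec m"
  shows "qf (kron A B) (vec (n * m) (\<lambda>k. u $ (k div m) * v $ (k mod m))) = qf A u * qf B v"
proof -
  let ?w = "vec (n * m) (\<lambda>k. u $ (k div m) * v $ (k mod m))"
  note dm = psdD(4,5)[OF A] psdD(4,5)[OF B] carrier_vecD[OF u] carrier_vecD[OF v]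
  have entry: "(kron A B *\<^sub>v ?w) $ k = (A *\<^sub>v u) $ (k div m) * (B *\<^sub>v v) $ (k mod m)" if k: "k < n * m" for k
  proof -
    note km = div_mod_less[OF k]
    have "(kron A B *\<^sub>v ?w) $ k = (\<Sum>l<n * m. (A $$ (k div m, l div m) * u $ (l div m)) * (B $$ (k mod m, l mod m) * v $ (l mod m)))"
      using k dm by (simp add: scalar_prod_def atLeast0LessThan mult_ac)
    also have "\<dots> = (\<Sum>i<n. \<Sum>j<m. (A $$ (k div m, i) * u $ i) * (B $$ (k mod m, j) * v $ j))"
      by (rule sum_div_mod)
    also have "\<dots> = (A *\<^sub>v u) $ (k div m) * (B *\<^sub>v v) $ (k mod m)"
      using km dm by (simp add: scalar_prod_def atLeast0LessThan sum_product)
    finally show ?thesis .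
  qed
  have "conjugate ?w \<bullet> (kron A B *\<^sub>v ?w)
    = (\<Sum>k<n * m. (cnj (u $ (k div m)) * (A *\<^sub>v u) $ (k div m)) * (cnj (v $ (k mod m)) * (B *\<^sub>v v) $ (k mod m)))"
    unfolding scalar_prod_def using dm entry
    by (intro sum.cong) (auto simp: atLeast0LessThan mult_ac simp del: index_mult_mat_vec)
  also have "\<dots> = (\<Sum>i<n. \<Sum>j<m. (cnj (u $ i) * (A *\<^sub>v u) $ i) * (cnj (v $ j) * (B *\<^sub>v v) $ j))"
    by (rule sum_div_mod)
  also have "\<dots> = (conjugate u \<bullet> (A *\<^sub>v u)) * (conjugate v \<bullet> (B *\<^sub>v v))"
    unfolding scalar_prod_def using dm by (simp add: sum_product atLeast0LessThan del: index_mult_mat_vec)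
  finally show ?thesis
    unfolding qf_def using A B u v unfolding psd_def by simp
qed

text \<open>A fixed \<open>v\<close> on which \<open>\<rho>2\<close> does not vanish turns product
  vectors into tests for the first factor alone. For \<open>\<rho>2 = 0\<close> the inclusion of the
  products would say nothing.\<close>

lemma supp_le_kron_left:
  assumes p: "psd n \<rho>1" "psd n \<sigma>1" "psd m \<rho>2" "psd m \<sigma>2"
    and s: "supp_le (kron \<rho>1 \<rho>2) (kron \<sigma>1 \<sigma>2)" and v: "v \<in> carrier_vec m" "qf \<rho>2 v \<noteq> 0"
  shows "supp_le \<rho>1 \<sigma>1"
  unfolding supp_le_iff[OF p(1,2)]
proof (intro ballI impI)
  fix u assume u: "u \<in> carrier_vec n" "qf \<sigma>1 u = 0"
  let ?w = "vec (n * m) (\<lambda>k. u $ (k div m) * v $ (k mod m))"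
  have "qf (kron \<sigma>1 \<sigma>2) ?w = 0" unfolding qf_kron_vec[OF p(2,4) u(1) v(1)] u(2) by simp
  hence "qf (kron \<rho>1 \<rho>2) ?w = 0"
    using s unfolding supp_le_iff[OF psd_kron[OF p(1,3)] psd_kron[OF p(2,4)]] by auto
  thus "qf \<rho>1 u = 0" unfolding qf_kron_vec[OF p(1,3) u(1) v(1)] using v(2) by simp
qed

lemma supp_le_kron_right:
  assumes p: "psd n \<rho>1" "psd n \<sigma>1" "psd m \<rho>2" "psd m \<sigma>2"
    and s: "supp_le (kron \<rho>1 \<rho>2) (kron \<sigma>1 \<sigma>2)" and u: "u \<in> carrier_vec n" "qf \<rho>1 u \<noteq> 0"
  shows "supp_le \<rho>2 \<sigma>2"
  unfolding supp_le_iff[OF p(3,4)]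
proof (intro ballI impI)
  fix v assume v: "v \<in> carrier_vec m" "qf \<sigma>2 v = 0"
  let ?w = "vec (n * m) (\<lambda>k. u $ (k div m) * v $ (k mod m))"
  have "qf (kron \<sigma>1 \<sigma>2) ?w = 0" unfolding qf_kron_vec[OF p(2,4) u(1) v(1)] v(2) by simp
  hence "qf (kron \<rho>1 \<rho>2) ?w = 0"
    using s unfolding supp_le_iff[OF psd_kron[OF p(1,3)] psd_kron[OF p(2,4)]] by auto
  thus "qf \<rho>2 v = 0" unfolding qf_kron_vec[OF p(1,3) u(1) v(1)] using u(2) by simp
qed

lemma supp_le_unitary:
  assumes p: "psd n \<rho>" "psd n \<sigma>" and U: "unitary n U"
    and s: "supp_le (U * \<rho> * adj U) (U * \<sigma> * adj U)"
  shows "supp_le \<rho> \<sigma>"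
  unfolding supp_le_iff[OF p]
proof (intro ballI impI)
  have Uc: "U \<in> carrier_mat n n" using unitary_carrier[OF U] .
  fix u :: "complex vec" assume u: "u \<in> carrier_vec n" "qf \<sigma> u = 0"
  have w: "U *\<^sub>v u \<in> carrier_vec n" using Uc u by simp
  have "adj U *\<^sub>v (U *\<^sub>v u) = (adj U * U) *\<^sub>v u"
    using Uc u(1) by (intro assoc_mult_mat_vec[symmetric]) auto
  also have "\<dots> = u" using U u(1) unfolding unitary_def by simp
  finally have Uu: "adj U *\<^sub>v (U *\<^sub>v u) = u" .
  have "qf (U * \<sigma> * adj U) (U *\<^sub>v u) = 0" unfolding qf_congr[OF psdD(1)[OF p(2)] Uc w] Uu by (rule u(2))
  hence "qf (U * \<rho> * adj U) (U *\<^sub>v u) = 0"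
    using s w unfolding supp_le_iff[OF psd_congr[OF p(1) Uc] psd_congr[OF p(2) Uc]] by blast
  thus "qf \<rho> u = 0" unfolding qf_congr[OF psdD(1)[OF p(1)] Uc w] Uu .
qed

lemma Qs_unitary:
  assumes p: "psd n \<rho>" "psd n \<sigma>" and U: "unitary n U"
  shows "Qs a (U * \<rho> * adj U) (U * \<sigma> * adj U) = Qs a \<rho> \<sigma>"
proof -
  have Uc: "U \<in> carrier_mat n n" using unitary_carrier[OF U] .
  define S where "S = mpow ((1 - a) / (2 * a)) \<sigma>"
  have S: "psd n S" unfolding S_def by (rule psd_mpow[OF psdD(2,1)[OF p(2)]])
  have SU: "mpow ((1 - a) / (2 * a)) (U * \<sigma> * adj U) = U * S * adj U"
    unfolding S_def mpow_def by (rule mat_fun_unitary[OF U psdD(2,1)[OF p(2)]])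
  note dm = psdD(4,5)[OF S] psdD(4,5)[OF p(1)]
  have K: "psd n (S * \<rho> * S)"
  proof -
    have "S * \<rho> * S = S * \<rho> * adj S" using psdD(2)[OF S] unfolding hermitian_def by simp
    thus ?thesis using psd_congr[OF p(1) psdD(1)[OF S]] by simp
  qed
  have "(U * S * adj U) * (U * \<rho> * adj U) * (U * S * adj U) = U * (S * \<rho> * S) * adj U"
    using dm U Uc by (simp add: mult_assoc_dim unitary_cancel)
  hence "Qs a (U * \<rho> * adj U) (U * \<sigma> * adj U) = Re (mtrace (mpow a (U * (S * \<rho> * S) * adj U)))"
    unfolding Qs_def SU by simp
  also have "mpow a (U * (S * \<rho> * S) * adj U) = U * mpow a (S * \<rho> * S) * adj U"
    unfolding mpow_def by (rule mat_fun_unitary[OF U psdD(2,1)[OF K]])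
  also have "mtrace \<dots> = mtrace (mpow a (S * \<rho> * S))"
    by (rule mtrace_unitary(1)[OF U psdD(1)[OF psd_mpow[OF psdD(2,1)[OF K]]]])
  finally show ?thesis unfolding Qs_def S_def .
qed

text \<open>Valid also where the logarithm is infinite. With it, divergences are handled only
  through real thresholds \<open>l\<close>.\<close>

lemma elog2_le_iff:
  assumes a: "1 < (a::real)"
  shows "ereal (1 / (a - 1)) * elog2 x \<le> ereal l \<longleftrightarrow> x \<le> ereal (2 powr ((a - 1) * l))"
proof (cases x)
  case (real r)
  show ?thesis
  proof (cases "r \<le> 0")
    case True
    have "r \<le> 2 powr ((a - 1) * l)" using True powr_gt_zero[of 2 "(a - 1) * l"] by linarith
    thus ?thesis using True a unfolding real elog2_def by (simp add: ereal_mult_infty)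
  next
    case False
    have "1 / (a - 1) * log 2 r \<le> l \<longleftrightarrow> log 2 r \<le> (a - 1) * l" using a by (simp add: field_simps)
    also have "\<dots> \<longleftrightarrow> r \<le> 2 powr ((a - 1) * l)" using False by (simp add: log_le_iff)
    finally show ?thesis using False unfolding real elog2_def by simp
  qed
next
  case PInf
  thus ?thesis using a unfolding elog2_def by simp
next
  case MInf
  thus ?thesis using a unfolding elog2_def by simp
qed

lemma sandwiched_le_iff:
  assumes "1 < a"
  shows "sandwiched a \<rho> \<sigma> \<le> ereal l \<longleftrightarrow> supp_le \<rho> \<sigma> \<and> Qs a \<rho> \<sigma> \<le> 2 powr ((a - 1) * l)"
  unfolding sandwiched_def Let_def Qs_def[symmetric] using elog2_le_iff[OF assms] by auto

lemma Dsharp_le_iff: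
  assumes "1 < a"
  shows "Dsharp a \<rho> \<sigma> \<le> ereal l \<longleftrightarrow> Qsharp a \<rho> \<sigma> \<le> ereal (2 powr ((a - 1) * l))"
  unfolding Dsharp_def by (rule elog2_le_iff[OF assms])

section \<open>Bounds for channels\<close>

context
  fixes dX dY :: nat and a :: real and JN JM :: "complex mat"
  assumes d: "0 < dX" "0 < dY" and a: "1 < a"
    and JN: "psd (dX * dY) JN" and JM: "psd (dX * dY) JM"
begin

abbreviation "D m \<equiv> dX ^ m * dY ^ m"

lemma ainv: "0 < 1/a" "1/a < 1" using a by auto

lemma psd_NM: "psd (D m) (JP dX dY JN m)" "psd (D m) (JP dX dY JM m)"
  using psd_JP[OF d JN] psd_JP[OF d JM] by auto

text \<open>Certificates for the Choi operators themselves, without an input state. Congruence with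
  the root of an input relates them to the operators \<open>A\<close> in
  \<open>Qsharp\<close>.\<close>

definition feas :: "nat \<Rightarrow> complex mat \<Rightarrow> bool" where
  "feas m A \<longleftrightarrow> psd (D m) A \<and> loewner_le (D m) (JP dX dY JN m) (wgm (1/a) (JP dX dY JM m) A)"

text \<open>The mean is concave in its second argument. Convexity of the set of certificates is what
  the minimax theorem asks for.\<close>

lemma feas_convex:
  assumes A: "feas m A" and B: "feas m B" and t: "0 \<le> t" "t \<le> 1"
  shows "feas m (complex_of_real (1 - t) \<cdot>\<^sub>m A + complex_of_real t \<cdot>\<^sub>m B)"
proof -
  have p: "psd (D m) A" "psd (D m) B" and le: "loewner_le (D m) (JP dX dY JN m) (wgm (1/a) (JP dX dY JM m) A)" "loewner_le (D m) (JP dX dY JN m) (wgm (1/a) (JP dX dY JM m) B)"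
    using A B unfolding feas_def by auto
  have t': "0 \<le> 1 - t" using t by simp
  have p3: "psd (D m) (complex_of_real (1 - t) \<cdot>\<^sub>m A + complex_of_real t \<cdot>\<^sub>m B)"
    by (rule psd_add[OF psd_smult[OF p(1) t'] psd_smult[OF p(2) t(1)]])
  have "qf (JP dX dY JN m) v \<le> qf (wgm (1/a) (JP dX dY JM m) (complex_of_real (1 - t) \<cdot>\<^sub>m A + complex_of_real t \<cdot>\<^sub>m B)) v"
    if v: "v \<in> carrier_vec (D m)" for v
  proof -
    have "qf (JP dX dY JN m) v = (1 - t) * qf (JP dX dY JN m) v + t * qf (JP dX dY JN m) v" by (simp add: algebra_simps)
    also have "\<dots> \<le> (1 - t) * qf (wgm (1/a) (JP dX dY JM m) A) v + t * qf (wgm (1/a) (JP dX dY JM m) B) v"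
      using t t' loewnerD[OF le(1) v] loewnerD[OF le(2) v] by (intro add_mono mult_left_mono) auto
    also have "\<dots> \<le> qf (wgm (1/a) (JP dX dY JM m) (complex_of_real (1 - t) \<cdot>\<^sub>m A + complex_of_real t \<cdot>\<^sub>m B)) v"
      by (rule wgm_concave[OF ainv psd_NM(2) p t' t(1) _ v]) simp
    finally show ?thesis .
  qed
  hence "loewner_le (D m) (JP dX dY JN m) (wgm (1/a) (JP dX dY JM m) (complex_of_real (1 - t) \<cdot>\<^sub>m A + complex_of_real t \<cdot>\<^sub>m B))"
    unfolding loewner_psd_iff[OF psd_NM(1) psd_wgm[OF ainv psd_NM(2) p3]] by blast
  thus ?thesis unfolding feas_def using p3 by blast
qed

text \<open>The certificate \<open>A\<close> serves all input states at once. By the minimax theorem this loses nothing, and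
  unlike state-dependent certificates it multiplies under tensor products.\<close>
definition good :: "nat \<Rightarrow> real \<Rightarrow> bool" where
  "good m t \<longleftrightarrow> (\<exists>A. feas m A \<and> loewner_le (dX ^ m) (ptr (dX ^ m) (dY ^ m) A) (complex_of_real t \<cdot>\<^sub>m 1\<^sub>m (dX ^ m)))"

lemma D_add: "D m * D n = D (m + n)"
  by (simp add: power_add mult_ac)

text \<open>The reordering keeps inputs and outputs apart, so tracing out all outputs treats the two
  blocks independently.\<close>

lemma ptr_rpm:
  assumes A: "A \<in> carrier_mat (D m) (D m)" and B: "B \<in> carrier_mat (D n) (D n)"
  shows "ptr (dX ^ (m + n)) (dY ^ (m + n)) (rpm dX dY m n * kron A B * adj (rpm dX dY m n))
    = kron (ptr (dX ^ m) (dY ^ m) A) (ptr (dX ^ n) (dY ^ n) B)"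
proof (rule eq_matI)
  fix x x' assume "x < dim_row (kron (ptr (dX ^ m) (dY ^ m) A) (ptr (dX ^ n) (dY ^ n) B))"
    "x' < dim_col (kron (ptr (dX ^ m) (dY ^ m) A) (ptr (dX ^ n) (dY ^ n) B))"
  hence x': "x < dX ^ m * dX ^ n" "x' < dX ^ m * dX ^ n" by (auto simp: ptr_def)
  hence x: "x < dX ^ (m + n)" "x' < dX ^ (m + n)" by (simp_all add: power_add)
  note b = div_mod_less[OF x'(1)] div_mod_less[OF x'(2)]
  have "ptr (dX ^ (m + n)) (dY ^ (m + n)) (rpm dX dY m n * kron A B * adj (rpm dX dY m n)) $$ (x,x')
     = (\<Sum>y<dY ^ m * dY ^ n. A $$ (x div dX ^ n * dY ^ m + y div dY ^ n, x' div dX ^ n * dY ^ m + y div dY ^ n)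
        * B $$ (x mod dX ^ n * dY ^ n + y mod dY ^ n, x' mod dX ^ n * dY ^ n + y mod dY ^ n))"
  proof -
    have "(rpm dX dY m n * kron A B * adj (rpm dX dY m n)) $$ (x * dY ^ (m + n) + y, x' * dY ^ (m + n) + y)
       = A $$ (x div dX ^ n * dY ^ m + y div dY ^ n, x' div dX ^ n * dY ^ m + y div dY ^ n)
        * B $$ (x mod dX ^ n * dY ^ n + y mod dY ^ n, x' mod dX ^ n * dY ^ n + y mod dY ^ n)"
      if y: "y < dY ^ (m + n)" for y
      unfolding rpm_conj_kron[OF d A B mult_add_less[OF x(1) y] mult_add_less[OF x(2) y]] xyhi_def xylo_def
        mult_add_div_mod[OF y] ..
    thus ?thesis using x unfolding ptr_def by (simp add: power_add del: index_mult_mat(1))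
  qed
  also have "\<dots> = (\<Sum>y<dY ^ m. \<Sum>z<dY ^ n. A $$ (x div dX ^ n * dY ^ m + y, x' div dX ^ n * dY ^ m + y)
        * B $$ (x mod dX ^ n * dY ^ n + z, x' mod dX ^ n * dY ^ n + z))"
    by (rule sum_div_mod)
  also have "\<dots> = kron (ptr (dX ^ m) (dY ^ m) A) (ptr (dX ^ n) (dY ^ n) B) $$ (x,x')"
    using x' b by (simp add: ptr_def sum_product)
  finally show "ptr (dX ^ (m + n)) (dY ^ (m + n)) (rpm dX dY m n * kron A B * adj (rpm dX dY m n)) $$ (x,x')
     = kron (ptr (dX ^ m) (dY ^ m) A) (ptr (dX ^ n) (dY ^ n) B) $$ (x,x')" .
qed (auto simp: ptr_def power_add)

text \<open>The Kronecker product of two certificates, reordered by \<open>rpm\<close>, is again a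
  certificate, and the bounds on the marginals multiply.\<close>

lemma good_add:
  assumes "good m s" "good n t" and st: "0 \<le> s" "0 \<le> t"
  shows "good (m + n) (s * t)"
proof -
  obtain A where A: "psd (D m) A" "loewner_le (D m) (JP dX dY JN m) (wgm (1/a) (JP dX dY JM m) A)"
    "loewner_le (dX ^ m) (ptr (dX ^ m) (dY ^ m) A) (complex_of_real s \<cdot>\<^sub>m 1\<^sub>m (dX ^ m))"
    using assms(1) unfolding good_def feas_def by blast
  obtain B where B: "psd (D n) B" "loewner_le (D n) (JP dX dY JN n) (wgm (1/a) (JP dX dY JM n) B)"
    "loewner_le (dX ^ n) (ptr (dX ^ n) (dY ^ n) B) (complex_of_real t \<cdot>\<^sub>m 1\<^sub>m (dX ^ n))"
    using assms(2) unfolding good_def feas_def by blast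
  let ?R = "rpm dX dY m n"
  have R: "?R \<in> carrier_mat (D (m + n)) (D m * D n)" using rpm_carrier[OF d] unfolding D_add .
  define Z where "Z = ?R * kron A B * adj ?R"
  have "psd (D (m + n)) Z" unfolding Z_def by (rule psd_congr[OF psd_kron[OF A(1) B(1)] R])
  moreover have "loewner_le (D (m + n)) (JP dX dY JN (m + n)) (wgm (1/a) (JP dX dY JM (m + n)) Z)"
    unfolding JP_add[OF d] Z_def
    by (rule feasible_congr[OF ainv psd_kron[OF psd_NM(1) psd_NM(1)] psd_kron[OF psd_NM(2) psd_NM(2)] psd_kron[OF A(1) B(1)]
          feasible_kron[OF ainv psd_NM A(1) psd_NM B(1) A(2) B(2)] R])
  moreover have "loewner_le (dX ^ (m + n)) (ptr (dX ^ (m + n)) (dY ^ (m + n)) Z) (complex_of_real (s * t) \<cdot>\<^sub>m 1\<^sub>m (dX ^ (m + n)))"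
  proof -
    have "loewner_le (dX ^ m * dX ^ n) (kron (ptr (dX ^ m) (dY ^ m) A) (ptr (dX ^ n) (dY ^ n) B))
      (kron (complex_of_real s \<cdot>\<^sub>m 1\<^sub>m (dX ^ m)) (complex_of_real t \<cdot>\<^sub>m 1\<^sub>m (dX ^ n)))"
      by (rule kron_mono[OF psd_ptr[OF A(1)] psd_smult[OF psd_one st(1)] psd_ptr[OF B(1)] psd_smult[OF psd_one st(2)] A(3) B(3)])
    moreover have "kron (complex_of_real s \<cdot>\<^sub>m 1\<^sub>m (dX ^ m)) (complex_of_real t \<cdot>\<^sub>m 1\<^sub>m (dX ^ n))
      = complex_of_real (s * t) \<cdot>\<^sub>m 1\<^sub>m (dX ^ (m + n))"
      unfolding kron_smult_left kron_smult_right kron_one by (rule eq_matI) (auto simp: power_add)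
    ultimately show ?thesis unfolding Z_def ptr_rpm[OF psdD(1)[OF A(1)] psdD(1)[OF B(1)]] by (simp add: power_add)
  qed
  ultimately show ?thesis unfolding good_def feas_def by blast
qed

lemma good_0: "good 0 1"
proof -
  have "ptr 1 1 (1\<^sub>m 1) = 1\<^sub>m 1" unfolding ptr_def by (rule eq_matI) auto
  moreover have "complex_of_real 1 \<cdot>\<^sub>m 1\<^sub>m 1 = 1\<^sub>m 1" by (rule eq_matI) auto
  moreover have "loewner_le 1 (1\<^sub>m 1) (1\<^sub>m 1)" unfolding loewner_psd_iff[OF psd_one psd_one] by simp
  moreover have "feas 0 (1\<^sub>m 1)" unfolding feas_def JP_0[OF d] using feasible_one[OF ainv] by simp
  ultimately show ?thesis unfolding good_def by (intro exI[of _ "1\<^sub>m 1"]) simp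
qed

lemma good_pow: "good m t \<Longrightarrow> 0 \<le> t \<Longrightarrow> good (n * m) (t ^ n)"
proof (induction n)
  case 0
  show ?case using good_0 by simp
next
  case (Suc n)
  thus ?case using good_add[of m t "n * m" "t ^ n"] by simp
qed

section \<open>Passing between input states and certificates\<close>

definition wk :: "nat \<Rightarrow> complex mat \<Rightarrow> complex mat" where
  "wk m \<omega> = kron (mpow (1/2) \<omega>) (1\<^sub>m (dY ^ m))"

lemma wk:
  assumes "psd (dX ^ m) \<omega>"
  shows "wk m \<omega> \<in> carrier_mat (D m) (D m)" "adj (wk m \<omega>) = wk m \<omega>" "wk m \<omega> * wk m \<omega> = kron \<omega> (1\<^sub>m (dY ^ m))"
proof -
  note p = psd_mpow[OF psdD(2,1)[OF assms], of "1/2"]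
  show "wk m \<omega> \<in> carrier_mat (D m) (D m)" unfolding wk_def by (rule kron_carrier[OF psdD(1)[OF p] one_carrier_mat])
  show "adj (wk m \<omega>) = wk m \<omega>" unfolding wk_def adj_kron using psdD(2)[OF p] unfolding hermitian_def by simp
  show "wk m \<omega> * wk m \<omega> = kron \<omega> (1\<^sub>m (dY ^ m))"
    unfolding wk_def using psdD(4,5)[OF p] by (simp add: kron_mult mpow_half_square[OF assms])
qed

abbreviation "sw m \<omega> J \<equiv> sandwich_in (dY ^ m) \<omega> (JP dX dY J m)"

lemma sw_eq: "psd (dX ^ m) \<omega> \<Longrightarrow> sw m \<omega> J = wk m \<omega> * JP dX dY J m * adj (wk m \<omega>)"
proof -
  assume \<omega>: "psd (dX ^ m) \<omega>"
  have "sw m \<omega> J = wk m \<omega> * JP dX dY J m * wk m \<omega>" unfolding sandwich_in_def wk_def ..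
  thus ?thesis unfolding wk(2)[OF \<omega>] .
qed

lemma psd_sw:
  assumes "psd (dX ^ m) \<omega>"
  shows "psd (D m) (sw m \<omega> JN)" "psd (D m) (sw m \<omega> JM)"
  unfolding sw_eq[OF assms] using psd_congr[OF psd_NM(1) wk(1)[OF assms]] psd_congr[OF psd_NM(2) wk(1)[OF assms]] by auto

lemma trace_wk:
  assumes "psd (dX ^ m) \<omega>" "A \<in> carrier_mat (D m) (D m)"
  shows "mtrace (wk m \<omega> * A * adj (wk m \<omega>)) = mtrace (kron \<omega> (1\<^sub>m (dY ^ m)) * A)"
proof -
  note w = wk[OF assms(1)]
  have "mtrace (wk m \<omega> * A * adj (wk m \<omega>)) = mtrace (wk m \<omega> * (wk m \<omega> * A))"
    unfolding w(2) using w(1) assms(2) by (intro mtrace_comm[of _ "D m" "D m"]) auto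
  also have "wk m \<omega> * (wk m \<omega> * A) = kron \<omega> (1\<^sub>m (dY ^ m)) * A"
    unfolding w(3)[symmetric] using w(1) assms(2) by (simp add: mult_assoc_dim)
  finally show ?thesis .
qed

lemma feas_sw:
  assumes \<omega>: "psd (dX ^ m) \<omega>" and A: "feas m A"
  obtains A' where "psd (D m) A'" "loewner_le (D m) (sw m \<omega> JN) (wgm (1/a) (sw m \<omega> JM) A')"
    "Re (mtrace A') = Re (mtrace (kron \<omega> (1\<^sub>m (dY ^ m)) * A))"
proof -
  have p: "psd (D m) A" and le: "loewner_le (D m) (JP dX dY JN m) (wgm (1/a) (JP dX dY JM m) A)" using A unfolding feas_def by auto
  note w = wk(1)[OF \<omega>]
  show ?thesis
    by (rule that[OF psd_congr[OF p w] _ arg_cong[OF trace_wk[OF \<omega> psdD(1)[OF p]], of Re]])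
       (use feasible_congr[OF ainv psd_NM p le w] in \<open>simp only: sw_eq[OF \<omega>]\<close>)
qed

text \<open>The bound on the marginal controls the weighted trace of the certificate for every input
  at once, and \<open>Qs_le_trace\<close> turns that trace into a bound on
  \<open>Qs\<close>.\<close>

lemma good_upper:
  assumes g: "good m t" and \<omega>: "psd (dX ^ m) \<omega>" and tr: "Re (mtrace \<omega>) = 1"
  shows "supp_le (sw m \<omega> JN) (sw m \<omega> JM)" "Qs a (sw m \<omega> JN) (sw m \<omega> JM) \<le> t"
proof -
  obtain A where A: "feas m A" and le: "loewner_le (dX ^ m) (ptr (dX ^ m) (dY ^ m) A) (complex_of_real t \<cdot>\<^sub>m 1\<^sub>m (dX ^ m))"
    using g unfolding good_def by blast
  have Ac: "A \<in> carrier_mat (D m) (D m)" using A psdD(1) unfolding feas_def by blast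
  obtain A' where A': "psd (D m) A'" "loewner_le (D m) (sw m \<omega> JN) (wgm (1/a) (sw m \<omega> JM) A')"
    "Re (mtrace A') = Re (mtrace (kron \<omega> (1\<^sub>m (dY ^ m)) * A))" by (rule feas_sw[OF \<omega> A]) blast
  show "supp_le (sw m \<omega> JN) (sw m \<omega> JM)" by (rule feasible_supp_le[OF a psd_sw[OF \<omega>] A'(1,2)])
  have "Qs a (sw m \<omega> JN) (sw m \<omega> JM) \<le> Re (mtrace A')" by (rule Qs_le_trace[OF a psd_sw[OF \<omega>] A'(1,2)])
  also have "\<dots> = Re (mtrace (\<omega> * ptr (dX ^ m) (dY ^ m) A))"
    unfolding A'(3) trace_ptr[OF psdD(1)[OF \<omega>] Ac] ..
  also have "\<dots> \<le> Re (mtrace (\<omega> * (complex_of_real t \<cdot>\<^sub>m 1\<^sub>m (dX ^ m))))" by (rule trace_mult_mono[OF \<omega> le])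
  also have "\<dots> = t" using psdD(1)[OF \<omega>] psdD(4,5)[OF \<omega>] tr by (simp add: mult_smult_right mtrace_smult)
  finally show "Qs a (sw m \<omega> JN) (sw m \<omega> JM) \<le> t" .
qed

text \<open>\<open>V\<close> inverts the congruence with the root of \<open>\<omega>\<close>, for
  which \<open>\<omega>\<close> must have full rank. This is why \<open>minimax\<close> tests
  full-rank states.\<close>

lemma feas_of_sw:
  assumes \<omega>: "psd (dX ^ m) \<omega>" and \<eta>: "0 < \<eta>" "\<And>v. v \<in> carrier_vec (dX ^ m) \<Longrightarrow> \<eta> * sqn v \<le> qf \<omega> v"
    and A': "psd (D m) A'" "loewner_le (D m) (sw m \<omega> JN) (wgm (1/a) (sw m \<omega> JM) A')"
  obtains A where "feas m A" "Re (mtrace (kron \<omega> (1\<^sub>m (dY ^ m)) * A)) = Re (mtrace A')"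
proof -
  note w = wk[OF \<omega>]
  obtain U e where U: "unitary (dX ^ m) U" "\<omega> = U * rdiag (dX ^ m) e * adj U" "\<forall>i<dX ^ m. 0 < e i"
    by (rule pd_spectral[OF \<omega> \<eta>]) blast
  define V where "V = kron (mpow (- (1/2)) \<omega>) (1\<^sub>m (dY ^ m))"
  note p = psd_mpow[OF psdD(2,1)[OF \<omega>], of "- (1/2)"] psd_mpow[OF psdD(2,1)[OF \<omega>], of "1/2"]
  have Vc: "V \<in> carrier_mat (D m) (D m)" unfolding V_def by (rule kron_carrier[OF psdD(1)[OF p(1)] one_carrier_mat])
  have "mpow (- (1/2)) \<omega> * mpow (1/2) \<omega> = 1\<^sub>m (dX ^ m)"
    by (rule mpow_minus_mult[OF U(1,2)]) (use U(3) in blast)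
  hence VW: "V * wk m \<omega> = 1\<^sub>m (D m)"
    unfolding V_def wk_def using psdD(4,5)[OF p(1)] psdD(4,5)[OF p(2)] by (simp add: kron_mult)
  hence WV: "wk m \<omega> * V = 1\<^sub>m (D m)" using mat_mult_left_right_inverse[OF Vc w(1)] by blast
  have WaV: "adj (wk m \<omega>) * adj V = 1\<^sub>m (D m)"
    using adj_mult[of V "wk m \<omega>"] VW Vc w(1) by simp
  have cancel: "V * (wk m \<omega> * X * adj (wk m \<omega>)) * adj V = X" if X: "X \<in> carrier_mat (D m) (D m)" for X
  proof -
    have "V * (wk m \<omega> * X * adj (wk m \<omega>)) * adj V = (V * wk m \<omega>) * X * (adj (wk m \<omega>) * adj V)"
      using Vc w(1) X by (simp add: mult_assoc_dim)
    thus ?thesis unfolding VW WaV using X by simp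
  qed
  have cancel': "wk m \<omega> * (V * X * adj V) * adj (wk m \<omega>) = X" if X: "X \<in> carrier_mat (D m) (D m)" for X
  proof -
    have VaW: "adj V * adj (wk m \<omega>) = 1\<^sub>m (D m)" using adj_mult[of "wk m \<omega>" V] WV Vc w(1) by simp
    have "wk m \<omega> * (V * X * adj V) * adj (wk m \<omega>) = (wk m \<omega> * V) * X * (adj V * adj (wk m \<omega>))"
      using Vc w(1) X by (simp add: mult_assoc_dim)
    thus ?thesis unfolding WV VaW using X by simp
  qed
  define A where "A = V * A' * adj V"
  have Ap: "psd (D m) A" unfolding A_def by (rule psd_congr[OF A'(1) Vc])
  have "loewner_le (D m) (V * sw m \<omega> JN * adj V) (wgm (1/a) (V * sw m \<omega> JM * adj V) A)"
    unfolding A_def by (rule feasible_congr[OF ainv psd_sw[OF \<omega>] A' Vc])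
  hence "feas m A" unfolding feas_def sw_eq[OF \<omega>] cancel[OF JP_carrier] using Ap by blast
  moreover have "Re (mtrace (kron \<omega> (1\<^sub>m (dY ^ m)) * A)) = Re (mtrace A')"
    unfolding trace_wk[OF \<omega> psdD(1)[OF Ap], symmetric] unfolding A_def cancel'[OF psdD(1)[OF A'(1)]] ..
  ultimately show ?thesis by (rule that)
qed

text \<open>The minimax theorem is applied to the convex set of input marginals of certificates, on
  which the trace against an input state is linear.\<close>

lemma good_of_bound:
  assumes H: "\<And>\<omega> \<epsilon>. psd (dX ^ m) \<omega> \<Longrightarrow> Re (mtrace \<omega>) = 1 \<Longrightarrow> 0 < \<epsilon> \<Longrightarrow>
      \<exists>A'. psd (D m) A' \<and> loewner_le (D m) (sw m \<omega> JN) (wgm (1/a) (sw m \<omega> JM) A') \<and> Re (mtrace A') \<le> T + \<epsilon>"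
    and \<epsilon>: "0 < \<epsilon>"
  shows "good m (T + \<epsilon>)"
proof -
  have n: "0 < dX ^ m" using d by simp
  have "\<exists>X\<in>ptr (dX ^ m) (dY ^ m) ` {A. feas m A}. loewner_le (dX ^ m) X (complex_of_real (T + \<epsilon>) \<cdot>\<^sub>m 1\<^sub>m (dX ^ m))"
  proof (rule minimax[OF n _ _ _ \<epsilon>])
    fix X assume "X \<in> ptr (dX ^ m) (dY ^ m) ` {A. feas m A}"
    thus "psd (dX ^ m) X" using psd_ptr unfolding feas_def by blast
  next
    fix X Y and t :: real
    assume "X \<in> ptr (dX ^ m) (dY ^ m) ` {A. feas m A}" "Y \<in> ptr (dX ^ m) (dY ^ m) ` {A. feas m A}" and t: "0 \<le> t" "t \<le> 1"
    then obtain A B where AB: "feas m A" "feas m B" "X = ptr (dX ^ m) (dY ^ m) A" "Y = ptr (dX ^ m) (dY ^ m) B" by blast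
    have c: "A \<in> carrier_mat (D m) (D m)" "B \<in> carrier_mat (D m) (D m)" using AB psdD(1) unfolding feas_def by auto
    show "complex_of_real (1 - t) \<cdot>\<^sub>m X + complex_of_real t \<cdot>\<^sub>m Y \<in> ptr (dX ^ m) (dY ^ m) ` {A. feas m A}"
      unfolding AB(3,4) ptr_lincomb[OF c, symmetric] using feas_convex[OF AB(1,2) t] by blast
  next
    fix \<omega> \<eta> \<epsilon>'
    assume \<omega>: "psd (dX ^ m) \<omega>" "Re (mtrace \<omega>) = 1" and \<eta>: "0 < \<eta>" "\<And>v. v \<in> carrier_vec (dX ^ m) \<Longrightarrow> \<eta> * sqn v \<le> qf \<omega> v"
      and e: "(0::real) < \<epsilon>'"
    obtain A' where A': "psd (D m) A'" "loewner_le (D m) (sw m \<omega> JN) (wgm (1/a) (sw m \<omega> JM) A')" "Re (mtrace A') \<le> T + \<epsilon>'"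
      using H[OF \<omega> e] by blast
    obtain A where A: "feas m A" "Re (mtrace (kron \<omega> (1\<^sub>m (dY ^ m)) * A)) = Re (mtrace A')"
      by (rule feas_of_sw[OF \<omega>(1) \<eta> A'(1,2)]) blast
    have Ac: "A \<in> carrier_mat (D m) (D m)" using A psdD(1) unfolding feas_def by blast
    have "Re (mtrace (\<omega> * ptr (dX ^ m) (dY ^ m) A)) \<le> T + \<epsilon>'"
      using A(2) A'(3) unfolding trace_ptr[OF psdD(1)[OF \<omega>(1)] Ac] by simp
    thus "\<exists>X\<in>ptr (dX ^ m) (dY ^ m) ` {A. feas m A}. Re (mtrace (\<omega> * X)) \<le> T + \<epsilon>'" using A(1) by blast
  qed
  thus ?thesis unfolding good_def by blast
qed

section \<open>Permutation-invariant inputs\<close>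

abbreviation "Up m p \<equiv> pm (D m) (actXY dX dY m p)"
abbreviation "Xp m p \<equiv> pm (dX ^ m) (actd dX m p)"

lemma Up_kron_one:
  assumes p: "p permutes {..<m}" and W: "W \<in> carrier_mat (dX ^ m) (dX ^ m)"
  shows "Up m p * kron W (1\<^sub>m (dY ^ m)) * adj (Up m p) = kron (Xp m p * W * adj (Xp m p)) (1\<^sub>m (dY ^ m))"
proof -
  have Y: "unitary (dY ^ m) (pm (dY ^ m) (actd dY m p))" by (rule unitary_pm_actd[OF d d(2) p])
  show ?thesis unfolding pm_actXY[OF d] adj_kron using W Y
    by (simp add: kron_mult right_mult_one_mat[of _ "dY ^ m" "dY ^ m"])
qed

text \<open>Functional calculus commutes with conjugation, so the root of an invariant input is
  invariant as well.\<close>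

lemma sw_perm:
  assumes \<omega>: "psd (dX ^ m) \<omega>" and p: "p permutes {..<m}" and inv: "Xp m p * \<omega> * adj (Xp m p) = \<omega>"
  shows "Up m p * sw m \<omega> J * adj (Up m p) = sw m \<omega> J"
proof -
  let ?U = "Up m p" and ?K = "wk m \<omega>" and ?J = "JP dX dY J m"
  note w = wk[OF \<omega>]
  have u: "unitary (D m) ?U" by (rule unitary_pm_actXY[OF d p])
  have uX: "unitary (dX ^ m) (Xp m p)" by (rule unitary_pm_actd[OF d d(1) p])
  have mc: "mpow (1/2) \<omega> \<in> carrier_mat (dX ^ m) (dX ^ m)" by (rule psdD(1)[OF psd_mpow[OF psdD(2,1)[OF \<omega>]]])
  have "Xp m p * mpow (1/2) \<omega> * adj (Xp m p) = mpow (1/2) \<omega>"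
    using mat_fun_unitary[OF uX psdD(2,1)[OF \<omega>]] unfolding mpow_def inv by metis
  hence K: "?U * ?K * adj ?U = ?K" unfolding wk_def Up_kron_one[OF p mc] by simp
  have "?U * (?K * ?J * ?K) * adj ?U = (?U * ?K * adj ?U) * (?U * ?J * adj ?U) * (?U * ?K * adj ?U)"
    using u w(1) by (simp add: mult_assoc_dim unitary_cancel carrier_matD[OF JP_carrier] carrier_matD[OF w(1)])
  thus ?thesis unfolding K JP_perm[OF d p] sw_eq[OF \<omega>] w(2) .
qed

text \<open>For a permutation-invariant full-rank input the number of eigenvalues of the second operator is
  polynomial in \<open>m\<close>. A general input is reduced to this case by mixing with the maximally mixed state
  and averaging; since the trace is linear in the input, one of the permuted certificates does at
  least as well as the average.\<close>
lemma symm_bound: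
  assumes H: "\<And>\<omega>. psd (dX ^ m) \<omega> \<Longrightarrow> Re (mtrace \<omega>) = 1 \<Longrightarrow>
      supp_le (sw m \<omega> JN) (sw m \<omega> JM) \<and> Qs a (sw m \<omega> JN) (sw m \<omega> JM) \<le> Qb"
    and \<omega>: "psd (dX ^ m) \<omega>" "Re (mtrace \<omega>) = 1" and \<delta>: "0 < \<delta>" "\<delta> < 1"
  obtains A where "feas m A"
    "Re (mtrace (kron \<omega> (1\<^sub>m (dY ^ m)) * A)) \<le> pw a (real ((m + 1) ^ (dX * dY * (dX * dY)))) * Qb / (1 - \<delta>)"
proof -
  let ?n = "dX ^ m"
  let ?v = "pw a (real ((m + 1) ^ (dX * dY * (dX * dY))))"
  have n: "0 < ?n" using d by simp
  define \<omega>d where "\<omega>d = complex_of_real (1 - \<delta>) \<cdot>\<^sub>m \<omega> + complex_of_real (\<delta> / real ?n) \<cdot>\<^sub>m 1\<^sub>m ?n"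
  have oc: "\<omega> \<in> carrier_mat ?n ?n" using psdD(1)[OF \<omega>(1)] .
  have od: "psd ?n \<omega>d" unfolding \<omega>d_def using \<delta> by (intro psd_add psd_smult \<omega>(1) psd_one) auto
  have odc: "\<omega>d \<in> carrier_mat ?n ?n" using psdD(1)[OF od] .
  have tr1: "mtrace (1\<^sub>m ?n) = of_nat ?n" unfolding mtrace_def by simp
  have c12: "complex_of_real (1 - \<delta>) \<cdot>\<^sub>m \<omega> \<in> carrier_mat ?n ?n" "complex_of_real (\<delta> / real ?n) \<cdot>\<^sub>m 1\<^sub>m ?n \<in> carrier_mat ?n ?n"
    using oc by auto
  have tod: "Re (mtrace \<omega>d) = 1"
  proof -
    have "mtrace \<omega>d = complex_of_real (1 - \<delta>) * mtrace \<omega> + complex_of_real (\<delta> / real ?n) * mtrace (1\<^sub>m ?n)"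
      unfolding \<omega>d_def using oc by (simp add: mtrace_add[of _ ?n] mtrace_smult)
    hence "Re (mtrace \<omega>d) = (1 - \<delta>) * Re (mtrace \<omega>) + \<delta> / real ?n * real ?n" unfolding tr1 by simp
    thus ?thesis using \<omega>(2) d by simp
  qed
  define \<eta> where "\<eta> = \<delta> / real ?n"
  have \<eta>: "0 < \<eta>" unfolding \<eta>_def using \<delta> n by simp
  have low: "\<eta> * sqn v \<le> qf \<omega>d v" if v: "v \<in> carrier_vec ?n" for v
  proof -
    have "qf \<omega>d v = (1 - \<delta>) * qf \<omega> v + \<eta> * sqn v"
      unfolding \<omega>d_def qf_add[OF c12 v] qf_smult[OF oc v] qf_smult[OF one_carrier_mat v] qf_one[OF v] \<eta>_def ..
    moreover have "0 \<le> (1 - \<delta>) * qf \<omega> v" using \<delta> psdD(3)[OF \<omega>(1) v] by simp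
    ultimately show ?thesis by simp
  qed
  define \<omega>b where "\<omega>b = avg dX m \<omega>d"
  have ob: "psd ?n \<omega>b" unfolding \<omega>b_def by (rule psd_avg[OF d(1) od])
  have tob: "Re (mtrace \<omega>b) = 1" unfolding \<omega>b_def trace_avg_one[OF d(1) od] by (rule tod)
  have lowb: "\<eta> * sqn v \<le> qf \<omega>b v" if "v \<in> carrier_vec ?n" for v
    unfolding \<omega>b_def by (rule avg_lower[OF d(1) od low that])
  have invb: "Xp m p * \<omega>b * adj (Xp m p) = \<omega>b" if "p permutes {..<m}" for p
    unfolding \<omega>b_def by (rule avg_perm[OF d(1) od that])
  note ps = psd_sw[OF ob]
  obtain V s where V: "unitary (D m) V" and \<sigma>: "sw m \<omega>b JM = V * rdiag (D m) s * adj V"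
    and s: "\<And>i. i < D m \<Longrightarrow> 0 \<le> s i"
    using psd_spectral[OF ps(2)] by metis
  have Cfin: "finite {..<dX * dY}" by simp
  have card: "card (s ` {..<D m}) \<le> (m + 1) ^ (card {..<dX * dY} * card {..<dX * dY})"
  proof (rule card_eigen_perm[OF V \<sigma> Cfin, where enc = "enc dX dY m" and act = "actXY dX dY m"])
    show "enc dX dY m i k \<in> {..<dX * dY}" for i k using enc_less[OF d] by simp
    show "i = j" if "i < D m" "j < D m" "\<And>k. k < m \<Longrightarrow> enc dX dY m i k = enc dX dY m j k" for i j
      by (rule enc_inj[OF d that])
    show "actXY dX dY m p i < D m" for p i by (rule actXY_less[OF d])
    show "enc dX dY m (actXY dX dY m p i) k = enc dX dY m i (p k)" if "k < m" for p i k by (rule enc_actXY[OF d that])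
    show "unitary (D m) (Up m p)" if "p permutes {..<m}" for p by (rule unitary_pm_actXY[OF d that])
    show "Up m p * sw m \<omega>b JM * adj (Up m p) = sw m \<omega>b JM" if "p permutes {..<m}" for p
      by (rule sw_perm[OF ob that invb[OF that]])
  qed
  note Hb = H[OF ob tob]
  obtain A' where A': "psd (D m) A'" "loewner_le (D m) (sw m \<omega>b JN) (wgm (1/a) (sw m \<omega>b JM) A')"
    "Re (mtrace A') \<le> pw a (real (card (s ` {..<D m}))) * Qs a (sw m \<omega>b JN) (sw m \<omega>b JM)"
    by (rule feasible_exists[OF a V \<sigma> s ps(1) conjunct1[OF Hb]]) blast
  have tA': "Re (mtrace A') \<le> ?v * Qb"
  proof -
    have Qnn: "0 \<le> Qs a (sw m \<omega>b JN) (sw m \<omega>b JM)" by (rule Qs_nonneg[OF ps])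
    have "pw a (real (card (s ` {..<D m}))) \<le> ?v"
      using card a by (intro pw_mono) (auto simp del: of_nat_power)
    hence "pw a (real (card (s ` {..<D m}))) * Qs a (sw m \<omega>b JN) (sw m \<omega>b JM) \<le> ?v * Qb"
      using Hb Qnn by (intro mult_mono) auto
    thus ?thesis using A'(3) by linarith
  qed
  obtain A where A: "feas m A" "Re (mtrace (kron \<omega>b (1\<^sub>m (dY ^ m)) * A)) = Re (mtrace A')"
    by (rule feas_of_sw[OF ob \<eta> lowb A'(1,2)]) blast
  have Ap: "psd (D m) A" and Ale: "loewner_le (D m) (JP dX dY JN m) (wgm (1/a) (JP dX dY JM m) A)"
    using A(1) unfolding feas_def by auto
  note Ac = psdD(1)[OF Ap]
  let ?P = "ptr ?n (dY ^ m) A"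
  let ?X = "\<lambda>p. Xp m p * \<omega>d * adj (Xp m p)"
  have "\<exists>p. p permutes {..<m} \<and> Re (mtrace (?X p * ?P)) \<le> ?v * Qb"
  proof (rule ccontr)
    assume "\<not> ?thesis"
    hence gt: "?v * Qb < Re (mtrace (?X p * ?P))" if "p permutes {..<m}" for p using that by (meson not_le)
    have ne: "{p. p permutes {..<m}} \<noteq> {}" using permutes_id by blast
    have "(\<Sum>p | p permutes {..<m}. ?v * Qb) < (\<Sum>p | p permutes {..<m}. Re (mtrace (?X p * ?P)))"
      by (rule sum_strict_mono[OF finite_permutations[OF finite_lessThan] ne]) (use gt in auto)
    hence "fact m * (?v * Qb) < (\<Sum>p | p permutes {..<m}. Re (mtrace (?X p * ?P)))"
      by (simp add: card_perms[OF d(1) od])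
    also have "\<dots> = fact m * Re (mtrace (\<omega>b * ?P))"
      unfolding \<omega>b_def trace_avg[OF d(1) od ptr_carrier] by (simp del: of_real_divide)
    also have "Re (mtrace (\<omega>b * ?P)) = Re (mtrace A')"
      unfolding A(2)[symmetric] trace_ptr[OF psdD(1)[OF ob] Ac] ..
    finally have "fact m * (?v * Qb) < fact m * Re (mtrace A')" .
    hence "?v * Qb < Re (mtrace A')" by simp
    thus False using tA' by simp
  qed
  then obtain p where p: "p permutes {..<m}" "Re (mtrace (?X p * ?P)) \<le> ?v * Qb" by blast
  let ?U = "Up m p"
  have u: "unitary (D m) ?U" by (rule unitary_pm_actXY[OF d p(1)])
  have Uc: "?U \<in> carrier_mat (D m) (D m)" by simp
  have Ua: "adj ?U \<in> carrier_mat (D m) (D m)" by simp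
  have bk: "adj ?U * JP dX dY J m * adj (adj ?U) = JP dX dY J m" for J
  proof -
    have "adj ?U * (?U * JP dX dY J m * adj ?U) * adj (adj ?U) = JP dX dY J m"
      using u by (simp add: mult_assoc_dim unitary_cancel carrier_matD[OF JP_carrier] right_mult_one_mat[OF JP_carrier])
    thus ?thesis unfolding JP_perm[OF d p(1)] .
  qed
  \<comment> \<open>Moves the permutation from the input to the certificate; feasibility is kept
    because the Choi operators are permutation-invariant.\<close>
  define B where "B = adj ?U * A * ?U"
  have B: "B = adj ?U * A * adj (adj ?U)" unfolding B_def by simp
  have Bp: "psd (D m) B" unfolding B by (rule psd_congr[OF Ap Ua])
  note Bc = psdD(1)[OF Bp]
  have "loewner_le (D m) (JP dX dY JN m) (wgm (1/a) (JP dX dY JM m) B)"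
    using feasible_congr[OF ainv psd_NM Ap Ale Ua] unfolding bk B .
  hence fB: "feas m B" unfolding feas_def using Bp by blast
  have kc: "kron W (1\<^sub>m (dY ^ m)) \<in> carrier_mat (D m) (D m)" if "W \<in> carrier_mat ?n ?n" for W
    using that by (intro kron_carrier) auto
  have tB: "Re (mtrace (kron \<omega>d (1\<^sub>m (dY ^ m)) * B)) \<le> ?v * Qb"
  proof -
    have "mtrace (kron \<omega>d (1\<^sub>m (dY ^ m)) * B) = mtrace ((kron \<omega>d (1\<^sub>m (dY ^ m)) * adj ?U * A) * ?U)"
      unfolding B_def using carrier_matD[OF odc] carrier_matD[OF Ac] by (simp add: mult_assoc_dim)
    also have "\<dots> = mtrace (?U * (kron \<omega>d (1\<^sub>m (dY ^ m)) * adj ?U * A))"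
      using kc[OF odc] Uc Ac by (intro mtrace_comm[of _ "D m" "D m"]) auto
    also have "?U * (kron \<omega>d (1\<^sub>m (dY ^ m)) * adj ?U * A) = (?U * kron \<omega>d (1\<^sub>m (dY ^ m)) * adj ?U) * A"
      using carrier_matD[OF odc] carrier_matD[OF Ac] by (simp add: mult_assoc_dim)
    also have "\<dots> = kron (?X p) (1\<^sub>m (dY ^ m)) * A" unfolding Up_kron_one[OF p(1) odc] ..
    also have "mtrace \<dots> = mtrace (?X p * ?P)" by (rule trace_ptr) (use Ac in auto)
    finally show ?thesis using p(2) by simp
  qed
  \<comment> \<open>\<open>(1 - \<delta>)\<close> times \<open>\<omega>\<close> lies below
    \<open>\<omega>d\<close>, which is where the division by \<open>1 - \<delta>\<close> comes
    from.\<close>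
  have "(1 - \<delta>) * Re (mtrace (kron \<omega> (1\<^sub>m (dY ^ m)) * B)) \<le> Re (mtrace (kron \<omega>d (1\<^sub>m (dY ^ m)) * B))"
  proof -
    have "kron \<omega>d (1\<^sub>m (dY ^ m)) = complex_of_real (1 - \<delta>) \<cdot>\<^sub>m kron \<omega> (1\<^sub>m (dY ^ m)) + complex_of_real \<eta> \<cdot>\<^sub>m 1\<^sub>m (D m)"
      unfolding \<omega>d_def \<eta>_def using oc by (simp add: kron_add_left kron_smult_left)
    hence "kron \<omega>d (1\<^sub>m (dY ^ m)) * B = complex_of_real (1 - \<delta>) \<cdot>\<^sub>m (kron \<omega> (1\<^sub>m (dY ^ m)) * B) + complex_of_real \<eta> \<cdot>\<^sub>m B"
      using oc Bc by (simp add: mult_add_left mult_smult_left left_mult_one_mat[OF Bc])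
    hence "mtrace (kron \<omega>d (1\<^sub>m (dY ^ m)) * B) = complex_of_real (1 - \<delta>) * mtrace (kron \<omega> (1\<^sub>m (dY ^ m)) * B) + complex_of_real \<eta> * mtrace B"
      using oc Bc by (simp add: mtrace_add[of _ "D m"] mtrace_smult)
    hence "Re (mtrace (kron \<omega>d (1\<^sub>m (dY ^ m)) * B)) = (1 - \<delta>) * Re (mtrace (kron \<omega> (1\<^sub>m (dY ^ m)) * B)) + \<eta> * Re (mtrace B)"
      by simp
    moreover have "0 \<le> \<eta> * Re (mtrace B)" using \<eta> mtrace_psd(2)[OF Bp] by simp
    ultimately show ?thesis by linarith
  qed
  hence "(1 - \<delta>) * Re (mtrace (kron \<omega> (1\<^sub>m (dY ^ m)) * B)) \<le> ?v * Qb" using tB by linarith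
  hence "Re (mtrace (kron \<omega> (1\<^sub>m (dY ^ m)) * B)) \<le> ?v * Qb / (1 - \<delta>)"
    using \<delta> by (simp add: pos_le_divide_eq mult.commute)
  thus ?thesis by (rule that[OF fB])
qed

text \<open>The values of \<open>chan_div\<close> on the \<open>m\<close>-th powers after
  \<open>choi_tpow\<close> has rewritten the Choi operators; \<open>S\<close> stands for sandwiched
  and \<open>H\<close> for the sharp version.\<close>

abbreviation "SD m \<equiv> SUP \<omega>\<in>{\<omega>. Defs.density (dX ^ m) \<omega>}. sandwiched a (sw m \<omega> JN) (sw m \<omega> JM)"
abbreviation "HD m \<equiv> SUP \<omega>\<in>{\<omega>. Defs.density (dX ^ m) \<omega>}. Dsharp a (sw m \<omega> JN) (sw m \<omega> JM)"

lemma density_iff: "Defs.density n \<omega> \<longleftrightarrow> psd n \<omega> \<and> Re (mtrace \<omega>) = 1"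
  unfolding Defs.density_def using mtrace_psd(1) by force

lemma SD_le_iff: "SD m \<le> ereal l \<longleftrightarrow> (\<forall>\<omega>. psd (dX ^ m) \<omega> \<longrightarrow> Re (mtrace \<omega>) = 1 \<longrightarrow>
    supp_le (sw m \<omega> JN) (sw m \<omega> JM) \<and> Qs a (sw m \<omega> JN) (sw m \<omega> JM) \<le> 2 powr ((a - 1) * l))"
  unfolding SUP_le_iff sandwiched_le_iff[OF a] density_iff by auto

lemma HD_le_iff: "HD m \<le> ereal l \<longleftrightarrow> (\<forall>\<omega>. psd (dX ^ m) \<omega> \<longrightarrow> Re (mtrace \<omega>) = 1 \<longrightarrow>
    Qsharp a (sw m \<omega> JN) (sw m \<omega> JM) \<le> ereal (2 powr ((a - 1) * l)))"
  unfolding SUP_le_iff Dsharp_le_iff[OF a] density_iff by auto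

lemma Qsharp_eq:
  assumes \<omega>: "psd (dX ^ m) \<omega>"
  shows "Qsharp a (sw m \<omega> JN) (sw m \<omega> JM) = Inf {ereal (Re (mtrace A)) | A.
    psd (D m) A \<and> loewner_le (D m) (sw m \<omega> JN) (wgm (1/a) (sw m \<omega> JM) A)}"
  unfolding Qsharp_def psdD(4)[OF psd_sw(1)[OF \<omega>]] ..

text \<open>A certificate for \<open>m\<close> copies slightly above the threshold is raised to the
  \<open>n\<close>-th power and bounds \<open>Qs\<close> for \<open>n * m\<close> copies. The slack
  is sent to 0 afterwards.\<close>

lemma SD_mult_le:
  assumes H: "HD m \<le> ereal l"
  shows "SD (n * m) \<le> ereal (real n * l)"
  unfolding SD_le_iff
proof (intro allI impI)
  fix \<omega> assume \<omega>: "psd (dX ^ (n * m)) \<omega>" "Re (mtrace \<omega>) = 1"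
  let ?E = "2 powr ((a - 1) * l)"
  have g: "good m (?E + \<epsilon>)" if e: "0 < \<epsilon>" for \<epsilon>
  proof (rule good_of_bound[OF _ e])
    fix \<omega> and \<epsilon> :: real assume \<omega>: "psd (dX ^ m) \<omega>" "Re (mtrace \<omega>) = 1" and \<epsilon>: "0 < \<epsilon>"
    have "Qsharp a (sw m \<omega> JN) (sw m \<omega> JM) \<le> ereal ?E" using H \<omega> unfolding HD_le_iff by blast
    also have "ereal ?E < ereal (?E + \<epsilon>)" using \<epsilon> by simp
    finally obtain A where "psd (D m) A" "loewner_le (D m) (sw m \<omega> JN) (wgm (1/a) (sw m \<omega> JM) A)"
      "ereal (Re (mtrace A)) < ereal (?E + \<epsilon>)"
      unfolding Qsharp_eq[OF \<omega>(1)] Inf_less_iff by blast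
    thus "\<exists>A'. psd (D m) A' \<and> loewner_le (D m) (sw m \<omega> JN) (wgm (1/a) (sw m \<omega> JM) A')
      \<and> Re (mtrace A') \<le> ?E + \<epsilon>" by auto
  qed
  have gp: "good (n * m) ((?E + \<epsilon>) ^ n)" if e: "0 < \<epsilon>" for \<epsilon>
    by (rule good_pow[OF g[OF e]]) (use e in simp)
  have up: "supp_le (sw (n * m) \<omega> JN) (sw (n * m) \<omega> JM)"
    "Qs a (sw (n * m) \<omega> JN) (sw (n * m) \<omega> JM) \<le> (?E + \<epsilon>) ^ n" if "0 < \<epsilon>" for \<epsilon>
    using good_upper[OF gp[OF that] \<omega>] by auto
  have "((\<lambda>\<epsilon>. (?E + \<epsilon>) ^ n) \<longlongrightarrow> (?E + 0) ^ n) (at_right 0)" by (intro tendsto_intros)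
  moreover have "\<forall>\<^sub>F \<epsilon> in at_right 0. Qs a (sw (n * m) \<omega> JN) (sw (n * m) \<omega> JM) \<le> (?E + \<epsilon>) ^ n"
    using eventually_at_right_less[of 0] by eventually_elim (rule up(2))
  ultimately have "Qs a (sw (n * m) \<omega> JN) (sw (n * m) \<omega> JM) \<le> (?E + 0) ^ n"
    by (rule tendsto_lowerbound) simp
  also have "(?E + 0) ^ n = 2 powr ((a - 1) * (real n * l))"
    by (simp add: powr_power mult_ac)
  finally show "supp_le (sw (n * m) \<omega> JN) (sw (n * m) \<omega> JM)
    \<and> Qs a (sw (n * m) \<omega> JN) (sw (n * m) \<omega> JM) \<le> 2 powr ((a - 1) * (real n * l))"
    using up(1)[of 1] by simp
qed

text \<open>The eigenvalue count to the power \<open>a\<close>, after taking the logarithm and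
  dividing by \<open>a - 1\<close>, becomes the additive correction. The perturbation
  \<open>\<delta>\<close> from \<open>symm_bound\<close> is sent to 0.\<close>

lemma HD_le:
  assumes S: "SD m \<le> ereal l"
  shows "HD m \<le> ereal (l + a / (a - 1) * (real (dX * dY) ^ 2 + real (dX * dY)) * log 2 (real m + real (dX * dY)))"
    (is "_ \<le> ereal (l + ?c)")
  unfolding HD_le_iff
proof (intro allI impI)
  fix \<omega> assume \<omega>: "psd (dX ^ m) \<omega>" "Re (mtrace \<omega>) = 1"
  let ?E = "2 powr ((a - 1) * l)" and ?v = "pw a (real ((m + 1) ^ (dX * dY * (dX * dY))))"
  let ?e = "dX * dY"
  have e: "1 \<le> real ?e" using d by (simp add: Suc_le_eq flip: of_nat_mult)
  have bound: "Qsharp a (sw m \<omega> JN) (sw m \<omega> JM) \<le> ereal (?v * ?E / (1 - \<delta>))" if \<delta>: "0 < \<delta>" "\<delta> < 1" for \<delta>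
  proof -
    have H: "supp_le (sw m \<omega> JN) (sw m \<omega> JM) \<and> Qs a (sw m \<omega> JN) (sw m \<omega> JM) \<le> ?E"
      if "psd (dX ^ m) \<omega>" "Re (mtrace \<omega>) = 1" for \<omega>
      using S that unfolding SD_le_iff by blast
    obtain A where A: "feas m A" "Re (mtrace (kron \<omega> (1\<^sub>m (dY ^ m)) * A)) \<le> ?v * ?E / (1 - \<delta>)"
      by (rule symm_bound[OF H \<omega> \<delta>]) blast+
    obtain A' where A': "psd (D m) A'" "loewner_le (D m) (sw m \<omega> JN) (wgm (1/a) (sw m \<omega> JM) A')"
      "Re (mtrace A') = Re (mtrace (kron \<omega> (1\<^sub>m (dY ^ m)) * A))"
      by (rule feas_sw[OF \<omega>(1) A(1)]) blast
    have "Qsharp a (sw m \<omega> JN) (sw m \<omega> JM) \<le> ereal (Re (mtrace A'))"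
      unfolding Qsharp_eq[OF \<omega>(1)] using A'(1,2) by (intro Inf_lower) blast
    also have "\<dots> \<le> ereal (?v * ?E / (1 - \<delta>))" using A(2) A'(3) by simp
    finally show ?thesis .
  qed
  have "((\<lambda>\<delta>. ereal (?v * ?E / (1 - \<delta>))) \<longlongrightarrow> ereal (?v * ?E / (1 - 0))) (at_right 0)"
    by (intro tendsto_ereal tendsto_divide tendsto_intros) auto
  moreover have "\<forall>\<^sub>F \<delta> in at_right 0. Qsharp a (sw m \<omega> JN) (sw m \<omega> JM) \<le> ereal (?v * ?E / (1 - \<delta>))"
  proof (rule eventually_mono[OF eventually_at_right_real[of 0 1]])
    show "(0::real) < 1" by simp
  next
    fix \<delta> :: real assume "\<delta> \<in> {0<..<1}"
    thus "Qsharp a (sw m \<omega> JN) (sw m \<omega> JM) \<le> ereal (?v * ?E / (1 - \<delta>))" by (intro bound) auto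
  qed
  ultimately have "Qsharp a (sw m \<omega> JN) (sw m \<omega> JM) \<le> ereal (?v * ?E / (1 - 0))"
    by (rule tendsto_lowerbound) simp
  also have "?v * ?E / (1 - 0) \<le> 2 powr ((a - 1) * (l + ?c))"
  proof -
    \<comment> \<open>The count yields the base \<open>m + 1\<close> and the exponent
      \<open>?e * ?e * a\<close>. Base and exponent are enlarged to \<open>m + ?e\<close> and
      \<open>a * (?e ^ 2 + ?e)\<close>, the form in the claim.\<close>
    have "?v = real (m + 1) powr (real (?e * ?e) * a)"
      unfolding pw_def by (simp add: powr_realpow[symmetric] powr_powr del: of_nat_mult of_nat_Suc)
    also have "\<dots> \<le> real (m + ?e) powr (real (?e * ?e) * a)"
      using e a by (intro powr_mono2) (auto simp del: of_nat_mult)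
    also have "\<dots> \<le> real (m + ?e) powr (a * (real ?e ^ 2 + real ?e))"
    proof (rule powr_mono)
      have "0 \<le> a * real ?e" using a by simp
      thus "real (?e * ?e) * a \<le> a * (real ?e ^ 2 + real ?e)"
        by (simp add: power2_eq_square distrib_left mult.commute)
      show "1 \<le> real (m + ?e)" using e unfolding of_nat_add by linarith
    qed
    also have "\<dots> = (2 powr log 2 (real (m + ?e))) powr (a * (real ?e ^ 2 + real ?e))"
    proof -
      have "0 < real (m + ?e)" using e unfolding of_nat_add by linarith
      thus ?thesis by simp
    qed
    also have "\<dots> = 2 powr ((a - 1) * ?c)"
    proof -
      have "(a - 1) * (a / (a - 1) * x * y) = y * (a * x)" for x y :: real using a by simp
      thus ?thesis unfolding powr_powr of_nat_add by simp
    qed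
    finally have "?v * ?E \<le> 2 powr ((a - 1) * ?c) * ?E" by (intro mult_right_mono) auto
    also have "\<dots> = 2 powr ((a - 1) * (l + ?c))"
      by (simp only: powr_add[symmetric] distrib_left add.commute)
    finally show ?thesis by simp
  qed
  finally show "Qsharp a (sw m \<omega> JN) (sw m \<omega> JM) \<le> ereal (2 powr ((a - 1) * (l + ?c)))"
    by simp
qed

lemma sandwich_tensor:
  assumes \<omega>: "psd (dX ^ m) \<omega>1" "psd (dX ^ n) \<omega>2" 
  shows "sw (m + n) (kron \<omega>1 \<omega>2) J = rpm dX dY m n * kron (sw m \<omega>1 J) (sw n \<omega>2 J) * adj (rpm dX dY m n)"
proof -
  let ?P = "rpm dX dY m n"
  let ?W1 = "mpow (1/2) \<omega>1" and ?W2 = "mpow (1/2) \<omega>2"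
  have W: "?W1 \<in> carrier_mat (dX ^ m) (dX ^ m)" "?W2 \<in> carrier_mat (dX ^ n) (dX ^ n)"
    using psdD(1)[OF psd_mpow[OF psdD(2,1)[OF \<omega>(1)]]] psdD(1)[OF psd_mpow[OF psdD(2,1)[OF \<omega>(2)]]] by auto
  let ?K1 = "kron ?W1 (1\<^sub>m (dY ^ m))" and ?K2 = "kron ?W2 (1\<^sub>m (dY ^ n))"
  let ?J1 = "JP dX dY J m" and ?J2 = "JP dX dY J n"
  have u: "unitary (D (m + n)) ?P" by (rule unitary_rpm[OF d])
  have e: "D (m + n) = D m * D n" by (simp add: power_add mult_ac)
  have K: "kron ?K1 ?K2 \<in> carrier_mat (D (m + n)) (D (m + n))" "kron ?J1 ?J2 \<in> carrier_mat (D (m + n)) (D (m + n))"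
    unfolding e using W by (auto intro!: kron_carrier)
  have Kd: "dim_row (kron ?K1 ?K2) = D (m + n)" "dim_col (kron ?K1 ?K2) = D (m + n)"
    "dim_row (kron ?J1 ?J2) = D (m + n)" "dim_col (kron ?J1 ?J2) = D (m + n)"
    using carrier_matD[OF K(1)] carrier_matD[OF K(2)] by blast+
  have Pc: "?P \<in> carrier_mat (D (m + n)) (D (m + n))" by (rule unitary_carrier[OF u])
  have gen: "(P * K * adj P) * (P * J * adj P) * (P * K * adj P) = P * (K * J * K) * adj P"
    if "unitary k P" "K \<in> carrier_mat k k" "J \<in> carrier_mat k k" for P K J k
    using that unitary_carrier[OF that(1)] by (simp add: mult_assoc_dim unitary_cancel)
  have "sw (m + n) (kron \<omega>1 \<omega>2) J = (?P * kron ?K1 ?K2 * adj ?P) * (?P * kron ?J1 ?J2 * adj ?P) * (?P * kron ?K1 ?K2 * adj ?P)"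
    unfolding sandwich_in_def mpow_kron[OF \<omega>] kron_one_add[OF d W] JP_add[OF d] ..
  also have "\<dots> = ?P * (kron ?K1 ?K2 * kron ?J1 ?J2 * kron ?K1 ?K2) * adj ?P"
    by (rule gen[OF u K])
  also have "kron ?K1 ?K2 * kron ?J1 ?J2 * kron ?K1 ?K2 = kron (?K1 * ?J1 * ?K1) (?K2 * ?J2 * ?K2)"
    using carrier_matD[OF W(1)] carrier_matD[OF W(2)] carrier_matD[OF JP_carrier] by (simp add: kron_mult)
  finally show ?thesis unfolding sandwich_in_def .
qed

text \<open>For \<open>\<rho> = 0\<close> the supports are nested and 0 is a certificate, so
  \<open>Qs\<close> stays below every threshold. A violated threshold thus gives a vector with
  nonzero form, as the support lemmas for products require.\<close>

lemma nonzero_of_not_le: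
  assumes p: "psd n \<rho>" "psd n \<sigma>" and H: "\<not> (supp_le \<rho> \<sigma> \<and> Qs a \<rho> \<sigma> \<le> 2 powr l)"
  obtains v where "v \<in> carrier_vec n" "qf \<rho> v \<noteq> 0"
proof -
  have "\<exists>v\<in>carrier_vec n. qf \<rho> v \<noteq> 0"
  proof (rule ccontr)
    assume z: "\<not> ?thesis"
    have s: "supp_le \<rho> \<sigma>" unfolding supp_le_iff[OF p] using z by blast
    have b: "0 < 1/a" "1/a < 1" using a by auto
    note w = psd_wgm[OF b p(2) psd_zero[of n]]
    have "loewner_le n \<rho> (wgm (1/a) \<sigma> (0\<^sub>m n n))"
      unfolding loewner_psd_iff[OF p(1) w] using z psdD(3)[OF w] by auto
    hence "Qs a \<rho> \<sigma> \<le> Re (mtrace (0\<^sub>m n n))" by (rule Qs_le_trace[OF a p psd_zero])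
    also have "\<dots> = 0" unfolding mtrace_def by simp
    also have "\<dots> \<le> 2 powr l" by simp
    finally show False using H s by blast
  qed
  thus ?thesis using that by blast
qed

text \<open>On product inputs \<open>Qs\<close> multiplies, and nested supports of the product imply
  nested supports of both factors. Strict real lower bounds avoid sums of opposite
  infinities.\<close>

lemma SD_superadd:
  fixes m n :: nat
  assumes L: "ereal l1 < SD m" "ereal l2 < SD n"
  shows "ereal (l1 + l2) < SD (m + n)"
proof (rule ccontr)
  assume "\<not> ?thesis"
  hence S: "SD (m + n) \<le> ereal (l1 + l2)" by simp
  let ?E = "\<lambda>l. 2 powr ((a - 1) * l)"
  obtain \<omega>1 where w1: "psd (dX ^ m) \<omega>1" "Re (mtrace \<omega>1) = 1"
    and n1: "\<not> (supp_le (sw m \<omega>1 JN) (sw m \<omega>1 JM) \<and> Qs a (sw m \<omega>1 JN) (sw m \<omega>1 JM) \<le> ?E l1)"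
    using L(1) unfolding not_le[symmetric] SD_le_iff by blast
  obtain \<omega>2 where w2: "psd (dX ^ n) \<omega>2" "Re (mtrace \<omega>2) = 1"
    and n2: "\<not> (supp_le (sw n \<omega>2 JN) (sw n \<omega>2 JM) \<and> Qs a (sw n \<omega>2 JN) (sw n \<omega>2 JM) \<le> ?E l2)"
    using L(2) unfolding not_le[symmetric] SD_le_iff by blast
  note p1 = psd_sw[OF w1(1)] and p2 = psd_sw[OF w2(1)]
  have e: "D (m + n) = D m * D n" by (simp add: power_add mult_ac)
  have P: "unitary (D m * D n) (rpm dX dY m n)" using unitary_rpm[OF d, of m n] unfolding e .
  note k = psd_kron[OF p1(1) p2(1)] psd_kron[OF p1(2) p2(2)]
  have w: "psd (dX ^ (m + n)) (kron \<omega>1 \<omega>2)" unfolding power_add by (rule psd_kron[OF w1(1) w2(1)])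
  have "mtrace \<omega>1 = 1" "mtrace \<omega>2 = 1" using w1 w2 unfolding atomize_conj by (metis mtrace_psd(1) of_real_1)
  hence tr: "Re (mtrace (kron \<omega>1 \<omega>2)) = 1" unfolding mtrace_kron[OF psdD(1)[OF w1(1)] psdD(1)[OF w2(1)]] by simp
  have H: "supp_le (sw (m + n) (kron \<omega>1 \<omega>2) JN) (sw (m + n) (kron \<omega>1 \<omega>2) JM)
    \<and> Qs a (sw (m + n) (kron \<omega>1 \<omega>2) JN) (sw (m + n) (kron \<omega>1 \<omega>2) JM) \<le> ?E (l1 + l2)"
    using S w tr unfolding SD_le_iff by blast
  have s: "supp_le (kron (sw m \<omega>1 JN) (sw n \<omega>2 JN)) (kron (sw m \<omega>1 JM) (sw n \<omega>2 JM))"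
    using supp_le_unitary[OF k P] H unfolding sandwich_tensor[OF w1(1) w2(1)] by blast
  obtain u where u: "u \<in> carrier_vec (D m)" "qf (sw m \<omega>1 JN) u \<noteq> 0" by (rule nonzero_of_not_le[OF p1 n1])
  obtain v where v: "v \<in> carrier_vec (D n)" "qf (sw n \<omega>2 JN) v \<noteq> 0" by (rule nonzero_of_not_le[OF p2 n2])
  have q1: "?E l1 < Qs a (sw m \<omega>1 JN) (sw m \<omega>1 JM)" using n1 supp_le_kron_left[OF p1 p2 s v] by simp
  have q2: "?E l2 < Qs a (sw n \<omega>2 JN) (sw n \<omega>2 JM)" using n2 supp_le_kron_right[OF p1 p2 s u] by simp
  have "?E (l1 + l2) = ?E l1 * ?E l2" by (simp add: distrib_left powr_add)
  also have "\<dots> < Qs a (sw m \<omega>1 JN) (sw m \<omega>1 JM) * Qs a (sw n \<omega>2 JN) (sw n \<omega>2 JM)"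
    using q1 q2 by (intro mult_strict_mono') auto
  also have "\<dots> = Qs a (sw (m + n) (kron \<omega>1 \<omega>2) JN) (sw (m + n) (kron \<omega>1 \<omega>2) JM)"
    unfolding sandwich_tensor[OF w1(1) w2(1)] Qs_unitary[OF k P] Qs_kron[OF p1 p2] ..
  finally show False using H by simp
qed

end

section \<open>Regularization\<close>

lemma fekete:
  fixes L :: "nat \<Rightarrow> real"
  assumes add: "\<And>m n. 1 \<le> m \<Longrightarrow> 1 \<le> n \<Longrightarrow> L m + L n \<le> L (m + n)"
    and bd: "\<And>n. 1 \<le> n \<Longrightarrow> L n \<le> real n * B"
  obtains R where "(\<lambda>n. L n / real n) \<longlonglongrightarrow> R" "\<And>m. 1 \<le> m \<Longrightarrow> L m / real m \<le> R"
proof -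
  define R where "R = (SUP n\<in>{1..}. L n / real n)"
  have bdd: "bdd_above ((\<lambda>n. L n / real n) ` {1..})"
    using bd by (intro bdd_aboveI2[where M = B]) (auto simp: divide_le_eq mult.commute)
  have up: "L m / real m \<le> R" if "1 \<le> m" for m
    unfolding R_def using that by (intro cSUP_upper[OF _ bdd]) auto
  have mult: "real q * L m \<le> L (q * m)" if m: "1 \<le> m" and q: "1 \<le> q" for q m
    using q
  proof (induction q rule: dec_induct)
    case (step q)
    have "L (q * m) + L m \<le> L (q * m + m)" using m step.hyps by (intro add) auto
    thus ?case using step.IH by (simp add: algebra_simps)
  qed simp
  have "(\<lambda>n. L n / real n) \<longlonglongrightarrow> R"
  proof (rule tendstoI)
    fix \<epsilon> :: real assume \<epsilon>: "0 < \<epsilon>"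
    have "\<exists>m\<in>{1..}. R - \<epsilon> / 2 < L m / real m"
      using \<epsilon> less_cSUP_iff[OF _ bdd, of "R - \<epsilon> / 2"] unfolding R_def[symmetric] by auto
    then obtain m where m: "1 \<le> m" "R - \<epsilon> / 2 < L m / real m" by auto
    \<comment> \<open>Bounds the loss from the remainder of the division by \<open>m\<close>,
      independently of \<open>n\<close>.\<close>
    define C where "C = (\<Sum>r<m. \<bar>L r\<bar>) + real m * \<bar>R\<bar>"
    have C0: "0 \<le> C" unfolding C_def by (intro add_nonneg_nonneg sum_nonneg) auto
    have low: "(R - \<epsilon> / 2) * real n - (C + real m * \<epsilon>) \<le> L n" if n: "m \<le> n" for n
    proof -
      define q r where "q = n div m" and "r = n mod m"
      have qr: "n = q * m + r" "r < m" "1 \<le> q"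
        unfolding q_def r_def using m n by (auto simp: Suc_le_eq div_greater_zero_iff)
      \<comment> \<open>Superadditivity starts at index 1 and says nothing about \<open>L 0\<close>,
        so a zero remainder is treated separately.\<close>
      have Lr: "- (\<Sum>r<m. \<bar>L r\<bar>) \<le> (if r = 0 then 0 else L r)"
      proof -
        have "\<bar>L r\<bar> \<le> (\<Sum>r<m. \<bar>L r\<bar>)" using qr(2) by (intro member_le_sum) auto
        thus ?thesis by auto
      qed
      have "L (q * m) + (if r = 0 then 0 else L r) \<le> L n"
        using add[of "q * m" r] qr m by auto
      moreover have "real q * L m \<le> L (q * m)" by (rule mult[OF m(1) qr(3)])
      moreover have "real q * ((R - \<epsilon> / 2) * real m) \<le> real q * L m"
        using m by (intro mult_left_mono) (auto simp: less_divide_eq)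
      moreover have "real n = real q * real m + real r" using qr(1) by simp
      moreover have "(R - \<epsilon> / 2) * real r \<le> real m * \<bar>R\<bar>"
      proof -
        have "(R - \<epsilon> / 2) * real r \<le> \<bar>R\<bar> * real r" using \<epsilon> by (intro mult_right_mono) auto
        also have "\<dots> \<le> \<bar>R\<bar> * real m" using qr(2) by (intro mult_left_mono) auto
        finally show ?thesis by (simp add: mult.commute)
      qed
      moreover have "0 \<le> real m * \<epsilon>" using \<epsilon> by simp
      ultimately show ?thesis using Lr unfolding C_def by (simp add: algebra_simps)
    qed
    define K where "K = 2 * (C + real m * \<epsilon>) / \<epsilon>"
    have "\<forall>\<^sub>F n in sequentially. m \<le> n \<and> K < real n"
      using eventually_ge_at_top[of m] filterlim_at_top_dense[THEN iffD1, OF filterlim_real_sequentially, rule_format, of K]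
      by eventually_elim simp
    thus "\<forall>\<^sub>F n in sequentially. dist (L n / real n) R < \<epsilon>"
    proof eventually_elim
      case (elim n)
      hence n: "m \<le> n" "K < real n" "0 < real n" using m by auto
      have "2 * (C + real m * \<epsilon>) < \<epsilon> * real n"
        using n(2) \<epsilon> unfolding K_def by (simp add: divide_less_eq mult.commute)
      hence "(R - \<epsilon>) * real n < L n" using low[OF n(1)] by (simp add: algebra_simps)
      hence "R - \<epsilon> < L n / real n" using n(3) by (simp add: less_divide_eq)
      moreover have "L n / real n \<le> R" using up n m by auto
      ultimately show ?case unfolding dist_real_def by auto
    qed
  qed
  thus ?thesis using up by (rule that)
qed

lemma ereal_eq_MInf_of_le: "(\<And>l. x \<le> ereal l) \<Longrightarrow> x = -\<infinity>"
  by (metis ereal_bot)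

text \<open>\<open>lim\<close> carries information only if the sequence converges, so each case
  establishes the limit. The hypotheses pass on to all later indices whether \<open>s 1\<close> is
  minus infinity, infinity or finite, and the finite case is Fekete's lemma.\<close>

lemma regularized_bounds:
  fixes s h :: "nat \<Rightarrow> ereal" and c :: "nat \<Rightarrow> real"
  assumes super: "\<And>m n l1 l2. ereal l1 < s m \<Longrightarrow> ereal l2 < s n \<Longrightarrow> ereal (l1 + l2) < s (m + n)"
    and up: "\<And>m n l. h m \<le> ereal l \<Longrightarrow> s (n * m) \<le> ereal (real n * l)"
    and low: "\<And>m l. s m \<le> ereal l \<Longrightarrow> h m \<le> ereal (l + c m)"
    and m: "1 \<le> m"
  defines "R \<equiv> lim (\<lambda>n. ereal (1 / real n) * s n)"
  shows "ereal (1 / real m) * h m - ereal (1 / real m * c m) \<le> R"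
    "R \<le> ereal (1 / real m) * h m"
    "R \<le> ereal (1 / real m) * s m + ereal (1 / real m * c m)"
proof -
  have up1: "h m \<le> ereal l \<Longrightarrow> s m \<le> ereal l" for m l using up[of m l 1] by simp
  have R: "R = x" if "(\<lambda>n. ereal (1 / real n) * s n) \<longlonglongrightarrow> x" for x
    unfolding R_def using that by (rule limI)
  have const: "R = x" if "\<And>n. 1 \<le> n \<Longrightarrow> ereal (1 / real n) * s n = x" for x
    by (rule R, rule tendsto_eventually) (rule eventually_mono[OF eventually_ge_at_top[of 1] that])
  consider "s 1 = -\<infinity>" | "s 1 = \<infinity>" | l where "s 1 = ereal l" by (cases "s 1") auto
  hence "ereal (1 / real m) * h m - ereal (1 / real m * c m) \<le> R \<and>
    R \<le> ereal (1 / real m) * h m \<and> R \<le> ereal (1 / real m) * s m + ereal (1 / real m * c m)"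
  proof cases
    case 1
    have h1: "h 1 \<le> ereal l" for l using low[of 1 "l - c 1"] 1 by simp
    have s: "s n = -\<infinity>" if "1 \<le> n" for n
    proof (rule ereal_eq_MInf_of_le)
      fix l show "s n \<le> ereal l" using up[OF h1[of "l / real n"], of n] that by simp
    qed
    have "h m = -\<infinity>"
    proof (rule ereal_eq_MInf_of_le)
      fix l show "h m \<le> ereal l" using low[of m "l - c m"] s[OF m] by simp
    qed
    moreover have "R = -\<infinity>" by (rule const) (simp add: s)
    ultimately show ?thesis using m by simp
  next
    case 2
    have s: "s n = \<infinity>" if "1 \<le> n" for n
      using that
    proof (induction n rule: dec_induct)
      case (step n)
      have "ereal l < s (Suc n)" for l using super[of l n 0 1] step.IH 2 by simp
      thus ?case by (metis ereal_top less_le)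
    qed (rule 2)
    have "h m = \<infinity>"
    proof (rule ccontr)
      assume "h m \<noteq> \<infinity>"
      then obtain l where "h m \<le> ereal l" by (cases "h m") auto
      hence "s m \<le> ereal l" by (rule up1)
      thus False using s[OF m] by simp
    qed
    moreover have "R = \<infinity>" by (rule const) (simp add: s)
    ultimately show ?thesis using m s[OF m] by simp
  next
    case (3 l)
    let ?b = "l + c 1"
    have h1: "h 1 \<le> ereal ?b" using low[of 1 l] 3 by simp
    have sup: "s n \<le> ereal (real n * ?b)" for n using up[OF h1, of n] by simp
    have sdn: "s n \<noteq> -\<infinity>" if "1 \<le> n" for n
      using that
    proof (induction n rule: dec_induct)
      case (step n)
      then obtain x where "ereal x < s n" using ereal_dense2[of "- \<infinity>" "s n"] by auto
      hence "ereal (x + (l - 1)) < s (n + 1)" using 3 by (intro super) auto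
      thus ?case by auto
    qed (use 3 in simp)
    define L where "L n = real_of_ereal (s n)" for n
    have sL: "s n = ereal (L n)" if "1 \<le> n" for n
      using sup[of n] sdn[OF that] unfolding L_def by (cases "s n") auto
    have hh: "\<exists>x. h n = ereal x \<and> L n \<le> x \<and> x \<le> L n + c n" if n: "1 \<le> n" for n
    proof -
      have u: "h n \<le> ereal (L n + c n)" using low[of n "L n"] sL[OF n] by simp
      have "h n \<noteq> -\<infinity>"
      proof
        assume "h n = -\<infinity>"
        hence "s n \<le> ereal (L n - 1)" by (intro up1) simp
        thus False using sL[OF n] by simp
      qed
      then obtain x where x: "h n = ereal x" using u by (cases "h n") auto
      show ?thesis using u up1[of n x] sL[OF n] unfolding x by auto
    qed
    have add: "L m + L n \<le> L (m + n)" if "1 \<le> m" "1 \<le> n" for m n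
    proof (rule field_le_epsilon)
      fix e :: real assume "0 < e"
      hence "ereal ((L m - e/2) + (L n - e/2)) < s (m + n)" using sL that by (intro super) auto
      thus "L m + L n \<le> L (m + n) + e" using sL[of "m + n"] that by simp
    qed
    have bd: "L n \<le> real n * ?b" if "1 \<le> n" for n using sup[of n] sL[OF that] by simp
    obtain r where r: "(\<lambda>n. L n / real n) \<longlonglongrightarrow> r" and ge: "\<And>m. 1 \<le> m \<Longrightarrow> L m / real m \<le> r"
      by (rule fekete[of L ?b, OF add bd]) blast+
    have Rr: "R = ereal r"
    proof (rule R)
      have "(\<lambda>n. ereal (L n / real n)) \<longlonglongrightarrow> ereal r" using r by simp
      moreover have "\<forall>\<^sub>F n in sequentially. ereal (L n / real n) = ereal (1 / real n) * s n"
        using eventually_ge_at_top[of 1] by eventually_elim (simp add: sL)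
      ultimately show "(\<lambda>n. ereal (1 / real n) * s n) \<longlonglongrightarrow> ereal r"
        by (rule Lim_transform_eventually)
    qed
    obtain x where x: "h m = ereal x" "L m \<le> x" "x \<le> L m + c m" using hh[OF m] by blast
    \<comment> \<open>The bound \<open>up\<close> applies along the multiples of \<open>m\<close>,
      and a subsequence has the same limit.\<close>
    have "r \<le> x / real m"
    proof (rule LIMSEQ_le_const2)
      show "(\<lambda>n. L (n * m) / real (n * m)) \<longlonglongrightarrow> r"
        using LIMSEQ_subseq_LIMSEQ[OF r, of "\<lambda>n. n * m"] m unfolding strict_mono_def comp_def by simp
      have "L (n * m) / real (n * m) \<le> x / real m" if "1 \<le> n" for n
        using up[of m x n] sL[of "n * m"] x(1) that m by (simp add: field_simps)
      thus "\<exists>N. \<forall>n\<ge>N. L (n * m) / real (n * m) \<le> x / real m" by blast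
    qed
    moreover have "L m / real m \<le> r" by (rule ge[OF m])
    moreover have "x / real m \<le> L m / real m + c m / real m"
      using x(3) m by (simp add: add_divide_distrib[symmetric] divide_right_mono)
    ultimately show ?thesis unfolding Rr x(1) sL[OF m] by simp
  qed
  thus "ereal (1 / real m) * h m - ereal (1 / real m * c m) \<le> R"
    "R \<le> ereal (1 / real m) * h m"
    "R \<le> ereal (1 / real m) * s m + ereal (1 / real m * c m)" by auto
qed

theorem theorem5p1:
  fixes \<alpha> :: real and dX dY m :: nat and N M :: qmap
  assumes "1 < \<alpha>" and "0 < dX" and "0 < dY"
    and "cp_map dX dY N" and "cp_map dX dY M"
    and "1 \<le> m"
  shows "ereal (1 / real m) *
           chan_div (Dsharp \<alpha>) (dX ^ m) (dY ^ m) (tpow dX dY N m) (tpow dX dY M m)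
         - ereal (1 / real m * (\<alpha> / (\<alpha> - 1)) * (real (dX * dY) ^ 2 + real (dX * dY))
                  * log 2 (real m + real (dX * dY)))
         \<le> Dreg \<alpha> dX dY N M
       \<and> Dreg \<alpha> dX dY N M \<le> ereal (1 / real m) *
           chan_div (Dsharp \<alpha>) (dX ^ m) (dY ^ m) (tpow dX dY N m) (tpow dX dY M m)
       \<and> Dreg \<alpha> dX dY N M \<le> ereal (1 / real m) *
           chan_div (sandwiched \<alpha>) (dX ^ m) (dY ^ m) (tpow dX dY N m) (tpow dX dY M m)
         + ereal (1 / real m * (\<alpha> / (\<alpha> - 1)) * (real (dX * dY) ^ 2 + real (dX * dY))
                  * log 2 (real m + real (dX * dY)))"
  proof -
  note d = assms(2,3) and a = assms(1)
  let ?J = "choi dX dY N" and ?K = "choi dX dY M"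
  note J = psd_choi[OF assms(4)] and K = psd_choi[OF assms(5)]
  note c = choi_tpow[OF assms(4) d] choi_tpow[OF assms(5) d]
  define cm where "cm m = \<alpha> / (\<alpha> - 1) * (real (dX * dY) ^ 2 + real (dX * dY)) * log 2 (real m + real (dX * dY))" for m :: nat
  have e: "1 / real m * (\<alpha> / (\<alpha> - 1)) * (real (dX * dY) ^ 2 + real (dX * dY)) * log 2 (real m + real (dX * dY))
    = 1 / real m * cm m" unfolding cm_def by (simp only: mult.assoc)
  \<comment> \<open>Channels enter the abstract statement only through superadditivity of
    \<open>SD\<close> and the two comparisons between \<open>SD\<close> and
    \<open>HD\<close>.\<close>
  show ?thesis unfolding Dreg_def chan_div_def c e
    by (intro conjI;
        rule regularized_bounds[where s = "SD dX dY \<alpha> ?J ?K" and h = "HD dX dY \<alpha> ?J ?K" and c = cm, OF _ _ _ assms(6)];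
        (erule (1) SD_superadd[OF d a J K] | erule SD_mult_le[OF d a J K] | erule HD_le[OF d a J K, folded cm_def]))
qed

end
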